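(* Let $\Phi$ be a random $\mathrm{FP}$-process in $\mathbb R^d$. Then the union set $$X:=\bigcup_{A\in\Phi}A$$ is a random set with locally finite perimeter. If $\Phi$ is stationary, then so is $X$.
   Context: A Lebesgue measurable set $A\subset\mathbb R^d$ has (locally) finite perimeter if the distributional derivative $D\mathbf 1_A$ is represented by a (locally) finite $\mathbb R^d$-valued Radon measure; $|D\mathbf 1_A|$ is its variation measure and $P(A)=|D\mathbf 1_A|(\mathbb R^d)$. Sets are identified with their indicator functions, so sets differing by a Lebesgue null set are identified. $\mathrm{FP}$ is the family of sets with $\mathbf 1_A\in L^1(\mathbb R^d)$ and finite perimeter, with the topology of strict convergence, induced by the metric $d_s(A,B)=\int|\mathbf 1_A-\mathbf 1_B|\,dx+|P(A)-P(B)|$. $\mathrm{FP}_{\rm loc}$ is the family of sets of locally finite perimeter with the topology of locally strict convergence: $A_i\to A$ iff $\mathbf 1_{A_i}\to\mathbf 1_A$ in $L^1_{\rm loc}$ and $|D\mathbf 1_{A_i}|\to|D\mathbf 1_A|$ vaguely. $\mathcal B(\cdot)$ denotes Borel $\sigma$-algebras. A random set with locally finite perimeter is a measurable mapping from a standard probability space $(\Omega,\Sigma,\Pr)$ to $(\mathrm{FP}_{\rm loc},\mathcal B(\mathrm{FP}_{\rm loc}))$; it is stationary if its distribution is invariant under $A\mapsto A+z$ for all $z\in\mathbb R^d$. Let $\mathcal B_0$ be the family of those $U\in\mathcal B(\mathrm{FP})$ for which there is a compact $K\subset\mathbb R^d$ with $|D\mathbf 1_A|(K)>0$ for all $A\in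 U$. Let $\mathcal N^{\#}$ be the set of all nonnegative integer-valued Borel measures on $\mathrm{FP}$ (the value $\infty$ allowed for sets outside $\mathcal B_0$) which are finite on each set of $\mathcal B_0$, and let $\mathfrak N^{\#}$ be the smallest $\sigma$-algebra on $\mathcal N^{\#}$ making all mappings $\nu\mapsto\nu(U)$, $U\in\mathcal B_0$, measurable. A random $\mathrm{FP}$-process is a measurable mapping $\Phi:(\Omega,\Sigma,\Pr)\to(\mathcal N^{\#},\mathfrak N^{\#})$. $A\in\Phi$ means $\Phi(\{A\})>0$. $\Phi$ is stationary if its distribution is invariant under the shifts of $\mathcal N^{\#}$ induced by $A\mapsto A+z$, $z\in\mathbb R^d$. *)

theory Defs
  imports "HOL-Probability.Probability"
begin

section \<open>Measurable sets up to null sets\<close>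

definition null_eq :: "'a::euclidean_space set \<Rightarrow> 'a set \<Rightarrow> bool" where
  "null_eq A B \<longleftrightarrow> A \<in> sets lebesgue \<and> B \<in> sets lebesgue \<and> sym_diff A B \<in> null_sets lebesgue"

lemma null_eq_AE:
  assumes "null_eq A B"
  shows "AE x in lebesgue. x \<in> A \<longleftrightarrow> x \<in> B"
  using assms unfolding null_eq_def
  by (auto intro: AE_I'[of "sym_diff A B"])

lemma AE_null_eq:
  assumes "A \<in> sets lebesgue" "B \<in> sets lebesgue" "AE x in lebesgue. x \<in> A \<longleftrightarrow> x \<in> B"
  shows "null_eq A B"
proof -
  have "{x \<in> space lebesgue. \<not> (x \<in> A \<longleftrightarrow> x \<in> B)} = sym_diff A B"
    by auto
  with assms show ?thesis
    unfolding null_eq_def completion.AE_iff_null_sets by simp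
qed

quotient_type (overloaded) 'a lset = "'a::euclidean_space set" / partial: null_eq
proof (rule part_equivpI)
  show "\<exists>x::'a set. null_eq x x"
    by (rule exI[of _ "{}"]) (simp add: null_eq_def)
  show "symp (null_eq :: 'a set \<Rightarrow> _)"
    by (auto simp: symp_def null_eq_def Un_commute)
  show "transp (null_eq :: 'a set \<Rightarrow> _)"
  proof (rule transpI)
    fix A B C :: "'a set" assume AB: "null_eq A B" and BC: "null_eq B C"
    have "AE x in lebesgue. x \<in> A \<longleftrightarrow> x \<in> C"
      using null_eq_AE[OF AB] null_eq_AE[OF BC] by eventually_elim auto
    then show "null_eq A C"
      using AB BC by (intro AE_null_eq) (auto simp: null_eq_def)
  qed
qed

lemma borel_measurable_lebesgue_AE:
  fixes f g :: "'a::euclidean_space \<Rightarrow> real"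
  assumes "f \<in> borel_measurable lebesgue" "AE x in lebesgue. f x = g x"
  shows "g \<in> borel_measurable lebesgue"
proof (rule measurableI)
  fix V :: "real set" assume V: "V \<in> sets borel"
  show "g -` V \<inter> space lebesgue \<in> sets lebesgue"
  proof (rule completion.in_sets_AE)
    show "AE x in lebesgue. x \<in> f -` V \<inter> space lebesgue \<longleftrightarrow> x \<in> g -` V \<inter> space lebesgue"
      using assms(2) by eventually_elim auto
    show "f -` V \<inter> space lebesgue \<in> sets lebesgue"
      using assms(1) V by (rule measurable_sets)
  qed auto
qed auto

lemma
  fixes f g :: "'a::euclidean_space \<Rightarrow> real"
  assumes AE: "AE x in lebesgue. f x = g x"
  shows integrable_lebesgue_AE: "integrable lebesgue f \<longleftrightarrow> integrable lebesgue g"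
    and integral_lebesgue_AE: "integral\<^sup>L lebesgue f = integral\<^sup>L lebesgue g"
proof -
  have AE': "AE x in lebesgue. g x = f x"
    using AE by eventually_elim simp
  have m: "f \<in> borel_measurable lebesgue \<longleftrightarrow> g \<in> borel_measurable lebesgue"
    using borel_measurable_lebesgue_AE[OF _ AE] borel_measurable_lebesgue_AE[OF _ AE'] by blast
  show i: "integrable lebesgue f \<longleftrightarrow> integrable lebesgue g"
    using integrable_cong_AE[OF _ _ AE] m borel_measurable_integrable[of lebesgue f]
      borel_measurable_integrable[of lebesgue g] by blast
  show "integral\<^sup>L lebesgue f = integral\<^sup>L lebesgue g"
  proof (cases "integrable lebesgue f")
    case True
    then show ?thesis
      using m by (intro integral_cong_AE AE) auto
  next
    case False
    then show ?thesis
      using i by (simp add: not_integrable_integral_eq)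
  qed
qed

lemma set_integral_null_eq:
  fixes f :: "'a::euclidean_space \<Rightarrow> real"
  assumes "null_eq A B"
  shows "(LINT x:A|lebesgue. f x) = (LINT x:B|lebesgue. f x)"
  unfolding set_lebesgue_integral_def
proof (rule integral_lebesgue_AE)
  show "AE x in lebesgue. indicat_real A x *\<^sub>R f x = indicat_real B x *\<^sub>R f x"
    using null_eq_AE[OF assms] by eventually_elim (auto simp: indicator_def)
qed

lift_definition l1_dist :: "'a::euclidean_space set \<Rightarrow> 'a lset \<Rightarrow> 'a lset \<Rightarrow> real" is
  "\<lambda>K A B. LINT x:K|lebesgue. \<bar>indicat_real A x - indicat_real B x\<bar>"
  unfolding set_lebesgue_integral_def
proof (rule integral_lebesgue_AE)
  fix K A A' B B' :: "'a set" assume *: "null_eq A A'" "null_eq B B'"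
  show "AE x in lebesgue. indicat_real K x *\<^sub>R \<bar>indicat_real A x - indicat_real B x\<bar> =
          indicat_real K x *\<^sub>R \<bar>indicat_real A' x - indicat_real B' x\<bar>"
    using null_eq_AE[OF *(1)] null_eq_AE[OF *(2)] by eventually_elim (auto simp: indicator_def)
qed

lift_definition finite_volume :: "'a::euclidean_space lset \<Rightarrow> bool" is
  "\<lambda>A. integrable lebesgue (indicat_real A)"
proof (rule integrable_lebesgue_AE)
  fix A B :: "'a set" assume *: "null_eq A B"
  show "AE x in lebesgue. indicat_real A x = indicat_real B x"
    using null_eq_AE[OF *] by eventually_elim (auto simp: indicator_def)
qed

lift_definition translate :: "'a::euclidean_space \<Rightarrow> 'a lset \<Rightarrow> 'a lset" is "\<lambda>z A. (\<lambda>x. x + z) ` A"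
proof -
  fix z :: 'a and A B :: "'a set" assume *: "null_eq A B"
  have eq: "(\<lambda>x. x + z) = (+) z"
    by (simp add: fun_eq_iff add.commute)
  have "sym_diff ((+) z ` A) ((+) z ` B) = (+) z ` (sym_diff A B)"
    by auto
  moreover have "(+) z ` (sym_diff A B) \<in> null_sets lebesgue"
    using * unfolding null_eq_def negligible_iff_null_sets[symmetric]
    by (intro negligible_translation) simp
  ultimately show "null_eq ((\<lambda>x. x + z) ` A) ((\<lambda>x. x + z) ` B)"
    using * unfolding null_eq_def eq by (simp add: lebesgue_sets_translation)
qed

text \<open>Representatives are chosen arbitrarily; for countable families the result does not depend on
  the choice.\<close>

definition countable_union :: "'a::euclidean_space lset set \<Rightarrow> 'a lset" where
  "countable_union S = abs_lset (\<Union>A\<in>S. rep_lset A)"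

lemma countable_union_eq:
  fixes r :: "'a::euclidean_space lset \<Rightarrow> 'a set"
  assumes "countable S" "\<And>A. A \<in> S \<Longrightarrow> r A \<in> sets lebesgue" "\<And>A. A \<in> S \<Longrightarrow> abs_lset (r A) = A"
  shows "countable_union S = abs_lset (\<Union>A\<in>S. r A)"
proof -
  have *: "null_eq (rep_lset A) (r A)" if "A \<in> S" for A
  proof -
    have "null_eq (r A) (r A)"
      using assms(2)[OF that] by (simp add: null_eq_def)
    then show ?thesis
      using assms(3)[OF that] Quotient3_rep_reflp[OF Quotient3_lset, of A]
        Quotient3_abs_rep[OF Quotient3_lset, of A]
      by (intro Quotient3_rel[OF Quotient3_lset, THEN iffD1]) simp
  qed
  have "AE x in lebesgue. \<forall>A\<in>S. x \<in> rep_lset A \<longleftrightarrow> x \<in> r A"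
    using assms(1) null_eq_AE[OF *] by (intro AE_ball_countable') auto
  then have "AE x in lebesgue. x \<in> (\<Union>A\<in>S. rep_lset A) \<longleftrightarrow> x \<in> (\<Union>A\<in>S. r A)"
    by eventually_elim auto
  then have "null_eq (\<Union>A\<in>S. rep_lset A) (\<Union>A\<in>S. r A)"
    using assms(1) * by (intro AE_null_eq sets.countable_UN') (auto simp: null_eq_def)
  then show ?thesis
    unfolding countable_union_def by (rule Quotient3_rel_abs[OF Quotient3_lset])
qed

section \<open>Distributional derivatives of indicator functions\<close>

primrec Ck :: "nat \<Rightarrow> ('a::euclidean_space \<Rightarrow> real) \<Rightarrow> bool" where
  "Ck 0 f \<longleftrightarrow> continuous_on UNIV f"
| "Ck (Suc k) f \<longleftrightarrow> (\<forall>x. f differentiable (at x)) \<and>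
     (\<forall>b\<in>Basis. Ck k (\<lambda>x. frechet_derivative f (at x) b))"

definition compact_support :: "('a::euclidean_space \<Rightarrow> real) \<Rightarrow> bool" where
  "compact_support f \<longleftrightarrow> compact (closure {x. f x \<noteq> 0})"

definition test_function :: "('a::euclidean_space \<Rightarrow> real) \<Rightarrow> bool" where
  "test_function f \<longleftrightarrow> (\<forall>k. Ck k f) \<and> compact_support f"

definition radon_measure :: "'a::euclidean_space measure \<Rightarrow> bool" where
  "radon_measure M \<longleftrightarrow> sets M = sets borel \<and> (\<forall>K. compact K \<longrightarrow> emeasure M K < \<infinity>)"

text \<open>A (locally finite) vector-valued Radon measure is a set function on the bounded Borel sets;
  its values elsewhere are irrelevant.\<close>

definition vector_radon_measure :: "('a::euclidean_space set \<Rightarrow> 'a) \<Rightarrow> bool" where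
  "vector_radon_measure \<mu> \<longleftrightarrow>
     (\<forall>E. range E \<subseteq> sets borel \<longrightarrow> disjoint_family E \<longrightarrow> bounded (\<Union>n. E n) \<longrightarrow>
        (\<lambda>n. \<mu> (E n)) sums \<mu> (\<Union>n::nat. E n))"

text \<open>The integral of \<^term>\<open>f\<close> against a locally finite signed measure \<^term>\<open>\<nu>\<close>: split \<^term>\<open>\<nu>\<close> (for
  instance by Jordan decomposition) into a difference of Radon measures. The value does not depend
  on the splitting when \<^term>\<open>f\<close> is continuous with compact support.\<close>

definition has_signed_integral ::
    "('a::euclidean_space set \<Rightarrow> real) \<Rightarrow> ('a \<Rightarrow> real) \<Rightarrow> real \<Rightarrow> bool" where
  "has_signed_integral \<nu> f I \<longleftrightarrow>
     (\<exists>P N. radon_measure P \<and> radon_measure N \<and>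
        (\<forall>E\<in>sets borel. bounded E \<longrightarrow> \<nu> E = measure P E - measure N E) \<and>
        I = (LINT x|P. f x) - (LINT x|N. f x))"

text \<open>The pieces of a partition are required to be bounded because \<^term>\<open>\<mu>\<close> is a set function on
  bounded sets only; for bounded \<^term>\<open>E\<close> this is no restriction.\<close>

definition variation :: "('a::euclidean_space set \<Rightarrow> 'a) \<Rightarrow> 'a set \<Rightarrow> ennreal" where
  "variation \<mu> E =
     (SUP F \<in> {F. range F \<subseteq> sets borel \<and> (\<forall>h. bounded (F h)) \<and> disjoint_family F \<and> (\<Union>h. F h) = E}.
        \<Sum>h::nat. ennreal (norm (\<mu> (F h))))"

definition variation_measure :: "('a::euclidean_space set \<Rightarrow> 'a) \<Rightarrow> 'a measure" where
  "variation_measure \<mu> = measure_of UNIV (sets borel) (variation \<mu>)"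

lift_definition is_derivative :: "'a::euclidean_space lset \<Rightarrow> ('a set \<Rightarrow> 'a) \<Rightarrow> bool" is
  "\<lambda>A \<mu>. vector_radon_measure \<mu> \<and>
     (\<forall>b\<in>Basis. \<forall>\<phi>. test_function \<phi> \<longrightarrow>
        has_signed_integral (\<lambda>E. \<mu> E \<bullet> b) \<phi>
          (- (LINT x:A|lebesgue. frechet_derivative \<phi> (at x) b)))"
  by (simp add: set_integral_null_eq cong: conj_cong)

text \<open>Any two representing measures agree on bounded Borel sets, so the choice below is immaterial.\<close>

definition perimeter_measure :: "'a::euclidean_space lset \<Rightarrow> 'a measure" where
  "perimeter_measure A = variation_measure (SOME \<mu>. is_derivative A \<mu>)"

section \<open>Sets of (locally) finite perimeter\<close>

definition FPloc :: "'a::euclidean_space lset set" where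
  "FPloc = {A. \<exists>\<mu>. is_derivative A \<mu>}"

definition FP :: "'a::euclidean_space lset set" where
  "FP = {A \<in> FPloc. finite_volume A \<and> emeasure (perimeter_measure A) UNIV < \<infinity>}"

definition perimeter :: "'a::euclidean_space lset \<Rightarrow> real" where
  "perimeter A = measure (perimeter_measure A) UNIV"

definition strict_dist :: "'a::euclidean_space lset \<Rightarrow> 'a lset \<Rightarrow> real" where
  "strict_dist A B = l1_dist UNIV A B + \<bar>perimeter A - perimeter B\<bar>"

lemma integrable_lset_dist:
  assumes "A \<in> sets lebesgue" "B \<in> sets lebesgue" "K \<in> lmeasurable"
  shows "integrable lebesgue (\<lambda>x. indicat_real K x *\<^sub>R \<bar>indicat_real A x - indicat_real B x\<bar>)"
proof (rule Bochner_Integration.integrable_bound)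
  show "integrable lebesgue (indicat_real K)"
    using assms(3) by (intro integrable_real_indicator) (auto simp: fmeasurable_def)
  show "(\<lambda>x. indicat_real K x *\<^sub>R \<bar>indicat_real A x - indicat_real B x\<bar>) \<in> borel_measurable lebesgue"
    using assms
    by (intro borel_measurable_scaleR borel_measurable_abs borel_measurable_diff
          borel_measurable_indicator) (auto dest: fmeasurableD)
qed (auto simp: indicator_def)

lemma l1_dist_nonneg: "l1_dist K A B \<ge> 0"
  by transfer (auto simp: set_lebesgue_integral_def)

lemma l1_dist_commute: "l1_dist K A B = l1_dist K B A"
  by transfer (simp add: abs_minus_commute)

lemma l1_dist_self: "l1_dist K A A = 0"
  by transfer (simp add: set_lebesgue_integral_def)

lemma set_integral_triangle:
  fixes A B C :: "'a::euclidean_space set"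
  assumes AB: "integrable lebesgue (\<lambda>x. indicat_real K x *\<^sub>R \<bar>indicat_real A x - indicat_real B x\<bar>)"
    and BC: "integrable lebesgue (\<lambda>x. indicat_real K x *\<^sub>R \<bar>indicat_real B x - indicat_real C x\<bar>)"
    and AC: "integrable lebesgue (\<lambda>x. indicat_real K x *\<^sub>R \<bar>indicat_real A x - indicat_real C x\<bar>)"
  shows "(LINT x:K|lebesgue. \<bar>indicat_real A x - indicat_real C x\<bar>)
        \<le> (LINT x:K|lebesgue. \<bar>indicat_real A x - indicat_real B x\<bar>) +
          (LINT x:K|lebesgue. \<bar>indicat_real B x - indicat_real C x\<bar>)"
  unfolding set_lebesgue_integral_def Bochner_Integration.integral_add[OF AB BC, symmetric]
  by (rule integral_mono[OF AC Bochner_Integration.integrable_add[OF AB BC]])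
     (simp add: indicator_def)

lemma integrable_lset_dist_UNIV:
  assumes "integrable lebesgue (indicat_real A)" "integrable lebesgue (indicat_real B)"
  shows "integrable lebesgue (\<lambda>x. indicat_real UNIV x *\<^sub>R \<bar>indicat_real A x - indicat_real B x\<bar>)"
  using integrable_abs[OF Bochner_Integration.integrable_diff[OF assms]] by simp

lemma l1_dist_triangle_compact:
  assumes "compact K"
  shows "l1_dist K A C \<le> l1_dist K A B + l1_dist K B C"
proof -
  have K: "K \<in> lmeasurable"
    using assms by (rule lmeasurable_compact)
  then show ?thesis
  proof transfer
    fix K A B C :: "'a set"
    assume "K \<in> lmeasurable" "null_eq A A" "null_eq B B" "null_eq C C"
    then show "(LINT x:K|lebesgue. \<bar>indicat_real A x - indicat_real C x\<bar>)
        \<le> (LINT x:K|lebesgue. \<bar>indicat_real A x - indicat_real B x\<bar>) +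
          (LINT x:K|lebesgue. \<bar>indicat_real B x - indicat_real C x\<bar>)"
      unfolding null_eq_def by (intro set_integral_triangle integrable_lset_dist) auto
  qed
qed

lemma l1_dist_triangle_UNIV:
  assumes "finite_volume A" "finite_volume B" "finite_volume C"
  shows "l1_dist UNIV A C \<le> l1_dist UNIV A B + l1_dist UNIV B C"
  using assms
proof transfer
  fix A B C :: "'a set"
  assume "integrable lebesgue (indicat_real A)" "integrable lebesgue (indicat_real B)"
    "integrable lebesgue (indicat_real C)"
  then show "(LINT x:UNIV|lebesgue. \<bar>indicat_real A x - indicat_real C x\<bar>)
      \<le> (LINT x:UNIV|lebesgue. \<bar>indicat_real A x - indicat_real B x\<bar>) +
        (LINT x:UNIV|lebesgue. \<bar>indicat_real B x - indicat_real C x\<bar>)"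
    by (intro set_integral_triangle integrable_lset_dist_UNIV)
qed

lemma l1_dist_UNIV_eq_0:
  assumes "finite_volume A" "finite_volume B" "l1_dist UNIV A B = 0"
  shows "A = B"
  using assms
proof transfer
  fix A B :: "'a set"
  assume AB: "null_eq A A" "null_eq B B"
    and int: "integrable lebesgue (indicat_real A)" "integrable lebesgue (indicat_real B)"
    and "(LINT x:UNIV|lebesgue. \<bar>indicat_real A x - indicat_real B x\<bar>) = 0"
  then have "AE x in lebesgue. indicat_real UNIV x *\<^sub>R \<bar>indicat_real A x - indicat_real B x\<bar> = 0"
    using integral_nonneg_eq_0_iff_AE[OF integrable_lset_dist_UNIV[OF int]]
    unfolding set_lebesgue_integral_def by simp
  then have "AE x in lebesgue. x \<in> A \<longleftrightarrow> x \<in> B"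
    by eventually_elim (auto simp: indicator_def split: if_splits)
  with AB show "null_eq A B"
    by (intro AE_null_eq) (auto simp: null_eq_def)
qed

lemma Metric_space_FP: "Metric_space FP strict_dist"
proof
  fix A B C :: "'a lset"
  show "0 \<le> strict_dist A B"
    using l1_dist_nonneg[of UNIV A B] by (simp add: strict_dist_def)
  show "strict_dist A B = strict_dist B A"
    by (simp add: strict_dist_def l1_dist_commute abs_minus_commute)
  assume AB: "A \<in> FP" "B \<in> FP"
  show "strict_dist A B = 0 \<longleftrightarrow> A = B"
  proof
    assume "strict_dist A B = 0"
    then have "l1_dist UNIV A B = 0"
      using l1_dist_nonneg[of UNIV A B] by (simp add: strict_dist_def)
    then show "A = B"
      using AB l1_dist_UNIV_eq_0 by (auto simp: FP_def)
  qed (simp add: strict_dist_def l1_dist_self)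
  assume "C \<in> FP"
  with AB show "strict_dist A C \<le> strict_dist A B + strict_dist B C"
    using l1_dist_triangle_UNIV[of A B C] by (auto simp: strict_dist_def FP_def)
qed

definition strict_topology :: "'a::euclidean_space lset topology" where
  "strict_topology = Metric_space.mtopology FP strict_dist"

definition FP_borel :: "'a::euclidean_space lset measure" where
  "FP_borel = sigma FP {U. openin strict_topology U}"

text \<open>The coarsest topology for which the indicator function depends continuously on the set in
  the local L1 topology and the perimeter measure does so in the vague topology.\<close>

definition loc_strict_topology :: "'a::euclidean_space lset topology" where
  "loc_strict_topology = topology_generated_by
     ({{A \<in> FPloc. l1_dist K A B < \<epsilon>} | K B \<epsilon>. compact K \<and> B \<in> FPloc \<and> \<epsilon> > 0} \<union>
      {{A \<in> FPloc. (LINT x|perimeter_measure A. g x) \<in> V} | g V.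
         continuous_on UNIV g \<and> compact_support g \<and> open V})"

lemma topspace_loc_strict: "topspace loc_strict_topology = FPloc"
proof -
  have "{A \<in> FPloc. (LINT x|perimeter_measure A. (\<lambda>_. 0) x) \<in> (UNIV::real set)} \<in>
      {{A \<in> FPloc. (LINT x|perimeter_measure A. g x) \<in> V} | g V.
         continuous_on UNIV g \<and> compact_support g \<and> open V}"
    by (intro CollectI exI[of _ "\<lambda>_. 0"] exI[of _ UNIV]) (auto simp: compact_support_def)
  then show ?thesis
    unfolding loc_strict_topology_def topology_generated_by_topspace by blast
qed

lemma openin_loc_strict_l1:
  assumes "compact K" "B \<in> FPloc" "\<epsilon> > 0"
  shows "openin loc_strict_topology {A \<in> FPloc. l1_dist K A B < \<epsilon>}"
  unfolding loc_strict_topology_def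
  by (intro topology_generated_by_Basis UnI1 CollectI exI[of _ K] exI[of _ B] exI[of _ \<epsilon>] conjI refl)
    (fact assms)+

lemma openin_loc_strict_vague:
  assumes "continuous_on UNIV g" "compact_support g" "open V"
  shows "openin loc_strict_topology {A \<in> FPloc. (LINT x|perimeter_measure A. g x) \<in> V}"
  unfolding loc_strict_topology_def
  by (intro topology_generated_by_Basis UnI2 CollectI exI[of _ g] exI[of _ V] conjI refl)
    (fact assms)+

lemma limitin_loc_strict:
  "limitin loc_strict_topology A L sequentially \<longleftrightarrow>
     L \<in> FPloc \<and> (\<forall>\<^sub>F i in sequentially. A i \<in> FPloc) \<and>
     (\<forall>K. compact K \<longrightarrow> (\<lambda>i. l1_dist K (A i) L) \<longlonglongrightarrow> 0) \<and>
     (\<forall>g. continuous_on UNIV g \<and> compact_support g \<longrightarrow>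
        (\<lambda>i. LINT x|perimeter_measure (A i). g x) \<longlonglongrightarrow> (LINT x|perimeter_measure L. g x))"
  (is "?lhs \<longleftrightarrow> ?rhs")
proof
  assume lim: ?lhs
  have basic: "\<forall>\<^sub>F i in sequentially. A i \<in> U" if "openin loc_strict_topology U" "L \<in> U" for U
    using lim that by (auto simp: limitin_def)
  have L: "L \<in> FPloc"
    using limitin_topspace[OF lim] by (simp add: topspace_loc_strict)
  moreover have "\<forall>\<^sub>F i in sequentially. A i \<in> FPloc"
    using basic[OF openin_topspace] L by (simp add: topspace_loc_strict)
  moreover have "(\<lambda>i. l1_dist K (A i) L) \<longlonglongrightarrow> 0" if K: "compact K" for K
  proof (rule tendstoI)
    fix \<epsilon> :: real assume "\<epsilon> > 0"
    from basic[OF openin_loc_strict_l1[OF K L this]] have "\<forall>\<^sub>F i in sequentially. A i \<in> {A \<in> FPloc. l1_dist K A L < \<epsilon>}"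
      using L \<open>\<epsilon> > 0\<close> by (simp add: l1_dist_self)
    then show "\<forall>\<^sub>F i in sequentially. dist (l1_dist K (A i) L) 0 < \<epsilon>"
      by eventually_elim (simp add: l1_dist_nonneg)
  qed
  moreover have "(\<lambda>i. LINT x|perimeter_measure (A i). g x) \<longlonglongrightarrow> (LINT x|perimeter_measure L. g x)"
    if g: "continuous_on UNIV g" "compact_support g" for g
  proof (rule topological_tendstoI)
    fix V :: "real set" assume V: "open V" "(LINT x|perimeter_measure L. g x) \<in> V"
    from basic[OF openin_loc_strict_vague[OF g V(1)]]
    have "\<forall>\<^sub>F i in sequentially. A i \<in> {A \<in> FPloc. (LINT x|perimeter_measure A. g x) \<in> V}"
      using L V by simp
    then show "\<forall>\<^sub>F i in sequentially. (LINT x|perimeter_measure (A i). g x) \<in> V"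
      by eventually_elim simp
  qed
  ultimately show ?rhs
    by blast
next
  assume R: ?rhs
  then have L: "L \<in> FPloc" and ev: "\<forall>\<^sub>F i in sequentially. A i \<in> FPloc"
    by auto
  have "L \<in> U \<longrightarrow> (\<forall>\<^sub>F i in sequentially. A i \<in> U)" if "openin loc_strict_topology U" for U
    using that unfolding loc_strict_topology_def openin_topology_generated_by_iff
  proof induction
    case (Int a b)
    then show ?case by (auto simp: eventually_conj_iff)
  next
    case (UN X)
    show ?case
    proof
      assume "L \<in> \<Union>X"
      then obtain k where k: "k \<in> X" "L \<in> k"
        by blast
      from UN.IH[OF k(1)] k(2) have "\<forall>\<^sub>F i in sequentially. A i \<in> k"
        by simp
      then show "\<forall>\<^sub>F i in sequentially. A i \<in> \<Union>X"
        by eventually_elim (use k(1) in blast)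
    qed
  next
    case (Basis s)
    then show ?case
    proof
      assume "s \<in> {{A \<in> FPloc. l1_dist K A B < \<epsilon>} | K B \<epsilon>. compact K \<and> B \<in> FPloc \<and> \<epsilon> > 0}"
      then obtain K B \<epsilon> where s: "s = {A \<in> FPloc. l1_dist K A B < \<epsilon>}" and K: "compact K"
        by blast
      show ?case
      proof
        assume "L \<in> s"
        then have "l1_dist K L B < \<epsilon>"
          by (simp add: s)
        moreover have "(\<lambda>i. l1_dist K (A i) L) \<longlonglongrightarrow> 0"
          using R K by blast
        ultimately have "\<forall>\<^sub>F i in sequentially. l1_dist K (A i) L < \<epsilon> - l1_dist K L B"
          by (intro order_tendstoD) auto
        with ev show "\<forall>\<^sub>F i in sequentially. A i \<in> s"
        proof eventually_elim
          case (elim i)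
          then show ?case
            using l1_dist_triangle_compact[OF K, of "A i" B L] by (simp add: s)
        qed
      qed
    next
      assume "s \<in> {{A \<in> FPloc. (LINT x|perimeter_measure A. g x) \<in> V} | g V.
         continuous_on UNIV g \<and> compact_support g \<and> open V}"
      then obtain g V where s: "s = {A \<in> FPloc. (LINT x|perimeter_measure A. g x) \<in> V}"
        and g: "continuous_on UNIV g" "compact_support g" and V: "open V"
        by blast
      show ?case
      proof
        assume "L \<in> s"
        then have "\<forall>\<^sub>F i in sequentially. (LINT x|perimeter_measure (A i). g x) \<in> V"
          using R g V by (intro topological_tendstoD) (auto simp: s)
        with ev show "\<forall>\<^sub>F i in sequentially. A i \<in> s"
          by eventually_elim (simp add: s)
      qed
    qed
  qed simp
  with L show ?lhs
    by (simp add: limitin_def topspace_loc_strict)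
qed

definition FPloc_borel :: "'a::euclidean_space lset measure" where
  "FPloc_borel = sigma FPloc {U. openin loc_strict_topology U}"

section \<open>Random sets and random processes\<close>

text \<open>Standard in the sense of Rokhlin: after completion, isomorphic modulo null sets to the completion of
  a Borel probability measure on the real line. Completing the space first also admits
  probability measures on standard Borel spaces.\<close>

definition standard_prob_space :: "'w measure \<Rightarrow> bool" where
  "standard_prob_space M \<longleftrightarrow> prob_space M \<and>
     (\<exists>(\<nu>::real measure) \<Omega>\<^sub>0 R\<^sub>0 f g.
        prob_space \<nu> \<and> sets \<nu> = sets borel \<and>
        \<Omega>\<^sub>0 \<in> sets (completion M) \<and> emeasure (completion M) \<Omega>\<^sub>0 = 1 \<and>
        R\<^sub>0 \<in> sets (completion \<nu>) \<and> emeasure (completion \<nu>) R\<^sub>0 = 1 \<and>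
        f \<in> measurable (restrict_space (completion M) \<Omega>\<^sub>0) (restrict_space (completion \<nu>) R\<^sub>0) \<and>
        g \<in> measurable (restrict_space (completion \<nu>) R\<^sub>0) (restrict_space (completion M) \<Omega>\<^sub>0) \<and>
        (\<forall>w\<in>\<Omega>\<^sub>0. g (f w) = w) \<and> (\<forall>r\<in>R\<^sub>0. f (g r) = r) \<and>
        distr (restrict_space (completion M) \<Omega>\<^sub>0) (restrict_space (completion \<nu>) R\<^sub>0) f =
          restrict_space (completion \<nu>) R\<^sub>0)"

definition random_FPloc_set :: "'w measure \<Rightarrow> ('w \<Rightarrow> 'a::euclidean_space lset) \<Rightarrow> bool" where
  "random_FPloc_set M X \<longleftrightarrow> standard_prob_space M \<and> X \<in> measurable M FPloc_borel"

definition stationary_set :: "'w measure \<Rightarrow> ('w \<Rightarrow> 'a::euclidean_space lset) \<Rightarrow> bool" where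
  "stationary_set M X \<longleftrightarrow>
     (\<forall>z. distr (distr M FPloc_borel X) FPloc_borel (translate z) = distr M FPloc_borel X)"

definition B0 :: "'a::euclidean_space lset set set" where
  "B0 = {U \<in> sets FP_borel. \<exists>K. compact K \<and> (\<forall>A\<in>U. emeasure (perimeter_measure A) K > 0)}"

definition Nsharp :: "'a::euclidean_space lset measure set" where
  "Nsharp = {\<nu>. sets \<nu> = sets FP_borel \<and>
     (\<forall>U\<in>sets FP_borel. emeasure \<nu> U = \<infinity> \<or> (\<exists>n::nat. emeasure \<nu> U = of_nat n)) \<and>
     (\<forall>U\<in>B0. emeasure \<nu> U < \<infinity>)}"

definition Nsharp_algebra :: "'a::euclidean_space lset measure measure" where
  "Nsharp_algebra = sigma Nsharp {{\<nu> \<in> Nsharp. emeasure \<nu> U \<in> V} | U V. U \<in> B0 \<and> V \<in> sets borel}"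

definition random_FP_process ::
    "'w measure \<Rightarrow> ('w \<Rightarrow> 'a::euclidean_space lset measure) \<Rightarrow> bool" where
  "random_FP_process M \<Phi> \<longleftrightarrow> standard_prob_space M \<and> \<Phi> \<in> measurable M Nsharp_algebra"

definition shift :: "'a::euclidean_space \<Rightarrow> 'a lset measure \<Rightarrow> 'a lset measure" where
  "shift z \<nu> = distr \<nu> FP_borel (translate z)"

definition stationary_process ::
    "'w measure \<Rightarrow> ('w \<Rightarrow> 'a::euclidean_space lset measure) \<Rightarrow> bool" where
  "stationary_process M \<Phi> \<longleftrightarrow>
     (\<forall>z. distr (distr M Nsharp_algebra \<Phi>) Nsharp_algebra (shift z) = distr M Nsharp_algebra \<Phi>)"

definition process_atoms :: "'a::euclidean_space lset measure \<Rightarrow> 'a lset set" where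
  "process_atoms \<nu> = {A \<in> FP. emeasure \<nu> {A} > 0}"

end

theory Submission
  imports Defs
begin

text \<open>
  Only finitely many atoms of a point process charge a given ball with their perimeter measures, so
  the sum \<open>m\<close> of the perimeter measures of all atoms is a Radon measure. For a single set, the mean
  value theorem bounds the difference quotients of the indicator function by the perimeter measure;
  since \<open>|1\<^sub>X(x) - 1\<^sub>X(y)| \<le> \<Sum>\<^sub>A |1\<^sub>A(x) - 1\<^sub>A(y)|\<close> for the union \<open>X\<close>, passing to the limit gives
  \<open>|\<integral>\<^sub>X \<partial>\<^sub>b \<phi>| \<le> \<integral> |\<phi>| dm\<close> for all test functions \<open>\<phi>\<close>. A functional dominated in this way extends to
  indicator functions by density and is represented by a signed Radon measure, so no Riesz
  representation theorem is needed, and \<open>X\<close> has locally finite perimeter.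

  For measurability, the locally strict topology is the initial topology of countably many local
  \<open>L\<^sup>1\<close> distances and integrals against perimeter measures. The perimeter measure depends measurably
  on the set with respect to the maps \<open>A \<mapsto> \<integral>\<^sub>A f\<close>, because the derivative of a box is a limit of
  integrals of derivatives of bump functions, and the variation is a supremum along a fixed sequence
  of fine partitions. Hence only the maps \<open>\<nu> \<mapsto> \<integral>\<^sub>X f\<close> have to be measurable. This follows by replacing
  each of the finitely many atoms charging a ball by a nearby member of a countable dense family,
  which turns the union into a function of the events \<open>\<nu>(U) > 0\<close>. Stationarity is the
  translation equivariance of the map from point measures to unions.\<close>

section \<open>Smooth functions\<close>

text \<open>The obstacle is that 1_X depends nonlinearly on the 1_A, so adding the derivatives of
  the atoms says nothing about the derivative of X. Difference quotients do obey a pointwise bound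
  by a sum over the atoms, but with absolute values inside the Lebesgue integral, while integration
  by parts yields absolute values outside. The gap is closed for each atom separately, by testing
  with f times an approximate sign.

  An atom may charge no ball at all, and its mass may then be infinite. Finite volume identifies it
  as the class of the empty set: zero perimeter makes volume integrals shift invariant, and many
  disjoint bumps of equal integral do not fit into finite volume. Every other atom lies in some
  member of the sequence \<open>charging\<close>, where the process is finite.

  Perimeter measures and representatives arise by choice. Measurability arguments therefore run
  through the numbers \<open>lset_integral A f\<close>, which determine the derivative on bounded
  Borel sets.\<close>

lemma Ck_SucI:
  fixes f :: "'a::euclidean_space \<Rightarrow> real"
  assumes "\<And>x. (f has_derivative f' x) (at x)" "\<And>b. b \<in> Basis \<Longrightarrow> Ck k (\<lambda>x. f' x b)"
  shows "Ck (Suc k) f"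
  using assms frechet_derivative_at[OF assms(1)] unfolding Ck.simps
  by (auto simp: differentiable_def)

lemma Ck_SucD:
  fixes f :: "'a::euclidean_space \<Rightarrow> real"
  assumes "Ck (Suc k) f"
  shows "(f has_derivative frechet_derivative f (at x)) (at x)"
    "b \<in> Basis \<Longrightarrow> Ck k (\<lambda>x. frechet_derivative f (at x) b)"
  using assms frechet_derivative_works by auto

lemma Ck_Suc_imp: "Ck (Suc k) f \<Longrightarrow> Ck k f"
proof (induction k arbitrary: f)
  case 0
  then show ?case
    by (auto simp: continuous_on_eq_continuous_at intro!: differentiable_imp_continuous_within)
qed auto

lemma Ck_const: "Ck k (\<lambda>x::'a::euclidean_space. c)"
  by (induction k arbitrary: c) (auto intro!: continuous_intros)

lemma Ck_linear:
  assumes "bounded_linear (f :: 'a::euclidean_space \<Rightarrow> real)"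
  shows "Ck k f"
proof (cases k)
  case 0
  then show ?thesis
    using assms by (simp add: linear_continuous_on)
next
  case (Suc n)
  show ?thesis
    unfolding Suc by (rule Ck_SucI[of f "\<lambda>_. f"])
      (auto intro: bounded_linear_imp_has_derivative assms Ck_const)
qed

lemma Ck_add: "Ck k f \<Longrightarrow> Ck k g \<Longrightarrow> Ck k (\<lambda>x. f x + g x)"
proof (induction k arbitrary: f g)
  case 0
  then show ?case by (auto intro!: continuous_intros)
next
  case (Suc k)
  show ?case
    by (rule Ck_SucI[OF has_derivative_add[OF Ck_SucD(1)[OF Suc.prems(1)] Ck_SucD(1)[OF Suc.prems(2)]]])
      (intro Suc.IH Ck_SucD(2) Suc.prems)
qed

lemma Ck_mult: "Ck k f \<Longrightarrow> Ck k g \<Longrightarrow> Ck k (\<lambda>x. f x * g x)"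
proof (induction k arbitrary: f g)
  case 0
  then show ?case by (auto intro!: continuous_intros)
next
  case (Suc k)
  show ?case
    by (rule Ck_SucI[OF has_derivative_mult[OF Ck_SucD(1)[OF Suc.prems(1)] Ck_SucD(1)[OF
        Suc.prems(2)]]])
      (intro Ck_add Suc.IH Ck_SucD(2) Suc.prems Ck_Suc_imp)
qed

lemma Ck_diff: "Ck k f \<Longrightarrow> Ck k g \<Longrightarrow> Ck k (\<lambda>x. f x - g x)"
  using Ck_add[of k f "\<lambda>x. -1 * g x"] Ck_mult[OF Ck_const[of k "-1"], of g] by simp

lemma Ck_prod: "(\<And>i. i \<in> I \<Longrightarrow> Ck k (f i)) \<Longrightarrow> Ck k (\<lambda>x. \<Prod>i\<in>I. f i x)"
  by (induction I rule: infinite_finite_induct) (auto intro: Ck_mult Ck_const)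

text \<open>The chain rule replaces \<open>D n\<close> by \<open>D (Suc n)\<close>, so the induction
  carries the whole tower of derivatives and leaves \<open>n\<close> arbitrary.\<close>

lemma Ck_compose_real:
  fixes D :: "nat \<Rightarrow> real \<Rightarrow> real"
  assumes D: "\<And>n x. (D n has_real_derivative D (Suc n) x) (at x)"
  shows "Ck k f \<Longrightarrow> Ck k (\<lambda>x. D n (f x))"
proof (induction k arbitrary: f n)
  case 0
  have "continuous_on UNIV (D n)"
    using D by (intro DERIV_continuous_on) auto
  with 0 show ?case
    by (auto intro: continuous_on_compose2[of UNIV "D n"])
next
  case (Suc k)
  have der: "((\<lambda>x. D n (f x)) has_derivative
      (\<lambda>v. D (Suc n) (f x) * frechet_derivative f (at x) v)) (at x)" for x
    by (rule has_derivative_compose[OF Ck_SucD(1)[OF Suc.prems]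
          D[THEN has_field_derivative_imp_has_derivative, of n "f x"]])
  show ?case
    by (rule Ck_SucI[OF der]) (intro Ck_mult Suc.IH Ck_SucD(2) Suc.prems Ck_Suc_imp[OF Suc.prems])
qed

lemma has_derivative_translate:
  fixes f :: "'a::euclidean_space \<Rightarrow> real"
  assumes "(f has_derivative f') (at (x - c))"
  shows "((\<lambda>x. f (x - c)) has_derivative f') (at x)"
proof -
  have "((\<lambda>x. x - c) has_derivative (\<lambda>h. h)) (at x)"
    by (auto intro!: derivative_eq_intros)
  from has_derivative_compose[OF this assms] show ?thesis .
qed

lemma Ck_translate: "Ck k f \<Longrightarrow> Ck k (\<lambda>x. f (x - c))"
proof (induction k arbitrary: f)
  case 0
  then show ?case
    by (auto intro!: continuous_on_compose2[of UNIV f] continuous_intros)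
next
  case (Suc k)
  show ?case
    by (rule Ck_SucI[OF has_derivative_translate[OF Ck_SucD(1)[OF Suc.prems]]])
      (intro Suc.IH Ck_SucD(2) Suc.prems)
qed

text \<open>The classical flat function exp(-1/x), multiplied by a polynomial in 1/x. The polynomial
  parameter makes the family closed under differentiation, which gives derivatives of all orders at
  once.\<close>

definition flat :: "real poly \<Rightarrow> real \<Rightarrow> real" where
  "flat p x = (if x > 0 then poly p (1 / x) * exp (- 1 / x) else 0)"

lemma poly_div_exp_tendsto_0: "((\<lambda>y. poly p y / exp y) \<longlongrightarrow> 0) at_top" for p :: "real poly"
proof -
  have "((\<lambda>y. \<Sum>i\<le>degree p. coeff p i * (y ^ i / exp y)) \<longlongrightarrow> (\<Sum>i\<le>degree p. coeff p i * 0)) at_top"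
    by (intro tendsto_intros tendsto_power_div_exp_0)
  then show ?thesis
    by (simp add: poly_altdef sum_divide_distrib)
qed

text \<open>With y = 1/x, the chain rule turns p(y) exp(-y) into y^2 (p - p')(y) exp(-y), and
  \<open>[:0,0,1:]\<close> is y^2. At 0 both one-sided difference quotients tend to 0, since the
  exponential beats every polynomial.\<close>

lemma flat_has_derivative:
  "(flat p has_real_derivative flat ([:0,0,1:] * (p - pderiv p)) x) (at x)"
proof -
  consider "x > 0" | "x < 0" | "x = 0" by linarith
  then show ?thesis
  proof cases
    case 1
    have "((\<lambda>x. poly p (1 / x) * exp (- 1 / x)) has_real_derivative
        flat ([:0,0,1:] * (p - pderiv p)) x) (at x)"
      using 1 by (auto intro!: derivative_eq_intros simp: flat_def field_simps power2_eq_square)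
    moreover have "\<forall>\<^sub>F y in nhds x. y \<in> {0<..}"
      using 1 by (intro eventually_nhds_in_open) auto
    then have "\<forall>\<^sub>F y in nhds x. poly p (1 / y) * exp (- 1 / y) = flat p y"
      by eventually_elim (simp add: flat_def)
    ultimately show ?thesis
      by (rule DERIV_cong_ev[OF refl _ refl, THEN iffD1, rotated])
  next
    case 2
    have "((\<lambda>x. 0) has_real_derivative flat ([:0,0,1:] * (p - pderiv p)) x) (at x)"
      using 2 by (simp add: flat_def)
    moreover have "\<forall>\<^sub>F y in nhds x. y \<in> {..<0}"
      using 2 by (intro eventually_nhds_in_open) auto
    then have "\<forall>\<^sub>F y in nhds x. 0 = flat p y"
      by eventually_elim (simp add: flat_def)
    ultimately show ?thesis
      by (rule DERIV_cong_ev[OF refl _ refl, THEN iffD1, rotated])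
  next
    case 3
    have "((\<lambda>y. flat p y / y) \<longlongrightarrow> 0) (at_right 0)"
    proof -
      \<comment> \<open>The factor \<open>[:0,1:]\<close>, that is y, accounts for the division by
        the increment.\<close>
      have "((\<lambda>y. poly ([:0,1:] * p) (inverse y) / exp (inverse y)) \<longlongrightarrow> 0) (at_right (0::real))"
        by (rule filterlim_compose[OF poly_div_exp_tendsto_0 filterlim_inverse_at_top_right])
      then show ?thesis
        by (rule Lim_transform_eventually)
          (simp add: eventually_at_filter flat_def divide_inverse exp_minus mult.commute)
    qed
    moreover have "((\<lambda>y. flat p y / y) \<longlongrightarrow> 0) (at_left 0)"
      by (rule Lim_transform_eventually[of "\<lambda>_. 0"])
        (simp_all add: eventually_at_filter flat_def)
    ultimately have "((\<lambda>y. flat p y / y) \<longlongrightarrow> 0) (at 0)"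
      by (simp add: filterlim_split_at)
    then show ?thesis
      using 3 by (simp add: has_field_derivative_iff flat_def)
  qed
qed

definition flat_exp :: "real \<Rightarrow> real" where "flat_exp = flat 1"

lemma flat_exp_pos_iff: "flat_exp x > 0 \<longleftrightarrow> x > 0" and flat_exp_nonneg: "flat_exp x \<ge> 0"
  by (auto simp: flat_exp_def flat_def)

lemma Ck_flat_exp:
  assumes "Ck k f"
  shows "Ck k (\<lambda>x. flat_exp (f x))"
proof -
  let ?D = "\<lambda>n. flat (((\<lambda>p. [:0,0,1:] * (p - pderiv p)) ^^ n) 1)"
  have "Ck k (\<lambda>x. ?D 0 (f x))"
    by (rule Ck_compose_real[OF _ assms]) (use flat_has_derivative in simp)
  then show ?thesis by (simp add: flat_exp_def)
qed

lemma Ck_exp: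
  assumes "Ck k f"
  shows "Ck k (\<lambda>x. exp (f x))"
  by (rule Ck_compose_real[of "\<lambda>_. exp", OF _ assms]) (auto intro: DERIV_exp)

text \<open>The product is a smooth weight w that is positive exactly on the open box. Passing to 1
  - exp(-n w) keeps the values in [0,1] and tends to the indicator of the box, which is itself a
  majorant for dominated convergence.\<close>

definition box_bump :: "'a::euclidean_space \<Rightarrow> 'a \<Rightarrow> nat \<Rightarrow> 'a \<Rightarrow> real" where
  "box_bump l u n x = 1 - exp (- real n *
     (\<Prod>b\<in>Basis. flat_exp (x \<bullet> b - l \<bullet> b) * flat_exp (u \<bullet> b - x \<bullet> b)))"

lemma box_bump_weight:
  fixes l u x :: "'a::euclidean_space"
  shows "(\<Prod>b\<in>Basis. flat_exp (x \<bullet> b - l \<bullet> b) * flat_exp (u \<bullet> b - x \<bullet> b)) \<ge> 0"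
    and "(\<Prod>b\<in>Basis. flat_exp (x \<bullet> b - l \<bullet> b) * flat_exp (u \<bullet> b - x \<bullet> b)) > 0 \<longleftrightarrow> x \<in> box l u"
proof -
  show nn: "(\<Prod>b\<in>Basis. flat_exp (x \<bullet> b - l \<bullet> b) * flat_exp (u \<bullet> b - x \<bullet> b)) \<ge> 0"
    by (intro prod_nonneg) (auto simp: flat_exp_nonneg)
  have "(\<Prod>b\<in>Basis. flat_exp (x \<bullet> b - l \<bullet> b) * flat_exp (u \<bullet> b - x \<bullet> b)) \<noteq> 0 \<longleftrightarrow>
      (\<forall>b\<in>Basis. flat_exp (x \<bullet> b - l \<bullet> b) > 0 \<and> flat_exp (u \<bullet> b - x \<bullet> b) > 0)"
    using flat_exp_nonneg by (auto simp: less_le)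
  then show "(\<Prod>b\<in>Basis. flat_exp (x \<bullet> b - l \<bullet> b) * flat_exp (u \<bullet> b - x \<bullet> b)) > 0 \<longleftrightarrow> x \<in> box l u"
    using nn by (auto simp: less_le[of "0::real" "prod _ _"] mem_box flat_exp_pos_iff)
qed

lemma box_bump_range: "0 \<le> box_bump l u n x" "box_bump l u n x \<le> 1"
  using box_bump_weight(1)[of x l u] by (auto simp: box_bump_def)

lemma box_bump_eq_0: "x \<notin> box l u \<Longrightarrow> box_bump l u n x = 0"
  using box_bump_weight[where x=x and l=l and u=u] by (simp add: box_bump_def)

lemma box_bump_tendsto: "(\<lambda>n. box_bump l u n x) \<longlonglongrightarrow> indicator (box l u) x"
proof (cases "x \<in> box l u")
  case True
  define c where "c = (\<Prod>b\<in>Basis. flat_exp (x \<bullet> b - l \<bullet> b) * flat_exp (u \<bullet> b - x \<bullet> b))"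
  have c: "c > 0"
    using True box_bump_weight(2)[where x=x and l=l and u=u] by (simp add: c_def)
  have "(\<lambda>n. 1 - (exp (- c)) ^ n) \<longlonglongrightarrow> 1 - 0"
    using c by (intro tendsto_intros LIMSEQ_realpow_zero) auto
  then show ?thesis
    using True by (simp add: box_bump_def c_def exp_of_nat_mult[symmetric])
next
  case False
  then show ?thesis
    by (simp add: box_bump_eq_0)
qed

lemma compact_support_iff: "compact_support f \<longleftrightarrow> bounded {x. f x \<noteq> 0}"
  unfolding compact_support_def compact_closure ..

lemma test_function_box_bump: "test_function (box_bump l u n)"
proof -
  have "Ck k (box_bump l u n)" for k
    unfolding box_bump_def
    by (intro Ck_diff Ck_const Ck_exp Ck_mult Ck_prod Ck_flat_exp Ck_linear bounded_linear_inner_left)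
  moreover have "bounded {x. box_bump l u n x \<noteq> 0}"
    by (rule bounded_subset[OF bounded_box[of l u]]) (use box_bump_eq_0 in auto)
  ultimately show ?thesis
    by (simp add: test_function_def compact_support_iff)
qed

section \<open>Test functions\<close>

lemma test_functionD:
  assumes "test_function f"
  shows "continuous_on UNIV f" "bounded {x. f x \<noteq> 0}"
    "(f has_derivative frechet_derivative f (at x)) (at x)"
  using assms Ck_SucD(1)[of 0 f x] Ck.simps(1)[of f]
  unfolding test_function_def compact_support_iff by blast+

lemma test_function_mult_smooth:
  assumes "test_function f" "\<And>k. Ck k g"
  shows "test_function (\<lambda>x. f x * g x)"
  using assms unfolding test_function_def compact_support_iff
  by (auto intro: Ck_mult bounded_subset)

lemma test_function_smooth: "test_function f \<Longrightarrow> Ck k f"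
  by (simp add: test_function_def)

lemma test_function_0: "test_function (\<lambda>x. 0)"
  by (simp add: test_function_def compact_support_iff Ck_const)

lemma test_function_cmult: "test_function f \<Longrightarrow> test_function (\<lambda>x. c * f x)"
  using test_function_mult_smooth[of f "\<lambda>_. c"] by (simp add: Ck_const mult.commute)

lemma test_function_add: "test_function f \<Longrightarrow> test_function g \<Longrightarrow> test_function (\<lambda>x. f x + g x)"
  unfolding test_function_def compact_support_iff
  by (auto intro: Ck_add bounded_subset[of "{x. f x \<noteq> 0} \<union> {x. g x \<noteq> 0}"])

lemma test_function_diff: "test_function f \<Longrightarrow> test_function g \<Longrightarrow> test_function (\<lambda>x. f x - g x)"
  using test_function_add[of f "\<lambda>x. -1 * g x"] test_function_cmult[of g "-1"] by simp

lemma test_function_translate: "test_function f \<Longrightarrow> test_function (\<lambda>x. f (x - c))"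
proof -
  assume f: "test_function f"
  have "{x. f (x - c) \<noteq> 0} = (+) c ` {x. f x \<noteq> 0}"
    by (auto simp: image_iff intro!: exI[of _ "_ - c"])
  with f show ?thesis
    by (auto simp: test_function_def compact_support_iff intro!: Ck_translate bounded_translation)
qed

lemma frechet_derivative_test_function_translate:
  assumes "test_function f"
  shows "frechet_derivative (\<lambda>x. f (x - c)) (at x) = frechet_derivative f (at (x - c))"
  by (rule frechet_derivative_at[OF has_derivative_translate[OF test_functionD(3)[OF assms]],
      symmetric])

lemma
  fixes f :: "'a::euclidean_space \<Rightarrow> real"
  assumes f: "test_function f" and b: "b \<in> Basis"
  shows continuous_test_derivative: "continuous_on UNIV (\<lambda>x. frechet_derivative f (at x) b)"
    and bounded_support_test_derivative: "bounded {x. frechet_derivative f (at x) b \<noteq> 0}"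
proof -
  show "continuous_on UNIV (\<lambda>x. frechet_derivative f (at x) b)"
    using Ck_SucD(2)[OF test_function_smooth[OF f] b, of 0] by simp
  \<comment> \<open>Off the closed support, f vanishes in a whole neighbourhood.\<close>
  have "frechet_derivative f (at x) b = 0" if "x \<notin> closure {x. f x \<noteq> 0}" for x
  proof -
    have "\<forall>\<^sub>F y in nhds x. y \<in> - closure {x. f x \<noteq> 0}"
      using that by (intro eventually_nhds_in_open) auto
    then have "\<forall>\<^sub>F y in nhds x. 0 = f y"
      by eventually_elim (use closure_subset in force)
    then have "\<forall>\<^sub>F y in at x. 0 = f y"
      by (simp add: eventually_nhds_conv_at)
    moreover have "0 = f x"
      using that closure_subset[of "{x. f x \<noteq> 0}"] by auto
    ultimately have "(f has_derivative (\<lambda>_. 0)) (at x)"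
      using has_derivative_transform_eventually[of "\<lambda>_. 0" "\<lambda>_. 0" x UNIV f] by auto
    then show ?thesis
      by (metis frechet_derivative_at)
  qed
  then have "{x. frechet_derivative f (at x) b \<noteq> 0} \<subseteq> closure {x. f x \<noteq> 0}"
    by blast
  then show "bounded {x. frechet_derivative f (at x) b \<noteq> 0}"
    by (rule bounded_subset[OF bounded_closure[OF test_functionD(2)[OF f]]])
qed

lemma bounded_support_bounded_range:
  fixes f :: "'a::euclidean_space \<Rightarrow> real"
  assumes "continuous_on UNIV f" "bounded {x. f x \<noteq> 0}"
  obtains C where "C \<ge> 0" "\<And>x. \<bar>f x\<bar> \<le> C"
proof -
  have "compact (f ` closure {x. f x \<noteq> 0})"
    using assms by (intro compact_continuous_image) (auto intro: continuous_on_subset)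
  then obtain C where C: "C > 0" "\<And>x. x \<in> closure {x. f x \<noteq> 0} \<Longrightarrow> \<bar>f x\<bar> \<le> C"
    using compact_imp_bounded[THEN bounded_pos[THEN iffD1]] by (metis image_eqI real_norm_def)
  have "\<bar>f x\<bar> \<le> C" for x
    using C closure_subset[of "{x. f x \<noteq> 0}"] by (cases "f x = 0") auto
  with C(1) show ?thesis by (intro that[of C]) auto
qed

lemma bounded_support_uniformly_continuous:
  fixes f :: "'a::euclidean_space \<Rightarrow> real"
  assumes "continuous_on UNIV f" "bounded {x. f x \<noteq> 0}" "e > 0"
  obtains d where "d > 0" "\<And>x y. dist x y < d \<Longrightarrow> \<bar>f x - f y\<bar> < e"
proof -
  obtain r where r: "{x. f x \<noteq> 0} \<subseteq> ball 0 r"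
    using bounded_subset_ballD[OF assms(2), of 0] by auto
  have "uniformly_continuous_on (cball 0 (r + 1)) f"
    using assms(1) by (intro compact_uniformly_continuous) (auto intro: continuous_on_subset)
  then obtain d where d: "d > 0" "\<And>x y. x \<in> cball 0 (r + 1) \<Longrightarrow> y \<in> cball 0 (r + 1) \<Longrightarrow> dist x y < d \<Longrightarrow>
      \<bar>f x - f y\<bar> < e"
    using assms(3) unfolding uniformly_continuous_on_def dist_real_def by metis
  show ?thesis
  \<comment> \<open>The cap 1 matches the margin of the ball: if one of two points at distance below
    1 has norm above r + 1, both have norm above r, where f is 0.\<close>
  proof (rule that[of "min d 1"])
    fix x y :: 'a assume xy: "dist x y < min d 1"
    show "\<bar>f x - f y\<bar> < e"
    proof (cases "x \<in> cball 0 (r + 1) \<and> y \<in> cball 0 (r + 1)")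
      case True
      then show ?thesis using d xy by auto
    next
      case False
      then have "norm x > r + 1 \<or> norm y > r + 1" by auto
      moreover have "\<bar>norm x - norm y\<bar> < 1"
        using xy norm_triangle_ineq3[of x y] by (simp add: dist_norm)
      ultimately have "x \<notin> ball 0 r" "y \<notin> ball 0 r" by auto
      then have "f x = 0" "f y = 0" using r by auto
      then show ?thesis using assms(3) by simp
    qed
  qed (use d in auto)
qed

section \<open>Radon measures\<close>

lemma radon_measureD:
  assumes "radon_measure M"
  shows "sets M = sets borel" "space M = UNIV"
  using assms sets_eq_imp_space_eq[of M borel] by (auto simp: radon_measure_def)

lemma radon_emeasure_bounded:
  assumes "radon_measure M" "bounded E"
  shows "emeasure M E < \<infinity>"
proof -
  have "emeasure M E \<le> emeasure M (closure E)"
    using assms by (intro emeasure_mono closure_subset) (auto simp: radon_measureD)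
  also have "\<dots> < \<infinity>"
    using assms unfolding radon_measure_def compact_closure[symmetric] by blast
  finally show ?thesis .
qed

lemma emeasure_eq_measure_bounded:
  "radon_measure M \<Longrightarrow> bounded E \<Longrightarrow> emeasure M E = ennreal (measure M E)"
  using radon_emeasure_bounded[of M E] by (simp add: emeasure_eq_ennreal_measure less_top)

text \<open>Large enough to contain test functions, their derivatives and indicators of bounded
  Borel sets; small enough to be integrable for every Radon measure.\<close>

definition bounded_borel :: "('a::euclidean_space \<Rightarrow> real) \<Rightarrow> bool" where
  "bounded_borel f \<longleftrightarrow> f \<in> borel_measurable borel \<and> bounded (range f) \<and> bounded {x. f x \<noteq> 0}"

lemma bounded_borelI:
  assumes "f \<in> borel_measurable borel" "\<And>x. \<bar>f x\<bar> \<le> C" "bounded {x. f x \<noteq> 0}"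
  shows "bounded_borel f"
  using assms by (auto simp: bounded_borel_def intro!: boundedI[of _ C])

lemma bounded_borelD:
  assumes "bounded_borel f"
  shows "f \<in> borel_measurable borel" "bounded {x. f x \<noteq> 0}"
  using assms by (auto simp: bounded_borel_def)

lemma bounded_borel_bound:
  assumes "bounded_borel f"
  obtains C where "C > 0" "\<And>x. \<bar>f x\<bar> \<le> C"
  using assms unfolding bounded_borel_def bounded_pos by auto

lemma bounded_borel_continuous:
  assumes "continuous_on UNIV f" "bounded {x. f x \<noteq> 0}"
  shows "bounded_borel f"
proof -
  obtain C where "\<And>x. \<bar>f x\<bar> \<le> C"
    using bounded_support_bounded_range[OF assms] by blast
  then show ?thesis
    using assms by (intro bounded_borelI borel_measurable_continuous_onI)
qed

lemma bounded_borel_test: "test_function f \<Longrightarrow> bounded_borel f"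
  by (intro bounded_borel_continuous test_functionD)

lemma bounded_borel_indicator:
  "E \<in> sets borel \<Longrightarrow> bounded E \<Longrightarrow> bounded_borel (indicator E)"
  by (intro bounded_borelI[of _ 1]) (auto simp: indicator_def)

lemma bounded_borel_add:
  assumes "bounded_borel f" "bounded_borel g"
  shows "bounded_borel (\<lambda>x. f x + g x)"
proof -
  obtain C D where "\<And>x. \<bar>f x\<bar> \<le> C" "\<And>x. \<bar>g x\<bar> \<le> D"
    using assms by (metis bounded_borel_bound)
  then show ?thesis
    using assms bounded_borelD[OF assms(1)] bounded_borelD[OF assms(2)]
    by (intro bounded_borelI[of _ "C + D"])
      (auto intro: bounded_subset[of "{x. f x \<noteq> 0} \<union> {x. g x \<noteq> 0}"] abs_triangle_ineq[THEN
          order_trans] add_mono)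
qed

lemma bounded_borel_mult:
  assumes "bounded_borel f" "g \<in> borel_measurable borel" "\<And>x. \<bar>g x\<bar> \<le> D"
  shows "bounded_borel (\<lambda>x. f x * g x)"
proof -
  obtain C where "C > 0" "\<And>x. \<bar>f x\<bar> \<le> C"
    using assms by (metis bounded_borel_bound)
  then show ?thesis
    using assms bounded_borelD[OF assms(1)]
    by (intro bounded_borelI[of _ "C * D"])
      (auto intro: bounded_subset[of "{x. f x \<noteq> 0}"] mult_mono simp: abs_mult)
qed

lemma bounded_borel_cmult: "bounded_borel f \<Longrightarrow> bounded_borel (\<lambda>x. c * f x)"
  using bounded_borel_mult[of f "\<lambda>_. c" "\<bar>c\<bar>"] by (simp add: mult.commute)

lemma bounded_borel_diff:
  "bounded_borel f \<Longrightarrow> bounded_borel g \<Longrightarrow> bounded_borel (\<lambda>x. f x - g x)"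
  using bounded_borel_add[of f "\<lambda>x. -1 * g x"] bounded_borel_cmult[of g "-1"] by simp

lemma bounded_borel_abs: "bounded_borel f \<Longrightarrow> bounded_borel (\<lambda>x. \<bar>f x\<bar>)"
  by (auto simp: bounded_borel_def bounded_iff)

lemma bounded_borel_max: "bounded_borel f \<Longrightarrow> bounded_borel (\<lambda>x. max 0 (f x))"
  unfolding bounded_borel_def bounded_iff by (fastforce simp: max_def)

lemma bounded_borel_integrable:
  assumes "radon_measure M" "bounded_borel f"
  shows "integrable M f"
proof -
  obtain C where C: "C > 0" "\<And>x. \<bar>f x\<bar> \<le> C"
    using assms by (metis bounded_borel_bound)
  have b: "bounded (closure {x. f x \<noteq> 0})"
    using bounded_borelD[OF assms(2)] by (intro bounded_closure) auto
  show ?thesis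
  proof (rule Bochner_Integration.integrable_bound)
    show "integrable M (\<lambda>x. C * indicator (closure {x. f x \<noteq> 0}) x)"
      using radon_emeasure_bounded[OF assms(1) b] assms(1)
      by (intro integrable_mult_right integrable_real_indicator) (auto simp: radon_measureD)
    show "f \<in> borel_measurable M"
      using bounded_borelD[OF assms(2)] assms(1) by (simp add: radon_measureD cong:
          measurable_cong_sets)
    show "AE x in M. norm (f x) \<le> norm (C * indicator (closure {x. f x \<noteq> 0}) x)"
      using C closure_subset[of "{x. f x \<noteq> 0}"] by (intro AE_I2) (auto simp: indicator_def)
  qed
qed

lemma radon_lborel: "radon_measure lborel"
  using emeasure_bounded_finite[OF compact_imp_bounded] by (auto simp: radon_measure_def)

section \<open>Comparing integrals against Radon measures\<close>

lemma incseq_Int_cball: "incseq (\<lambda>n. E \<inter> cball 0 (real n))"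
  by (auto intro!: monoI)

lemma UN_Int_cball: "(\<Union>n. E \<inter> cball (0::'a::real_normed_vector) (real n)) = E"
  using real_arch_simple by auto

lemma Lim_emeasure_Int_cball:
  assumes "sets M = sets borel" "E \<in> sets borel"
  shows "(\<lambda>n. emeasure M (E \<inter> cball (0::'a::euclidean_space) (real n))) \<longlonglongrightarrow> emeasure M E"
  using Lim_emeasure_incseq[of "\<lambda>n. E \<inter> cball 0 (real n)" M] assms
  by (simp add: incseq_Int_cball UN_Int_cball image_subset_iff del: UN_simps)

text \<open>Differences of measures are compared with the subtracted terms moved to the other side,
  because extended values cannot be subtracted. The inequality passes from bounded to all Borel sets
  along balls, and from indicators to functions by monotone approximation.\<close>

lemma nn_integral_sum_le:
  fixes f :: "'a::euclidean_space \<Rightarrow> ennreal"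
  assumes s: "sets M1 = sets borel" "sets M2 = sets borel" "sets M3 = sets borel" "sets M4 = sets borel"
    and le: "\<And>E. E \<in> sets borel \<Longrightarrow> bounded E \<Longrightarrow> emeasure M1 E + emeasure M2 E \<le> emeasure M3 E +
        emeasure M4 E"
    and f: "f \<in> borel_measurable borel"
  shows "(\<integral>\<^sup>+x. f x \<partial>M1) + (\<integral>\<^sup>+x. f x \<partial>M2) \<le> (\<integral>\<^sup>+x. f x \<partial>M3) + (\<integral>\<^sup>+x. f x \<partial>M4)"
proof -
  note m[measurable_cong] = s
  have le': "emeasure M1 E + emeasure M2 E \<le> emeasure M3 E + emeasure M4 E" if E: "E \<in> sets borel" for E
    by (rule LIMSEQ_le[OF tendsto_add[OF Lim_emeasure_Int_cball Lim_emeasure_Int_cball]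
          tendsto_add[OF Lim_emeasure_Int_cball Lim_emeasure_Int_cball]])
      (use s E in \<open>auto intro!: exI[of _ 0] le bounded_Int\<close>)
  from f show ?thesis
  proof (induction rule: borel_measurable_induct)
    case (cong f g)
    then show ?case by simp
  next
    case (set A)
    then show ?case using le'[of A] s by simp
  next
    case (mult u v)
    then have "(\<integral>\<^sup>+x. v * u x \<partial>M1) + (\<integral>\<^sup>+x. v * u x \<partial>M2) = v * ((\<integral>\<^sup>+x. u x \<partial>M1) + (\<integral>\<^sup>+x. u x \<partial>M2))"
      by (simp add: nn_integral_cmult distrib_left)
    also have "\<dots> \<le> v * ((\<integral>\<^sup>+x. u x \<partial>M3) + (\<integral>\<^sup>+x. u x \<partial>M4))"
      by (intro mult_left_mono mult) auto
    also have "\<dots> = (\<integral>\<^sup>+x. v * u x \<partial>M3) + (\<integral>\<^sup>+x. v * u x \<partial>M4)"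
      using mult by (simp add: nn_integral_cmult distrib_left)
    finally show ?case .
  next
    case (add u v)
    then show ?case
      using add_mono[OF add.IH] by (simp add: nn_integral_add ac_simps)
  next
    case (seq U)
    have lim: "(\<lambda>i. \<integral>\<^sup>+x. U i x \<partial>N) \<longlonglongrightarrow> (\<integral>\<^sup>+x. (SUP i. U i x) \<partial>N)" if [measurable_cong]: "sets N =
        sets borel" for N
      using seq by (intro nn_integral_LIMSEQ) (auto simp: incseq_def le_fun_def intro!: LIMSEQ_SUP)
    show ?case
      unfolding SUP_apply image_image
      by (rule LIMSEQ_le[OF tendsto_add[OF lim lim] tendsto_add[OF lim lim]]) (use s seq in auto)
  qed
qed

lemma integral_sum_le:
  fixes f :: "'a::euclidean_space \<Rightarrow> real"
  assumes r: "radon_measure M1" "radon_measure M2" "radon_measure M3" "radon_measure M4"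
    and le: "\<And>E. E \<in> sets borel \<Longrightarrow> bounded E \<Longrightarrow> measure M1 E + measure M2 E \<le> measure M3 E + measure M4 E"
    and f: "bounded_borel f" "\<And>x. f x \<ge> 0"
  shows "(\<integral>x. f x \<partial>M1) + (\<integral>x. f x \<partial>M2) \<le> (\<integral>x. f x \<partial>M3) + (\<integral>x. f x \<partial>M4)"
proof -
  have "(\<integral>\<^sup>+x. ennreal (f x) \<partial>M1) + (\<integral>\<^sup>+x. ennreal (f x) \<partial>M2) \<le> (\<integral>\<^sup>+x. ennreal (f x) \<partial>M3) + (\<integral>\<^sup>+x.
      ennreal (f x) \<partial>M4)"
    using r le bounded_borelD[OF f(1)]
    by (intro nn_integral_sum_le)
      (auto simp: radon_measureD emeasure_eq_measure_bounded simp flip: ennreal_plus)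
  moreover have "(\<integral>\<^sup>+x. ennreal (f x) \<partial>M) = ennreal (\<integral>x. f x \<partial>M)" if "radon_measure M" for M
    using bounded_borel_integrable[OF that f(1)] f(2) by (intro nn_integral_eq_integral) auto
  ultimately show ?thesis
    using r f(2) by (simp flip: ennreal_plus)
qed

lemma radon_null_measure: "radon_measure (null_measure borel)"
  by (simp add: radon_measure_def)

lemma integral_max_decompose:
  assumes "radon_measure M" "bounded_borel f"
  shows "(\<integral>x. f x \<partial>M) = (\<integral>x. max 0 (f x) \<partial>M) - (\<integral>x. max 0 (- f x) \<partial>M)"
    and "(\<integral>x. \<bar>f x\<bar> \<partial>M) = (\<integral>x. max 0 (f x) \<partial>M) + (\<integral>x. max 0 (- f x) \<partial>M)"
proof -
  have i: "integrable M (\<lambda>x. max 0 (f x))" "integrable M (\<lambda>x. max 0 (- f x))"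
    using bounded_borel_max[OF assms(2)] bounded_borel_max[OF bounded_borel_cmult[OF assms(2), of "-1"]]
    by (auto intro!: bounded_borel_integrable assms(1))
  show "(\<integral>x. f x \<partial>M) = (\<integral>x. max 0 (f x) \<partial>M) - (\<integral>x. max 0 (- f x) \<partial>M)"
    by (subst Bochner_Integration.integral_diff[OF i, symmetric])
       (auto intro!: Bochner_Integration.integral_cong simp: max_def)
  show "(\<integral>x. \<bar>f x\<bar> \<partial>M) = (\<integral>x. max 0 (f x) \<partial>M) + (\<integral>x. max 0 (- f x) \<partial>M)"
    by (subst Bochner_Integration.integral_add[OF i, symmetric])
       (auto intro!: Bochner_Integration.integral_cong simp: max_def)
qed

text \<open>This makes the value in \<open>has_signed_integral\<close> independent of the splitting.
  For nonnegative integrands the equality P - N = P' - N' is used in the form P + N' = P' + N; a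
  general integrand is split into its positive and negative parts.\<close>

lemma signed_integral_unique:
  fixes f :: "'a::euclidean_space \<Rightarrow> real"
  assumes r: "radon_measure P" "radon_measure N" "radon_measure P'" "radon_measure N'"
    and eq: "\<And>E. E \<in> sets borel \<Longrightarrow> bounded E \<Longrightarrow> measure P E - measure N E = measure P' E - measure N' E"
    and f: "bounded_borel f"
  shows "(\<integral>x. f x \<partial>P) - (\<integral>x. f x \<partial>N) = (\<integral>x. f x \<partial>P') - (\<integral>x. f x \<partial>N')"
proof -
  have *: "(\<integral>x. g x \<partial>P) + (\<integral>x. g x \<partial>N') = (\<integral>x. g x \<partial>P') + (\<integral>x. g x \<partial>N)"
    if "bounded_borel g" "\<And>x. g x \<ge> 0" for g :: "'a \<Rightarrow> real"
  proof (rule antisym)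
    show "(\<integral>x. g x \<partial>P) + (\<integral>x. g x \<partial>N') \<le> (\<integral>x. g x \<partial>P') + (\<integral>x. g x \<partial>N)"
      by (rule integral_sum_le[OF r(1,4,3,2) _ that]) (use eq in fastforce)
    show "(\<integral>x. g x \<partial>P') + (\<integral>x. g x \<partial>N) \<le> (\<integral>x. g x \<partial>P) + (\<integral>x. g x \<partial>N')"
      by (rule integral_sum_le[OF r(3,2,1,4) _ that]) (use eq in fastforce)
  qed
  have "bounded_borel (\<lambda>x. max 0 (f x))" "bounded_borel (\<lambda>x. max 0 (- f x))"
    using bounded_borel_max[OF f] bounded_borel_max[OF bounded_borel_cmult[OF f, of "-1"]] by auto
  from *[OF this(1)] *[OF this(2)] show ?thesis
    unfolding r[THEN integral_max_decompose(1)[OF _ f]] by simp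
qed

text \<open>The hypothesis amounts to P \<le> N + V and N \<le> P + V on bounded sets. Used for the
  positive and the negative part of the integrand, the two inequalities add up to the bound.\<close>

lemma signed_integral_abs_le:
  fixes f :: "'a::euclidean_space \<Rightarrow> real"
  assumes r: "radon_measure P" "radon_measure N" "radon_measure V"
    and le: "\<And>E. E \<in> sets borel \<Longrightarrow> bounded E \<Longrightarrow> \<bar>measure P E - measure N E\<bar> \<le> measure V E"
    and f: "bounded_borel f"
  shows "\<bar>(\<integral>x. f x \<partial>P) - (\<integral>x. f x \<partial>N)\<bar> \<le> (\<integral>x. \<bar>f x\<bar> \<partial>V)"
proof -
  have le': "measure P E - measure N E \<le> measure V E" "measure N E - measure P E \<le> measure V E"
    if "E \<in> sets borel" "bounded E" for E
    using le[OF that] by auto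
  have *: "(\<integral>x. g x \<partial>P) \<le> (\<integral>x. g x \<partial>N) + (\<integral>x. g x \<partial>V)" "(\<integral>x. g x \<partial>N) \<le> (\<integral>x. g x \<partial>P) + (\<integral>x. g x \<partial>V)"
    if "bounded_borel g" "\<And>x. g x \<ge> 0" for g :: "'a \<Rightarrow> real"
    using integral_sum_le[OF r(1) radon_null_measure r(2,3) _ that] integral_sum_le[OF r(2)
        radon_null_measure r(1,3) _ that] le'
    by (force simp: integral_null_measure)+
  have "bounded_borel (\<lambda>x. max 0 (f x))" "bounded_borel (\<lambda>x. max 0 (- f x))"
    using bounded_borel_max[OF f] bounded_borel_max[OF bounded_borel_cmult[OF f, of "-1"]] by auto
  from *[OF this(1)] *[OF this(2)] show ?thesis
    unfolding r[THEN integral_max_decompose(1)[OF _ f]] integral_max_decompose(2)[OF r(3) f] by simp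
qed

section \<open>Density of test functions\<close>

text \<open>The L1 error is measured inside a window B. This makes the approximable sets closed
  under complements, which may have infinite measure as a whole.\<close>

definition test_approximable :: "'a::euclidean_space measure \<Rightarrow> 'a set \<Rightarrow> 'a set \<Rightarrow> bool" where
  "test_approximable M B E \<longleftrightarrow> (\<forall>e>0. \<exists>\<psi>. test_function \<psi> \<and> (\<forall>x. 0 \<le> \<psi> x \<and> \<psi> x \<le> 1) \<and>
      (\<integral>x. indicator B x * \<bar>\<psi> x - indicator E x\<bar> \<partial>M) < e)"

lemma test_approximableE:
  assumes "test_approximable M B E" "e > 0"
  obtains \<psi> where "test_function \<psi>" "\<And>x. 0 \<le> \<psi> x" "\<And>x. \<psi> x \<le> 1"
    "(\<integral>x. indicator B x * \<bar>\<psi> x - indicator E x\<bar> \<partial>M) < e"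
  using assms unfolding test_approximable_def by blast

lemma integrable_indicator_diff:
  fixes f g :: "'a::euclidean_space \<Rightarrow> real"
  assumes "radon_measure M" "B \<in> sets borel" "bounded B" "f \<in> borel_measurable borel" "g \<in>
      borel_measurable borel"
    "\<And>x. \<bar>f x\<bar> \<le> 1" "\<And>x. \<bar>g x\<bar> \<le> 1"
  shows "integrable M (\<lambda>x. indicator B x * \<bar>f x - g x\<bar>)"
proof -
  have "\<bar>f x - g x\<bar> \<le> 2" for x
    using assms(6)[of x] assms(7)[of x] by linarith
  then show ?thesis
    using assms by (intro bounded_borel_integrable bounded_borel_mult[of _ _ 2]
        bounded_borel_indicator) auto
qed

lemma box_bump_L1:
  fixes l u :: "'a::euclidean_space"
  assumes M: "radon_measure M" and "e > 0"
  obtains n where "(\<integral>x. \<bar>box_bump l u n x - indicator (box l u) x\<bar> \<partial>M) < e"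
proof -
  have "(\<lambda>n. \<integral>x. \<bar>box_bump l u n x - indicator (box l u) x\<bar> \<partial>M) \<longlonglongrightarrow> (\<integral>x. 0 \<partial>M)"
  proof (rule integral_dominated_convergence)
    show "integrable M (\<lambda>x. 1 * indicat_real (box l u) x)"
      using M by (intro bounded_borel_integrable bounded_borel_cmult bounded_borel_indicator) auto
    show "(\<lambda>x. \<bar>box_bump l u n x - indicator (box l u) x\<bar>) \<in> borel_measurable M" for n
      using M bounded_borelD(1)[OF bounded_borel_test[OF test_function_box_bump[of l u n]]]
      by (auto simp: radon_measureD cong: measurable_cong_sets)
    show "AE x in M. (\<lambda>n. \<bar>box_bump l u n x - indicator (box l u) x\<bar>) \<longlonglongrightarrow> 0"
      using box_bump_tendsto[of l u] by (intro AE_I2 tendsto_rabs_zero) (simp add: LIM_zero)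
    show "AE x in M. norm \<bar>box_bump l u n x - indicator (box l u) x\<bar> \<le> 1 * indicat_real (box l u) x"
        for n
      using box_bump_range[of l u n] box_bump_eq_0[of _ l u n] by (intro AE_I2) (auto simp:
          indicator_def)
  qed (auto)
  then have "\<forall>\<^sub>F n in sequentially. (\<integral>x. \<bar>box_bump l u n x - indicator (box l u) x\<bar> \<partial>M) < e"
    using \<open>e > 0\<close> by (intro order_tendstoD(2)) auto
  then show ?thesis
    using that by (auto simp: eventually_sequentially)
qed

lemma test_approximable_Un:
  fixes M :: "'a::euclidean_space measure"
  assumes M: "radon_measure M" and B: "B \<in> sets borel" "bounded B" and E: "E \<in> sets borel" "F \<in> sets
      borel"
    and ap: "test_approximable M B E" "test_approximable M B F"
  shows "test_approximable M B (E \<union> F)"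
  unfolding test_approximable_def
proof (intro allI impI)
  fix e :: real assume "e > 0"
  obtain \<psi> where
    \<psi>: "test_function \<psi>" "\<And>x. 0 \<le> \<psi> x" "\<And>x. \<psi> x \<le> 1" "(\<integral>x. indicator B x * \<bar>\<psi> x - indicator E x\<bar> \<partial>M)
        < e / 2"
    using test_approximableE[OF ap(1) half_gt_zero[OF \<open>e > 0\<close>]] by blast
  obtain \<eta> where
    \<eta>: "test_function \<eta>" "\<And>x. 0 \<le> \<eta> x" "\<And>x. \<eta> x \<le> 1" "(\<integral>x. indicator B x * \<bar>\<eta> x - indicator F x\<bar> \<partial>M)
        < e / 2"
    using test_approximableE[OF ap(2) half_gt_zero[OF \<open>e > 0\<close>]] by blast
  \<comment> \<open>Chosen such that 1 - \<theta> = (1 - \<psi>)(1 - \<eta>): a smooth union with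
    values still between 0 and 1.\<close>
  define \<theta> where "\<theta> x = \<psi> x + (\<eta> x - \<psi> x * \<eta> x)" for x
  have \<theta>: "test_function \<theta>"
    unfolding \<theta>_def
    by (intro test_function_add test_function_diff test_function_mult_smooth \<psi>(1) \<eta>(1)
        test_function_smooth[OF \<eta>(1)])
  have eq: "1 - \<theta> x = (1 - \<psi> x) * (1 - \<eta> x)" for x
    by (simp add: \<theta>_def algebra_simps)
  have r: "0 \<le> \<theta> x" "\<theta> x \<le> 1" for x
    using eq[of x] \<psi>(2,3)[of x] \<eta>(2,3)[of x] mult_left_le_one_le[of "1 - \<eta> x" "1 - \<psi> x"]
        mult_nonneg_nonneg[of "1 - \<psi> x" "1 - \<eta> x"]
    by linarith+
  have le: "\<bar>\<theta> x - indicator (E \<union> F) x\<bar> \<le> \<bar>\<psi> x - indicator E x\<bar> + \<bar>\<eta> x - indicator F x\<bar>" for x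
  proof -
    have "0 \<le> \<psi> x * \<eta> x" "\<psi> x * \<eta> x \<le> \<psi> x" "\<psi> x * \<eta> x \<le> \<eta> x"
      using \<psi>(2,3)[of x] \<eta>(2,3)[of x] by (auto intro: mult_left_le mult_left_le_one_le)
    then show ?thesis
      using \<psi>(2,3)[of x] \<eta>(2,3)[of x] r[of x] unfolding \<theta>_def by (auto simp: indicator_def abs_le_iff)
  qed
  have m: "\<psi> \<in> borel_measurable borel" "\<eta> \<in> borel_measurable borel" "\<theta> \<in> borel_measurable borel"
    using \<psi>(1) \<eta>(1) \<theta> by (auto intro: bounded_borelD bounded_borel_test)
  have "(\<integral>x. indicator B x * \<bar>\<theta> x - indicator (E \<union> F) x\<bar> \<partial>M) \<le>
     (\<integral>x. indicator B x * \<bar>\<psi> x - indicator E x\<bar> + indicator B x * \<bar>\<eta> x - indicator F x\<bar> \<partial>M)"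
    using \<psi>(2,3) \<eta>(2,3) r m E le
    by (intro integral_mono integrable_indicator_diff[OF M B] Bochner_Integration.integrable_add)
       (auto simp: indicator_def split: if_splits)
  also have "\<dots> = (\<integral>x. indicator B x * \<bar>\<psi> x - indicator E x\<bar> \<partial>M) + (\<integral>x. indicator B x * \<bar>\<eta> x -
      indicator F x\<bar> \<partial>M)"
    using \<psi>(2,3) \<eta>(2,3) m E
    by (intro Bochner_Integration.integral_add integrable_indicator_diff[OF M B]) (auto simp:
        indicator_def)
  also have "\<dots> < e" using \<psi>(4) \<eta>(4) by linarith
  finally show "\<exists>\<psi>. test_function \<psi> \<and> (\<forall>x. 0 \<le> \<psi> x \<and> \<psi> x \<le> 1) \<and>
      (\<integral>x. indicator B x * \<bar>\<psi> x - indicator (E \<union> F) x\<bar> \<partial>M) < e"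
    using \<theta> r by blast
qed

text \<open>Induction over the sigma-algebra generated by the open boxes. The window is itself a box
  because the complement step multiplies by a bump of the window.\<close>

lemma test_approximable_borel:
  fixes M :: "'a::euclidean_space measure"
  assumes M: "radon_measure M" and E: "E \<in> sets borel"
  shows "test_approximable M (box l u) E"
proof -
  let ?B = "box l u"
  note iid = integrable_indicator_diff[OF M borel_open[OF open_box] bounded_box[of l u]]
  have "E \<in> sigma_sets UNIV (range (\<lambda>(a, b). box a b))"
    using E unfolding borel_eq_box by simp
  then show ?thesis
  proof induction
    case (Basic a)
    then obtain l' u' where a: "a = box l' u'" by auto
    show ?case
      unfolding test_approximable_def
    proof (intro allI impI)
      fix e :: real assume "e > 0"
      then obtain n where n: "(\<integral>x. \<bar>box_bump l' u' n x - indicator (box l' u') x\<bar> \<partial>M) < e"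
        using box_bump_L1[OF M] by blast
      have bb: "bounded_borel (\<lambda>x. \<bar>box_bump l' u' n x - indicator (box l' u') x\<bar>)"
        by (intro bounded_borel_abs bounded_borel_diff bounded_borel_test test_function_box_bump
            bounded_borel_indicator) auto
      have "(\<integral>x. indicator ?B x * \<bar>box_bump l' u' n x - indicator a x\<bar> \<partial>M) \<le> (\<integral>x. \<bar>box_bump l' u' n
          x - indicator (box l' u') x\<bar> \<partial>M)"
        unfolding a using box_bump_range[of l' u' n] bounded_borelD(1)[OF bounded_borel_test[OF
            test_function_box_bump]]
        by (intro integral_mono iid bounded_borel_integrable[OF M] bb) (auto simp: indicator_def)
      with n show "\<exists>\<psi>. test_function \<psi> \<and> (\<forall>x. 0 \<le> \<psi> x \<and> \<psi> x \<le> 1) \<and>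
          (\<integral>x. indicator ?B x * \<bar>\<psi> x - indicator a x\<bar> \<partial>M) < e"
        using test_function_box_bump box_bump_range
        by (intro exI[of _ "box_bump l' u' n"]) auto
    qed
  next
    case Empty
    then show ?case
      unfolding test_approximable_def by (auto intro!: exI[of _ "\<lambda>_. 0"] test_function_0)
  next
    case (Compl a)
    then have a: "a \<in> sets borel"
      unfolding borel_eq_box by simp
    show ?case
      unfolding test_approximable_def
    proof (intro allI impI)
      fix e :: real assume "e > 0"
      obtain \<psi> where
        \<psi>: "test_function \<psi>" "\<And>x. 0 \<le> \<psi> x" "\<And>x. \<psi> x \<le> 1" "(\<integral>x. indicator ?B x * \<bar>\<psi> x - indicator a
            x\<bar> \<partial>M) < e / 2"
        using test_approximableE[OF Compl.IH half_gt_zero[OF \<open>e > 0\<close>]] by blast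
      obtain n where n: "(\<integral>x. \<bar>box_bump l u n x - indicator ?B x\<bar> \<partial>M) < e / 2"
        using box_bump_L1[OF M, of "e / 2" l u] \<open>e > 0\<close> by auto
      define \<theta> where "\<theta> = box_bump l u n"
      have \<theta>: "test_function \<theta>" "\<And>x. 0 \<le> \<theta> x" "\<And>x. \<theta> x \<le> 1"
        using test_function_box_bump box_bump_range by (auto simp: \<theta>_def)
      \<comment> \<open>1 - \<psi> approximates the complement but lacks compact support. The bump
        \<theta> restores it, at the cost of the L1 distance between \<theta> and the indicator of
        the window.\<close>
      define \<eta> where "\<eta> x = \<theta> x * (1 - \<psi> x)" for x
      have \<eta>: "test_function \<eta>"
        unfolding \<eta>_def
        by (intro test_function_mult_smooth Ck_diff Ck_const test_function_smooth[OF \<psi>(1)] \<theta>)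
      have r: "0 \<le> \<eta> x" "\<eta> x \<le> 1" for x
        using \<psi>(2,3)[of x] \<theta>(2,3)[of x] by (auto simp: \<eta>_def intro: mult_le_one)
      have le: "\<bar>\<eta> x - indicator (UNIV - a) x\<bar> \<le> \<bar>\<theta> x - 1\<bar> + \<bar>\<psi> x - indicator a x\<bar>" for x
      proof -
        have "\<bar>\<eta> x - (1 - \<psi> x)\<bar> = \<bar>\<theta> x - 1\<bar> * \<bar>1 - \<psi> x\<bar>"
          by (simp add: \<eta>_def abs_mult[symmetric] algebra_simps)
        also have "\<dots> \<le> \<bar>\<theta> x - 1\<bar> * 1"
          using \<psi>(2,3)[of x] by (intro mult_left_mono) auto
        finally show ?thesis
          by (auto simp: indicator_def)
      qed
      have m: "\<psi> \<in> borel_measurable borel" "\<eta> \<in> borel_measurable borel" "\<theta> \<in> borel_measurable borel"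
        using \<psi>(1) \<eta>(1) \<theta> by (auto intro: bounded_borelD bounded_borel_test)
      have bb: "bounded_borel (\<lambda>x. \<bar>\<theta> x - indicator ?B x\<bar>)"
        by (intro bounded_borel_abs bounded_borel_diff bounded_borel_test \<theta> bounded_borel_indicator)
            auto
      have "(\<integral>x. indicator ?B x * \<bar>\<eta> x - indicator (UNIV - a) x\<bar> \<partial>M) \<le>
         (\<integral>x. \<bar>\<theta> x - indicator ?B x\<bar> + indicator ?B x * \<bar>\<psi> x - indicator a x\<bar> \<partial>M)"
      proof (intro integral_mono Bochner_Integration.integrable_add iid bounded_borel_integrable[OF
          M bb])
        show "indicator ?B x * \<bar>\<eta> x - indicator (UNIV - a) x\<bar> \<le> \<bar>\<theta> x - indicator ?B x\<bar> + indicator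
            ?B x * \<bar>\<psi> x - indicator a x\<bar>" for x
          using le[of x] by (cases "x \<in> ?B") auto
      qed (use \<psi>(2,3) r m a in \<open>auto simp: indicator_def\<close>)
      also have "\<dots> = (\<integral>x. \<bar>\<theta> x - indicator ?B x\<bar> \<partial>M) + (\<integral>x. indicator ?B x * \<bar>\<psi> x - indicator a x\<bar> \<partial>M)"
        using \<psi>(2,3) m a
        by (intro Bochner_Integration.integral_add iid bounded_borel_integrable[OF M bb]) (auto
            simp: indicator_def)
      also have "\<dots> < e" using \<psi>(4) n by (simp add: \<theta>_def)
      finally show "\<exists>\<psi>. test_function \<psi> \<and> (\<forall>x. 0 \<le> \<psi> x \<and> \<psi> x \<le> 1) \<and>
          (\<integral>x. indicator ?B x * \<bar>\<psi> x - indicator (UNIV - a) x\<bar> \<partial>M) < e"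
        using \<eta> r by blast
    qed
  next
    case (Union a)
    then have a: "a i \<in> sets borel" for i
      unfolding borel_eq_box by simp
    \<comment> \<open>Finite unions follow from \<open>test_approximable_Un\<close>; the countable
      union is their limit by dominated convergence inside the bounded window.\<close>
    define c where "c n = (\<Union>i<n. a i)" for n
    have c: "c n \<in> sets borel" for n
      using a by (auto simp: c_def)
    have ap: "test_approximable M ?B (c n)" for n
    proof (induction n)
      case 0
      then show ?case
        unfolding test_approximable_def by (auto simp: c_def intro!: exI[of _ "\<lambda>_. 0"] test_function_0)
    next
      case (Suc n)
      have "c (Suc n) = a n \<union> c n" by (auto simp: c_def less_Suc_eq)
      then show ?case
        using test_approximable_Un[OF M _ _ a c Union.IH Suc] by simp
    qed
    have lim: "(\<lambda>n. \<integral>x. indicator ?B x * \<bar>indicator (c n) x - indicat_real (\<Union>i. a i) x\<bar> \<partial>M) \<longlonglongrightarrow> (\<integral>x. 0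
        \<partial>M)"
    proof (rule integral_dominated_convergence)
      show "integrable M (\<lambda>x. 1 * indicat_real ?B x)"
        using M by (intro bounded_borel_integrable bounded_borel_cmult bounded_borel_indicator) auto
      show "AE x in M. (\<lambda>n. indicator ?B x * \<bar>indicator (c n) x - indicat_real (\<Union>i. a i) x\<bar>) \<longlonglongrightarrow> 0"
      proof (intro AE_I2)
        fix x
        have "(\<lambda>n. indicat_real (c n) x) \<longlonglongrightarrow> indicator (\<Union>i. a i) x"
        proof -
          have "(\<Union>n. c n) = (\<Union>i. a i)" by (auto simp: c_def)
          moreover have "incseq c" by (fastforce simp: c_def incseq_def)
          ultimately show ?thesis using LIMSEQ_indicator_incseq by metis
        qed
        then show "(\<lambda>n. indicator ?B x * \<bar>indicator (c n) x - indicat_real (\<Union>i. a i) x\<bar>) \<longlonglongrightarrow> 0"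
          by (intro tendsto_mult_right_zero tendsto_rabs_zero) (simp add: LIM_zero)
      qed
      show "AE x in M. norm (indicator ?B x * \<bar>indicator (c n) x - indicat_real (\<Union>i. a i) x\<bar>) \<le> 1 *
          indicat_real (box l u) x" for n
        by (intro AE_I2) (auto simp: indicator_def)
      show "(\<lambda>x. indicator ?B x * \<bar>indicator (c n) x - indicat_real (\<Union>i. a i) x\<bar>) \<in> borel_measurable
          M" for n
        using M c a by (auto simp: radon_measureD cong: measurable_cong_sets)
    qed auto
    show ?case
      unfolding test_approximable_def
    proof (intro allI impI)
      fix e :: real assume "e > 0"
      then have "\<forall>\<^sub>F n in sequentially. (\<integral>x. indicator ?B x * \<bar>indicator (c n) x - indicat_real (\<Union>i.
          a i) x\<bar> \<partial>M) < e / 2"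
        using lim by (intro order_tendstoD(2)) auto
      then obtain n where n: "(\<integral>x. indicator ?B x * \<bar>indicator (c n) x - indicat_real (\<Union>i. a i) x\<bar>
          \<partial>M) < e / 2"
        by (auto simp: eventually_sequentially)
      obtain \<psi> where
        \<psi>: "test_function \<psi>" "\<And>x. 0 \<le> \<psi> x" "\<And>x. \<psi> x \<le> 1" "(\<integral>x. indicator ?B x * \<bar>\<psi> x - indicator (c
            n) x\<bar> \<partial>M) < e / 2"
        using test_approximableE[OF ap half_gt_zero[OF \<open>e > 0\<close>]] by blast
      have m: "\<psi> \<in> borel_measurable borel"
        using \<psi>(1) by (auto intro: bounded_borelD bounded_borel_test)
      have "(\<integral>x. indicator ?B x * \<bar>\<psi> x - indicator (\<Union>i. a i) x\<bar> \<partial>M) \<le>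
         (\<integral>x. indicator ?B x * \<bar>\<psi> x - indicator (c n) x\<bar> + indicator ?B x * \<bar>indicator (c n) x -
             indicat_real (\<Union>i. a i) x\<bar> \<partial>M)"
        using \<psi>(2,3) m a c
        by (intro integral_mono iid Bochner_Integration.integrable_add)
           (auto simp: indicator_def split: if_splits)
      also have "\<dots> = (\<integral>x. indicator ?B x * \<bar>\<psi> x - indicator (c n) x\<bar> \<partial>M) + (\<integral>x. indicator ?B x *
          \<bar>indicator (c n) x - indicat_real (\<Union>i. a i) x\<bar> \<partial>M)"
        using \<psi>(2,3) m a c
        by (intro Bochner_Integration.integral_add iid) (auto simp: indicator_def)
      also have "\<dots> < e" using \<psi>(4) n by linarith
      finally show "\<exists>\<psi>. test_function \<psi> \<and> (\<forall>x. 0 \<le> \<psi> x \<and> \<psi> x \<le> 1) \<and>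
          (\<integral>x. indicator ?B x * \<bar>\<psi> x - indicator (\<Union>i. a i) x\<bar> \<partial>M) < e"
        using \<psi> by blast
    qed
  qed
qed

text \<open>Three errors of size e/3: cutting E down to a large box, approximating E inside that
  box, and smoothing the box so that the result has compact support.\<close>

lemma test_function_dense:
  fixes M :: "'a::euclidean_space measure"
  assumes M: "radon_measure M" and E: "E \<in> sets borel" "emeasure M E < \<infinity>" and "e > 0"
  obtains \<psi> where "test_function \<psi>" "\<And>x. 0 \<le> \<psi> x" "\<And>x. \<psi> x \<le> 1"
    "(\<integral>x. \<bar>\<psi> x - indicator E x\<bar> \<partial>M) < e"
proof -
  have e3: "e / 3 > 0" using \<open>e > 0\<close> by simp
  define B where "B n = box (- (real n *\<^sub>R One)) (real n *\<^sub>R One :: 'a)" for n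
  have Bu: "(\<Union>n. B n) = UNIV"
    unfolding B_def using UN_box_eq_UNIV by simp
  have Binc: "incseq B"
    unfolding B_def incseq_def
    by (intro allI impI subset_box_imp) (auto simp: inner_Basis)
  have [measurable]: "B n \<in> sets borel" for n by (auto simp: B_def)
  have iE: "integrable M (indicat_real E)"
    using E M by (intro integrable_real_indicator) (auto simp: radon_measureD)
  have "(\<lambda>n. \<integral>x. \<bar>indicator (B n) x * indicator E x - indicat_real E x\<bar> \<partial>M) \<longlonglongrightarrow> (\<integral>x. 0 \<partial>M)"
  proof (rule integral_dominated_convergence[OF _ _ iE])
    show "AE x in M. (\<lambda>n. \<bar>indicator (B n) x * indicator E x - indicat_real E x\<bar>) \<longlonglongrightarrow> 0"
    proof (intro AE_I2)
      fix x
      have "(\<lambda>n. indicat_real (B n) x) \<longlonglongrightarrow> indicator UNIV x"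
        using LIMSEQ_indicator_incseq[OF Binc] unfolding Bu by auto
      then have "(\<lambda>n. indicator (B n) x * indicator E x) \<longlonglongrightarrow> 1 * indicat_real E x"
        by (intro tendsto_intros) auto
      then show "(\<lambda>n. \<bar>indicator (B n) x * indicator E x - indicat_real E x\<bar>) \<longlonglongrightarrow> 0"
        by (intro tendsto_rabs_zero) (simp add: LIM_zero)
    qed
    show "(\<lambda>x. \<bar>indicator (B n) x * indicator E x - indicat_real E x\<bar>) \<in> borel_measurable M" for n
      using M E by (auto simp: radon_measureD cong: measurable_cong_sets)
  qed (auto simp: indicator_def)
  then have "\<forall>\<^sub>F n in sequentially. (\<integral>x. \<bar>indicator (B n) x * indicator E x - indicat_real E x\<bar> \<partial>M)
      < e / 3"
    using \<open>e > 0\<close> by (intro order_tendstoD(2)) auto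
  then obtain k where k: "(\<integral>x. \<bar>indicator (B k) x * indicator E x - indicat_real E x\<bar> \<partial>M) < e / 3"
    by (auto simp: eventually_sequentially)
  obtain \<psi> where
    \<psi>: "test_function \<psi>" "\<And>x. 0 \<le> \<psi> x" "\<And>x. \<psi> x \<le> 1" "(\<integral>x. indicator (B k) x * \<bar>\<psi> x - indicator E x\<bar>
        \<partial>M) < e / 3"
    using test_approximableE[OF test_approximable_borel[OF M E(1)] e3] unfolding B_def by blast
  obtain n where n: "(\<integral>x. \<bar>box_bump (- (real k *\<^sub>R One)) (real k *\<^sub>R One) n x - indicator (B k) x\<bar>
      \<partial>M) < e / 3"
    using box_bump_L1[OF M e3] unfolding B_def by blast
  define \<theta> where "\<theta> = box_bump (- (real k *\<^sub>R One)) (real k *\<^sub>R One :: 'a) n"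
  have \<theta>: "test_function \<theta>" "\<And>x. 0 \<le> \<theta> x" "\<And>x. \<theta> x \<le> 1" "\<And>x. x \<notin> B k \<Longrightarrow> \<theta> x = 0"
    using test_function_box_bump box_bump_range box_bump_eq_0 by (auto simp: \<theta>_def B_def)
  define \<eta> where "\<eta> x = \<theta> x * \<psi> x" for x
  have \<eta>: "test_function \<eta>"
    unfolding \<eta>_def by (intro test_function_mult_smooth test_function_smooth \<psi> \<theta>)
  have r: "0 \<le> \<eta> x" "\<eta> x \<le> 1" for x
    using \<psi>(2,3)[of x] \<theta>(2,3)[of x] by (auto simp: \<eta>_def intro: mult_le_one)
  have m: "\<psi> \<in> borel_measurable borel" "\<eta> \<in> borel_measurable borel" "\<theta> \<in> borel_measurable borel"
    using \<psi>(1) \<eta>(1) \<theta> by (auto intro: bounded_borelD bounded_borel_test)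
  have i1: "integrable M (\<lambda>x. \<bar>\<theta> x - indicator (B k) x\<bar>)"
    by (intro bounded_borel_integrable[OF M] bounded_borel_abs bounded_borel_diff bounded_borel_test
        \<theta> bounded_borel_indicator)
      (auto simp: B_def)
  have i2: "integrable M (\<lambda>x. indicator (B k) x * \<bar>\<psi> x - indicator E x\<bar>)"
    using \<psi>(2,3) m E by (intro integrable_indicator_diff[OF M]) (auto simp: B_def indicator_def)
  have i3: "integrable M (\<lambda>x. \<bar>indicator (B k) x * indicator E x - indicat_real E x\<bar>)"
    using M E by (intro Bochner_Integration.integrable_bound[OF iE])
      (auto simp: indicator_def radon_measureD cong: measurable_cong_sets)
  have i4: "integrable M (\<lambda>x. \<bar>\<eta> x - indicator E x\<bar>)"
    by (intro integrable_abs Bochner_Integration.integrable_diff iE bounded_borel_integrable[OF M]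
        bounded_borel_test \<eta>)
  have "(\<integral>x. \<bar>\<eta> x - indicator E x\<bar> \<partial>M) \<le>
    (\<integral>x. \<bar>\<theta> x - indicator (B k) x\<bar> + indicator (B k) x * \<bar>\<psi> x - indicator E x\<bar> + \<bar>indicator (B k) x
        * indicator E x - indicat_real E x\<bar> \<partial>M)"
  proof (intro integral_mono i1 i2 i3 i4 Bochner_Integration.integrable_add)
    fix x
    have "\<bar>\<eta> x - \<psi> x\<bar> = \<bar>\<theta> x - 1\<bar> * \<bar>\<psi> x\<bar>"
      by (simp add: \<eta>_def abs_mult[symmetric] algebra_simps)
    also have "\<dots> \<le> \<bar>\<theta> x - 1\<bar> * 1"
      using \<psi>(2,3)[of x] by (intro mult_left_mono) auto
    finally show "\<bar>\<eta> x - indicator E x\<bar> \<le> \<bar>\<theta> x - indicator (B k) x\<bar> + indicator (B k) x * \<bar>\<psi> x -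
        indicator E x\<bar> + \<bar>indicator (B k) x * indicator E x - indicat_real E x\<bar>"
      using \<theta>(4)[of x] by (cases "x \<in> B k") (auto simp: indicator_def \<eta>_def)
  qed
  also have "\<dots> = (\<integral>x. \<bar>\<theta> x - indicator (B k) x\<bar> \<partial>M) + (\<integral>x. indicator (B k) x * \<bar>\<psi> x - indicator E x\<bar>
      \<partial>M) + (\<integral>x. \<bar>indicator (B k) x * indicator E x - indicat_real E x\<bar> \<partial>M)"
    by (simp add: i1 i2 i3)
  also have "\<dots> < e"
    using k n \<psi>(4) by (simp add: \<theta>_def)
  finally show ?thesis
    using that[OF \<eta> r] by blast
qed

section \<open>The variation of a vector measure\<close>

definition bounded_partitions :: "'a::euclidean_space set \<Rightarrow> (nat \<Rightarrow> 'a set) set" where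
  "bounded_partitions E =
     {F. range F \<subseteq> sets borel \<and> (\<forall>h. bounded (F h)) \<and> disjoint_family F \<and> (\<Union>h. F h) = E}"

lemma variation_eq:
  "variation \<mu> E = (SUP F \<in> bounded_partitions E. \<Sum>h::nat. ennreal (norm (\<mu> (F h))))"
  by (simp add: variation_def bounded_partitions_def)

lemma bounded_partitionsD:
  assumes "F \<in> bounded_partitions E"
  shows "F h \<in> sets borel" "bounded (F h)" "disjoint_family F" "(\<Union>h. F h) = E"
  using assms by (auto simp: bounded_partitions_def)

lemma bounded_partitions_nonempty:
  assumes "E \<in> sets (borel :: 'a::euclidean_space measure)"
  shows "bounded_partitions E \<noteq> {}"
proof -
  have "disjointed (\<lambda>n. E \<inter> cball 0 (real n)) \<in> bounded_partitions E"
    unfolding bounded_partitions_def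
  proof (intro CollectI conjI allI)
    show "range (disjointed (\<lambda>n. E \<inter> cball 0 (real n))) \<subseteq> sets borel"
      using assms by (intro sets.range_disjointed_sets) auto
    show "bounded (disjointed (\<lambda>n. E \<inter> cball 0 (real n)) h)" for h
      by (rule bounded_subset[OF _ disjointed_subset]) (simp add: bounded_Int)
    show "(\<Union>h. disjointed (\<lambda>n. E \<inter> cball 0 (real n)) h) = E"
      by (simp only: UN_disjointed_eq UN_Int_cball)
  qed (rule disjoint_family_disjointed)
  then show ?thesis by blast
qed

lemma vector_radon_sums:
  assumes "vector_radon_measure \<mu>" "\<And>n. E n \<in> sets borel" "disjoint_family E" "bounded (\<Union>n. E n)"
  shows "(\<lambda>n. \<mu> (E n)) sums \<mu> (\<Union>n. E n)"
  using assms unfolding vector_radon_measure_def by blast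

lemma vector_radon_empty:
  assumes "vector_radon_measure \<mu>"
  shows "\<mu> {} = 0"
proof -
  have "(\<lambda>n::nat. \<mu> {}) sums \<mu> {}"
    using vector_radon_sums[OF assms, of "\<lambda>_. {}"] by (simp add: disjoint_family_on_def)
  then have "(\<lambda>n::nat. \<mu> {}) \<longlonglongrightarrow> 0"
    by (intro summable_LIMSEQ_zero) (auto simp: summable_def)
  then show ?thesis by (simp add: LIMSEQ_const_iff)
qed

lemma vector_radon_Un:
  assumes "vector_radon_measure \<mu>" "A \<in> sets borel" "B \<in> sets borel" "A \<inter> B = {}" "bounded A"
      "bounded B"
  shows "\<mu> (A \<union> B) = \<mu> A + \<mu> B"
proof -
  have "(\<lambda>n. \<mu> (binaryset A B n)) sums \<mu> (\<Union>n. binaryset A B n)"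
    using assms by (intro vector_radon_sums) (auto simp: binaryset_def disjoint_family_on_def
        UN_binaryset_eq)
  moreover have "(\<lambda>n. \<mu> (binaryset A B n)) sums (\<mu> A + \<mu> B)"
    using binaryset_sums[of \<mu> A B] vector_radon_empty[OF assms(1)] by simp
  ultimately show ?thesis
    using sums_unique2 by (fastforce simp: UN_binaryset_eq)
qed

lemma vector_radon_Diff:
  assumes "vector_radon_measure \<mu>" "A \<in> sets borel" "B \<in> sets borel" "B \<subseteq> A" "bounded A"
  shows "\<mu> (A - B) = \<mu> A - \<mu> B"
proof -
  have "A - B \<union> B = A" using assms(4) by auto
  then show ?thesis
    using vector_radon_Un[OF assms(1), of "A - B" B] assms bounded_subset[OF assms(5) Diff_subset]
      bounded_subset[OF assms(5,4)] by (simp add: Diff_Int_distrib2 Int_Diff)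
qed

lemma sums_norm_le_suminf:
  fixes f :: "nat \<Rightarrow> 'b::real_normed_vector"
  assumes "f sums s"
  shows "ennreal (norm s) \<le> (\<Sum>n. ennreal (norm (f n)))"
proof (rule LIMSEQ_le_const2)
  have "(\<lambda>n. norm (\<Sum>i<n. f i)) \<longlonglongrightarrow> norm s"
    using assms unfolding sums_def by (rule tendsto_norm)
  then show "(\<lambda>n. ennreal (norm (\<Sum>i<n. f i))) \<longlonglongrightarrow> ennreal (norm s)"
    by (rule tendsto_ennrealI)
  have "ennreal (norm (\<Sum>i<n. f i)) \<le> (\<Sum>n. ennreal (norm (f n)))" for n
  proof -
    have "ennreal (norm (\<Sum>i<n. f i)) \<le> ennreal (\<Sum>i<n. norm (f i))"
      by (intro ennreal_leI norm_sum)
    also have "\<dots> = (\<Sum>i<n. ennreal (norm (f i)))" by simp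
    also have "\<dots> \<le> (\<Sum>n. ennreal (norm (f n)))" by (rule sum_le_suminf) auto
    finally show ?thesis .
  qed
  then show "\<exists>N. \<forall>n\<ge>N. ennreal (norm (\<Sum>i<n. f i)) \<le> (\<Sum>n. ennreal (norm (f n)))" by blast
qed

lemma suminf_commute_ennreal:
  fixes f :: "nat \<Rightarrow> nat \<Rightarrow> ennreal"
  shows "(\<Sum>i. \<Sum>j. f i j) = (\<Sum>j. \<Sum>i. f i j)"
  using nn_integral_suminf[of "\<lambda>j i. f i j" "count_space UNIV"] by (simp add:
      nn_integral_count_space_nat)

text \<open>Each supremum is approached along an increasing sequence of values. Monotone convergence
  then turns the sum of suprema into a supremum of sums, and each of these sums is realised by one
  choice function.\<close>

lemma suminf_SUP_le:
  fixes f :: "nat \<Rightarrow> 'b \<Rightarrow> ennreal"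
  assumes ne: "\<And>i. S i \<noteq> {}" and le: "\<And>x. (\<And>i. x i \<in> S i) \<Longrightarrow> (\<Sum>i. f i (x i)) \<le> C"
  shows "(\<Sum>i. SUP x\<in>S i. f i x) \<le> C"
proof -
  have "\<exists>g::nat\<Rightarrow>ennreal. incseq g \<and> range g \<subseteq> f i ` S i \<and> (SUP x\<in>S i. f i x) = (SUP k. g k)" for i
    using ennreal_Sup_countable_SUP[of "f i ` S i"] ne by auto
  then obtain g where g: "\<And>i. incseq (g i)" "\<And>i. range (g i) \<subseteq> f i ` S i"
    "\<And>i. (SUP x\<in>S i. f i x) = (SUP k::nat. g i k)" by metis
  have "(\<Sum>i. SUP x\<in>S i. f i x) = (SUP k. \<Sum>i. g i k)"
    unfolding g(3) using g(1) by (intro ennreal_suminf_SUP_eq) (auto simp: incseq_def)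
  also have "\<dots> \<le> C"
  proof (rule SUP_least)
    fix k
    have "\<exists>x. x \<in> S i \<and> g i k = f i x" for i
      using g(2)[of i] by blast
    then obtain x where "\<And>i. x i \<in> S i" "\<And>i. g i k = f i (x i)" by metis
    then show "(\<Sum>i. g i k) \<le> C" using le[of x] by simp
  qed
  finally show ?thesis .
qed

text \<open>Partitions of the single sets are merged into one partition of the union through the
  pairing of natural numbers.\<close>

lemma variation_suminf_le:
  fixes E :: "nat \<Rightarrow> 'a::euclidean_space set"
  assumes E: "\<And>i. E i \<in> sets borel" "disjoint_family E"
  shows "(\<Sum>i. variation \<mu> (E i)) \<le> variation \<mu> (\<Union>i. E i)"
  unfolding variation_eq[of _ "E _"]
proof (rule suminf_SUP_le)
  show "bounded_partitions (E i) \<noteq> {}" for i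
    using E by (intro bounded_partitions_nonempty)
  fix F assume F: "F i \<in> bounded_partitions (E i)" for i
  note FD = bounded_partitionsD[OF F]
  define G where "G n = (case prod_decode n of (i, h) \<Rightarrow> F i h)" for n
  have "disjoint_family G"
    unfolding disjoint_family_on_def
  proof (intro ballI impI)
    fix m n :: nat assume "m \<noteq> n"
    moreover obtain i h i' h' where d: "prod_decode m = (i, h)" "prod_decode n = (i', h')"
      by (metis surj_pair)
    ultimately have "(i, h) \<noteq> (i', h')"
      by (metis prod_decode_inverse)
    then show "G m \<inter> G n = {}"
      using FD(4)[of i] FD(4)[of i'] FD(3)[of i] E(2) d unfolding G_def
      by (cases "i = i'") (fastforce simp: disjoint_family_on_def)+
  qed
  moreover have "(\<Union>n. G n) = (\<Union>i. E i)"
  proof -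
    have "G n \<subseteq> (\<Union>i. \<Union>h. F i h)" for n
      unfolding G_def by (cases "prod_decode n") auto
    moreover have "F i h \<subseteq> (\<Union>n. G n)" for i h
      using UN_upper[of "prod_encode (i, h)" UNIV G] by (simp add: G_def)
    ultimately have "(\<Union>n. G n) = (\<Union>i. \<Union>h. F i h)" by blast
    then show ?thesis using FD(4) by simp
  qed
  ultimately have "G \<in> bounded_partitions (\<Union>i. E i)"
    using FD(1,2) unfolding bounded_partitions_def by (auto simp: G_def split_beta)
  then have "(\<Sum>n. ennreal (norm (\<mu> (G n)))) \<le> variation \<mu> (\<Union>i. E i)"
    unfolding variation_eq by (rule SUP_upper)
  moreover have "(\<Sum>n. ennreal (norm (\<mu> (G n)))) = (\<Sum>i. \<Sum>h. ennreal (norm (\<mu> (F i h))))"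
    unfolding G_def split_beta
    by (rule suminf_ennreal_2dimen[of _ "\<lambda>p. ennreal (norm (\<mu> (F (fst p) (snd p))))"]) (simp only:
        fst_conv snd_conv)
  ultimately show "(\<Sum>i. \<Sum>h. ennreal (norm (\<mu> (F i h)))) \<le> variation \<mu> (\<Union>i. E i)" by simp
qed

text \<open>A partition of the union is refined by the sets \<open>E i\<close>. Countable additivity
  bounds each term by the sum over its refinement, and the two summations are exchanged.\<close>

lemma variation_le_suminf:
  fixes E :: "nat \<Rightarrow> 'a::euclidean_space set"
  assumes \<mu>: "vector_radon_measure \<mu>" and E: "\<And>i. E i \<in> sets borel" "disjoint_family E"
  shows "variation \<mu> (\<Union>i. E i) \<le> (\<Sum>i. variation \<mu> (E i))"
  unfolding variation_eq[of _ "\<Union>i. E i"]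
proof (rule SUP_least)
  fix F assume F: "F \<in> bounded_partitions (\<Union>i. E i)"
  note FD = bounded_partitionsD[OF F]
  have eq: "F h = (\<Union>i. F h \<inter> E i)" for h
    using FD(4) by blast
  have "(\<Sum>h. ennreal (norm (\<mu> (F h)))) \<le> (\<Sum>h. \<Sum>i. ennreal (norm (\<mu> (F h \<inter> E i))))"
  proof (intro suminf_le allI)
    fix h
    have "(\<lambda>i. \<mu> (F h \<inter> E i)) sums \<mu> (\<Union>i. F h \<inter> E i)"
      using E FD(1)[of h] FD(2)[of h] eq[of h]
      by (intro vector_radon_sums[OF \<mu>]) (auto simp: disjoint_family_on_def)
    from sums_norm_le_suminf[OF this] show "ennreal (norm (\<mu> (F h))) \<le> (\<Sum>i. ennreal (norm (\<mu> (F h \<inter>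
        E i))))"
      using eq[of h] by simp
  qed auto
  also have "\<dots> = (\<Sum>i. \<Sum>h. ennreal (norm (\<mu> (F h \<inter> E i))))"
    by (rule suminf_commute_ennreal)
  also have "\<dots> \<le> (\<Sum>i. variation \<mu> (E i))"
  proof (intro suminf_le allI)
    fix i
    have "(\<Union>h. F h \<inter> E i) = E i"
      using FD(4) by blast
    moreover have "disjoint_family (\<lambda>h. F h \<inter> E i)"
      using FD(3) unfolding disjoint_family_on_def by blast
    ultimately have "(\<lambda>h. F h \<inter> E i) \<in> bounded_partitions (E i)"
      using sets.Int[OF FD(1) E(1)] FD(2) unfolding bounded_partitions_def by (simp add: bounded_Int
          image_subset_iff)
    then show "(\<Sum>h. ennreal (norm (\<mu> (F h \<inter> E i)))) \<le> variation \<mu> (E i)"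
      unfolding variation_eq by (rule SUP_upper)
  qed auto
  finally show "(\<Sum>h. ennreal (norm (\<mu> (F h)))) \<le> (\<Sum>i. variation \<mu> (E i))" .
qed

lemma variation_empty:
  assumes "vector_radon_measure \<mu>"
  shows "variation \<mu> {} = 0"
proof -
  have "(\<Sum>h::nat. ennreal (norm (\<mu> (F h)))) = 0" if "F \<in> bounded_partitions {}" for F
    using bounded_partitionsD(4)[OF that] vector_radon_empty[OF assms] by simp
  then have "variation \<mu> {} \<le> 0"
    unfolding variation_eq by (intro SUP_least) (simp only: order_refl)
  then show ?thesis by simp
qed

lemma sets_variation_measure: "sets (variation_measure \<mu>) = sets borel"
  unfolding variation_measure_def using sets.sigma_sets_eq[of borel]
  by (simp add: sets_measure_of)

lemma emeasure_variation_measure: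
  assumes "vector_radon_measure \<mu>" "E \<in> sets borel"
  shows "emeasure (variation_measure \<mu>) E = variation \<mu> E"
  using assms
  by (intro emeasure_measure_of[OF variation_measure_def])
    (auto simp: positive_def variation_empty countably_additive_def sets_variation_measure
      intro!: antisym variation_suminf_le variation_le_suminf)

lemma norm_le_variation:
  assumes "vector_radon_measure \<mu>" "E \<in> sets borel" "bounded E"
  shows "ennreal (norm (\<mu> E)) \<le> variation \<mu> E"
proof -
  let ?F = "binaryset E {}"
  have "?F \<in> bounded_partitions E"
    using assms by (auto simp: bounded_partitions_def binaryset_def disjoint_family_on_def split:
        if_splits)
  then have "(\<Sum>h. ennreal (norm (\<mu> (?F h)))) \<le> variation \<mu> E"
    unfolding variation_eq by (rule SUP_upper)
  moreover have "ennreal (norm (\<mu> (?F 0))) \<le> (\<Sum>h. ennreal (norm (\<mu> (?F h))))"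
    by (rule order_trans[OF _ sum_le_suminf[of "\<lambda>h. ennreal (norm (\<mu> (?F h)))" "{0}"]]) simp_all
  ultimately show ?thesis by (simp add: binaryset_def)
qed

section \<open>Derivatives of sets\<close>

lemma rep_lset_lebesgue: "rep_lset A \<in> sets lebesgue" "null_eq (rep_lset A) (rep_lset A)"
  using Quotient3_rep_reflp[OF Quotient3_lset, of A] by (auto simp: null_eq_def)

lemma abs_rep_lset: "abs_lset (rep_lset A) = A"
  by (rule Quotient3_abs_rep[OF Quotient3_lset])

text \<open>Written with the chosen representative, although the value depends on the class alone;
  \<open>lset_integral_abs\<close> computes it from any Borel representative.\<close>

definition lset_integral :: "'a::euclidean_space lset \<Rightarrow> ('a \<Rightarrow> real) \<Rightarrow> real" where
  "lset_integral A f = (LINT x:rep_lset A|lebesgue. f x)"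

lemma is_derivative_iff:
  "is_derivative A \<mu> \<longleftrightarrow> vector_radon_measure \<mu> \<and>
     (\<forall>b\<in>Basis. \<forall>\<phi>. test_function \<phi> \<longrightarrow>
        has_signed_integral (\<lambda>E. \<mu> E \<bullet> b) \<phi> (- lset_integral A (\<lambda>x. frechet_derivative \<phi> (at x) b)))"
proof -
  have "is_derivative (abs_lset (rep_lset A)) \<mu> \<longleftrightarrow> vector_radon_measure \<mu> \<and>
     (\<forall>b\<in>Basis. \<forall>\<phi>. test_function \<phi> \<longrightarrow>
        has_signed_integral (\<lambda>E. \<mu> E \<bullet> b) \<phi> (- lset_integral A (\<lambda>x. frechet_derivative \<phi> (at x) b)))"
    by (simp only: is_derivative.abs_eq[OF rep_lset_lebesgue(2)] lset_integral_def)
  then show ?thesis by (simp only: abs_rep_lset)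
qed

text \<open>\<open>has_signed_integral\<close> permits another splitting for every test function. By
  \<open>signed_integral_unique\<close>, the splitting obtained from the zero function serves for
  all of them.\<close>

lemma is_derivative_splitting:
  assumes "is_derivative A \<mu>" "b \<in> Basis"
  obtains P N where "radon_measure P" "radon_measure N"
    "\<And>E. E \<in> sets borel \<Longrightarrow> bounded E \<Longrightarrow> \<mu> E \<bullet> b = measure P E - measure N E"
    "\<And>\<phi>. test_function \<phi> \<Longrightarrow>
       lset_integral A (\<lambda>x. frechet_derivative \<phi> (at x) b) = (\<integral>x. \<phi> x \<partial>N) - (\<integral>x. \<phi> x \<partial>P)"
proof -
  have d: "has_signed_integral (\<lambda>E. \<mu> E \<bullet> b) \<phi> (- lset_integral A (\<lambda>x. frechet_derivative \<phi> (at x) b))"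
    if "test_function \<phi>" for \<phi>
    using assms that unfolding is_derivative_iff by blast
  obtain P N where PN: "radon_measure P" "radon_measure N"
    "\<And>E. E \<in> sets borel \<Longrightarrow> bounded E \<Longrightarrow> \<mu> E \<bullet> b = measure P E - measure N E"
    using d[OF test_function_0] unfolding has_signed_integral_def by blast
  have "lset_integral A (\<lambda>x. frechet_derivative \<phi> (at x) b) = (\<integral>x. \<phi> x \<partial>N) - (\<integral>x. \<phi> x \<partial>P)"
    if \<phi>: "test_function \<phi>" for \<phi>
  proof -
    obtain P' N' where PN': "radon_measure P'" "radon_measure N'"
      "\<And>E. E \<in> sets borel \<Longrightarrow> bounded E \<Longrightarrow> \<mu> E \<bullet> b = measure P' E - measure N' E"
      "- lset_integral A (\<lambda>x. frechet_derivative \<phi> (at x) b) = (\<integral>x. \<phi> x \<partial>P') - (\<integral>x. \<phi> x \<partial>N')"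
      using d[OF \<phi>] unfolding has_signed_integral_def by blast
    have "(\<integral>x. \<phi> x \<partial>P') - (\<integral>x. \<phi> x \<partial>N') = (\<integral>x. \<phi> x \<partial>P) - (\<integral>x. \<phi> x \<partial>N)"
      by (rule signed_integral_unique[OF PN'(1,2) PN(1,2) _ bounded_borel_test[OF \<phi>]])
        (use PN(3) PN'(3) in auto)
    with PN'(4) show ?thesis by simp
  qed
  with PN show ?thesis by (rule that)
qed

text \<open>The norm of a vector is at most the sum of its coordinates in absolute value, so the
  variation is bounded by the total mass of both parts of the splittings, summed over the
  basis.\<close>

lemma radon_variation_measure:
  assumes "is_derivative A \<mu>"
  shows "radon_measure (variation_measure \<mu>)"
proof -
  have \<mu>: "vector_radon_measure \<mu>" using assms by (simp add: is_derivative_iff)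
  have "\<exists>P N. radon_measure P \<and> radon_measure N \<and> (\<forall>E\<in>sets borel. bounded E \<longrightarrow> \<mu> E \<bullet> b = measure P E
      - measure N E)"
    if "b \<in> Basis" for b
    using is_derivative_splitting[OF assms that] by metis
  then obtain P N where P: "\<And>b. b \<in> Basis \<Longrightarrow> radon_measure (P b)" and N: "\<And>b. b \<in> Basis \<Longrightarrow>
      radon_measure (N b)"
    and PN: "\<And>b E. b \<in> Basis \<Longrightarrow> E \<in> sets borel \<Longrightarrow> bounded E \<Longrightarrow> \<mu> E \<bullet> b = measure (P b) E - measure (N b) E"
    by metis
  have le: "ennreal (norm (\<mu> F)) \<le> (\<Sum>b\<in>Basis. emeasure (P b) F + emeasure (N b) F)"
    if F: "F \<in> sets borel" "bounded F" for F
  proof -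
    have "norm (\<mu> F) \<le> (\<Sum>b\<in>Basis. \<bar>\<mu> F \<bullet> b\<bar>)" by (rule norm_le_l1)
    also have "\<dots> \<le> (\<Sum>b\<in>Basis. measure (P b) F + measure (N b) F)"
      using PN[OF _ F] by (intro sum_mono) (auto simp: abs_le_iff intro: add_increasing add_increasing2)
    finally have "ennreal (norm (\<mu> F)) \<le> ennreal (\<Sum>b\<in>Basis. measure (P b) F + measure (N b) F)"
      by (rule ennreal_leI)
    also have "\<dots> = (\<Sum>b\<in>Basis. emeasure (P b) F + emeasure (N b) F)"
      using F P N by (subst sum_ennreal[symmetric]) (auto simp: emeasure_eq_measure_bounded)
    finally show ?thesis .
  qed
  have "variation \<mu> K < \<infinity>" if K: "compact K" for K
  proof -
    have "variation \<mu> K \<le> (\<Sum>b\<in>Basis. emeasure (P b) K + emeasure (N b) K)"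
      unfolding variation_eq
    proof (rule SUP_least)
      fix F assume F: "F \<in> bounded_partitions K"
      note FD = bounded_partitionsD[OF F]
      have "(\<Sum>h. ennreal (norm (\<mu> (F h)))) \<le> (\<Sum>h. \<Sum>b\<in>Basis. emeasure (P b) (F h) + emeasure (N b) (F
          h))"
        using FD by (intro suminf_le le) auto
      also have "\<dots> = (\<Sum>b\<in>Basis. (\<Sum>h. emeasure (P b) (F h)) + (\<Sum>h. emeasure (N b) (F h)))"
        by (subst suminf_sum) (auto intro!: sum.cong simp: suminf_add)
      also have "\<dots> = (\<Sum>b\<in>Basis. emeasure (P b) K + emeasure (N b) K)"
        using FD P N by (intro sum.cong refl arg_cong2[where f="(+)"]; subst suminf_emeasure) (auto
            simp: radon_measureD)
      finally show "(\<Sum>h. ennreal (norm (\<mu> (F h)))) \<le> (\<Sum>b\<in>Basis. emeasure (P b) K + emeasure (N b) K)" .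
    qed
    also have "\<dots> < \<infinity>"
      using P N radon_emeasure_bounded compact_imp_bounded[OF K] by (auto simp: sum_Pinfty less_top)
    finally show ?thesis .
  qed
  then show ?thesis
    unfolding radon_measure_def
    using emeasure_variation_measure[OF \<mu>] sets_variation_measure by (auto simp: compact_imp_closed)
qed

lemma norm_le_measure_variation:
  assumes "is_derivative A \<mu>" "E \<in> sets borel" "bounded E"
  shows "norm (\<mu> E) \<le> measure (variation_measure \<mu>) E"
proof -
  have \<mu>: "vector_radon_measure \<mu>"
    using assms(1) by (simp add: is_derivative_iff)
  have "ennreal (norm (\<mu> E)) \<le> ennreal (measure (variation_measure \<mu>) E)"
    using norm_le_variation[OF \<mu> assms(2,3)]
    unfolding emeasure_variation_measure[OF \<mu> assms(2), symmetric]
      emeasure_eq_measure_bounded[OF radon_variation_measure[OF assms(1)] assms(3)] .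
  then show ?thesis by (simp only: ennreal_le_iff[OF measure_nonneg])
qed

definition derivative_measure :: "'a::euclidean_space lset \<Rightarrow> 'a set \<Rightarrow> 'a" where
  "derivative_measure A = (SOME \<mu>. is_derivative A \<mu>)"

lemma perimeter_measure_eq: "perimeter_measure A = variation_measure (derivative_measure A)"
  by (simp add: perimeter_measure_def derivative_measure_def)

lemma is_derivative_derivative_measure: "A \<in> FPloc \<Longrightarrow> is_derivative A (derivative_measure A)"
  using someI_ex[of "is_derivative A"] by (simp add: derivative_measure_def FPloc_def)

lemma radon_perimeter_measure: "A \<in> FPloc \<Longrightarrow> radon_measure (perimeter_measure A)"
  unfolding perimeter_measure_eq by (rule radon_variation_measure[OF is_derivative_derivative_measure])

text \<open>Integration by parts in one coordinate, followed by |\<mu> \<bullet> b| \<le> |\<mu>|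
  \<le> variation. Volume integrals are estimated by perimeter measures through this bound.\<close>

lemma lset_integral_derivative_le:
  assumes A: "A \<in> FPloc" and b: "b \<in> Basis" and \<phi>: "test_function \<phi>"
  shows "\<bar>lset_integral A (\<lambda>x. frechet_derivative \<phi> (at x) b)\<bar> \<le> (\<integral>x. \<bar>\<phi> x\<bar> \<partial>perimeter_measure A)"
proof -
  note d = is_derivative_derivative_measure[OF A]
  from d b obtain P N where PN: "radon_measure P" "radon_measure N"
    "\<And>E. E \<in> sets borel \<Longrightarrow> bounded E \<Longrightarrow> derivative_measure A E \<bullet> b = measure P E - measure N E"
    "lset_integral A (\<lambda>x. frechet_derivative \<phi> (at x) b) = (\<integral>x. \<phi> x \<partial>N) - (\<integral>x. \<phi> x \<partial>P)"
    by (rule is_derivative_splitting) (use \<phi> in blast)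
  have "\<bar>measure N E - measure P E\<bar> \<le> measure (perimeter_measure A) E" if E: "E \<in> sets borel"
      "bounded E" for E
  proof -
    have "\<bar>measure N E - measure P E\<bar> = \<bar>derivative_measure A E \<bullet> b\<bar>"
      using PN(3)[OF E] by simp
    also have "\<dots> \<le> norm (derivative_measure A E)"
      by (rule Basis_le_norm[OF b])
    also have "\<dots> \<le> measure (perimeter_measure A) E"
      unfolding perimeter_measure_eq by (rule norm_le_measure_variation[OF d E])
    finally show ?thesis .
  qed
  then show ?thesis
    unfolding PN(4)
    by (intro signed_integral_abs_le PN radon_perimeter_measure A bounded_borel_test \<phi>)
qed

section \<open>The variation along fine partitions\<close>

definition dense_seq :: "nat \<Rightarrow> 'a::second_countable_topology" where
  "dense_seq = from_nat_into (SOME D. countable D \<and> (\<forall>X. open X \<longrightarrow> X \<noteq> {} \<longrightarrow> (\<exists>d\<in>D. d \<in> X)))"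

lemma dense_seq:
  assumes "open X" "X \<noteq> {}"
  obtains i where "dense_seq i \<in> X"
proof -
  define D where "D = (SOME D :: 'a set. countable D \<and> (\<forall>X. open X \<longrightarrow> X \<noteq> {} \<longrightarrow> (\<exists>d\<in>D. d \<in> X)))"
  have D: "countable D \<and> (\<forall>X. open X \<longrightarrow> X \<noteq> {} \<longrightarrow> (\<exists>d\<in>D. d \<in> X))"
    unfolding D_def by (rule someI_ex) (rule countable_dense_exists)
  then obtain d where d: "d \<in> D" "d \<in> X"
    using assms by blast
  then obtain i where "from_nat_into D i = d"
    using from_nat_into_surj D by metis
  with d show ?thesis
    using that[of i] unfolding dense_seq_def D_def by simp
qed

text \<open>A Borel partition with pieces of diameter below 2/(n+1). Consecutive partitions need not
  refine one another, so convergence along them requires an argument.\<close>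

definition cell :: "nat \<Rightarrow> nat \<Rightarrow> 'a::euclidean_space set" where
  "cell n = disjointed (\<lambda>i. ball (dense_seq i) (1 / real (Suc n)))"

lemma cell:
  shows sets_cell: "(cell n i :: 'a::euclidean_space set) \<in> sets borel"
    and disjoint_cell: "disjoint_family (cell n :: nat \<Rightarrow> 'a set)"
    and UN_cell: "(\<Union>i. cell n i) = (UNIV :: 'a set)"
proof -
  have "range (cell n) \<subseteq> sets (borel :: 'a measure)"
    unfolding cell_def by (rule sets.range_disjointed_sets) auto
  then show "(cell n i :: 'a set) \<in> sets borel" by auto
  show "disjoint_family (cell n :: nat \<Rightarrow> 'a set)"
    unfolding cell_def by (rule disjoint_family_disjointed)
  have "(\<Union>i. ball (dense_seq i) (1 / real (Suc n))) = (UNIV :: 'a set)"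
  proof (rule UNIV_eq_I[symmetric])
    fix x :: 'a
    obtain i where "dense_seq i \<in> ball x (1 / real (Suc n))"
      by (rule dense_seq[of "ball x (1 / real (Suc n))"]) auto
    then have "x \<in> ball (dense_seq i) (1 / real (Suc n))"
      by (simp add: dist_commute)
    then show "x \<in> (\<Union>i. ball (dense_seq i) (1 / real (Suc n)))"
      by (rule UN_I[OF UNIV_I])
  qed
  then show "(\<Union>i. cell n i) = (UNIV :: 'a set)"
    unfolding cell_def UN_disjointed_eq .
qed

lemma dist_cell:
  assumes "x \<in> cell n i" "y \<in> cell n i"
  shows "dist x y < 2 / real (Suc n)"
proof -
  have "cell n i \<subseteq> ball (dense_seq i) (1 / real (Suc n))"
    unfolding cell_def by (rule disjointed_subset)
  then have "dist (dense_seq i) x < 1 / real (Suc n)" "dist (dense_seq i) y < 1 / real (Suc n)"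
    using assms by auto
  then have "dist x y < 1 / real (Suc n) + 1 / real (Suc n)"
    using dist_triangle3[of x y "dense_seq i"] by linarith
  then show ?thesis by simp
qed

lemma mesh_tendsto_0: "(\<lambda>n. 2 / real (Suc n)) \<longlonglongrightarrow> 0"
  using tendsto_mult_right_zero[OF LIMSEQ_inverse_real_of_nat, of 2] by (simp add: divide_inverse)

text \<open>Inner regularity is applied to a finite measure, obtained by giving V the indicator of F
  as density.\<close>

lemma radon_inner_regular:
  fixes V :: "'a::euclidean_space measure"
  assumes V: "radon_measure V" and F: "F \<in> sets borel" "bounded F" and e: "(e::real) > 0"
  obtains K where "K \<subseteq> F" "compact K" "emeasure V (F - K) < ennreal e"
proof -
  define M where "M = density V (indicator F)"
  have [simp]: "sets M = sets borel" "sets V = sets borel" using V by (simp_all add: M_def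
      radon_measureD)
  have M: "emeasure M E = emeasure V (F \<inter> E)" if "E \<in> sets borel" for E
  proof -
    have "emeasure M E = (\<integral>\<^sup>+x. indicator F x * indicator E x \<partial>V)"
      unfolding M_def using F that by (intro emeasure_density borel_measurable_indicator) auto
    also have "(\<lambda>x. indicator F x * indicator E x :: ennreal) = indicator (F \<inter> E)"
      by (auto simp: fun_eq_iff indicator_def)
    finally show ?thesis using F that by simp
  qed
  have fin: "emeasure V F < \<infinity>" by (rule radon_emeasure_bounded[OF V F(2)])
  have "emeasure M F = (SUP K\<in>{K. K \<subseteq> F \<and> compact K}. emeasure M K)"
  proof (rule inner_regular)
    show "emeasure M (space M) \<noteq> \<infinity>"
      using M[of UNIV] fin V by (simp add: M_def radon_measureD)
  qed (use F in auto)
  also have "\<dots> = (SUP K\<in>{K. K \<subseteq> F \<and> compact K}. emeasure V K)"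
    using M by (intro SUP_cong refl) (auto simp: compact_imp_closed Int_absorb1)
  finally have eq: "emeasure V F = (SUP K\<in>{K. K \<subseteq> F \<and> compact K}. emeasure V K)"
    using M[OF F(1)] by simp
  have "\<exists>K\<in>{K. K \<subseteq> F \<and> compact K}. emeasure V F < emeasure V K + e"
    using fin by (intro SUP_approx_ennreal[OF e _ eq]) auto
  then obtain K where K: "K \<subseteq> F" "compact K" "emeasure V F < emeasure V K + e"
    by blast
  have "emeasure V F = emeasure V K + emeasure V (F - K)"
    using K F by (subst plus_emeasure) (auto simp: compact_imp_closed Un_absorb1)
  then have "emeasure V (F - K) < e"
    using K(3) ennreal_add_left_cancel_less[of "emeasure V K"] by simp
  with K show ?thesis using that by blast
qed

lemma norm_diff_le_variation:
  assumes \<mu>: "vector_radon_measure \<mu>" and AB: "A \<in> sets borel" "B \<in> sets borel" "B \<subseteq> A" "bounded A"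
  shows "ennreal (norm (\<mu> A - \<mu> B)) \<le> emeasure (variation_measure \<mu>) (A - B)"
  using norm_le_variation[OF \<mu>, of "A - B"] AB bounded_subset[OF AB(4) Diff_subset]
  by (simp add: emeasure_variation_measure[OF \<mu>] vector_radon_Diff[OF \<mu>])

text \<open>The first N sets are shrunk to disjoint, hence separated, compact sets
  \<open>K h\<close>. Once the mesh is small, no cell meets two of them, and the cells meeting
  \<open>K h\<close> exceed it by a set of small variation only. The sum over the cells then catches
  up with the given partition up to e.\<close>

lemma partition_sum_le_cells:
  fixes \<mu> :: "'a::euclidean_space set \<Rightarrow> 'a"
  assumes \<mu>: "vector_radon_measure \<mu>" and V: "radon_measure (variation_measure \<mu>)"
    and E: "E \<in> sets borel" "bounded E" and F: "F \<in> bounded_partitions E" and e: "e > 0"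
  shows "\<exists>n. (\<Sum>h<N. ennreal (norm (\<mu> (F h)))) \<le> (\<Sum>i. ennreal (norm (\<mu> (E \<inter> cell n i)))) + ennreal e"
proof -
  let ?V = "variation_measure \<mu>"
  note FD = bounded_partitionsD[OF F]
  \<comment> \<open>Each of the N sets causes two errors; \<open>Suc N\<close> keeps the denominator
    positive for N = 0.\<close>
  define \<epsilon> where "\<epsilon> = ennreal (e / (2 * real (Suc N)))"
  have \<epsilon>: "\<epsilon> > 0" using e by (simp add: \<epsilon>_def)
  have "\<exists>K. K \<subseteq> F h \<and> compact K \<and> emeasure ?V (F h - K) < \<epsilon>" for h
    using radon_inner_regular[OF V FD(1)[of h] FD(2)[of h], of "e / (2 * real (Suc N))"] e
    unfolding \<epsilon>_def by (metis divide_pos_pos mult_pos_pos of_nat_0_less_iff zero_less_Suc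
        zero_less_numeral)
  then obtain K where K: "\<And>h. K h \<subseteq> F h" "\<And>h. compact (K h)" "\<And>h. emeasure ?V (F h - K h) < \<epsilon>"
    by metis
  have Kb: "K h \<in> sets borel" for h
    using K(2) by (simp add: borel_closed compact_imp_closed)
  define I where "I n h = {i. cell n i \<inter> K h \<noteq> {}}" for n h
  define G where "G n h = (\<Union>i. if i \<in> I n h then E \<inter> cell n i else {})" for n h
  have G: "G n h \<in> sets borel" "G n h \<subseteq> E" "K h \<subseteq> G n h" for n h
  proof -
    show "G n h \<in> sets borel"
      using E(1) sets_cell unfolding G_def by auto
    show "G n h \<subseteq> E" by (auto simp: G_def split: if_splits)
    show "K h \<subseteq> G n h"
    proof
      fix x assume x: "x \<in> K h"
      then obtain i where i: "x \<in> cell n i" using UN_cell by blast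
      moreover have "x \<in> E" using x K(1) FD(4) by blast
      ultimately show "x \<in> G n h"
        using x unfolding G_def I_def by auto
    qed
  qed
  have small: "\<forall>\<^sub>F n in sequentially. emeasure ?V (G n h - K h) < \<epsilon>" for h
  \<comment> \<open>\<open>infdist\<close> to the empty set is 0 by convention, so the
    neighbourhoods \<open>D n\<close> below would not shrink in this case.\<close>
  proof (cases "K h = {}")
    case True
    then show ?thesis using \<epsilon> by (simp add: G_def I_def)
  next
    case False
    define D where "D n = E \<inter> {x. infdist x (K h) \<le> 2 / real (Suc n)} - K h" for n
    have cl: "closed {x. infdist x (K h) \<le> 2 / real (Suc n)}" for n
      by (intro closed_Collect_le continuous_intros)
    have D: "D n \<in> sets borel" for n
      unfolding D_def using cl E(1) Kb by auto
    have "(\<lambda>n. emeasure ?V (D n)) \<longlonglongrightarrow> emeasure ?V (\<Inter>n. D n)"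
    proof (rule Lim_emeasure_decseq)
      show "range D \<subseteq> sets ?V" using D by (auto simp: sets_variation_measure)
      have "2 / real (Suc n) \<le> 2 / real (Suc m)" if "m \<le> n" for m n
        using that by (intro divide_left_mono) auto
      then show "decseq D"
        unfolding D_def decseq_def by (fastforce intro: order_trans)
      have "D i \<subseteq> E" for i by (auto simp: D_def)
      then show "emeasure ?V (D i) \<noteq> \<infinity>" for i
        using radon_emeasure_bounded[OF V bounded_subset[OF E(2)]] by (simp add: less_top)
    qed
    moreover have "(\<Inter>n. D n) = {}"
    proof -
      have False if x: "\<And>n. x \<in> D n" for x
      proof -
        have "infdist x (K h) \<le> 0"
          using x by (intro LIMSEQ_le_const[OF mesh_tendsto_0]) (auto simp: D_def)
        then have "infdist x (K h) = 0"
          using infdist_nonneg[of x "K h"] by linarith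
        then have "x \<in> K h"
          using in_closed_iff_infdist_zero[OF compact_imp_closed[OF K(2)] False] by simp
        then show False using x[of 0] by (simp add: D_def)
      qed
      then show ?thesis by blast
    qed
    ultimately have "\<forall>\<^sub>F n in sequentially. emeasure ?V (D n) < \<epsilon>"
      using \<epsilon> by (intro order_tendstoD(2)) auto
    then show ?thesis
    proof eventually_elim
      case (elim n)
      have "G n h - K h \<subseteq> D n"
      proof
        fix x assume x: "x \<in> G n h - K h"
        then obtain i where i: "i \<in> I n h" "x \<in> cell n i" "x \<in> E"
          unfolding G_def by (auto split: if_splits)
        then obtain y where "y \<in> cell n i" "y \<in> K h" by (auto simp: I_def)
        then have "infdist x (K h) \<le> 2 / real (Suc n)"
          using infdist_le[of y "K h" x] dist_cell[OF i(2), of y] by linarith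
        then show "x \<in> D n" using x i by (auto simp: D_def)
      qed
      then have "emeasure ?V (G n h - K h) \<le> emeasure ?V (D n)"
        using D by (intro emeasure_mono) (auto simp: sets_variation_measure)
      then show ?case using elim by simp
    qed
  qed
  have disj: "\<forall>\<^sub>F n in sequentially. h \<noteq> k \<longrightarrow> I n h \<inter> I n k = {}" for h k
  proof (cases "h = k")
    case False
    then have "K h \<inter> K k = {}"
      using K(1) FD(3) unfolding disjoint_family_on_def by blast
    then obtain d where d: "d > 0" "\<And>x y. x \<in> K h \<Longrightarrow> y \<in> K k \<Longrightarrow> d \<le> dist x y"
      using separate_compact_closed[OF K(2) compact_imp_closed[OF K(2)], of h k] by blast
    have "\<forall>\<^sub>F n in sequentially. 2 / real (Suc n) < d"
      using order_tendstoD(2)[OF mesh_tendsto_0 d(1)] .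
    then show ?thesis
    proof eventually_elim
      case (elim n)
      have False if "i \<in> I n h" "i \<in> I n k" for i
      proof -
        obtain x y where "x \<in> cell n i" "x \<in> K h" "y \<in> cell n i" "y \<in> K k"
          using \<open>i \<in> I n h\<close> \<open>i \<in> I n k\<close> unfolding I_def by blast
        then show False using d(2)[of x y] dist_cell[of x n i y] elim by linarith
      qed
      then show ?case by blast
    qed
  qed auto
  have "\<forall>\<^sub>F n in sequentially. (\<forall>h\<in>{..<N}. emeasure ?V (G n h - K h) < \<epsilon>) \<and> (\<forall>h\<in>{..<N}. \<forall>k\<in>{..<N}. h
      \<noteq> k \<longrightarrow> I n h \<inter> I n k = {})"
    by (intro eventually_conj eventually_ball_finite ballI small disj) auto
  then obtain n where n: "\<And>h. h < N \<Longrightarrow> emeasure ?V (G n h - K h) < \<epsilon>"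
    "\<And>h k. h < N \<Longrightarrow> k < N \<Longrightarrow> h \<noteq> k \<Longrightarrow> I n h \<inter> I n k = {}"
    unfolding eventually_sequentially by (metis lessThan_iff order_refl)
  let ?c = "\<lambda>i. ennreal (norm (\<mu> (E \<inter> cell n i)))"
  have "ennreal (norm (\<mu> (F h))) \<le> (\<Sum>i. if i \<in> I n h then ?c i else 0) + (\<epsilon> + \<epsilon>)" if h: "h < N" for h
  proof -
    \<comment> \<open>\<open>F h\<close> and \<open>G n h\<close> are both compared with their
      common subset \<open>K h\<close>.\<close>
    have "norm (\<mu> (F h)) \<le> norm (\<mu> (G n h)) + (norm (\<mu> (F h) - \<mu> (K h)) + norm (\<mu> (G n h) - \<mu> (K h)))"
      using norm_triangle_ineq[of "\<mu> (G n h)" "(\<mu> (F h) - \<mu> (K h)) - (\<mu> (G n h) - \<mu> (K h))"]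
        norm_triangle_ineq4[of "\<mu> (F h) - \<mu> (K h)" "\<mu> (G n h) - \<mu> (K h)"] by simp
    then have "ennreal (norm (\<mu> (F h))) \<le> ennreal (norm (\<mu> (G n h))) + (ennreal (norm (\<mu> (F h) - \<mu>
        (K h))) + ennreal (norm (\<mu> (G n h) - \<mu> (K h))))"
      by (simp flip: ennreal_plus)
    also have "\<dots> \<le> (\<Sum>i. if i \<in> I n h then ?c i else 0) + (\<epsilon> + \<epsilon>)"
    proof (intro add_mono)
      have "(\<lambda>i. \<mu> (if i \<in> I n h then E \<inter> cell n i else {})) sums \<mu> (G n h)"
        unfolding G_def
      proof (rule vector_radon_sums[OF \<mu>])
        show "disjoint_family (\<lambda>i. if i \<in> I n h then E \<inter> cell n i else {})"
          using disjoint_cell[of n] unfolding disjoint_family_on_def by auto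
        show "bounded (\<Union>i. if i \<in> I n h then E \<inter> cell n i else {})"
          using bounded_subset[OF E(2) G(2)] unfolding G_def .
      qed (use E sets_cell in auto)
      from sums_norm_le_suminf[OF this]
      show "ennreal (norm (\<mu> (G n h))) \<le> (\<Sum>i. if i \<in> I n h then ?c i else 0)"
        by (simp add: if_distrib[of \<mu>] if_distrib[of norm] if_distrib[of ennreal]
            vector_radon_empty[OF \<mu>] cong: if_cong)
      show "ennreal (norm (\<mu> (F h) - \<mu> (K h))) \<le> \<epsilon>"
        using norm_diff_le_variation[OF \<mu> FD(1) Kb K(1) FD(2), of h] K(3)[of h] by simp
      show "ennreal (norm (\<mu> (G n h) - \<mu> (K h))) \<le> \<epsilon>"
        using norm_diff_le_variation[OF \<mu> G(1) Kb G(3) bounded_subset[OF E(2) G(2)], of n h] n(1)[OF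
            h] by simp
    qed
    finally show ?thesis .
  qed
  then have "(\<Sum>h<N. ennreal (norm (\<mu> (F h)))) \<le> (\<Sum>h<N. (\<Sum>i. if i \<in> I n h then ?c i else 0) + (\<epsilon> + \<epsilon>))"
    by (intro sum_mono) auto
  also have "\<dots> = (\<Sum>h<N. \<Sum>i. if i \<in> I n h then ?c i else 0) + of_nat N * (\<epsilon> + \<epsilon>)"
    by (simp add: sum.distrib)
  finally have le: "(\<Sum>h<N. ennreal (norm (\<mu> (F h)))) \<le>
    (\<Sum>h<N. \<Sum>i. if i \<in> I n h then ?c i else 0) + of_nat N * (\<epsilon> + \<epsilon>)" .
  have "(\<Sum>h<N. \<Sum>i. if i \<in> I n h then ?c i else 0) = (\<Sum>i. \<Sum>h<N. if i \<in> I n h then ?c i else 0)"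
    by (rule suminf_sum[symmetric]) auto
  also have "\<dots> \<le> (\<Sum>i. ?c i)"
  proof (intro suminf_le allI)
    fix i
    show "(\<Sum>h<N. if i \<in> I n h then ?c i else 0) \<le> ?c i"
    proof (cases "\<exists>h<N. i \<in> I n h")
      case True
      then obtain h where h: "h < N" "i \<in> I n h" by blast
      have "(\<Sum>h<N. if i \<in> I n h then ?c i else 0) = (\<Sum>k<N. if k = h then ?c i else 0)"
        using h n(2)[OF h(1)] by (intro sum.cong refl) auto
      then show ?thesis using h by simp
    qed (auto intro!: sum_nonneg)
  qed auto
  finally have c: "(\<Sum>h<N. \<Sum>i. if i \<in> I n h then ?c i else 0) \<le> (\<Sum>i. ?c i)" .
  have "of_nat N * (\<epsilon> + \<epsilon>) \<le> ennreal e"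
  proof -
    have "of_nat N * (\<epsilon> + \<epsilon>) = ennreal (real N * (e / (2 * real (Suc N)) + e / (2 * real (Suc N))))"
      using e by (simp add: \<epsilon>_def ennreal_of_nat_eq_real_of_nat flip: ennreal_plus ennreal_mult)
    also have "\<dots> \<le> ennreal e"
    proof (rule ennreal_leI)
      have "e / (2 * c) + e / (2 * c) = e / c" for c :: real
        by (simp add: field_simps)
      from this[of "real (Suc N)"] have "real N * (e / (2 * real (Suc N)) + e / (2 * real (Suc N)))
          = e * (real N / real (Suc N))"
        by simp
      also have "\<dots> \<le> e * 1"
        using e by (intro mult_left_mono) auto
      finally show "real N * (e / (2 * real (Suc N)) + e / (2 * real (Suc N))) \<le> e" by simp
    qed
    finally show ?thesis .
  qed
  from order_trans[OF le add_mono[OF c this]] show ?thesis by (rule exI)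
qed

text \<open>The defining supremum ranges over uncountably many partitions. Along a fixed sequence of
  them, measurable dependence on \<mu> survives the supremum.\<close>

lemma emeasure_variation_cells:
  fixes \<mu> :: "'a::euclidean_space set \<Rightarrow> 'a"
  assumes \<mu>: "vector_radon_measure \<mu>" and V: "radon_measure (variation_measure \<mu>)"
    and E: "E \<in> sets borel" "bounded E"
  shows "emeasure (variation_measure \<mu>) E = (SUP n. \<Sum>i. ennreal (norm (\<mu> (E \<inter> cell n i))))"
  unfolding emeasure_variation_measure[OF \<mu> E(1)]
proof (rule antisym)
  show "variation \<mu> E \<le> (SUP n. \<Sum>i. ennreal (norm (\<mu> (E \<inter> cell n i))))"
    unfolding variation_eq
  proof (rule SUP_least)
    fix F assume F: "F \<in> bounded_partitions E"
    show "(\<Sum>h. ennreal (norm (\<mu> (F h)))) \<le> (SUP n. \<Sum>i. ennreal (norm (\<mu> (E \<inter> cell n i))))"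
    proof (rule suminf_le_const)
      fix N
      show "(\<Sum>h<N. ennreal (norm (\<mu> (F h)))) \<le> (SUP n. \<Sum>i. ennreal (norm (\<mu> (E \<inter> cell n i))))"
      proof (rule ennreal_le_epsilon)
        fix e :: real assume "e > 0"
        then obtain n where "(\<Sum>h<N. ennreal (norm (\<mu> (F h)))) \<le> (\<Sum>i. ennreal (norm (\<mu> (E \<inter> cell n
            i)))) + ennreal e"
          using partition_sum_le_cells[OF \<mu> V E F] by blast
        also have "\<dots> \<le> (SUP n. \<Sum>i. ennreal (norm (\<mu> (E \<inter> cell n i)))) + ennreal e"
          by (intro add_right_mono SUP_upper UNIV_I)
        finally show "(\<Sum>h<N. ennreal (norm (\<mu> (F h)))) \<le> (SUP n. \<Sum>i. ennreal (norm (\<mu> (E \<inter> cell n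
            i)))) + ennreal e" .
      qed
    qed simp
  qed
  show "(SUP n. \<Sum>i. ennreal (norm (\<mu> (E \<inter> cell n i)))) \<le> variation \<mu> E"
  proof (rule SUP_least)
    fix n
    have "(\<Union>i. E \<inter> cell n i) = E" using UN_cell[of n] by blast
    moreover have "disjoint_family (\<lambda>i. E \<inter> cell n i)"
      using disjoint_cell[of n] unfolding disjoint_family_on_def by blast
    ultimately have "(\<lambda>i. E \<inter> cell n i) \<in> bounded_partitions E"
      using E sets.Int[OF E(1) sets_cell] unfolding bounded_partitions_def by (simp add: bounded_Int
          image_subset_iff)
    then show "(\<Sum>i. ennreal (norm (\<mu> (E \<inter> cell n i)))) \<le> variation \<mu> E"
      unfolding variation_eq by (rule SUP_upper)
  qed
qed

section \<open>Functionals dominated by a measure\<close>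

text \<open>The instances to come map \<phi> to minus the integral over the union of a partial
  derivative of \<phi>, and m is the sum of the perimeter measures.\<close>

locale dominated_functional =
  fixes m :: "'a::euclidean_space measure" and T :: "('a \<Rightarrow> real) \<Rightarrow> real"
  assumes radon: "radon_measure m"
    and T_add: "\<And>f g. test_function f \<Longrightarrow> test_function g \<Longrightarrow> T (\<lambda>x. f x + g x) = T f + T g"
    and T_cmult: "\<And>c f. test_function f \<Longrightarrow> T (\<lambda>x. c * f x) = c * T f"
    and T_bound: "\<And>f. test_function f \<Longrightarrow> \<bar>T f\<bar> \<le> (\<integral>x. \<bar>f x\<bar> \<partial>m)"
begin

lemma T_diff: "test_function f \<Longrightarrow> test_function g \<Longrightarrow> T (\<lambda>x. f x - g x) = T f - T g"
  using T_add[of f "\<lambda>x. -1 * g x"] T_cmult[of g "-1"] test_function_cmult[of g "-1"] by simp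

lemma T_0: "T (\<lambda>x. 0) = 0"
  using T_cmult[OF test_function_0, of 0] by simp

lemma test_integrable: "test_function f \<Longrightarrow> integrable m f"
  by (intro bounded_borel_integrable radon bounded_borel_test)

lemma L1_triangle:
  fixes f g h :: "'a \<Rightarrow> real"
  assumes "integrable m f" "integrable m g" "integrable m h"
  shows "(\<integral>x. \<bar>f x - h x\<bar> \<partial>m) \<le> (\<integral>x. \<bar>f x - g x\<bar> \<partial>m) + (\<integral>x. \<bar>g x - h x\<bar> \<partial>m)"
proof -
  have "(\<integral>x. \<bar>f x - h x\<bar> \<partial>m) \<le> (\<integral>x. \<bar>f x - g x\<bar> + \<bar>g x - h x\<bar> \<partial>m)"
    using assms by (intro integral_mono) auto
  also have "\<dots> = (\<integral>x. \<bar>f x - g x\<bar> \<partial>m) + (\<integral>x. \<bar>g x - h x\<bar> \<partial>m)"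
    using assms by (intro Bochner_Integration.integral_add) auto
  finally show ?thesis .
qed

text \<open>y is the value at f of the continuous extension of T to L1(m). The last clause
  determines it by comparison with every test function, so no approximating sequence is built into
  the notion.\<close>

definition extends_to :: "('a \<Rightarrow> real) \<Rightarrow> real \<Rightarrow> bool" where
  "extends_to f y \<longleftrightarrow> integrable m f \<and> (\<forall>e>0. \<exists>\<phi>. test_function \<phi> \<and> (\<integral>x. \<bar>\<phi> x - f x\<bar> \<partial>m) < e) \<and>
     (\<forall>\<phi>. test_function \<phi> \<longrightarrow> \<bar>T \<phi> - y\<bar> \<le> (\<integral>x. \<bar>\<phi> x - f x\<bar> \<partial>m))"

lemma extends_toD:
  assumes "extends_to f y"
  shows "integrable m f" "\<And>\<phi>. test_function \<phi> \<Longrightarrow> \<bar>T \<phi> - y\<bar> \<le> (\<integral>x. \<bar>\<phi> x - f x\<bar> \<partial>m)"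
  using assms by (auto simp: extends_to_def)

lemma extends_toE:
  assumes "extends_to f y" "e > 0"
  obtains \<phi> where "test_function \<phi>" "(\<integral>x. \<bar>\<phi> x - f x\<bar> \<partial>m) < e"
  using assms unfolding extends_to_def by blast

lemma extends_to_test: "test_function f \<Longrightarrow> extends_to f (T f)"
  unfolding extends_to_def
  by (auto intro: test_integrable exI[of _ f] simp: T_diff[symmetric] intro!: T_bound
      test_function_diff)

lemma extends_to_abs_le: "extends_to f y \<Longrightarrow> \<bar>y\<bar> \<le> (\<integral>x. \<bar>f x\<bar> \<partial>m)"
  using extends_toD(2)[of f y, OF _ test_function_0] by (simp add: T_0)

text \<open>A test function closer to f than half of |y - z| would have its value closer than that
  to both y and z.\<close>

lemma extends_to_unique:
  assumes "extends_to f y" "extends_to f z"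
  shows "y = z"
proof (rule ccontr)
  assume "y \<noteq> z"
  then have e: "\<bar>y - z\<bar> / 2 > 0" by simp
  obtain \<phi> where \<phi>: "test_function \<phi>" "(\<integral>x. \<bar>\<phi> x - f x\<bar> \<partial>m) < \<bar>y - z\<bar> / 2"
    using extends_toE[OF assms(1) e] .
  have False if "i < \<bar>y - z\<bar> / 2" "\<bar>t - y\<bar> \<le> i" "\<bar>t - z\<bar> \<le> i" for i t
    using that by (auto simp: abs_le_iff abs_if split: if_splits)
  from this[OF \<phi>(2) extends_toD(2)[OF assms(1) \<phi>(1)] extends_toD(2)[OF assms(2) \<phi>(1)]] show False .
qed

lemma extends_to_add:
  assumes f: "extends_to f y" and g: "extends_to g z"
  shows "extends_to (\<lambda>x. f x + g x) (y + z)"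
  unfolding extends_to_def
proof (intro conjI allI impI)
  note i = extends_toD(1)[OF f] extends_toD(1)[OF g]
  show "integrable m (\<lambda>x. f x + g x)" using i by simp
  have approx: "\<exists>\<phi> \<psi>. test_function \<phi> \<and> test_function \<psi> \<and> (\<integral>x. \<bar>\<phi> x - f x\<bar> \<partial>m) < e \<and> (\<integral>x. \<bar>\<psi> x - g
      x\<bar> \<partial>m) < e" if "e > 0" for e
    using extends_toE[OF f that] extends_toE[OF g that] by metis
  have tri: "(\<integral>x. \<bar>(\<phi> x + \<psi> x) - (f x + g x)\<bar> \<partial>m) \<le> (\<integral>x. \<bar>\<phi> x - f x\<bar> \<partial>m) + (\<integral>x. \<bar>\<psi> x - g x\<bar> \<partial>m)"
    if "test_function \<phi>" "test_function \<psi>" for \<phi> \<psi>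
  proof -
    have "(\<integral>x. \<bar>(\<phi> x + \<psi> x) - (f x + g x)\<bar> \<partial>m) \<le> (\<integral>x. \<bar>\<phi> x - f x\<bar> + \<bar>\<psi> x - g x\<bar> \<partial>m)"
      using i that[THEN test_integrable] by (intro integral_mono) auto
    also have "\<dots> = (\<integral>x. \<bar>\<phi> x - f x\<bar> \<partial>m) + (\<integral>x. \<bar>\<psi> x - g x\<bar> \<partial>m)"
      using i that[THEN test_integrable] by (intro Bochner_Integration.integral_add) auto
    finally show ?thesis .
  qed
  {
    fix e :: real assume "e > 0"
    then obtain \<phi> \<psi> where "test_function \<phi>" "test_function \<psi>"
      "(\<integral>x. \<bar>\<phi> x - f x\<bar> \<partial>m) < e / 2" "(\<integral>x. \<bar>\<psi> x - g x\<bar> \<partial>m) < e / 2"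
      using approx[of "e / 2"] by auto
    with tri[of \<phi> \<psi>] show "\<exists>\<phi>. test_function \<phi> \<and> (\<integral>x. \<bar>\<phi> x - (f x + g x)\<bar> \<partial>m) < e"
      by (intro exI[of _ "\<lambda>x. \<phi> x + \<psi> x"] conjI test_function_add) auto
  }
  fix \<theta> :: "'a \<Rightarrow> real" assume \<theta>: "test_function \<theta>"
  show "\<bar>T \<theta> - (y + z)\<bar> \<le> (\<integral>x. \<bar>\<theta> x - (f x + g x)\<bar> \<partial>m)"
  proof (rule field_le_epsilon)
    fix e :: real assume "e > 0"
    \<comment> \<open>Each of the two errors enters twice, once through T and once through the
      triangle inequality in L1; hence e/4.\<close>
    then obtain \<phi> \<psi> where t: "test_function \<phi>" "test_function \<psi>"
      "(\<integral>x. \<bar>\<phi> x - f x\<bar> \<partial>m) < e / 4" "(\<integral>x. \<bar>\<psi> x - g x\<bar> \<partial>m) < e / 4"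
      using approx[of "e / 4"] by auto
    have "\<bar>T \<theta> - (T \<phi> + T \<psi>)\<bar> \<le> (\<integral>x. \<bar>\<theta> x - (\<phi> x + \<psi> x)\<bar> \<partial>m)"
      using T_bound[OF test_function_diff[OF \<theta> test_function_add[OF t(1,2)]]]
      by (simp add: T_diff[OF \<theta> test_function_add[OF t(1,2)]] T_add[OF t(1,2)])
    also have "\<dots> \<le> (\<integral>x. \<bar>\<theta> x - (f x + g x)\<bar> \<partial>m) + (\<integral>x. \<bar>(f x + g x) - (\<phi> x + \<psi> x)\<bar> \<partial>m)"
      using i \<theta> t by (intro L1_triangle) (auto intro: test_integrable)
    finally show "\<bar>T \<theta> - (y + z)\<bar> \<le> (\<integral>x. \<bar>\<theta> x - (f x + g x)\<bar> \<partial>m) + e"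
      using extends_toD(2)[OF f t(1)] extends_toD(2)[OF g t(2)] t(3,4) tri[OF t(1,2)]
      by (simp add: abs_minus_commute[of "f _ + g _"])
  qed
qed

lemma extends_to_cmult:
  assumes f: "extends_to f y"
  shows "extends_to (\<lambda>x. c * f x) (c * y)"
proof (cases "c = 0")
  case True
  then show ?thesis using extends_to_test[OF test_function_0] by (simp add: T_0)
next
  case False
  have scale: "(\<integral>x. \<bar>c * \<phi> x - c * f x\<bar> \<partial>m) = \<bar>c\<bar> * (\<integral>x. \<bar>\<phi> x - f x\<bar> \<partial>m)" for \<phi>
    by (simp add: right_diff_distrib[symmetric] abs_mult)
  show ?thesis
    unfolding extends_to_def
  proof (intro conjI allI impI)
    show "integrable m (\<lambda>x. c * f x)" using extends_toD(1)[OF f] by simp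
  next
    fix e :: real assume "e > 0"
    then have "e / \<bar>c\<bar> > 0" using False by simp
    from extends_toE[OF f this] obtain \<phi> where "test_function \<phi>" "(\<integral>x. \<bar>\<phi> x - f x\<bar> \<partial>m) < e / \<bar>c\<bar>" .
    then show "\<exists>\<phi>. test_function \<phi> \<and> (\<integral>x. \<bar>\<phi> x - c * f x\<bar> \<partial>m) < e"
      using False scale[of \<phi>] by (intro exI[of _ "\<lambda>x. c * \<phi> x"]) (auto intro: test_function_cmult
          simp: field_simps)
  next
    fix \<phi> :: "'a \<Rightarrow> real" assume \<phi>: "test_function \<phi>"
    have \<psi>: "test_function (\<lambda>x. inverse c * \<phi> x)" by (rule test_function_cmult[OF \<phi>])
    have "\<bar>T \<phi> - c * y\<bar> = \<bar>c\<bar> * \<bar>T (\<lambda>x. inverse c * \<phi> x) - y\<bar>"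
      unfolding T_cmult[OF \<phi>] abs_mult[symmetric] using False by (simp add: right_diff_distrib
          mult.assoc[symmetric])
    also have "\<dots> \<le> \<bar>c\<bar> * (\<integral>x. \<bar>inverse c * \<phi> x - f x\<bar> \<partial>m)"
      by (intro mult_left_mono extends_toD(2)[OF f \<psi>]) auto
    also have "\<dots> = (\<integral>x. \<bar>\<phi> x - c * f x\<bar> \<partial>m)"
      unfolding scale[symmetric] using False by (simp add: mult.assoc[symmetric])
    finally show "\<bar>T \<phi> - c * y\<bar> \<le> (\<integral>x. \<bar>\<phi> x - c * f x\<bar> \<partial>m)" .
  qed
qed

text \<open>Along test functions converging to f in L1, the values of T form a Cauchy sequence by
  \<open>T_bound\<close>, and the defining estimate passes to the limit.\<close>

lemma extends_to_exists:
  assumes f: "integrable m f" and ap: "\<And>e. e > 0 \<Longrightarrow> \<exists>\<phi>. test_function \<phi> \<and> (\<integral>x. \<bar>\<phi> x - f x\<bar> \<partial>m) < e"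
  shows "\<exists>y. extends_to f y"
proof -
  have "\<exists>\<phi>. test_function \<phi> \<and> (\<integral>x. \<bar>\<phi> x - f x\<bar> \<partial>m) < 1 / real (Suc n)" for n
    using ap[of "1 / real (Suc n)"] by simp
  then obtain \<phi> where \<phi>: "\<And>n. test_function (\<phi> n)" "\<And>n. (\<integral>x. \<bar>\<phi> n x - f x\<bar> \<partial>m) < 1 / real (Suc n)"
    by metis
  have lim0: "(\<lambda>n. \<integral>x. \<bar>\<phi> n x - f x\<bar> \<partial>m) \<longlonglongrightarrow> 0"
    using \<phi>(2) by (intro tendsto_sandwich[OF _ _ tendsto_const LIMSEQ_Suc[OF lim_1_over_n]])
      (auto intro!: always_eventually less_imp_le simp del: of_nat_Suc)
  have diff: "\<bar>T \<theta> - T (\<phi> n)\<bar> \<le> (\<integral>x. \<bar>\<theta> x - f x\<bar> \<partial>m) + (\<integral>x. \<bar>\<phi> n x - f x\<bar> \<partial>m)" if "test_function \<theta>"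
      for \<theta> n
  proof -
    have "\<bar>T \<theta> - T (\<phi> n)\<bar> \<le> (\<integral>x. \<bar>\<theta> x - \<phi> n x\<bar> \<partial>m)"
      using T_bound[OF test_function_diff[OF that \<phi>(1)]] by (simp add: T_diff[OF that \<phi>(1)])
    also have "\<dots> \<le> (\<integral>x. \<bar>\<theta> x - f x\<bar> \<partial>m) + (\<integral>x. \<bar>f x - \<phi> n x\<bar> \<partial>m)"
      by (intro L1_triangle test_integrable that \<phi>(1) f)
    finally show ?thesis by (simp add: abs_minus_commute)
  qed
  have "Cauchy (\<lambda>n. T (\<phi> n))"
  proof (rule CauchyI)
    fix e :: real assume "e > 0"
    then obtain N where N: "\<And>n. n \<ge> N \<Longrightarrow> (\<integral>x. \<bar>\<phi> n x - f x\<bar> \<partial>m) < e / 2"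
      using order_tendstoD(2)[OF lim0, of "e / 2"] by (auto simp: eventually_sequentially)
    show "\<exists>M. \<forall>k\<ge>M. \<forall>n\<ge>M. norm (T (\<phi> k) - T (\<phi> n)) < e"
    proof (intro exI[of _ N] allI impI)
      fix k n assume "k \<ge> N" "n \<ge> N"
      then show "norm (T (\<phi> k) - T (\<phi> n)) < e"
        using diff[OF \<phi>(1)[of k], of n] N[of k] N[of n] by simp
    qed
  qed
  then obtain y where y: "(\<lambda>n. T (\<phi> n)) \<longlonglongrightarrow> y"
    using Cauchy_convergent_iff convergent_def by blast
  have "extends_to f y"
    unfolding extends_to_def
  proof (intro conjI allI impI f)
    show "\<exists>\<phi>. test_function \<phi> \<and> (\<integral>x. \<bar>\<phi> x - f x\<bar> \<partial>m) < e" if "e > 0" for e by (rule ap[OF that])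
    fix \<theta> :: "'a \<Rightarrow> real" assume \<theta>: "test_function \<theta>"
    have l: "(\<lambda>n. \<bar>T \<theta> - T (\<phi> n)\<bar>) \<longlonglongrightarrow> \<bar>T \<theta> - y\<bar>"
      by (intro tendsto_intros y)
    have r: "(\<lambda>n. (\<integral>x. \<bar>\<theta> x - f x\<bar> \<partial>m) + (\<integral>x. \<bar>\<phi> n x - f x\<bar> \<partial>m)) \<longlonglongrightarrow> (\<integral>x. \<bar>\<theta> x - f x\<bar> \<partial>m) + 0"
      by (intro tendsto_intros lim0)
    show "\<bar>T \<theta> - y\<bar> \<le> (\<integral>x. \<bar>\<theta> x - f x\<bar> \<partial>m)"
      using LIMSEQ_le[OF l r] diff[OF \<theta>] by auto
  qed
  then show ?thesis ..
qed

section \<open>The extended functional as a countably additive set function\<close>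

definition ext :: "'a set \<Rightarrow> real" where
  "ext E = (SOME y. extends_to (indicator E) y)"

lemma extends_to_ext:
  assumes "E \<in> sets borel" "emeasure m E < \<infinity>"
  shows "extends_to (indicator E) (ext E)"
  unfolding ext_def
proof (rule someI_ex, rule extends_to_exists)
  show "integrable m (indicat_real E)"
    using assms radon by (intro integrable_real_indicator) (auto simp: radon_measureD)
  show "\<exists>\<phi>. test_function \<phi> \<and> (\<integral>x. \<bar>\<phi> x - indicator E x\<bar> \<partial>m) < e" if "e > 0" for e
    using test_function_dense[OF radon assms that] by metis
qed

lemma ext_abs_le:
  assumes "E \<in> sets borel" "emeasure m E < \<infinity>"
  shows "\<bar>ext E\<bar> \<le> measure m E"
  using extends_to_abs_le[OF extends_to_ext[OF assms]] assms radon by (simp add: radon_measureD)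

lemma ext_Un:
  assumes "A \<in> sets borel" "B \<in> sets borel" "emeasure m A < \<infinity>" "emeasure m B < \<infinity>" "A \<inter> B = {}"
  shows "ext (A \<union> B) = ext A + ext B"
proof -
  have "emeasure m (A \<union> B) \<le> emeasure m A + emeasure m B"
    using assms radon by (intro emeasure_subadditive) (auto simp: radon_measureD)
  also have "\<dots> < \<infinity>" using assms by simp
  finally have "extends_to (indicator (A \<union> B)) (ext (A \<union> B))"
    using assms by (intro extends_to_ext) auto
  moreover have "extends_to (\<lambda>x. indicator A x + indicator B x) (ext A + ext B)"
    using assms by (intro extends_to_add extends_to_ext)
  moreover have "(\<lambda>x. indicator A x + indicator B x :: real) = indicator (A \<union> B)"
    using assms(5) by (auto simp: fun_eq_iff indicator_def)
  ultimately show ?thesis using extends_to_unique by simp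
qed

text \<open>Finite additivity and |\<open>ext\<close>| \<le> m: the remainders of the union decrease
  to the empty set inside a set of finite measure, so their m-measure tends to 0.\<close>

lemma ext_sums:
  assumes E: "\<And>i. E i \<in> sets borel" "disjoint_family E" and fin: "emeasure m (\<Union>i. E i) < \<infinity>"
  shows "(\<lambda>i. ext (E i)) sums ext (\<Union>i. E i)"
proof -
  note s = radon_measureD(1)[OF radon]
  have sub: "emeasure m A < \<infinity>" if "A \<subseteq> (\<Union>i. E i)" for A
    using emeasure_mono[OF that, of m] E fin s by (auto intro: le_less_trans)
  have eq: "(\<Sum>i<n. ext (E i)) = ext (\<Union>i<n. E i)" for n
  proof (induction n)
    case 0
    then show ?case using ext_abs_le[of "{}"] by simp
  next
    case (Suc n)
    have "E i \<inter> E n = {}" if "i < n" for i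
      using E(2) that unfolding disjoint_family_on_def by simp
    then have "ext ((\<Union>i<n. E i) \<union> E n) = ext (\<Union>i<n. E i) + ext (E n)"
      using E by (intro ext_Un sub) auto
    moreover have "(\<Union>i<Suc n. E i) = (\<Union>i<n. E i) \<union> E n" by (auto simp: less_Suc_eq)
    ultimately show ?case using Suc by simp
  qed
  have split: "ext (\<Union>i. E i) = ext (\<Union>i<n. E i) + ext ((\<Union>i. E i) - (\<Union>i<n. E i))" for n
  proof -
    have c: "(\<Union>i<n. E i) \<subseteq> (\<Union>i. E i)" by auto
    then have "(\<Union>i<n. E i) \<union> ((\<Union>i. E i) - (\<Union>i<n. E i)) = (\<Union>i. E i)" by blast
    then show ?thesis
      using ext_Un[of "\<Union>i<n. E i" "(\<Union>i. E i) - (\<Union>i<n. E i)"] E sub[OF c] sub[OF Diff_subset] by simp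
  qed
  have "(\<lambda>n. measure m ((\<Union>i. E i) - (\<Union>i<n. E i))) \<longlonglongrightarrow> 0"
  proof -
    have "(\<lambda>n. measure m ((\<Union>i. E i) - (\<Union>i<n. E i))) \<longlonglongrightarrow> measure m (\<Inter>n. (\<Union>i. E i) - (\<Union>i<n. E i))"
    proof (rule Lim_measure_decseq)
      show "decseq (\<lambda>n. (\<Union>i. E i) - (\<Union>i<n. E i))"
        unfolding decseq_def by (fastforce intro: less_le_trans)
      show "emeasure m ((\<Union>i. E i) - (\<Union>i<n. E i)) \<noteq> \<infinity>" for n
        using sub[of "(\<Union>i. E i) - (\<Union>i<n. E i)"] by auto
      show "range (\<lambda>n. (\<Union>i. E i) - (\<Union>i<n. E i)) \<subseteq> sets m" using E s by auto
    qed
    moreover have "(\<Inter>n. (\<Union>i. E i) - (\<Union>i<n. E i)) = {}" by auto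
    ultimately show ?thesis by (simp only: measure_empty)
  qed
  then have "(\<lambda>n. ext ((\<Union>i. E i) - (\<Union>i<n. E i))) \<longlonglongrightarrow> 0"
    by (rule Lim_null_comparison[rotated])
      (use E sub[OF Diff_subset] in \<open>auto intro!: always_eventually ext_abs_le\<close>)
  then have "(\<lambda>n. ext (\<Union>i. E i) - ext ((\<Union>i. E i) - (\<Union>i<n. E i))) \<longlonglongrightarrow> ext (\<Union>i. E i) - 0"
    by (intro tendsto_intros)
  moreover have "ext (\<Union>i. E i) - ext ((\<Union>i. E i) - (\<Union>i<n. E i)) = ext (\<Union>i<n. E i)" for n
    using split[of n] by linarith
  ultimately show ?thesis
    unfolding sums_def eq by simp
qed

text \<open>Adding \<^term>\<open>2\<close> copies of \<^term>\<open>m\<close> (one would suffice for positivity) makes the value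
  \<^term>\<open>\<infinity>\<close> correct on every set of infinite \<^term>\<open>m\<close>-measure.\<close>

definition pos_measure :: "'a measure" where
  "pos_measure = measure_of UNIV (sets borel)
     (\<lambda>E. if emeasure m E = \<infinity> then \<infinity> else ennreal (ext E + 2 * measure m E))"

lemma sets_pos_measure: "sets pos_measure = sets borel"
  unfolding pos_measure_def using sets.sigma_sets_eq[of borel] by (simp add: sets_measure_of)

lemma emeasure_pos_measure:
  assumes "E \<in> sets borel"
  shows "emeasure pos_measure E = (if emeasure m E = \<infinity> then \<infinity> else ennreal (ext E + 2 * measure m E))"
proof (rule emeasure_measure_of[OF pos_measure_def])
  note s = radon_measureD(1)[OF radon]
  show "positive (sets pos_measure) (\<lambda>E. if emeasure m E = \<infinity> then \<infinity> else ennreal (ext E + 2 *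
      measure m E))"
    using ext_abs_le[of "{}"] by (simp add: positive_def)
  show "countably_additive (sets pos_measure) (\<lambda>E. if emeasure m E = \<infinity> then \<infinity> else ennreal (ext E +
      2 * measure m E))"
    unfolding countably_additive_def sets_pos_measure
  proof (intro allI impI)
    fix E :: "nat \<Rightarrow> 'a set" assume "range E \<subseteq> sets borel" and d: "disjoint_family E"
    then have E: "\<And>i. E i \<in> sets borel" by auto
    let ?p = "\<lambda>E. if emeasure m E = \<infinity> then \<infinity> else ennreal (ext E + 2 * measure m E)"
    show "(\<Sum>i. ?p (E i)) = ?p (\<Union>i. E i)"
    proof (cases "emeasure m (\<Union>i. E i) = \<infinity>")
      case True
      \<comment> \<open>Since |\<open>ext\<close>| \<le> m, the new value is at least m, so an
        infinite sum of m-measures forces an infinite sum of values.\<close>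
      have "emeasure m (E i) \<le> ?p (E i)" for i
        using ext_abs_le[OF E, of i] by (auto simp: emeasure_eq_ennreal_measure less_top intro!:
            ennreal_leI)
      then have "(\<Sum>i. emeasure m (E i)) \<le> (\<Sum>i. ?p (E i))"
        by (intro suminf_le) auto
      moreover have "(\<Sum>i. emeasure m (E i)) = \<infinity>"
        using E d True s by (subst suminf_emeasure) auto
      ultimately show ?thesis using True by (simp add: top_unique)
    next
      case False
      have fin: "emeasure m (E i) < \<infinity>" for i
        using emeasure_mono[of "E i" "\<Union>i. E i" m] E False s by (auto simp: less_top intro:
            le_less_trans)
      have "(\<lambda>i. measure m (E i)) sums measure m (\<Union>i. E i)"
        using E s d False by (intro measure_UNION) (auto)
      then have "(\<lambda>i. ext (E i) + 2 * measure m (E i)) sums (ext (\<Union>i. E i) + 2 * measure m (\<Union>i. E i))"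
        using False by (intro sums_add sums_mult ext_sums E d) (auto simp: less_top)
      moreover have "0 \<le> ext (E i) + 2 * measure m (E i)" for i
        using ext_abs_le[OF E fin, of i] measure_nonneg[of m "E i"] by linarith
      ultimately have "(\<Sum>i. ennreal (ext (E i) + 2 * measure m (E i))) = ennreal (ext (\<Union>i. E i) + 2
          * measure m (\<Union>i. E i))"
        by (intro suminf_ennreal_eq)
      moreover have "emeasure m (E i) \<noteq> \<infinity>" for i using fin[of i] by simp
      ultimately show ?thesis by (simp only: False if_False)
    qed
  qed
qed (use assms sets_pos_measure in auto)

lemma measure_pos_measure:
  assumes "E \<in> sets borel" "emeasure m E < \<infinity>"
  shows "measure pos_measure E = ext E + 2 * measure m E" "emeasure pos_measure E < \<infinity>"
  using ext_abs_le[OF assms] assms measure_nonneg[of m E]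
  by (auto simp: measure_def[of pos_measure] emeasure_pos_measure less_top)

lemma emeasure_pos_measure_le:
  assumes "E \<in> sets borel"
  shows "emeasure pos_measure E \<le> 3 * emeasure m E"
proof (cases "emeasure m E = \<infinity>")
  case False
  then have fin: "emeasure m E < \<infinity>" by (simp add: less_top)
  have "emeasure pos_measure E = ennreal (ext E + 2 * measure m E)"
    using False by (simp add: emeasure_pos_measure assms)
  also have "\<dots> \<le> ennreal (3 * measure m E)"
    using ext_abs_le[OF assms fin] by (intro ennreal_leI) linarith
  also have "\<dots> = 3 * emeasure m E"
    using False by (simp add: emeasure_eq_ennreal_measure ennreal_mult)
  finally show ?thesis .
qed (simp add: ennreal_mult_eq_top_iff)

lemma radon_pos_measure: "radon_measure pos_measure"
  unfolding radon_measure_def sets_pos_measure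
  using measure_pos_measure(2) radon by (auto simp: radon_measure_def compact_imp_closed)

lemma integrable_pos_measure:
  assumes "integrable m f"
  shows "integrable pos_measure (f :: 'a \<Rightarrow> real)"
proof (rule integrableI_bounded)
  note s = radon_measureD(1)[OF radon]
  have f: "f \<in> borel_measurable borel"
    using borel_measurable_integrable[OF assms] s by (simp cong: measurable_cong_sets)
  then show "f \<in> borel_measurable pos_measure"
    by (simp add: sets_pos_measure cong: measurable_cong_sets)
  have "(\<integral>\<^sup>+x. norm (f x) \<partial>pos_measure) + (\<integral>\<^sup>+x. norm (f x) \<partial>null_measure borel) \<le>
      (\<integral>\<^sup>+x. norm (f x) \<partial>scale_measure 3 m) + (\<integral>\<^sup>+x. norm (f x) \<partial>null_measure borel)"
    using f by (intro nn_integral_sum_le) (auto simp: sets_pos_measure s emeasure_pos_measure_le)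
  then have "(\<integral>\<^sup>+x. norm (f x) \<partial>pos_measure) \<le> (\<integral>\<^sup>+x. norm (f x) \<partial>scale_measure 3 m)"
    by (simp add: nn_integral_null_measure)
  also have "\<dots> = 3 * (\<integral>\<^sup>+x. norm (f x) \<partial>m)"
    using f s by (intro nn_integral_scale_measure) (simp cong: measurable_cong_sets)
  also have "\<dots> < \<infinity>"
    using assms by (simp add: integrable_iff_bounded ennreal_mult_less_top)
  finally show "(\<integral>\<^sup>+x. norm (f x) \<partial>pos_measure) < \<infinity>" .
qed

text \<open>On sets of finite measure \<open>pos_measure\<close> is \<open>ext\<close> plus 2 m, so
  subtracting 2 m recovers \<open>ext\<close>. Linearity and dominated limits spread this from
  indicators to all integrable functions.\<close>

lemma extends_to_integral:
  assumes "integrable m f"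
  shows "extends_to f ((\<integral>x. f x \<partial>pos_measure) - 2 * (\<integral>x. f x \<partial>m))"
  using assms
proof (induction rule: integrable_induct)
  note s = radon_measureD(1)[OF radon]
  {
    case (base A c)
    then have A: "A \<in> sets borel" "emeasure m A < \<infinity>" using s by auto
    have "extends_to (\<lambda>x. c * indicator A x) (c * ext A)"
      by (intro extends_to_cmult extends_to_ext A)
    moreover have "c * ext A = (\<integral>x. indicator A x *\<^sub>R c \<partial>pos_measure) - 2 * (\<integral>x. indicator A x *\<^sub>R c
        \<partial>m)"
      using measure_pos_measure[OF A] A by (simp add: sets_pos_measure s algebra_simps)
    ultimately show ?case by (simp add: mult.commute)
  next
    case (add f g)
    then show ?case
      using extends_to_add[OF add(3,4)] integrable_pos_measure by (simp add: algebra_simps)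
  next
    case (lim f F)
    let ?L = "\<lambda>f. (\<integral>x. f x \<partial>pos_measure) - 2 * (\<integral>x. f x \<partial>m)"
    have sp: "space m = UNIV" "space pos_measure = UNIV"
      using sets_eq_imp_space_eq[of m borel] sets_eq_imp_space_eq[of pos_measure borel] s
          sets_pos_measure by auto
    \<comment> \<open>The induction rule supplies |F i| \<le> 2 |f|, whence the majorants 2 |f| and
      3 |f|. The measure is left general because both m and \<open>pos_measure\<close> are
      inserted.\<close>
    have dom: "(\<lambda>i. \<integral>x. F i x \<partial>M) \<longlonglongrightarrow> (\<integral>x. f x \<partial>M)" "(\<lambda>i. \<integral>x. \<bar>F i x - f x\<bar> \<partial>M) \<longlonglongrightarrow> (\<integral>x. 0 \<partial>M)"
      if i: "integrable M f" "\<And>i. integrable M (F i)" and [simp]: "space M = UNIV" for M :: "'a measure"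
    proof -
      have b: "\<bar>F i x\<bar> \<le> 2 * \<bar>f x\<bar>" for i x
        using lim(3)[of x i] sp by simp
      have c: "(\<lambda>i. F i x) \<longlonglongrightarrow> f x" for x
        using lim(2)[of x] sp by simp
      show "(\<lambda>i. \<integral>x. F i x \<partial>M) \<longlonglongrightarrow> (\<integral>x. f x \<partial>M)"
        using i b c by (intro integral_dominated_convergence[where w="\<lambda>x. 2 * \<bar>f x\<bar>"]) auto
      have b': "\<bar>F i x - f x\<bar> \<le> 3 * \<bar>f x\<bar>" for i x
        using b[of i x] by linarith
      have c': "(\<lambda>i. \<bar>F i x - f x\<bar>) \<longlonglongrightarrow> 0" for x
        using tendsto_rabs[OF tendsto_diff[OF c[of x] tendsto_const[of "f x"]]] by simp
      show "(\<lambda>i. \<integral>x. \<bar>F i x - f x\<bar> \<partial>M) \<longlonglongrightarrow> (\<integral>x. 0 \<partial>M)"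
        using i b' c' by (intro integral_dominated_convergence[where w="\<lambda>x. 3 * \<bar>f x\<bar>"]) auto
    qed
    note ip = integrable_pos_measure[OF lim(4)] integrable_pos_measure[OF lim(1)]
    have L: "(\<lambda>i. ?L (F i)) \<longlonglongrightarrow> ?L f"
      by (intro tendsto_intros dom sp lim(1,4) ip)
    have L1: "(\<lambda>i. \<integral>x. \<bar>F i x - f x\<bar> \<partial>m) \<longlonglongrightarrow> 0"
      using dom(2)[OF lim(4,1) sp(1)] by simp
    show ?case
      unfolding extends_to_def
    proof (intro conjI allI impI lim(4))
      fix e :: real assume e: "e > 0"
      then obtain i where i: "(\<integral>x. \<bar>F i x - f x\<bar> \<partial>m) < e / 2"
        using order_tendstoD(2)[OF L1, of "e / 2"] by (auto simp: eventually_sequentially)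
      obtain \<phi> where \<phi>: "test_function \<phi>" "(\<integral>x. \<bar>\<phi> x - F i x\<bar> \<partial>m) < e / 2"
        using extends_toE[OF lim(5)[of i], of "e / 2"] e by auto
      then show "\<exists>\<phi>. test_function \<phi> \<and> (\<integral>x. \<bar>\<phi> x - f x\<bar> \<partial>m) < e"
        using i L1_triangle[OF test_integrable[OF \<phi>(1)] lim(1)[of i] lim(4)] by (intro exI[of _ \<phi>]) auto
    next
      fix \<phi> :: "'a \<Rightarrow> real" assume \<phi>: "test_function \<phi>"
      have l: "(\<lambda>i. \<bar>T \<phi> - ?L (F i)\<bar>) \<longlonglongrightarrow> \<bar>T \<phi> - ?L f\<bar>"
        by (intro tendsto_rabs tendsto_diff tendsto_const L)
      have r: "(\<lambda>i. (\<integral>x. \<bar>\<phi> x - f x\<bar> \<partial>m) + (\<integral>x. \<bar>F i x - f x\<bar> \<partial>m)) \<longlonglongrightarrow> (\<integral>x. \<bar>\<phi> x - f x\<bar> \<partial>m) + 0"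
        by (intro tendsto_intros L1)
      have "\<bar>T \<phi> - ?L (F i)\<bar> \<le> (\<integral>x. \<bar>\<phi> x - f x\<bar> \<partial>m) + (\<integral>x. \<bar>F i x - f x\<bar> \<partial>m)" for i
        using extends_toD(2)[OF lim(5)[of i] \<phi>] L1_triangle[OF test_integrable[OF \<phi>] lim(4)
            lim(1)[of i]]
        by (simp add: abs_minus_commute[of "f _"])
      then show "\<bar>T \<phi> - ?L f\<bar> \<le> (\<integral>x. \<bar>\<phi> x - f x\<bar> \<partial>m)"
        using LIMSEQ_le[OF l r] by auto
    qed
  }
qed

end

lemma radon_measure_density_const:
  assumes "radon_measure m"
  shows "radon_measure (density m (\<lambda>_. ennreal c))"
  using assms by (auto simp: radon_measure_def emeasure_density_const compact_imp_closed
      ennreal_mult_less_top)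

text \<open>A test function is extended both by its own value under T and by the integral formula;
  uniqueness equates the two. P is \<open>pos_measure\<close> and N is 2 m.\<close>

lemma dominated_functional_representation:
  assumes "dominated_functional m T"
  obtains P N where "radon_measure P" "radon_measure N"
    "\<And>\<phi>. test_function \<phi> \<Longrightarrow> T \<phi> = (\<integral>x. \<phi> x \<partial>P) - (\<integral>x. \<phi> x \<partial>N)"
proof -
  interpret dominated_functional m T by fact
  have "T \<phi> = (\<integral>x. \<phi> x \<partial>pos_measure) - (\<integral>x. \<phi> x \<partial>density m (\<lambda>_. ennreal 2))" if \<phi>: "test_function \<phi>"
      for \<phi>
  proof -
    have "T \<phi> = (\<integral>x. \<phi> x \<partial>pos_measure) - 2 * (\<integral>x. \<phi> x \<partial>m)"
      using extends_to_unique[OF extends_to_test[OF \<phi>] extends_to_integral[OF test_integrable[OF \<phi>]]] .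
    also have "2 * (\<integral>x. \<phi> x \<partial>m) = (\<integral>x. \<phi> x \<partial>density m (\<lambda>_. ennreal 2))"
      using borel_measurable_integrable[OF test_integrable[OF \<phi>]]
      by (subst integral_real_density) auto
    finally show ?thesis .
  qed
  then show ?thesis
    by (rule that[OF radon_pos_measure radon_measure_density_const[OF radon]])
qed

section \<open>Integrals over sets and Borel representatives\<close>

text \<open>A Lebesgue set is an F-sigma set up to a null set.\<close>

lemma borel_representative:
  fixes A :: "'a::euclidean_space lset"
  shows "\<exists>B. B \<in> sets borel \<and> abs_lset B = A"
proof -
  obtain C T where C: "fsigma C" "T \<in> null_sets lebesgue" "C \<union> T = rep_lset A" "disjnt C T"
    by (rule lebesgue_set_almost_fsigma[OF rep_lset_lebesgue(1)[of A]])
  have Cb: "C \<in> sets borel"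
    using C(1) by (auto elim!: fsigma.cases)
  have "sym_diff C (rep_lset A) = T"
    using C(3,4) by (auto simp: disjnt_def)
  then have "null_eq C (rep_lset A)"
    using Cb C(2) rep_lset_lebesgue(1)[of A] by (auto simp: null_eq_def)
  then have "abs_lset C = abs_lset (rep_lset A)"
    by (rule Quotient3_rel_abs[OF Quotient3_lset])
  with Cb show ?thesis by (auto simp: abs_rep_lset)
qed

definition borel_rep :: "'a::euclidean_space lset \<Rightarrow> 'a set" where
  "borel_rep A = (SOME B. B \<in> sets borel \<and> abs_lset B = A)"

lemma borel_rep[measurable]: "borel_rep A \<in> sets borel" and abs_borel_rep: "abs_lset (borel_rep A) = A"
  using someI_ex[OF borel_representative[of A]] by (simp_all add: borel_rep_def)

lemma abs_lset_eq_iff: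
  assumes "A \<in> sets lebesgue" "B \<in> sets lebesgue"
  shows "abs_lset A = abs_lset B \<longleftrightarrow> null_eq A B"
  using Quotient3_rel[OF Quotient3_lset, of A B] assms by (simp add: null_eq_def)

lemma lset_integral_abs:
  fixes f :: "'a::euclidean_space \<Rightarrow> real"
  assumes B: "B \<in> sets borel" and f: "f \<in> borel_measurable borel"
  shows "lset_integral (abs_lset B) f = (\<integral>x. indicator B x * f x \<partial>lborel)"
proof -
  have "null_eq (rep_lset (abs_lset B)) B"
    using abs_lset_eq_iff[of "rep_lset (abs_lset B)" B] B rep_lset_lebesgue(1)[of "abs_lset B"]
        abs_rep_lset by auto
  then have "lset_integral (abs_lset B) f = (LINT x:B|lebesgue. f x)"
    unfolding lset_integral_def by (rule set_integral_null_eq)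
  also have "\<dots> = (\<integral>x. indicator B x * f x \<partial>lborel)"
    unfolding set_lebesgue_integral_def using B f by (subst integral_completion) (auto simp:
        measurable_lborel1)
  finally show ?thesis .
qed

lemma lset_integral_eq:
  "f \<in> borel_measurable borel \<Longrightarrow> lset_integral A f = (\<integral>x. indicator (borel_rep A) x * f x \<partial>lborel)"
  using lset_integral_abs[OF borel_rep, of f A] by (simp add: abs_borel_rep)

lemma bounded_borel_indicator_mult:
  assumes "bounded_borel f" "B \<in> sets borel"
  shows "bounded_borel (\<lambda>x. indicator B x * f x)"
  using bounded_borel_mult[OF assms(1), of "indicator B" 1] assms(2)
  by (simp add: mult.commute indicator_def)

lemma integrable_lset:
  "bounded_borel f \<Longrightarrow> integrable lborel (\<lambda>x. indicator (borel_rep A) x * f x)"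
  by (intro bounded_borel_integrable radon_lborel bounded_borel_indicator_mult borel_rep)

lemma lset_integral_add:
  assumes f: "bounded_borel f" and g: "bounded_borel g"
  shows "lset_integral A (\<lambda>x. f x + g x) = lset_integral A f + lset_integral A g"
  using integrable_lset[OF f, of A] integrable_lset[OF g, of A]
    bounded_borelD(1)[OF f] bounded_borelD(1)[OF g] bounded_borelD(1)[OF bounded_borel_add[OF f g]]
  by (simp add: lset_integral_eq distrib_left)

lemma lset_integral_cmult:
  assumes f: "bounded_borel f"
  shows "lset_integral A (\<lambda>x. c * f x) = c * lset_integral A f"
  using bounded_borelD(1)[OF f] bounded_borelD(1)[OF bounded_borel_cmult[OF f, of c]]
  by (simp add: lset_integral_eq mult.left_commute)

lemma lset_integral_diff:
  assumes f: "bounded_borel f" and g: "bounded_borel g"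
  shows "lset_integral A (\<lambda>x. f x - g x) = lset_integral A f - lset_integral A g"
  using lset_integral_add[OF f bounded_borel_cmult[OF g, of "-1"], of A] lset_integral_cmult[OF g,
      of A "-1"]
  by simp

lemma lset_integral_abs_le:
  assumes f: "bounded_borel f" and g: "bounded_borel g" and le: "\<And>x. \<bar>f x\<bar> \<le> g x"
  shows "\<bar>lset_integral A f\<bar> \<le> (\<integral>x. g x \<partial>lborel)"
proof -
  have "\<bar>lset_integral A f\<bar> \<le> (\<integral>x. \<bar>indicator (borel_rep A) x * f x\<bar> \<partial>lborel)"
    unfolding lset_integral_eq[OF bounded_borelD(1)[OF f]] by (rule integral_abs_bound)
  also have "\<dots> \<le> (\<integral>x. g x \<partial>lborel)"
    using le by (intro integral_mono integrable_abs integrable_lset f bounded_borel_integrable[OF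
        radon_lborel g])
      (auto simp: indicator_def intro: order_trans[OF abs_ge_zero])
  finally show ?thesis .
qed

section \<open>Difference quotients\<close>

lemma test_function_has_directional_derivative:
  assumes "test_function f"
  shows "((\<lambda>t. f (x - t *\<^sub>R b)) has_real_derivative - frechet_derivative f (at (x - t *\<^sub>R b)) b) (at t)"
proof -
  have "((\<lambda>t. x - t *\<^sub>R b) has_derivative (\<lambda>h. 0 - h *\<^sub>R b)) (at t)"
    by (intro has_derivative_diff has_derivative_const has_derivative_scaleR_left has_derivative_ident)
  from has_derivative_compose[OF this test_functionD(3)[OF assms]]
  have "((\<lambda>t. f (x - t *\<^sub>R b)) has_derivative (\<lambda>h. frechet_derivative f (at (x - t *\<^sub>R b)) (- (h *\<^sub>R
      b)))) (at t)" by simp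
  moreover have "frechet_derivative f (at y) (- (h *\<^sub>R b)) = - frechet_derivative f (at y) b * h"
      for y h
  proof -
    interpret linear "frechet_derivative f (at y)"
      using test_functionD(3)[OF assms] by (rule has_derivative_linear)
    show ?thesis by (simp add: neg scale)
  qed
  ultimately show ?thesis
    unfolding has_field_derivative_def by (elim has_derivative_eq_rhs) (simp add: fun_eq_iff)
qed

text \<open>The radius is fixed before e, so the remainder is o(h) uniformly and lives on one
  bounded set; it can then be integrated over any set.\<close>

lemma test_function_difference_quotient:
  fixes f :: "'a::euclidean_space \<Rightarrow> real"
  assumes f: "test_function f" and b: "b \<in> Basis"
  obtains r where "\<And>e. e > 0 \<Longrightarrow> \<exists>d>0. \<forall>h. \<bar>h\<bar> < d \<longrightarrow>
    (\<forall>x. \<bar>f (x - h *\<^sub>R b) - f x + h * frechet_derivative f (at x) b\<bar> \<le> e * \<bar>h\<bar> * indicator (cball 0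
        r) x)"
proof -
  let ?D = "\<lambda>x. frechet_derivative f (at x) b"
  have "bounded ({x. f x \<noteq> 0} \<union> {x. ?D x \<noteq> 0})"
    using test_functionD(2)[OF f] bounded_support_test_derivative[OF f b] by simp
  then obtain r where r: "\<And>x. f x \<noteq> 0 \<Longrightarrow> norm x \<le> r" "\<And>x. ?D x \<noteq> 0 \<Longrightarrow> norm x \<le> r"
    unfolding bounded_iff by blast
  show ?thesis
  \<comment> \<open>Shifts are kept below 1 and b has norm 1, so a shifted support stays within
    radius r + 1.\<close>
  proof (rule that[of "r + 1"])
    fix e :: real assume "e > 0"
    then obtain d where d: "d > 0" "\<And>x y. dist x y < d \<Longrightarrow> \<bar>?D x - ?D y\<bar> < e"
      using bounded_support_uniformly_continuous[OF continuous_test_derivative[OF f b]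
          bounded_support_test_derivative[OF f b]]
      by blast
    show "\<exists>d>0. \<forall>h. \<bar>h\<bar> < d \<longrightarrow> (\<forall>x. \<bar>f (x - h *\<^sub>R b) - f x + h * ?D x\<bar> \<le> e * \<bar>h\<bar> * indicator (cball 0
        (r + 1)) x)"
    proof (intro exI[of _ "min d 1"] conjI allI impI)
      show "min d 1 > 0" using d by simp
      fix h :: real and x :: 'a assume h: "\<bar>h\<bar> < min d 1"
      show "\<bar>f (x - h *\<^sub>R b) - f x + h * ?D x\<bar> \<le> e * \<bar>h\<bar> * indicator (cball 0 (r + 1)) x"
      proof (cases "x \<in> cball 0 (r + 1)")
        case True
        \<comment> \<open>The remainder as a function of the shift. Its derivative is a difference
          of two values of the partial derivative, which uniform continuity makes smaller than
          e.\<close>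
        define u where "u t = f (x - t *\<^sub>R b) + t * ?D x" for t
        have "norm (u h - u 0) \<le> e * norm (h - 0)"
        proof (rule field_differentiable_bound)
          show "convex {-\<bar>h\<bar>..\<bar>h\<bar>}" by simp
          fix t assume t: "t \<in> {-\<bar>h\<bar>..\<bar>h\<bar>}"
          show "(u has_real_derivative (- ?D (x - t *\<^sub>R b) + ?D x)) (at t within {-\<bar>h\<bar>..\<bar>h\<bar>})"
            unfolding u_def
            by (rule has_field_derivative_at_within)
               (auto intro!: derivative_eq_intros test_function_has_directional_derivative[OF f])
          have "dist x (x - t *\<^sub>R b) < d"
            using t h b by (auto simp: dist_norm)
          from d(2)[OF this] show "norm (- ?D (x - t *\<^sub>R b) + ?D x) \<le> e"
            by simp
        qed auto
        then show ?thesis using True by (simp add: u_def algebra_simps)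
      next
        case False
        have "norm (h *\<^sub>R b) \<le> 1" using h b by simp
        then have "norm (x - h *\<^sub>R b) > r" "norm x > r"
          using False norm_triangle_ineq2[of x "h *\<^sub>R b"] by auto
        then have "f (x - h *\<^sub>R b) = 0" "f x = 0" "?D x = 0"
          using r by (meson not_less)+
        then show ?thesis using \<open>e > 0\<close> by simp
      qed
    qed
  qed
qed

lemma bounded_borel_test_derivative:
  "test_function f \<Longrightarrow> b \<in> Basis \<Longrightarrow> bounded_borel (\<lambda>x. frechet_derivative f (at x) b)"
  by (intro bounded_borel_continuous continuous_test_derivative bounded_support_test_derivative)

text \<open>The remainder is estimated by the Lebesgue measure of a ball, whatever the set A
  is.\<close>

lemma lset_integral_difference_quotient:
  fixes f :: "'a::euclidean_space \<Rightarrow> real"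
  assumes f: "test_function f" and b: "b \<in> Basis" and e: "e > 0"
  shows "\<exists>d>0. \<forall>h A. \<bar>h\<bar> < d \<longrightarrow>
    \<bar>lset_integral A (\<lambda>x. f (x - h *\<^sub>R b) - f x) + h * lset_integral A (\<lambda>x. frechet_derivative f (at
        x) b)\<bar> \<le> e * \<bar>h\<bar>"
proof -
  obtain r where r: "\<And>e. e > 0 \<Longrightarrow> \<exists>d>0. \<forall>h. \<bar>h\<bar> < d \<longrightarrow>
    (\<forall>x. \<bar>f (x - h *\<^sub>R b) - f x + h * frechet_derivative f (at x) b\<bar> \<le> e * \<bar>h\<bar> * indicator (cball 0
        r) x)"
    using test_function_difference_quotient[OF f b] by blast
  let ?m = "measure lborel (cball (0::'a) r)"
  \<comment> \<open>The summand 1 keeps the denominator positive when the ball has measure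
    0.\<close>
  have e': "e / (?m + 1) > 0" using e by (simp add: add_nonneg_pos)
  obtain d where d: "d > 0" "\<And>h x. \<bar>h\<bar> < d \<Longrightarrow>
    \<bar>f (x - h *\<^sub>R b) - f x + h * frechet_derivative f (at x) b\<bar> \<le> e / (?m + 1) * \<bar>h\<bar> * indicator
        (cball 0 r) x"
    using r[OF e'] by blast
  show ?thesis
  proof (intro exI[of _ d] conjI allI impI d(1))
    fix h :: real and A :: "'a lset" assume h: "\<bar>h\<bar> < d"
    have bb: "bounded_borel (\<lambda>x. f (x - h *\<^sub>R b) - f x)"
      by (intro bounded_borel_diff bounded_borel_test f test_function_translate)
    have bd: "bounded_borel (\<lambda>x. h * frechet_derivative f (at x) b)"
      by (intro bounded_borel_cmult bounded_borel_test_derivative f b)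
    have bi: "bounded_borel (indicat_real (cball (0::'a) r))"
      by (intro bounded_borel_indicator) auto
    have "\<bar>lset_integral A (\<lambda>x. f (x - h *\<^sub>R b) - f x + h * frechet_derivative f (at x) b)\<bar> \<le>
      (\<integral>x. e / (?m + 1) * \<bar>h\<bar> * indicator (cball (0::'a) r) x \<partial>lborel)"
      by (rule lset_integral_abs_le[OF bounded_borel_add[OF bb bd] bounded_borel_cmult[OF bi]
          d(2)[OF h]])
    also have "\<dots> = e / (?m + 1) * \<bar>h\<bar> * ?m" by simp
    also have "\<dots> = e * \<bar>h\<bar> * (?m / (?m + 1))" by simp
    also have "\<dots> \<le> e * \<bar>h\<bar> * 1"
      using e by (intro mult_left_mono) (auto simp: divide_le_eq_1 intro: add_nonneg_pos)
    finally show "\<bar>lset_integral A (\<lambda>x. f (x - h *\<^sub>R b) - f x) + h * lset_integral A (\<lambda>x.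
        frechet_derivative f (at x) b)\<bar> \<le> e * \<bar>h\<bar>"
      by (simp add: lset_integral_add[OF bb bd] lset_integral_cmult[OF
          bounded_borel_test_derivative[OF f b]])
  qed
qed

text \<open>A shift by s + h is a shift by h of the function already shifted by s, so the estimate
  at 0 applies at every s.\<close>

lemma lset_integral_translate_has_derivative:
  fixes f :: "'a::euclidean_space \<Rightarrow> real"
  assumes f: "test_function f" and b: "b \<in> Basis"
  shows "((\<lambda>s. lset_integral A (\<lambda>x. f (x - s *\<^sub>R b))) has_real_derivative
    - lset_integral A (\<lambda>x. frechet_derivative (\<lambda>x. f (x - s *\<^sub>R b)) (at x) b)) (at s)"
proof -
  let ?g = "\<lambda>x. f (x - s *\<^sub>R b)"
  let ?D = "lset_integral A (\<lambda>x. frechet_derivative ?g (at x) b)"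
  have g: "test_function ?g" by (rule test_function_translate[OF f])
  show ?thesis
    unfolding DERIV_def LIM_eq
  proof (intro allI impI)
    fix e :: real assume "e > 0"
    then have e2: "e / 2 > 0" by simp
    obtain d where d: "d > 0" "\<And>h. \<bar>h\<bar> < d \<Longrightarrow> \<bar>lset_integral A (\<lambda>x. ?g (x - h *\<^sub>R b) - ?g x) + h *
        ?D\<bar> \<le> e / 2 * \<bar>h\<bar>"
      using lset_integral_difference_quotient[OF g b e2] by blast
    show "\<exists>d>0. \<forall>h. h \<noteq> 0 \<and> norm (h - 0) < d \<longrightarrow>
      norm ((lset_integral A (\<lambda>x. f (x - (s + h) *\<^sub>R b)) - lset_integral A ?g) / h - - ?D) < e"
    proof (intro exI[of _ d] conjI allI impI d(1))
      fix h :: real assume h: "h \<noteq> 0 \<and> norm (h - 0) < d"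
      have eq: "?g (x - h *\<^sub>R b) = f (x - (s + h) *\<^sub>R b)" for x
        by (simp add: algebra_simps)
      have "lset_integral A (\<lambda>x. ?g (x - h *\<^sub>R b) - ?g x) = lset_integral A (\<lambda>x. f (x - (s + h) *\<^sub>R
          b)) - lset_integral A ?g"
        unfolding eq by (intro lset_integral_diff bounded_borel_test test_function_translate f)
      then have "\<bar>lset_integral A (\<lambda>x. f (x - (s + h) *\<^sub>R b)) - lset_integral A ?g + h * ?D\<bar> \<le> e / 2
          * \<bar>h\<bar>"
        using d(2)[of h] h by simp
      then have "\<bar>(lset_integral A (\<lambda>x. f (x - (s + h) *\<^sub>R b)) - lset_integral A ?g + h * ?D) / h\<bar> \<le>
          e / 2"
        using h by (simp add: pos_divide_le_eq)
      then show "norm ((lset_integral A (\<lambda>x. f (x - (s + h) *\<^sub>R b)) - lset_integral A ?g) / h - -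
          ?D) < e"
        using h \<open>e > 0\<close> by (simp add: add_divide_distrib)
    qed
  qed
qed

text \<open>Mean value theorem in the shift parameter. The intermediate shift is unknown, so C has
  to bound the perimeter integrals of all shifts up to t.\<close>

lemma lset_integral_shift_le:
  fixes f :: "'a::euclidean_space \<Rightarrow> real"
  assumes A: "A \<in> FPloc" and f: "test_function f" and b: "b \<in> Basis" and t: "t > 0"
    and C: "\<And>s. 0 \<le> s \<Longrightarrow> s \<le> t \<Longrightarrow> (\<integral>x. \<bar>f (x - s *\<^sub>R b)\<bar> \<partial>perimeter_measure A) \<le> C"
  shows "\<bar>lset_integral A (\<lambda>x. f (x - t *\<^sub>R b)) - lset_integral A f\<bar> \<le> t * C"
proof -
  obtain s where s: "0 < s" "s < t" and
    eq: "lset_integral A (\<lambda>x. f (x - t *\<^sub>R b)) - lset_integral A (\<lambda>x. f (x - 0 *\<^sub>R b)) =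
      (t - 0) * - lset_integral A (\<lambda>x. frechet_derivative (\<lambda>x. f (x - s *\<^sub>R b)) (at x) b)"
    using MVT2[OF t lset_integral_translate_has_derivative[OF f b]] by blast
  have "\<bar>lset_integral A (\<lambda>x. f (x - t *\<^sub>R b)) - lset_integral A f\<bar> =
      t * \<bar>lset_integral A (\<lambda>x. frechet_derivative (\<lambda>x. f (x - s *\<^sub>R b)) (at x) b)\<bar>"
    using eq t by (simp add: abs_mult)
  also have "\<dots> \<le> t * C"
    using lset_integral_derivative_le[OF A b test_function_translate[OF f]] C[of s] s t
    by (intro mult_left_mono) (auto intro: order_trans)
  finally show ?thesis .
qed

section \<open>Moving a shift from the function to the set\<close>

lemma lborel_integral_translate:
  fixes f :: "'a::euclidean_space \<Rightarrow> real"
  assumes "f \<in> borel_measurable borel"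
  shows "(\<integral>x. f (x + c) \<partial>lborel) = (\<integral>x. f x \<partial>lborel)"
proof -
  have "(\<integral>x. f x \<partial>lborel) = (\<integral>x. f x \<partial>distr lborel borel ((+) c))"
    by (simp add: lborel_distr_plus)
  also have "\<dots> = (\<integral>x. f (c + x) \<partial>lborel)"
    using assms by (intro integral_distr) auto
  finally show ?thesis by (simp add: add.commute)
qed

definition set_shift_diff :: "'a::euclidean_space set \<Rightarrow> 'a \<Rightarrow> 'a \<Rightarrow> real" where
  "set_shift_diff B c x = indicator B (x + c) - indicator B x"

lemma set_shift_diff_measurable[measurable]: "B \<in> sets borel \<Longrightarrow> set_shift_diff B c \<in> borel_measurable
    borel"
proof -
  assume [measurable]: "B \<in> sets borel"
  have "(\<lambda>x. indicat_real B (x + c)) \<in> borel_measurable borel"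
    by (rule measurable_compose[of "\<lambda>x. x + c" borel borel]) auto
  then show ?thesis unfolding set_shift_diff_def by measurable
qed

lemma set_shift_diff_abs: "\<bar>set_shift_diff B c x\<bar> \<le> 1"
  by (simp add: set_shift_diff_def indicator_def)

lemma lset_integral_abs_shift_eq:
  assumes f: "bounded_borel f" and [measurable]: "B \<in> sets borel"
  shows "lset_integral (abs_lset B) (\<lambda>x. f (x - c)) - lset_integral (abs_lset B) f =
    (\<integral>x. f x * set_shift_diff B c x \<partial>lborel)"
proof -
  have m: "f \<in> borel_measurable borel" by (rule bounded_borelD[OF f])
  have m1: "(\<lambda>x. f (x - c)) \<in> borel_measurable borel"
    by (rule measurable_compose[of "\<lambda>x. x - c" borel borel]) (use m in auto)
  have m2: "(\<lambda>x. indicat_real B (x + c)) \<in> borel_measurable borel"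
    by (rule measurable_compose[of "\<lambda>x. x + c" borel borel]) auto
  have "(\<integral>x. indicator B x * f (x - c) \<partial>lborel) = (\<integral>x. indicator B (x + c) * f x \<partial>lborel)"
    using lborel_integral_translate[of "\<lambda>x. indicator B x * f (x - c)" c] m1 by simp
  moreover have "(\<integral>x. indicator B (x + c) * f x \<partial>lborel) - (\<integral>x. indicator B x * f x \<partial>lborel) =
      (\<integral>x. indicator B (x + c) * f x - indicator B x * f x \<partial>lborel)"
  proof (rule Bochner_Integration.integral_diff[symmetric])
    have "bounded_borel (\<lambda>x. f x * indicator B (x + c))"
      by (rule bounded_borel_mult[OF f m2, of 1]) (simp add: indicator_def)
    from bounded_borel_integrable[OF radon_lborel this]
    show "integrable lborel (\<lambda>x. indicator B (x + c) * f x)" by (simp add: mult.commute)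
  qed (use f in \<open>auto intro!: bounded_borel_integrable radon_lborel bounded_borel_indicator_mult\<close>)
  ultimately show ?thesis
    by (simp add: lset_integral_abs m m1 set_shift_diff_def algebra_simps)
qed

lemma lset_integral_shift_eq:
  "bounded_borel f \<Longrightarrow> lset_integral A (\<lambda>x. f (x - c)) - lset_integral A f =
    (\<integral>x. f x * set_shift_diff (borel_rep A) c x \<partial>lborel)"
  using lset_integral_abs_shift_eq[OF _ borel_rep, of f A c] by (simp only: abs_borel_rep)

text \<open>Testing with \<open>f\<close> times smooth approximations of the sign of the difference moves the absolute
  value inside the integral.\<close>

lemma integral_abs_shift_diff_le:
  fixes f :: "'a::euclidean_space \<Rightarrow> real"
  assumes A: "A \<in> FPloc" and f: "test_function f" and b: "b \<in> Basis" and t: "t > 0"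
    and C: "\<And>s. 0 \<le> s \<Longrightarrow> s \<le> t \<Longrightarrow> (\<integral>x. \<bar>f (x - s *\<^sub>R b)\<bar> \<partial>perimeter_measure A) \<le> C"
  shows "(\<integral>x. \<bar>f x\<bar> * \<bar>set_shift_diff (borel_rep A) (t *\<^sub>R b) x\<bar> \<partial>lborel) \<le> t * C"
proof (rule field_le_epsilon)
  fix e :: real assume "e > 0"
  let ?d = "set_shift_diff (borel_rep A) (t *\<^sub>R b)"
  obtain D where D: "D > 0" "\<And>x. \<bar>f x\<bar> \<le> D"
    using bounded_borel_bound[OF bounded_borel_test[OF f]] by blast
  have [measurable]: "f \<in> borel_measurable borel" by (rule bounded_borelD[OF bounded_borel_test[OF f]])
  define P where "P = {x. f x * ?d x > 0}"
  define N where "N = {x. f x * ?d x < 0}"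
  have PN: "P \<in> sets borel" "N \<in> sets borel"
    unfolding P_def N_def by measurable
  have bd: "bounded P" "bounded N"
    by (rule bounded_subset[OF test_functionD(2)[OF f]]; auto simp: P_def N_def)+
  have fin: "emeasure lborel P < \<infinity>" "emeasure lborel N < \<infinity>"
    using emeasure_bounded_finite[OF bd(1)] emeasure_bounded_finite[OF bd(2)] by simp_all
  \<comment> \<open>Two approximations, each multiplied by the bound D of |f|, together cost
    e.\<close>
  have e': "e / (2 * D) > 0" using D \<open>e > 0\<close> by simp
  obtain \<psi> where \<psi>: "test_function \<psi>" "\<And>x. 0 \<le> \<psi> x" "\<And>x. \<psi> x \<le> 1" "(\<integral>x. \<bar>\<psi> x - indicator P x\<bar>
      \<partial>lborel) < e / (2 * D)"
    using test_function_dense[OF radon_lborel PN(1) fin(1) e'] by blast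
  obtain \<eta> where \<eta>: "test_function \<eta>" "\<And>x. 0 \<le> \<eta> x" "\<And>x. \<eta> x \<le> 1" "(\<integral>x. \<bar>\<eta> x - indicator N x\<bar>
      \<partial>lborel) < e / (2 * D)"
    using test_function_dense[OF radon_lborel PN(2) fin(2) e'] by blast
  define g where "g x = f x * (\<psi> x - \<eta> x)" for x
  have g: "test_function g"
    unfolding g_def by (intro test_function_mult_smooth f Ck_diff test_function_smooth \<psi> \<eta>)
  \<comment> \<open>This makes C a bound for the perimeter integrals of the shifts of g as
    well.\<close>
  have gle: "\<bar>g x\<bar> \<le> \<bar>f x\<bar>" for x
  proof -
    have "\<bar>\<psi> x - \<eta> x\<bar> \<le> 1" using \<psi>(2,3)[of x] \<eta>(2,3)[of x] by linarith
    then show ?thesis using mult_left_mono[of "\<bar>\<psi> x - \<eta> x\<bar>" 1 "\<bar>f x\<bar>"] by (simp add: g_def abs_mult)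
  qed
  note tb = bounded_borel_test
  have "(\<integral>x. \<bar>g (x - s *\<^sub>R b)\<bar> \<partial>perimeter_measure A) \<le> C" if s: "0 \<le> s" "s \<le> t" for s
  proof (rule order_trans[OF integral_mono C[OF s]])
    show "integrable (perimeter_measure A) (\<lambda>x. \<bar>g (x - s *\<^sub>R b)\<bar>)" "integrable (perimeter_measure
        A) (\<lambda>x. \<bar>f (x - s *\<^sub>R b)\<bar>)"
      by (intro bounded_borel_integrable radon_perimeter_measure A bounded_borel_abs tb
          test_function_translate f g)+
  qed (rule gle)
  from lset_integral_shift_le[OF A g b t this]
  have le1: "\<bar>\<integral>x. g x * ?d x \<partial>lborel\<bar> \<le> t * C"
    by (simp add: lset_integral_shift_eq[OF tb[OF g]])
  have i1: "integrable lborel (\<lambda>x. \<bar>f x\<bar> * \<bar>?d x\<bar>)"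
    by (intro bounded_borel_integrable[OF radon_lborel] bounded_borel_mult[of _ _ 1]
        bounded_borel_abs tb f)
      (auto simp: set_shift_diff_abs)
  have i2: "integrable lborel (\<lambda>x. g x * ?d x)"
    by (intro bounded_borel_integrable[OF radon_lborel] bounded_borel_mult[of _ _ 1] tb g)
      (auto simp: set_shift_diff_abs)
  have i3: "integrable lborel (\<lambda>x. \<bar>\<psi> x - indicator P x\<bar>)" "integrable lborel (\<lambda>x. \<bar>\<eta> x - indicator
      N x\<bar>)"
    by (intro bounded_borel_integrable[OF radon_lborel] bounded_borel_abs bounded_borel_diff tb \<psi> \<eta>
        bounded_borel_indicator PN bd)+
  have pt: "\<bar>f x\<bar> * \<bar>?d x\<bar> - g x * ?d x \<le> D * \<bar>\<psi> x - indicator P x\<bar> + D * \<bar>\<eta> x - indicator N x\<bar>" for x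
  proof -
    have "\<bar>f x\<bar> * \<bar>?d x\<bar> = f x * ?d x * (indicator P x - indicator N x)"
      by (auto simp: P_def N_def indicator_def abs_mult[symmetric])
    then have "\<bar>f x\<bar> * \<bar>?d x\<bar> - g x * ?d x = f x * ?d x * ((indicator P x - \<psi> x) - (indicator N x -
        \<eta> x))"
      by (simp add: g_def algebra_simps)
    also have "\<dots> \<le> \<bar>f x * ?d x\<bar> * \<bar>(indicator P x - \<psi> x) - (indicator N x - \<eta> x)\<bar>"
      unfolding abs_mult[symmetric] by (rule abs_ge_self)
    also have "\<dots> \<le> D * (\<bar>\<psi> x - indicator P x\<bar> + \<bar>\<eta> x - indicator N x\<bar>)"
    proof (rule mult_mono)
      show "\<bar>f x * ?d x\<bar> \<le> D"
        using mult_mono[OF D(2)[of x] set_shift_diff_abs[of "borel_rep A" "t *\<^sub>R b" x]] D(1) by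
            (simp add: abs_mult)
    qed (use D(1) in auto)
    finally show ?thesis by (simp add: distrib_left)
  qed
  have "(\<integral>x. \<bar>f x\<bar> * \<bar>?d x\<bar> \<partial>lborel) - (\<integral>x. g x * ?d x \<partial>lborel) = (\<integral>x. \<bar>f x\<bar> * \<bar>?d x\<bar> - g x * ?d x
      \<partial>lborel)"
    by (rule Bochner_Integration.integral_diff[OF i1 i2, symmetric])
  also have "\<dots> \<le> (\<integral>x. D * \<bar>\<psi> x - indicator P x\<bar> + D * \<bar>\<eta> x - indicator N x\<bar> \<partial>lborel)"
    using i1 i2 i3 pt by (intro integral_mono) auto
  also have "\<dots> = D * (\<integral>x. \<bar>\<psi> x - indicator P x\<bar> \<partial>lborel) + D * (\<integral>x. \<bar>\<eta> x - indicator N x\<bar> \<partial>lborel)"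
    using i3 by simp
  also have "\<dots> \<le> D * (e / (2 * D)) + D * (e / (2 * D))"
    using D(1) \<psi>(4) \<eta>(4) by (intro add_mono mult_left_mono) auto
  also have "\<dots> = e" using D(1) by simp
  finally show "(\<integral>x. \<bar>f x\<bar> * \<bar>?d x\<bar> \<partial>lborel) \<le> t * C + e"
    using le1 by (simp add: abs_le_iff)
qed

section \<open>Countable unions\<close>

text \<open>Integrating over \<open>count_space S\<close> sums without an enumeration; in the
  application the atoms index themselves.\<close>

definition sum_measure :: "'i set \<Rightarrow> ('i \<Rightarrow> 'a::euclidean_space measure) \<Rightarrow> 'a measure" where
  "sum_measure S M = measure_of UNIV (sets borel) (\<lambda>E. \<integral>\<^sup>+i. emeasure (M i) E \<partial>count_space S)"

lemma sets_sum_measure: "sets (sum_measure S M) = sets borel"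
  unfolding sum_measure_def using sets.sigma_sets_eq[of borel] by (simp add: sets_measure_of)

lemma emeasure_sum_measure:
  fixes M :: "'i \<Rightarrow> 'a::euclidean_space measure"
  assumes M: "\<And>i. i \<in> S \<Longrightarrow> sets (M i) = sets borel" and "E \<in> sets borel"
  shows "emeasure (sum_measure S M) E = (\<integral>\<^sup>+i. emeasure (M i) E \<partial>count_space S)"
proof (rule emeasure_measure_of[OF sum_measure_def])
  show "countably_additive (sets (sum_measure S M)) (\<lambda>E. \<integral>\<^sup>+i. emeasure (M i) E \<partial>count_space S)"
    unfolding countably_additive_def sets_sum_measure
  proof (intro allI impI)
    fix E :: "nat \<Rightarrow> 'a set" assume E: "range E \<subseteq> sets borel" "disjoint_family E"
    have "(\<Sum>n. \<integral>\<^sup>+i. emeasure (M i) (E n) \<partial>count_space S) = (\<integral>\<^sup>+i. (\<Sum>n. emeasure (M i) (E n))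
        \<partial>count_space S)"
      by (rule nn_integral_suminf[symmetric]) simp
    also have "\<dots> = (\<integral>\<^sup>+i. emeasure (M i) (\<Union>n. E n) \<partial>count_space S)"
      using E M by (intro nn_integral_cong suminf_emeasure) auto
    finally show "(\<Sum>n. \<integral>\<^sup>+i. emeasure (M i) (E n) \<partial>count_space S) = (\<integral>\<^sup>+i. emeasure (M i) (\<Union>n. E n)
        \<partial>count_space S)" .
  qed
qed (use assms in \<open>auto simp: sets_sum_measure positive_def\<close>)

lemma nn_integral_sum_measure:
  assumes M: "\<And>i. i \<in> S \<Longrightarrow> sets (M i) = sets borel" and f: "f \<in> borel_measurable borel"
  shows "(\<integral>\<^sup>+x. f x \<partial>sum_measure S M) = (\<integral>\<^sup>+i. \<integral>\<^sup>+x. f x \<partial>M i \<partial>count_space S)"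
  using f
proof (induction rule: borel_measurable_induct)
  note m = measurable_cong_sets[OF sets_sum_measure refl] measurable_cong_sets[OF M refl]
  {
    case (cong f g)
    then show ?case by simp
  next
    case (set A)
    then show ?case
      using M by (auto simp: sets_sum_measure emeasure_sum_measure intro!: nn_integral_cong)
  next
    case (mult u v)
    then have "(\<integral>\<^sup>+i. \<integral>\<^sup>+x. v * u x \<partial>M i \<partial>count_space S) = (\<integral>\<^sup>+i. v * \<integral>\<^sup>+x. u x \<partial>M i \<partial>count_space S)"
      by (intro nn_integral_cong nn_integral_cmult) (auto simp: m)
    with mult show ?case by (simp add: nn_integral_cmult m)
  next
    case (add u v)
    then have "(\<integral>\<^sup>+i. \<integral>\<^sup>+x. v x + u x \<partial>M i \<partial>count_space S) = (\<integral>\<^sup>+i. (\<integral>\<^sup>+x. v x \<partial>M i) + (\<integral>\<^sup>+x. u x \<partial>M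
        i) \<partial>count_space S)"
      by (intro nn_integral_cong nn_integral_add) (auto simp: m)
    with add show ?case by (simp add: nn_integral_add m)
  next
    case (seq U)
    have "(\<integral>\<^sup>+i. \<integral>\<^sup>+x. (SUP n. U n x) \<partial>M i \<partial>count_space S) = (\<integral>\<^sup>+i. (SUP n. \<integral>\<^sup>+x. U n x \<partial>M i)
        \<partial>count_space S)"
      using seq by (intro nn_integral_cong nn_integral_monotone_convergence_SUP) (auto simp: m)
    also have "\<dots> = (SUP n. \<integral>\<^sup>+i. \<integral>\<^sup>+x. U n x \<partial>M i \<partial>count_space S)"
      using seq(3) by (intro nn_integral_monotone_convergence_SUP)
        (auto simp: incseq_def le_fun_def intro!: nn_integral_mono)
    finally show ?case
      using seq by (simp add: nn_integral_monotone_convergence_SUP m SUP_apply image_image)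
  }
qed

lemma countable_union_borel_rep:
  assumes "countable S"
  shows "countable_union S = abs_lset (\<Union>A\<in>S. borel_rep A)"
  by (rule countable_union_eq[OF assms]) (auto simp: abs_borel_rep)

text \<open>Uniform continuity, with a compact set fixed before e. For short shifts, the bound in
  the shift estimate can thereby be taken close to the integral of |f|.\<close>

lemma test_function_shift_bound:
  fixes f :: "'a::euclidean_space \<Rightarrow> real"
  assumes f: "test_function f" and b: "b \<in> Basis" 
  obtains K where "compact K" "\<And>e. e > 0 \<Longrightarrow>
    \<exists>d>0. \<forall>s x. \<bar>s\<bar> < d \<longrightarrow> \<bar>f (x - s *\<^sub>R b)\<bar> \<le> \<bar>f x\<bar> + e * indicator K x"
proof -
  obtain r where r: "\<And>x. f x \<noteq> 0 \<Longrightarrow> norm x \<le> r"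
    using test_functionD(2)[OF f] unfolding bounded_iff by blast
  show ?thesis
  proof (rule that[of "cball 0 (r + 1)"])
    fix e :: real assume "e > 0"
    then obtain d where d: "d > 0" "\<And>x y. dist x y < d \<Longrightarrow> \<bar>f x - f y\<bar> < e"
      using bounded_support_uniformly_continuous[OF test_functionD(1,2)[OF f]] by blast
    show "\<exists>d>0. \<forall>s x. \<bar>s\<bar> < d \<longrightarrow> \<bar>f (x - s *\<^sub>R b)\<bar> \<le> \<bar>f x\<bar> + e * indicator (cball 0 (r + 1)) x"
    proof (intro exI[of _ "min d 1"] conjI allI impI)
      show "min d 1 > 0" using d by simp
      fix s :: real and x assume s: "\<bar>s\<bar> < min d 1"
      show "\<bar>f (x - s *\<^sub>R b)\<bar> \<le> \<bar>f x\<bar> + e * indicator (cball 0 (r + 1)) x"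
      proof (cases "x \<in> cball 0 (r + 1)")
        case True
        have "dist (x - s *\<^sub>R b) x < d" using s b by (simp add: dist_norm)
        from d(2)[OF this] True show ?thesis by simp
      next
        case False
        have "norm (s *\<^sub>R b) \<le> 1" using s b by simp
        then have "norm (x - s *\<^sub>R b) > r"
          using False norm_triangle_ineq2[of x "s *\<^sub>R b"] by auto
        then have "f (x - s *\<^sub>R b) = 0"
          using r by (meson not_less)
        then show ?thesis using \<open>e > 0\<close> by simp
      qed
    qed
  qed simp
qed

section \<open>The derivative of a countable union\<close>

context
  fixes S :: "'a::euclidean_space lset set" and m :: "'a measure"
  assumes S: "countable S" "S \<subseteq> FPloc"
    and m_def: "m = sum_measure S perimeter_measure" and m: "radon_measure m"
begin

text \<open>If the union separates x from x + t b, then some member of S does so too. Hence the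
  integrand for the union is at most the sum of the integrands for the members, and each of these is
  controlled by its own perimeter measure.\<close>

lemma countable_union_shift_le:
  assumes f: "test_function f" and b: "b \<in> Basis" and t: "t > 0"
    and g: "bounded_borel g" "\<And>s x. 0 \<le> s \<Longrightarrow> s \<le> t \<Longrightarrow> \<bar>f (x - s *\<^sub>R b)\<bar> \<le> g x"
  shows "\<bar>lset_integral (countable_union S) (\<lambda>x. f (x - t *\<^sub>R b)) - lset_integral (countable_union
      S) f\<bar> \<le> t * (\<integral>x. g x \<partial>m)"
proof -
  let ?U = "\<Union>A\<in>S. borel_rep A" and ?c = "t *\<^sub>R b"
  have [measurable]: "f \<in> borel_measurable borel" by (rule bounded_borelD[OF bounded_borel_test[OF f]])
  have [measurable]: "?U \<in> sets borel" using S by (intro sets.countable_UN') auto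
  have g0: "g x \<ge> 0" for x using g(2)[of 0 x] t by auto
  have gm: "(\<lambda>x. ennreal (g x)) \<in> borel_measurable borel" using bounded_borelD(1)[OF g(1)] by simp
  have sp: "sets (perimeter_measure A) = sets borel" if "A \<in> S" for A
    using radon_perimeter_measure[of A] that S(2) by (auto simp: radon_measureD)
  have le: "(\<integral>\<^sup>+x. \<bar>f x\<bar> * \<bar>set_shift_diff (borel_rep A) ?c x\<bar> \<partial>lborel) \<le> ennreal t * (\<integral>\<^sup>+x. g x
      \<partial>perimeter_measure A)"
    if A: "A \<in> S" for A
  proof -
    have AF: "A \<in> FPloc" using A S by blast
    note V = radon_perimeter_measure[OF AF]
    have ig: "integrable (perimeter_measure A) g" by (rule bounded_borel_integrable[OF V g(1)])
    have "(\<integral>x. \<bar>f x\<bar> * \<bar>set_shift_diff (borel_rep A) ?c x\<bar> \<partial>lborel) \<le> t * (\<integral>x. g x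
        \<partial>perimeter_measure A)"
    proof (rule integral_abs_shift_diff_le[OF AF f b t])
      fix s assume s: "0 \<le> s" "s \<le> t"
      have "integrable (perimeter_measure A) (\<lambda>x. \<bar>f (x - s *\<^sub>R b)\<bar>)"
        by (intro bounded_borel_integrable[OF V] bounded_borel_abs bounded_borel_test
            test_function_translate f)
      then show "(\<integral>x. \<bar>f (x - s *\<^sub>R b)\<bar> \<partial>perimeter_measure A) \<le> (\<integral>x. g x \<partial>perimeter_measure A)"
        using ig g(2)[OF s] by (rule integral_mono)
    qed
    moreover have "integrable lborel (\<lambda>x. \<bar>f x\<bar> * \<bar>set_shift_diff (borel_rep A) ?c x\<bar>)"
      by (intro bounded_borel_integrable[OF radon_lborel] bounded_borel_mult[of _ _ 1]
          bounded_borel_abs bounded_borel_test f)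
        (auto simp: set_shift_diff_abs)
    ultimately show ?thesis
      using g0 t ig by (simp add: nn_integral_eq_integral ennreal_leI flip: ennreal_mult)
  qed
  have "ennreal \<bar>\<integral>x. f x * set_shift_diff ?U ?c x \<partial>lborel\<bar> \<le> ennreal (\<integral>x. \<bar>f x * set_shift_diff ?U
      ?c x\<bar> \<partial>lborel)"
    by (intro ennreal_leI integral_abs_bound)
  also have "\<dots> = (\<integral>\<^sup>+x. \<bar>f x * set_shift_diff ?U ?c x\<bar> \<partial>lborel)"
    by (intro nn_integral_eq_integral[symmetric] integrable_abs bounded_borel_integrable[OF
        radon_lborel]
        bounded_borel_mult[of _ _ 1] bounded_borel_test f) (auto simp: set_shift_diff_abs)
  also have "\<dots> \<le> (\<integral>\<^sup>+x. \<integral>\<^sup>+A. \<bar>f x\<bar> * \<bar>set_shift_diff (borel_rep A) ?c x\<bar> \<partial>count_space S \<partial>lborel)"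
  proof (rule nn_integral_mono)
    fix x
    show "ennreal \<bar>f x * set_shift_diff ?U ?c x\<bar> \<le> (\<integral>\<^sup>+A. \<bar>f x\<bar> * \<bar>set_shift_diff (borel_rep A) ?c
        x\<bar> \<partial>count_space S)"
    proof (cases "set_shift_diff ?U ?c x = 0")
      case False
      have "(x + ?c \<in> ?U) \<noteq> (x \<in> ?U)"
      proof
        assume "(x + ?c \<in> ?U) = (x \<in> ?U)"
        then have "indicator ?U (x + ?c) = (indicator ?U x :: real)"
          by (simp only: indicator_def)
        with False show False by (simp only: set_shift_diff_def diff_self)
      qed
      then obtain A where A: "A \<in> S" "(x + ?c \<in> borel_rep A) \<noteq> (x \<in> borel_rep A)"
        by blast
      then have A1: "\<bar>set_shift_diff (borel_rep A) ?c x\<bar> = 1"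
        by (cases "x \<in> borel_rep A") (auto simp: set_shift_diff_def)
      have "ennreal \<bar>f x * set_shift_diff ?U ?c x\<bar> \<le> ennreal (\<bar>f x\<bar> * \<bar>set_shift_diff (borel_rep A)
          ?c x\<bar>)"
        unfolding abs_mult A1 by (intro ennreal_leI mult_left_mono set_shift_diff_abs) auto
      also have "\<dots> \<le> (\<integral>\<^sup>+A. \<bar>f x\<bar> * \<bar>set_shift_diff (borel_rep A) ?c x\<bar> \<partial>count_space S)"
        by (rule nn_integral_ge_point[OF A(1)])
      finally show ?thesis .
    qed simp
  qed
  also have "\<dots> = (\<integral>\<^sup>+A. \<integral>\<^sup>+x. \<bar>f x\<bar> * \<bar>set_shift_diff (borel_rep A) ?c x\<bar> \<partial>lborel \<partial>count_space S)"
    by (rule nn_integral_count_space_nn_integral[OF S(1)]) simp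
  also have "\<dots> \<le> (\<integral>\<^sup>+A. ennreal t * (\<integral>\<^sup>+x. g x \<partial>perimeter_measure A) \<partial>count_space S)"
    by (intro nn_integral_mono) (simp add: le)
  also have "\<dots> = ennreal t * (\<integral>\<^sup>+x. g x \<partial>m)"
    by (simp add: nn_integral_cmult m_def nn_integral_sum_measure[OF sp gm])
  also have "\<dots> = ennreal (t * (\<integral>x. g x \<partial>m))"
    using bounded_borel_integrable[OF m g(1)] g0 t by (simp add: nn_integral_eq_integral ennreal_mult)
  finally have "\<bar>\<integral>x. f x * set_shift_diff ?U ?c x \<partial>lborel\<bar> \<le> t * (\<integral>x. g x \<partial>m)"
    using t g0 by (subst (asm) ennreal_le_iff) auto
  then show ?thesis
    unfolding countable_union_borel_rep[OF S(1)]
    by (subst lset_integral_abs_shift_eq) (auto intro: bounded_borel_test f)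
qed

text \<open>For a short shift t the common majorant |f| + e 1_K dominates all shifted functions.
  Dividing the shift estimate by t leaves the derivative, up to an error proportional to e.\<close>

lemma countable_union_derivative_le:
  assumes f: "test_function f" and b: "b \<in> Basis"
  shows "\<bar>lset_integral (countable_union S) (\<lambda>x. frechet_derivative f (at x) b)\<bar> \<le> (\<integral>x. \<bar>f x\<bar> \<partial>m)"
proof -
  let ?X = "countable_union S"
  obtain K where K: "compact K" "\<And>e. e > 0 \<Longrightarrow>
    \<exists>d>0. \<forall>s x. \<bar>s\<bar> < d \<longrightarrow> \<bar>f (x - s *\<^sub>R b)\<bar> \<le> \<bar>f x\<bar> + e * indicator K x"
    using test_function_shift_bound[OF f b] by blast
  have bK: "bounded_borel (indicat_real K)"
    using K(1) by (intro bounded_borel_indicator) (auto intro: borel_compact compact_imp_bounded)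
  have *: "\<bar>lset_integral ?X (\<lambda>x. frechet_derivative f (at x) b)\<bar> \<le> (\<integral>x. \<bar>f x\<bar> \<partial>m) + e * (measure m
      K + 1)"
    if e: "e > 0" for e
  proof -
    obtain d1 where d1: "d1 > 0" "\<And>s x. \<bar>s\<bar> < d1 \<Longrightarrow> \<bar>f (x - s *\<^sub>R b)\<bar> \<le> \<bar>f x\<bar> + e * indicator K x"
      using K(2)[OF e] by blast
    obtain d2 where d2: "d2 > 0" "\<And>h. \<bar>h\<bar> < d2 \<Longrightarrow>
      \<bar>lset_integral ?X (\<lambda>x. f (x - h *\<^sub>R b) - f x) + h * lset_integral ?X (\<lambda>x. frechet_derivative f
          (at x) b)\<bar> \<le> e * \<bar>h\<bar>"
      using lset_integral_difference_quotient[OF f b e] by blast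
    define t where "t = min d1 d2 / 2"
    have t: "t > 0" "t < d1" "t < d2" using d1 d2 by (auto simp: t_def)
    have g: "bounded_borel (\<lambda>x. \<bar>f x\<bar> + e * indicator K x)"
      by (intro bounded_borel_add bounded_borel_abs bounded_borel_test f bounded_borel_cmult bK)
    have "\<bar>lset_integral ?X (\<lambda>x. f (x - t *\<^sub>R b)) - lset_integral ?X f\<bar> \<le> t * (\<integral>x. \<bar>f x\<bar> + e *
        indicator K x \<partial>m)"
      using t by (intro countable_union_shift_le f b g d1(2)) auto
    also have "(\<integral>x. \<bar>f x\<bar> + e * indicator K x \<partial>m) = (\<integral>x. \<bar>f x\<bar> \<partial>m) + e * measure m K"
    proof (subst Bochner_Integration.integral_add)
      show "integrable m (\<lambda>x. \<bar>f x\<bar>)" "integrable m (\<lambda>x. e * indicator K x)"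
        by (intro bounded_borel_integrable[OF m] bounded_borel_abs bounded_borel_test f
            bounded_borel_cmult bK)+
    qed (use radon_measureD[OF m] in simp)
    finally have "\<bar>lset_integral ?X (\<lambda>x. f (x - t *\<^sub>R b)) - lset_integral ?X f\<bar> \<le> t * ((\<integral>x. \<bar>f x\<bar>
        \<partial>m) + e * measure m K)" .
    moreover have "lset_integral ?X (\<lambda>x. f (x - t *\<^sub>R b) - f x) = lset_integral ?X (\<lambda>x. f (x - t *\<^sub>R
        b)) - lset_integral ?X f"
      by (intro lset_integral_diff bounded_borel_test test_function_translate f)
    ultimately have "\<bar>t * lset_integral ?X (\<lambda>x. frechet_derivative f (at x) b)\<bar> \<le> t * ((\<integral>x. \<bar>f x\<bar>
        \<partial>m) + e * measure m K) + e * t"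
      using d2(2)[of t] t abs_triangle_ineq4[of "lset_integral ?X (\<lambda>x. f (x - t *\<^sub>R b) - f x) + t *
          lset_integral ?X (\<lambda>x. frechet_derivative f (at x) b)"
          "lset_integral ?X (\<lambda>x. f (x - t *\<^sub>R b) - f x)"] by simp
    then have "t * \<bar>lset_integral ?X (\<lambda>x. frechet_derivative f (at x) b)\<bar> \<le> t * ((\<integral>x. \<bar>f x\<bar> \<partial>m) + e
        * (measure m K + 1))"
      using t by (simp add: abs_mult algebra_simps)
    then show ?thesis using t by simp
  qed
  show ?thesis
  proof (rule field_le_epsilon)
    fix e :: real assume "e > 0"
    have p: "measure m K + 1 > 0" by (simp add: add_nonneg_pos)
    with \<open>e > 0\<close> *[of "e / (measure m K + 1)"] show "\<bar>lset_integral ?X (\<lambda>x. frechet_derivative f (at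
        x) b)\<bar> \<le> (\<integral>x. \<bar>f x\<bar> \<partial>m) + e"
      by simp
  qed
qed

lemma frechet_derivative_test_add:
  assumes "test_function f" "test_function g"
  shows "frechet_derivative (\<lambda>x. f x + g x) (at x) b = frechet_derivative f (at x) b +
      frechet_derivative g (at x) b"
  using frechet_derivative_at[OF has_derivative_add[OF test_functionD(3)[OF assms(1)]
      test_functionD(3)[OF assms(2)]], symmetric]
  by (simp add: fun_eq_iff)

lemma frechet_derivative_test_cmult:
  assumes "test_function f"
  shows "frechet_derivative (\<lambda>x. c * f x) (at x) b = c * frechet_derivative f (at x) b"
  using frechet_derivative_at[OF has_derivative_mult_right[OF test_functionD(3)[OF assms]], symmetric]
  by (simp add: fun_eq_iff)

text \<open>Each coordinate functional is dominated by m and therefore is a difference of two Radon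
  measures; these are assembled along the basis into one vector measure.\<close>

lemma countable_union_in_FPloc: "countable_union S \<in> FPloc"
proof -
  let ?X = "countable_union S"
  let ?T = "\<lambda>b f. - lset_integral ?X (\<lambda>x. frechet_derivative f (at x) b)"
  have "dominated_functional m (?T b)" if b: "b \<in> Basis" for b
  proof
    fix f g :: "'a \<Rightarrow> real" and c :: real
    assume f: "test_function f"
    show "?T b (\<lambda>x. c * f x) = c * ?T b f"
      by (simp add: frechet_derivative_test_cmult f lset_integral_cmult[OF
          bounded_borel_test_derivative[OF f b]])
    show "\<bar>?T b f\<bar> \<le> (\<integral>x. \<bar>f x\<bar> \<partial>m)"
      using countable_union_derivative_le[OF f b] by simp
    assume g: "test_function g"
    show "?T b (\<lambda>x. f x + g x) = ?T b f + ?T b g"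
      by (simp add: frechet_derivative_test_add f g lset_integral_add[OF
          bounded_borel_test_derivative[OF f b] bounded_borel_test_derivative[OF g b]])
  qed (rule m)
  then have "\<exists>P N. radon_measure P \<and> radon_measure N \<and> (\<forall>f. test_function f \<longrightarrow> ?T b f = (\<integral>x. f x \<partial>P)
      - (\<integral>x. f x \<partial>N))"
    if "b \<in> Basis" for b
    using dominated_functional_representation[of m "?T b"] that by metis
  then obtain P N where PN: "\<And>b. b \<in> Basis \<Longrightarrow> radon_measure (P b)" "\<And>b. b \<in> Basis \<Longrightarrow> radon_measure (N b)"
    "\<And>b f. b \<in> Basis \<Longrightarrow> test_function f \<Longrightarrow> ?T b f = (\<integral>x. f x \<partial>P b) - (\<integral>x. f x \<partial>N b)"
    by metis
  define \<mu> where "\<mu> E = (\<Sum>b\<in>Basis. (measure (P b) E - measure (N b) E) *\<^sub>R b)" for E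
  have \<mu>b: "\<mu> E \<bullet> b = measure (P b) E - measure (N b) E" if "b \<in> Basis" for E b
    using that by (simp add: \<mu>_def)
  have "vector_radon_measure \<mu>"
    unfolding vector_radon_measure_def
  proof (intro allI impI)
    fix E :: "nat \<Rightarrow> 'a set" assume E: "range E \<subseteq> sets borel" "disjoint_family E" "bounded (\<Union>n. E n)"
    have *: "(\<lambda>n. measure M (E n)) sums measure M (\<Union>n. E n)" if "radon_measure M" for M :: "'a measure"
      using E radon_emeasure_bounded[OF that E(3)] that by (intro measure_UNION) (auto simp:
          radon_measureD)
    show "(\<lambda>n. \<mu> (E n)) sums \<mu> (\<Union>n. E n)"
      unfolding \<mu>_def by (intro sums_sum sums_scaleR_left sums_diff *[OF PN(1)] *[OF PN(2)])
  qed
  moreover have "has_signed_integral (\<lambda>E. \<mu> E \<bullet> b) f (?T b f)" if "b \<in> Basis" "test_function f" for b f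
    unfolding has_signed_integral_def using PN \<mu>b that by (intro exI[of _ "P b"] exI[of _ "N b"]) auto
  ultimately have "is_derivative ?X \<mu>"
    by (simp add: is_derivative_iff)
  then show ?thesis by (auto simp: FPloc_def)
qed

end

text \<open>Without perimeter, integrals over A do not change under shifts. A bump can be shifted N
  times with disjoint supports, so N times its integral is at most the volume of A for every N, and
  the integral is 0. Bumps approximate boxes, and boxes exhaust the space.\<close>

lemma perimeter_measure_zero_imp_empty:
  fixes A :: "'a::euclidean_space lset"
  assumes A: "A \<in> FPloc" and fin: "finite_volume A" and zero: "\<And>n::nat. emeasure (perimeter_measure
      A) (cball 0 (real n)) = 0"
  shows "A = abs_lset {}"
proof -
  let ?B = "borel_rep A" and ?V = "perimeter_measure A"
  note V = radon_perimeter_measure[OF A]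
  have "emeasure ?V UNIV = 0"
    using LIMSEQ_unique[OF Lim_emeasure_Int_cball[OF radon_measureD(1)[OF V], of UNIV]] zero by simp
  then have V0: "(\<integral>x. f x \<partial>?V) = 0" for f :: "'a \<Rightarrow> real"
    using radon_measureD[OF V] by (intro integral_eq_zero_AE AE_I'[of UNIV]) (auto simp: null_sets_def)
  obtain b :: 'a where b: "b \<in> Basis" using nonempty_Basis by blast
  have inv: "lset_integral A (\<lambda>x. f (x - t *\<^sub>R b)) = lset_integral A f" if f: "test_function f" and
      "t \<ge> 0" for f t
    using lset_integral_shift_le[OF A f b, of t 0] V0 \<open>t \<ge> 0\<close> by (cases "t = 0") auto
  have iB: "integrable lborel (indicat_real ?B)"
  proof -
    have "finite_volume (abs_lset ?B)" using fin by (simp add: abs_borel_rep)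
    then have "integrable lebesgue (indicat_real ?B)"
      using finite_volume.abs_eq[of ?B] by (simp add: null_eq_def)
    then show ?thesis by (simp add: integrable_completion)
  qed
  have box0: "emeasure lborel (?B \<inter> box (- (real n *\<^sub>R One)) (real n *\<^sub>R One)) = 0" for n
  proof -
    let ?l = "- (real n *\<^sub>R One) :: 'a" and ?u = "real n *\<^sub>R One :: 'a"
    have zero: "lset_integral A (box_bump ?l ?u k) = 0" for k
    proof -
      let ?f = "box_bump ?l ?u k"
      \<comment> \<open>The step 2 n is the side length of the box, so different shifts have
        disjoint supports.\<close>
      let ?f' = "\<lambda>j x. ?f (x - real j *\<^sub>R (2 * real n) *\<^sub>R b)"
      have f: "test_function ?f" by (rule test_function_box_bump)
      have f': "test_function (?f' j)" for j by (rule test_function_translate[OF f])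
      have nn: "0 \<le> lset_integral A ?f"
        unfolding lset_integral_eq[OF bounded_borelD(1)[OF bounded_borel_test[OF f]]]
        by (intro Bochner_Integration.integral_nonneg) (simp add: box_bump_range)
      have sum_le: "(\<Sum>j<N. ?f' j x) \<le> 1" for N x
      proof (cases "\<exists>j<N. ?f' j x \<noteq> 0")
        case True
        then obtain j where j: "j < N" "?f' j x \<noteq> 0" by blast
        have "?f' i x = 0" if "i \<noteq> j" for i
        proof (rule ccontr)
          assume i: "?f' i x \<noteq> 0"
          have in_box: "\<bar>x \<bullet> b - real k * (2 * real n)\<bar> < real n" if "?f' k x \<noteq> 0" for k
          proof -
            have "x - real k *\<^sub>R (2 * real n) *\<^sub>R b \<in> box ?l ?u"
              using that box_bump_eq_0 by blast
            then have "- real n < (x - real k *\<^sub>R (2 * real n) *\<^sub>R b) \<bullet> b" "(x - real k *\<^sub>R (2 *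
                real n) *\<^sub>R b) \<bullet> b < real n"
              using b by (auto simp: mem_box)
            then show ?thesis using b by (simp add: inner_diff_left abs_less_iff)
          qed
          have "\<bar>(real i - real j) * (2 * real n)\<bar> < 2 * real n"
            using in_box[OF i] in_box[OF j(2)] by (simp add: left_diff_distrib abs_less_iff)
          moreover have "1 \<le> \<bar>real i - real j\<bar>" using that by linarith
          then have "1 * (2 * real n) \<le> \<bar>real i - real j\<bar> * (2 * real n)" by (intro mult_right_mono)
              auto
          ultimately show False by (simp add: abs_mult)
        qed
        then have "(\<Sum>i<N. ?f' i x) = (\<Sum>i<N. if i = j then ?f' j x else 0)"
          by (intro sum.cong) auto
        also have "\<dots> \<le> 1" using j box_bump_range(2) by simp
        finally show ?thesis .
      qed (auto simp: sum.neutral)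
      have "real N * lset_integral A ?f \<le> measure lborel ?B" for N
      proof -
        have "real N * lset_integral A ?f = (\<Sum>j<N. lset_integral A (?f' j))"
          using inv[OF f, of "real _ * (2 * real n)"] by simp
        also have "\<dots> = (\<integral>x. (\<Sum>j<N. indicator ?B x * ?f' j x) \<partial>lborel)"
          unfolding lset_integral_eq[OF bounded_borelD(1)[OF bounded_borel_test[OF f']]]
          by (rule Bochner_Integration.integral_sum[symmetric]) (rule integrable_lset[OF
              bounded_borel_test[OF f']])
        also have "\<dots> \<le> (\<integral>x. indicator ?B x \<partial>lborel)"
        proof (rule integral_mono)
          show "integrable lborel (\<lambda>x. \<Sum>j<N. indicator ?B x * ?f' j x)"
            by (intro Bochner_Integration.integrable_sum integrable_lset[OF bounded_borel_test[OF f']])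
          show "(\<Sum>j<N. indicator ?B x * ?f' j x) \<le> indicator ?B x" for x
            unfolding sum_distrib_left[symmetric] using sum_le[of x N] by (auto simp: indicator_def)
        qed (rule iB)
        finally show ?thesis by simp
      qed
      then have "lset_integral A ?f \<le> 0"
        using reals_Archimedean3[of "lset_integral A ?f"] by (meson not_le)
      with nn show ?thesis by simp
    qed
    have "(\<lambda>k. lset_integral A (box_bump ?l ?u k)) \<longlonglongrightarrow> (\<integral>x. indicat_real ?B x * indicator (box ?l ?u)
        x \<partial>lborel)"
      unfolding lset_integral_eq[OF bounded_borelD(1)[OF bounded_borel_test[OF test_function_box_bump]]]
    proof (rule integral_dominated_convergence[OF _ _ iB])
      show "AE x in lborel. (\<lambda>k. indicator ?B x * box_bump ?l ?u k x) \<longlonglongrightarrow> indicat_real ?B x *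
          indicator (box ?l ?u) x"
        by (intro AE_I2 tendsto_intros box_bump_tendsto)
      show "(\<lambda>x. indicator ?B x * box_bump ?l ?u k x) \<in> borel_measurable lborel" for k
        using bounded_borelD(1)[OF bounded_borel_indicator_mult[OF bounded_borel_test[OF
            test_function_box_bump] borel_rep]]
        by simp
      show "AE x in lborel. norm (indicator ?B x * box_bump ?l ?u k x) \<le> indicator ?B x" for k
        using box_bump_range[of ?l ?u k] by (intro AE_I2) (auto simp: indicator_def)
    qed auto
    then have "(\<integral>x. indicat_real ?B x * indicator (box ?l ?u) x \<partial>lborel) = 0"
      by (simp add: zero LIMSEQ_const_iff)
    then have "measure lborel (?B \<inter> box ?l ?u) = 0"
      by (simp add: indicator_inter_arith[symmetric])
    moreover have "emeasure lborel (?B \<inter> box ?l ?u) < \<infinity>"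
      by (intro emeasure_bounded_finite) (simp add: bounded_Int)
    ultimately show ?thesis
      by (simp add: emeasure_eq_ennreal_measure less_top)
  qed
  have "?B = (\<Union>n. ?B \<inter> box (- (real n *\<^sub>R One)) (real n *\<^sub>R One))"
    using UN_box_eq_UNIV by blast
  moreover have "(\<Union>n. ?B \<inter> box (- (real n *\<^sub>R One)) (real n *\<^sub>R One)) \<in> null_sets lborel"
    using box0 by (intro null_sets_UN) auto
  ultimately have "?B \<in> null_sets lborel" by simp
  then have "null_eq ?B {}"
    by (auto simp: null_eq_def intro: null_sets_completionI)
  then have "abs_lset ?B = abs_lset {}"
    by (rule Quotient3_rel_abs[OF Quotient3_lset])
  then show ?thesis by (simp add: abs_borel_rep)
qed

section \<open>Measurable dependence on the set\<close>

text \<open>A Dynkin argument on the intersection-stable boxes. Everything is intersected with one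
  large box, which turns complements into differences of bounded sets.\<close>

lemma bounded_borel_induct[consumes 2, case_names box diff union]:
  fixes P :: "'a::euclidean_space set \<Rightarrow> bool"
  assumes E: "E \<in> sets borel" "bounded E"
    and box: "\<And>l u. P (box l u)"
    and diff: "\<And>A B. A \<in> sets borel \<Longrightarrow> B \<in> sets borel \<Longrightarrow> B \<subseteq> A \<Longrightarrow> bounded A \<Longrightarrow> P A \<Longrightarrow> P B \<Longrightarrow> P (A - B)"
    and union: "\<And>A. (\<And>n::nat. A n \<in> sets borel) \<Longrightarrow> disjoint_family A \<Longrightarrow> bounded (\<Union>n. A n) \<Longrightarrow> (\<And>n. P (A
        n)) \<Longrightarrow> P (\<Union>n. A n)"
  shows "P E"
proof -
  obtain a where a: "E \<subseteq> box (-a) a"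
    using bounded_subset_box_symmetric[OF E(2)] by blast
  let ?B = "box (-a) a"
  let ?G = "range (\<lambda>(a, b). box a b :: 'a set)"
  have G: "sigma_sets UNIV ?G = sets borel" unfolding borel_eq_box by simp
  have "Int_stable ?G"
    unfolding Int_stable_def by (auto simp: box_Int_box)
  moreover have "?G \<subseteq> Pow UNIV" by simp
  moreover have "E \<in> sigma_sets UNIV ?G" using E(1) unfolding G .
  ultimately have "P (E \<inter> ?B)"
  proof (induction rule: sigma_sets_induct_disjoint)
    case (basic A)
    then obtain l u where "A = box l u" by auto
    then show ?case using box by (simp only: box_Int_box)
  next
    case empty
    then show ?case using box[of 0 0] by simp
  next
    case (compl A)
    have "(UNIV - A) \<inter> ?B = ?B - (A \<inter> ?B)" by blast
    moreover have "P (?B - (A \<inter> ?B))"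
      using compl G by (intro diff box) auto
    ultimately show ?case by (simp only:)
  next
    case (union A)
    have "P (\<Union>i. A i \<inter> ?B)"
    proof (rule assms(5))
      show "A i \<inter> ?B \<in> sets borel" for i using union(2) G by auto
      show "disjoint_family (\<lambda>i. A i \<inter> ?B)" using union(1) unfolding disjoint_family_on_def by blast
      show "bounded (\<Union>i. A i \<inter> ?B)" by (rule bounded_subset[of ?B]) auto
    qed (rule union(3))
    then show ?case by (simp only: UN_simps)
  qed
  then show ?thesis using a by (simp add: Int_absorb2)
qed

lemma box_bump_integral_tendsto:
  assumes M: "radon_measure M"
  shows "(\<lambda>n. \<integral>x. box_bump l u n x \<partial>M) \<longlonglongrightarrow> measure M (box l u)"
proof -
  have "(\<lambda>n. \<integral>x. box_bump l u n x \<partial>M) \<longlonglongrightarrow> (\<integral>x. indicator (box l u) x \<partial>M)"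
  proof (rule integral_dominated_convergence)
    show "integrable M (indicat_real (box l u))"
      using M by (intro bounded_borel_integrable bounded_borel_indicator) auto
    show "box_bump l u n \<in> borel_measurable M" for n
      using borel_measurable_integrable[OF bounded_borel_integrable[OF M bounded_borel_test[OF
          test_function_box_bump]]] .
    show "AE x in M. (\<lambda>n. box_bump l u n x) \<longlonglongrightarrow> indicator (box l u) x"
      by (intro AE_I2 box_bump_tendsto)
    show "AE x in M. norm (box_bump l u n x) \<le> indicat_real (box l u) x" for n
      using box_bump_range[of l u n] box_bump_eq_0[of _ l u n] by (intro AE_I2) (auto simp:
          indicator_def)
    show "indicat_real (box l u) \<in> borel_measurable M"
      using M by (intro borel_measurable_indicator) (simp add: radon_measureD)
  qed
  then show ?thesis using radon_measureD[OF M] by simp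
qed

text \<open>The value on a box is recovered from volume integrals over A alone. This serves both the
  uniqueness of the derivative and its measurable dependence on A.\<close>

lemma derivative_box_tendsto:
  assumes "is_derivative A \<mu>" "b \<in> Basis"
  shows "(\<lambda>n. - lset_integral A (\<lambda>x. frechet_derivative (box_bump l u n) (at x) b)) \<longlonglongrightarrow> \<mu> (box l u) \<bullet> b"
proof -
  obtain P N where PN: "radon_measure P" "radon_measure N"
    "\<And>E. E \<in> sets borel \<Longrightarrow> bounded E \<Longrightarrow> \<mu> E \<bullet> b = measure P E - measure N E"
    "\<And>\<phi>. test_function \<phi> \<Longrightarrow>
       lset_integral A (\<lambda>x. frechet_derivative \<phi> (at x) b) = (\<integral>x. \<phi> x \<partial>N) - (\<integral>x. \<phi> x \<partial>P)"
    by (rule is_derivative_splitting[OF assms]) blast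
  have "(\<lambda>n. (\<integral>x. box_bump l u n x \<partial>P) - (\<integral>x. box_bump l u n x \<partial>N)) \<longlonglongrightarrow> measure P (box l u) - measure
      N (box l u)"
    by (intro tendsto_diff box_bump_integral_tendsto PN)
  then show ?thesis
    using PN(3)[of "box l u"] by (simp add: PN(4) test_function_box_bump)
qed

text \<open>On boxes both values are the same limit, and agreement of two vector measures is
  preserved by differences and disjoint unions.\<close>

lemma is_derivative_unique:
  assumes \<mu>: "is_derivative A \<mu>" and \<nu>: "is_derivative A \<nu>" and E: "E \<in> sets borel" "bounded E"
  shows "\<mu> E = \<nu> E"
  using E
proof (induction rule: bounded_borel_induct)
  note v = \<mu>[unfolded is_derivative_iff, THEN conjunct1] \<nu>[unfolded is_derivative_iff, THEN conjunct1]
  {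
    case (box l u)
    show ?case
      by (rule euclidean_eqI) (rule LIMSEQ_unique[OF derivative_box_tendsto[OF \<mu>]
          derivative_box_tendsto[OF \<nu>]])
  next
    case (diff A B)
    then show ?case by (simp add: vector_radon_Diff[OF v(1)] vector_radon_Diff[OF v(2)])
  next
    case (union A)
    have "(\<lambda>n. \<mu> (A n)) sums \<nu> (\<Union>n. A n)"
      using vector_radon_sums[OF v(2) union(1-3)] union(4) by simp
    from sums_unique2[OF vector_radon_sums[OF v(1) union(1-3)] this] show ?case .
  }
qed

text \<open>Measurability tested on volume integrals. It is accessible for a union, and
  \<open>set_measurable_imp_measurable\<close> upgrades it to Borel measurability for the locally
  strict topology.\<close>

definition set_measurable :: "'w measure \<Rightarrow> ('w \<Rightarrow> 'a::euclidean_space lset) \<Rightarrow> bool" where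
  "set_measurable N U \<longleftrightarrow> (\<forall>\<omega>\<in>space N. U \<omega> \<in> FPloc) \<and>
     (\<forall>f. bounded_borel f \<longrightarrow> (\<lambda>\<omega>. lset_integral (U \<omega>) f) \<in> borel_measurable N)"

context
  fixes N :: "'w measure" and U :: "'w \<Rightarrow> 'a::euclidean_space lset"
  assumes U: "set_measurable N U"
begin

lemma set_measurable_FPlocD: "\<omega> \<in> space N \<Longrightarrow> U \<omega> \<in> FPloc"
  and set_measurable_integralD: "bounded_borel f \<Longrightarrow> (\<lambda>\<omega>. lset_integral (U \<omega>) f) \<in> borel_measurable N"
  using U unfolding set_measurable_def by blast+

lemma set_measurable_vector_radon:
  assumes "\<omega> \<in> space N"
  shows "vector_radon_measure (derivative_measure (U \<omega>))"
  using is_derivative_derivative_measure[OF set_measurable_FPlocD[OF assms]] by (simp add: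
      is_derivative_iff)

text \<open>On boxes the value is a limit of volume integrals; differences and disjoint unions carry
  measurability on.\<close>

lemma measurable_derivative_measure:
  assumes b: "b \<in> Basis" and E: "E \<in> sets borel" "bounded E"
  shows "(\<lambda>\<omega>. derivative_measure (U \<omega>) E \<bullet> b) \<in> borel_measurable N"
  using E
proof (induction rule: bounded_borel_induct)
  case (box l u)
  show ?case
  proof (rule borel_measurable_LIMSEQ_real)
    show "(\<lambda>n. - lset_integral (U \<omega>) (\<lambda>x. frechet_derivative (box_bump l u n) (at x) b)) \<longlonglongrightarrow>
        derivative_measure (U \<omega>) (box l u) \<bullet> b"
      if "\<omega> \<in> space N" for \<omega>
      by (rule derivative_box_tendsto[OF is_derivative_derivative_measure[OF
          set_measurable_FPlocD[OF that]] b])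
    show "(\<lambda>\<omega>. - lset_integral (U \<omega>) (\<lambda>x. frechet_derivative (box_bump l u n) (at x) b)) \<in>
        borel_measurable N" for n
      by (intro borel_measurable_uminus set_measurable_integralD bounded_borel_test_derivative
          test_function_box_bump b)
  qed
next
  case (diff A B)
  have "derivative_measure (U \<omega>) (A - B) \<bullet> b = derivative_measure (U \<omega>) A \<bullet> b - derivative_measure
      (U \<omega>) B \<bullet> b" if "\<omega> \<in> space N" for \<omega>
    using vector_radon_Diff[OF set_measurable_vector_radon[OF that] diff(1-4)] by (simp add:
        inner_diff_left)
  then show ?case
    using diff(5,6) by (simp cong: measurable_cong)
next
  case (union A)
  show ?case
  proof (rule borel_measurable_LIMSEQ_real)
    show "(\<lambda>n. \<Sum>i<n. derivative_measure (U \<omega>) (A i) \<bullet> b) \<longlonglongrightarrow> derivative_measure (U \<omega>) (\<Union>i. A i) \<bullet> b"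
        if "\<omega> \<in> space N" for \<omega>
      using tendsto_inner[OF vector_radon_sums[OF set_measurable_vector_radon[OF that] union(1-3),
          unfolded sums_def] tendsto_const[of b]]
      by (simp add: inner_sum_left)
  qed (use union(4) in measurable)
qed

text \<open>Along the cells, the variation is a countable supremum of countable sums of measurable
  terms.\<close>

lemma measurable_perimeter_measure_bounded:
  assumes E: "E \<in> sets borel" "bounded E"
  shows "(\<lambda>\<omega>. emeasure (perimeter_measure (U \<omega>)) E) \<in> borel_measurable N"
proof -
  have [measurable]: "(\<lambda>\<omega>. derivative_measure (U \<omega>) (E \<inter> cell n i)) \<in> borel_measurable N" for n i
    using E sets_cell by (auto simp: borel_measurable_euclidean_space[of "\<lambda>\<omega>. derivative_measure (U
        \<omega>) (E \<inter> cell n i)"]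
        intro!: measurable_derivative_measure)
  have "(\<lambda>\<omega>. SUP n. \<Sum>i. ennreal (norm (derivative_measure (U \<omega>) (E \<inter> cell n i)))) \<in> borel_measurable N"
    by measurable
  moreover have "emeasure (perimeter_measure (U \<omega>)) E = (SUP n. \<Sum>i. ennreal (norm
      (derivative_measure (U \<omega>) (E \<inter> cell n i))))"
    if "\<omega> \<in> space N" for \<omega>
    unfolding perimeter_measure_eq
    by (rule emeasure_variation_cells[OF set_measurable_vector_radon[OF that]
        radon_perimeter_measure[OF set_measurable_FPlocD[OF that], unfolded perimeter_measure_eq] E])
  ultimately show ?thesis by (rule measurable_cong[THEN iffD2, rotated])
qed

lemma measurable_perimeter_measure:
  assumes E: "E \<in> sets borel"
  shows "(\<lambda>\<omega>. emeasure (perimeter_measure (U \<omega>)) E) \<in> borel_measurable N"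
proof (rule borel_measurable_LIMSEQ_order)
  show "(\<lambda>n. emeasure (perimeter_measure (U \<omega>)) (E \<inter> cball 0 (real n))) \<longlonglongrightarrow> emeasure
      (perimeter_measure (U \<omega>)) E"
    if "\<omega> \<in> space N" for \<omega>
    by (rule Lim_emeasure_Int_cball[OF radon_measureD(1)[OF radon_perimeter_measure[OF
        set_measurable_FPlocD[OF that]]] E])
  show "(\<lambda>\<omega>. emeasure (perimeter_measure (U \<omega>)) (E \<inter> cball 0 (real n))) \<in> borel_measurable N" for n
    using E by (intro measurable_perimeter_measure_bounded) (auto simp: bounded_Int)
qed

lemma measurable_nn_integral_perimeter_measure:
  assumes f: "f \<in> borel_measurable borel"
  shows "(\<lambda>\<omega>. \<integral>\<^sup>+x. f x \<partial>perimeter_measure (U \<omega>)) \<in> borel_measurable N"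
  using f
proof (induction rule: borel_measurable_induct)
  note s = radon_measureD(1)[OF radon_perimeter_measure[OF set_measurable_FPlocD]]
  note m = measurable_cong_sets[OF s refl]
  {
    case (cong f g)
    then show ?case by simp
  next
    case (set A)
    then show ?case using measurable_perimeter_measure[of A] by (simp add: s cong: measurable_cong)
  next
    case (mult u v)
    have "(\<integral>\<^sup>+x. v * u x \<partial>perimeter_measure (U \<omega>)) = v * (\<integral>\<^sup>+x. u x \<partial>perimeter_measure (U \<omega>))" if "\<omega>
        \<in> space N" for \<omega>
      using mult(2) by (intro nn_integral_cmult) (simp add: m[OF that])
    moreover have "(\<lambda>\<omega>. v * (\<integral>\<^sup>+x. u x \<partial>perimeter_measure (U \<omega>))) \<in> borel_measurable N"
      using mult(4) by measurable
    ultimately show ?case by (simp cong: measurable_cong)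
  next
    case (add u v)
    have "(\<integral>\<^sup>+x. v x + u x \<partial>perimeter_measure (U \<omega>)) = (\<integral>\<^sup>+x. v x \<partial>perimeter_measure (U \<omega>)) + (\<integral>\<^sup>+x.
        u x \<partial>perimeter_measure (U \<omega>))"
      if "\<omega> \<in> space N" for \<omega>
      by (intro nn_integral_add) (simp_all add: m[OF that] add.hyps)
    moreover have "(\<lambda>\<omega>. (\<integral>\<^sup>+x. v x \<partial>perimeter_measure (U \<omega>)) + (\<integral>\<^sup>+x. u x \<partial>perimeter_measure (U \<omega>)))
        \<in> borel_measurable N"
      by (intro borel_measurable_add add.IH)
    ultimately show ?case by (simp cong: measurable_cong)
  next
    case (seq V)
    have "(\<integral>\<^sup>+x. (SUP i. V i x) \<partial>perimeter_measure (U \<omega>)) = (SUP i. \<integral>\<^sup>+x. V i x \<partial>perimeter_measure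
        (U \<omega>))" if "\<omega> \<in> space N" for \<omega>
    proof (rule nn_integral_monotone_convergence_SUP)
      show "incseq V" by (rule seq)
      show "V i \<in> borel_measurable (perimeter_measure (U \<omega>))" for i
        unfolding m[OF that] by (rule seq)
    qed
    moreover have "(\<lambda>\<omega>. SUP i. \<integral>\<^sup>+x. V i x \<partial>perimeter_measure (U \<omega>)) \<in> borel_measurable N"
      by (intro borel_measurable_SUP seq.IH) simp
    ultimately show ?case unfolding SUP_apply image_image by (simp cong: measurable_cong)
  }
qed

lemma measurable_integral_perimeter_measure:
  assumes f: "bounded_borel f" "\<And>x. f x \<ge> 0"
  shows "(\<lambda>\<omega>. \<integral>x. f x \<partial>perimeter_measure (U \<omega>)) \<in> borel_measurable N"
proof -
  have "(\<integral>x. f x \<partial>perimeter_measure (U \<omega>)) = enn2real (\<integral>\<^sup>+x. f x \<partial>perimeter_measure (U \<omega>))" if "\<omega> \<in>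
      space N" for \<omega>
    using borel_measurable_integrable[OF bounded_borel_integrable[OF radon_perimeter_measure[OF
        set_measurable_FPlocD[OF that]] f(1)]] f(2)
    by (intro integral_eq_nn_integral) auto
  moreover have "(\<lambda>\<omega>. enn2real (\<integral>\<^sup>+x. f x \<partial>perimeter_measure (U \<omega>))) \<in> borel_measurable N"
    using bounded_borelD(1)[OF f(1)] by (intro borel_measurable_enn2real
        measurable_nn_integral_perimeter_measure) simp
  ultimately show ?thesis by (simp cong: measurable_cong)
qed

end

section \<open>The Borel sets of the locally strict topology\<close>

lemma l1_dist_abs:
  assumes "B \<in> sets borel" "R \<in> sets borel"
  shows "l1_dist K (abs_lset B) (abs_lset R) = (LINT x:K|lebesgue. \<bar>indicat_real B x - indicat_real
      R x\<bar>)"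
  using l1_dist.abs_eq[of B R K] assms by (simp add: null_eq_def)

text \<open>On K the identity |1_A - 1_R| = 1_A (1 - 2 1_R) + 1_R makes the distance to a fixed set
  an affine function of 1_A, so \<open>set_measurable\<close> covers it.\<close>

lemma l1_dist_eq:
  assumes K: "K \<in> sets borel" "bounded K" and R: "R \<in> sets borel"
  shows "l1_dist K A (abs_lset R) =
    lset_integral A (\<lambda>x. indicator K x - 2 * indicator (K \<inter> R) x) + measure lborel (K \<inter> R)"
proof -
  let ?B = "borel_rep A"
  have f: "bounded_borel (\<lambda>x. indicator K x - 2 * indicat_real (K \<inter> R) x)"
    using K R by (intro bounded_borel_diff bounded_borel_cmult bounded_borel_indicator) (auto simp:
        bounded_Int)
  have "l1_dist K A (abs_lset R) = (LINT x:K|lebesgue. \<bar>indicat_real ?B x - indicat_real R x\<bar>)"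
    using l1_dist_abs[OF borel_rep R, of K A] by (simp only: abs_borel_rep)
  also have "\<dots> = (\<integral>x. indicator K x * \<bar>indicat_real ?B x - indicat_real R x\<bar> \<partial>lborel)"
    unfolding set_lebesgue_integral_def using K R by (subst integral_completion) auto
  also have "\<dots> = (\<integral>x. indicator ?B x * (indicator K x - 2 * indicat_real (K \<inter> R) x) + indicator (K \<inter>
      R) x \<partial>lborel)"
    by (intro Bochner_Integration.integral_cong) (auto simp: indicator_def)
  also have "\<dots> = (\<integral>x. indicator ?B x * (indicator K x - 2 * indicat_real (K \<inter> R) x) \<partial>lborel) + (\<integral>x.
      indicator (K \<inter> R) x \<partial>lborel)"
    using K R by (intro Bochner_Integration.integral_add integrable_lset[OF f]
        bounded_borel_integrable[OF radon_lborel] bounded_borel_indicator)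
      (auto simp: bounded_Int)
  finally show ?thesis
    using lset_integral_eq[OF bounded_borelD(1)[OF f], of A] by simp
qed

lemma l1_dist_mono:
  assumes "K \<subseteq> L" "compact K" "compact L"
  shows "l1_dist K A B \<le> l1_dist L A B"
proof -
  have KL: "K \<in> lmeasurable" "L \<in> lmeasurable"
    using assms by (auto intro: lmeasurable_compact)
  have eq: "l1_dist K A B = (LINT x:K|lebesgue. \<bar>indicat_real (borel_rep A) x - indicat_real
      (borel_rep B) x\<bar>)" for K
    using l1_dist_abs[OF borel_rep borel_rep, of K A B] by (simp only: abs_borel_rep)
  show ?thesis
    unfolding eq set_lebesgue_integral_def
  proof (rule integral_mono)
    have bl: "borel_rep A \<in> sets lebesgue" for A :: "'a lset"
      using borel_rep[of A] by simp
    show "integrable lebesgue (\<lambda>x. indicat_real K x *\<^sub>R \<bar>indicat_real (borel_rep A) x - indicat_real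
        (borel_rep B) x\<bar>)"
      by (rule integrable_lset_dist[OF bl bl KL(1)])
    show "integrable lebesgue (\<lambda>x. indicat_real L x *\<^sub>R \<bar>indicat_real (borel_rep A) x - indicat_real
        (borel_rep B) x\<bar>)"
      by (rule integrable_lset_dist[OF bl bl KL(2)])
  qed (use assms(1) in \<open>auto simp: indicator_def\<close>)
qed

section \<open>A countable family of sets dense in the L1 distance\<close>

definition basis_seq :: "nat \<Rightarrow> 'a::second_countable_topology set" where
  "basis_seq = from_nat_into (SOME B. countable B \<and> topological_basis B)"

lemma basis_seq:
  shows open_basis_seq: "open (basis_seq i :: 'a::second_countable_topology set)"
    and basis_seq_union: "open (O' :: 'a set) \<Longrightarrow> \<exists>I. O' = (\<Union>i\<in>I. basis_seq i)"
proof -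
  define B where "B = (SOME B :: 'a set set. countable B \<and> topological_basis B)"
  have B: "countable B \<and> topological_basis B"
    unfolding B_def by (rule someI_ex) (rule ex_countable_basis)
  have ne: "B \<noteq> {}"
  proof
    assume "B = {}"
    then have "\<forall>O'. open (O' :: 'a set) \<longrightarrow> (\<exists>B'\<subseteq>{}. \<Union>B' = O')"
      using B by (simp add: topological_basis_def)
    then show False by (metis UNIV_not_empty Union_empty open_UNIV subset_empty)
  qed
  have seq: "range basis_seq = B"
    using B ne unfolding basis_seq_def B_def[symmetric] by (auto simp: range_from_nat_into)
  then show "open (basis_seq i :: 'a set)"
    using topological_basis_open[of B] B by blast
  assume "open O'"
  then obtain C where C: "C \<subseteq> B" "\<Union>C = O'"
    using B unfolding topological_basis_def by blast
  have "O' = (\<Union>i\<in>{i. basis_seq i \<in> C}. basis_seq i)"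
    using C seq by blast
  then show "\<exists>I. O' = (\<Union>i\<in>I. basis_seq i)" by blast
qed

text \<open>Bounded open sets indexed by a countable type. Finite unions suffice for density, and
  the ball makes them bounded.\<close>

definition ring_set :: "nat \<Rightarrow> nat list \<Rightarrow> 'a::euclidean_space set" where
  "ring_set k xs = (\<Union>i\<in>set xs. basis_seq i) \<inter> ball 0 (real k)"

lemma ring_set: "ring_set k xs \<in> sets (borel :: 'a::euclidean_space measure)" "bounded (ring_set k
    xs :: 'a set)"
  unfolding ring_set_def by (auto intro!: borel_open open_Int open_UN open_basis_seq)

text \<open>Outer regularity gives an open superset of nearly the same measure, and that superset is
  the increasing union of ring sets.\<close>

lemma ring_set_dense:
  fixes E :: "'a::euclidean_space set"
  assumes E: "E \<in> lmeasurable" and e: "e > 0"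
  obtains k xs where "(\<integral>x. \<bar>indicat_real E x - indicat_real (ring_set k xs) x\<bar> \<partial>lebesgue) < e"
proof -
  have e2: "e / 2 > 0" using e by simp
  obtain T where T: "open T" "E \<subseteq> T" "T - E \<in> lmeasurable" "emeasure lebesgue (T - E) < ennreal (e / 2)"
    by (rule sets_lebesgue_outer_open[OF fmeasurableD[OF E] e2])
  have Tm: "T \<in> lmeasurable"
    using fmeasurable.Un[OF E T(3)] T(2) by (simp add: Un_absorb1)
  obtain I where I: "T = (\<Union>i\<in>I. basis_seq i)"
    using basis_seq_union[OF T(1)] by blast
  have "\<exists>xs. set xs = I \<inter> {..<n}" for n
    using finite_list[of "I \<inter> {..<n}"] by simp
  then obtain xs where xs: "\<And>n. set (xs n) = I \<inter> {..<n}" by metis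
  define R :: "nat \<Rightarrow> 'a set" where "R n = ring_set n (xs n)" for n
  have R: "R n = (\<Union>i\<in>I \<inter> {..<n}. basis_seq i) \<inter> ball 0 (real n)" for n
    by (simp add: R_def ring_set_def xs)
  have Rb: "R n \<in> sets lebesgue" for n
    using ring_set(1)[of n "xs n", where 'a='a] by (simp add: R_def)
  have inc: "incseq R"
    unfolding R incseq_def by (intro allI impI Int_mono UN_mono subset_ball) auto
  have un: "(\<Union>n. R n) = T"
  proof
    show "(\<Union>n. R n) \<subseteq> T" unfolding I R by blast
    show "T \<subseteq> (\<Union>n. R n)"
    proof
      fix x assume "x \<in> T"
      then obtain i where i: "i \<in> I" "x \<in> basis_seq i" using I by blast
      obtain n where n: "norm x < real n" using reals_Archimedean2 by blast
      have "x \<in> R (max n (Suc i))"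
        unfolding R using i n by (auto simp: max_def)
      then show "x \<in> (\<Union>n. R n)" by blast
    qed
  qed
  have iT: "integrable lebesgue (indicat_real T)" and iE: "integrable lebesgue (indicat_real E)"
    using Tm E by (simp_all add: lmeasurable_iff_integrable)
  have iR: "integrable lebesgue (indicat_real (R n))" for n
    by (rule Bochner_Integration.integrable_bound[OF iT]) (use Rb un in \<open>auto simp: indicator_def\<close>)
  have "(\<lambda>n. \<integral>x. \<bar>indicat_real T x - indicator (R n) x\<bar> \<partial>lebesgue) \<longlonglongrightarrow> integral\<^sup>L lebesgue (\<lambda>x::'a. 0)"
  proof (rule integral_dominated_convergence[OF _ _ iT])
    show "AE x in lebesgue. (\<lambda>n. \<bar>indicat_real T x - indicator (R n) x\<bar>) \<longlonglongrightarrow> 0"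
    proof (rule AE_I2)
      fix x
      have "(\<lambda>n. indicat_real (R n) x) \<longlonglongrightarrow> indicator T x"
        using LIMSEQ_indicator_incseq[OF inc, of x] unfolding un .
      from tendsto_rabs[OF tendsto_diff[OF tendsto_const[of "indicat_real T x"] this]]
      show "(\<lambda>n. \<bar>indicat_real T x - indicator (R n) x\<bar>) \<longlonglongrightarrow> 0" by simp
    qed
    show "AE x in lebesgue. norm \<bar>indicat_real T x - indicator (R n) x\<bar> \<le> indicat_real T x" for n
      using un by (intro AE_I2) (auto simp: indicator_def)
    show "(\<lambda>x. \<bar>indicat_real T x - indicator (R n) x\<bar>) \<in> borel_measurable lebesgue" for n
      using iT iR[of n] by (intro borel_measurable_abs borel_measurable_diff) auto
  qed auto
  then have "\<forall>\<^sub>F n in sequentially. (\<integral>x. \<bar>indicat_real T x - indicator (R n) x\<bar> \<partial>lebesgue) < e / 2"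
    using e2 by (intro order_tendstoD(2)) auto
  then obtain n where n: "(\<integral>x. \<bar>indicat_real T x - indicator (R n) x\<bar> \<partial>lebesgue) < e / 2"
    by (auto simp: eventually_sequentially)
  have "(\<integral>x. \<bar>indicat_real E x - indicat_real T x\<bar> \<partial>lebesgue) = (\<integral>x. indicator (T - E) x \<partial>lebesgue)"
    using T(2) by (intro Bochner_Integration.integral_cong) (auto simp: indicator_def)
  also have "\<dots> < e / 2"
    using T(3,4) e2 by (simp add: fmeasurable_def emeasure_eq_ennreal_measure ennreal_less_iff less_top)
  finally have ET: "(\<integral>x. \<bar>indicat_real E x - indicat_real T x\<bar> \<partial>lebesgue) < e / 2" .
  have "(\<integral>x. \<bar>indicat_real E x - indicator (R n) x\<bar> \<partial>lebesgue) \<le>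
    (\<integral>x. \<bar>indicat_real E x - indicat_real T x\<bar> + \<bar>indicat_real T x - indicator (R n) x\<bar> \<partial>lebesgue)"
    using iE iT iR[of n] by (intro integral_mono) auto
  also have "\<dots> = (\<integral>x. \<bar>indicat_real E x - indicat_real T x\<bar> \<partial>lebesgue) + (\<integral>x. \<bar>indicat_real T x -
      indicator (R n) x\<bar> \<partial>lebesgue)"
    using iE iT iR[of n] by (intro Bochner_Integration.integral_add) auto
  also have "\<dots> < e" using ET n by linarith
  finally show ?thesis using that[of n "xs n"] by (simp add: R_def)
qed

lemma l1_dist_dense:
  fixes A :: "'a::euclidean_space lset"
  assumes "e > 0"
  obtains k xs where "l1_dist (cball 0 r) A (abs_lset (ring_set k xs)) < e"
proof -
  let ?K = "cball (0::'a) r" and ?B = "borel_rep A"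
  have "?B \<inter> ?K \<in> lmeasurable"
    by (intro bounded_set_imp_lmeasurable) (auto simp: bounded_Int)
  then obtain k xs where *: "(\<integral>x. \<bar>indicat_real (?B \<inter> ?K) x - indicat_real (ring_set k xs) x\<bar>
      \<partial>lebesgue) < e"
    using ring_set_dense[OF _ assms] by blast
  have ir: "integrable lebesgue (indicat_real (ring_set k xs :: 'a set))"
    using bounded_set_imp_lmeasurable[OF ring_set(2)[of k xs, where 'a='a]] ring_set(1)[of k xs,
        where 'a='a]
    by (simp add: lmeasurable_iff_integrable)
  have ib: "integrable lebesgue (indicat_real (?B \<inter> ?K))"
    using \<open>?B \<inter> ?K \<in> lmeasurable\<close> by (simp add: lmeasurable_iff_integrable)
  have "l1_dist ?K A (abs_lset (ring_set k xs)) = (LINT x:?K|lebesgue. \<bar>indicat_real ?B x -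
      indicat_real (ring_set k xs) x\<bar>)"
    using l1_dist_abs[OF borel_rep ring_set(1), of ?K A] by (simp only: abs_borel_rep)
  also have "\<dots> \<le> (\<integral>x. \<bar>indicat_real (?B \<inter> ?K) x - indicat_real (ring_set k xs) x\<bar> \<partial>lebesgue)"
    unfolding set_lebesgue_integral_def
  proof (rule integral_mono)
    show "integrable lebesgue (\<lambda>x. indicat_real ?K x *\<^sub>R \<bar>indicat_real ?B x - indicat_real (ring_set
        k xs) x\<bar>)"
      using borel_rep[of A] ring_set(1)[of k xs, where 'a='a] by (intro integrable_lset_dist
          lmeasurable_cball) auto
    show "integrable lebesgue (\<lambda>x. \<bar>indicat_real (?B \<inter> ?K) x - indicat_real (ring_set k xs) x\<bar>)"
      using ib ir by auto
  qed (auto simp: indicator_def)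
  finally show ?thesis using * that by (meson le_less_trans)
qed

text \<open>Finite maxima of hats: a countable family which is uniformly dense among the nonnegative
  continuous functions of compact support.\<close>

fun hat :: "rat \<times> nat \<times> nat \<Rightarrow> 'a::euclidean_space \<Rightarrow> real" where
  "hat (c, n, j) x = max 0 (of_rat c - real (Suc n) * dist x (dense_seq j))"

fun hats :: "(rat \<times> nat \<times> nat) list \<Rightarrow> 'a::euclidean_space \<Rightarrow> real" where
  "hats [] x = 0"
| "hats (p # ps) x = max (hat p x) (hats ps x)"

lemma hats_nonneg: "hats ps x \<ge> 0"
  by (induction ps) (auto simp: max_def)

lemma continuous_hat: "continuous_on UNIV (hat p :: 'a::euclidean_space \<Rightarrow> real)"
proof (cases p)
  case (fields c n j)
  have "(hat p :: 'a \<Rightarrow> real) = (\<lambda>x. max 0 (of_rat c - real (Suc n) * dist x (dense_seq j)))"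
    by (simp add: fun_eq_iff fields)
  then show ?thesis by (simp only:) (intro continuous_intros)
qed

lemma continuous_hats: "continuous_on UNIV (hats ps :: 'a::euclidean_space \<Rightarrow> real)"
proof (induction ps)
  case Nil
  have "(hats [] :: 'a \<Rightarrow> real) = (\<lambda>x. 0)" by (simp add: fun_eq_iff)
  then show ?case by simp
next
  case (Cons p ps)
  have "continuous_on UNIV (\<lambda>x::'a. max (hat p x) (hats ps x))"
    by (intro continuous_on_max continuous_hat Cons)
  moreover have "(hats (p # ps) :: 'a \<Rightarrow> real) = (\<lambda>x. max (hat p x) (hats ps x))" by (simp add:
      fun_eq_iff)
  ultimately show ?case by (simp only:)
qed

lemma bounded_support_hat: "bounded {x. hat p x \<noteq> 0}"
proof (cases p)
  case (fields c n j)
  have "{x. hat p x \<noteq> 0} \<subseteq> cball (dense_seq j) (of_rat c)"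
  proof
    fix x assume "x \<in> {x. hat p x \<noteq> 0}"
    then have "real (Suc n) * dist x (dense_seq j) \<le> of_rat c"
      using fields by (auto simp: max_def split: if_splits)
    moreover have "1 * dist x (dense_seq j) \<le> real (Suc n) * dist x (dense_seq j)"
      by (intro mult_right_mono) auto
    ultimately show "x \<in> cball (dense_seq j) (of_rat c)"
      by (simp add: dist_commute)
  qed
  then show ?thesis by (rule bounded_subset[OF bounded_cball])
qed

lemma bounded_support_hats: "bounded {x. hats ps x \<noteq> 0}"
proof (induction ps)
  case (Cons p ps)
  have "{x. hats (p # ps) x \<noteq> 0} \<subseteq> {x. hat p x \<noteq> 0} \<union> {x. hats ps x \<noteq> 0}"
    by (auto simp: max_def split: if_splits)
  then show ?case
    by (rule bounded_subset[rotated]) (simp only: bounded_Un bounded_support_hat Cons)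
qed simp

lemma bounded_borel_hats: "bounded_borel (hats ps)"
  by (intro bounded_borel_continuous continuous_hats bounded_support_hats)

lemma hats_le: "(\<And>p. p \<in> set ps \<Longrightarrow> hat p x \<le> y) \<Longrightarrow> y \<ge> 0 \<Longrightarrow> hats ps x \<le> y"
  by (induction ps) auto

lemma hats_ge: "p \<in> set ps \<Longrightarrow> hat p x \<le> hats ps x"
  by (induction ps) (auto simp: le_max_iff_disj)

text \<open>A narrow hat with its peak slightly below g x, centred at a dense point near x;
  continuity keeps it below g on its support.\<close>

lemma hat_approx:
  fixes g :: "'a::euclidean_space \<Rightarrow> real"
  assumes g: "continuous_on UNIV g" "\<And>x. g x \<ge> 0" and e: "e > 0"
  shows "\<exists>p. (\<forall>y. hat p y \<le> g y) \<and> g x - e < hat p x"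
proof (cases "g x < e")
  case True
  have "hat (0, 0, 0) y = 0" for y :: 'a by simp
  then show ?thesis using True g(2) by (metis diff_less_0_iff_less)
next
  case False
  obtain d where d: "d > 0" "\<And>y. dist y x < d \<Longrightarrow> dist (g y) (g x) < e / 3"
    using g(1) e unfolding continuous_on_iff by (metis UNIV_I divide_pos_pos zero_less_numeral)
  \<comment> \<open>The upper gap e/3 absorbs the oscillation of g near x. The lower bound leaves
    e/3 for moving the centre away from x, of which e/4 is spent.\<close>
  obtain c where c: "g x - 2 * e / 3 < of_rat c" "of_rat c < g x - e / 3"
    using of_rat_dense[of "g x - 2 * e / 3" "g x - e / 3"] e by auto
  \<comment> \<open>With this slope the hat vanishes beyond distance d/2 from its centre.\<close>
  obtain n where n: "2 * of_rat c / d < real (Suc n)"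
    using reals_Archimedean2[of "2 * of_rat c / d"] by (meson less_trans lessI of_nat_less_iff)
  define \<delta> where "\<delta> = min (d / 2) (e / (4 * real (Suc n)))"
  have "\<delta> > 0" using d e by (simp add: \<delta>_def)
  then have "ball x \<delta> \<noteq> {}" by simp
  then obtain j where j: "dense_seq j \<in> ball x \<delta>"
    using dense_seq[OF open_ball] by blast
  have "hat (c, n, j) y \<le> g y" for y
  proof (cases "real (Suc n) * dist y (dense_seq j) < of_rat c")
    case True
    have "of_rat c < real (Suc n) * (d / 2)"
      using n d(1) by (simp add: field_simps)
    then have "real (Suc n) * dist y (dense_seq j) < real (Suc n) * (d / 2)"
      using True by linarith
    then have "dist y (dense_seq j) < d / 2"
      by (simp only: mult_less_cancel_left_pos of_nat_0_less_iff zero_less_Suc)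
    moreover have "dist x (dense_seq j) < d / 2" using j by (simp add: \<delta>_def)
    ultimately have "dist y x < d"
      using dist_triangle2[of y x "dense_seq j"] by linarith
    then have "\<bar>g y - g x\<bar> < e / 3" using d(2) by (simp add: dist_real_def)
    then have "of_rat c < g y" using c(2) by linarith
    moreover have "0 \<le> real (Suc n) * dist y (dense_seq j)" by simp
    ultimately have "of_rat c - real (Suc n) * dist y (dense_seq j) \<le> g y" by linarith
    then show ?thesis using g(2)[of y] by (simp del: of_nat_Suc)
  qed (use g(2) in \<open>simp del: of_nat_Suc\<close>)
  moreover have "g x - e < hat (c, n, j) x"
  proof -
    have "dist x (dense_seq j) < e / (4 * real (Suc n))" using j by (simp add: \<delta>_def)
    then have "real (Suc n) * dist x (dense_seq j) < real (Suc n) * (e / (4 * real (Suc n)))"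
      by (intro mult_strict_left_mono) auto
    also have "\<dots> = e / 4" by (simp del: of_nat_Suc)
    finally have "g x - e < of_rat c - real (Suc n) * dist x (dense_seq j)"
      using c(1) e by linarith
    then show ?thesis by (simp add: less_max_iff_disj del: of_nat_Suc)
  qed
  ultimately show ?thesis by blast
qed

text \<open>Hats below g have a maximum below g, so only the lower estimate has to be arranged near
  each point, and compactness of K leaves finitely many hats. Lying between 0 and g, the maximum
  vanishes off K.\<close>

lemma hats_approx:
  fixes g :: "'a::euclidean_space \<Rightarrow> real"
  assumes g: "continuous_on UNIV g" "\<And>x. g x \<ge> 0" and K: "compact K" "\<And>x. x \<notin> K \<Longrightarrow> g x = 0" and e: "e
      > 0"
  obtains ps where "\<And>x. \<bar>g x - hats ps x\<bar> \<le> e * indicator K x"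
proof -
  have "\<exists>p. (\<forall>y. hat p y \<le> g y) \<and> g x - e < hat p x" for x
    by (rule hat_approx[OF g e])
  then obtain p where p: "\<And>x y. hat (p x) y \<le> g y" "\<And>x. g x - e < hat (p x) x"
    by metis
  define O' where "O' x = {y. g y - e < hat (p x) y}" for x
  have "open (O' x)" for x
    unfolding O'_def using g(1) continuous_hat[of "p x"]
    by (intro open_Collect_less continuous_on_diff continuous_on_const)
  moreover have "K \<subseteq> (\<Union>x\<in>K. O' x)"
    using p(2) by (auto simp: O'_def)
  ultimately obtain C where C: "C \<subseteq> K" "finite C" "K \<subseteq> (\<Union>x\<in>C. O' x)"
    using compactE_image[OF K(1), of K O'] by metis
  obtain ps where ps: "set ps = p ` C"
    using finite_list[OF finite_imageI[OF C(2), of p]] by blast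
  have le: "hats ps y \<le> g y" for y
    by (rule hats_le[OF _ g(2)]) (use ps p(1) in auto)
  show ?thesis
  proof (rule that[of ps])
    fix x
    show "\<bar>g x - hats ps x\<bar> \<le> e * indicator K x"
    proof (cases "x \<in> K")
      case True
      then obtain z where z: "z \<in> C" "x \<in> O' z" using C(3) by blast
      have "hat (p z) x \<le> hats ps x" by (rule hats_ge) (use ps z in auto)
      then have "g x - e < hats ps x" using z(2) by (simp add: O'_def)
      then show ?thesis using le[of x] True by simp
    next
      case False
      then have "hats ps x = 0" using le[of x] hats_nonneg[of ps x] K(2) by simp
      then show ?thesis using K(2) False by simp
    qed
  qed
qed

section \<open>Countably many coordinates for the locally strict topology\<close>

type_synonym coord = "(nat \<times> nat \<times> nat list) + (rat \<times> nat \<times> nat) list"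

text \<open>A map into a product of lines under which each locally strictly open set is the preimage
  of an open set. The index type is countable, so measurability into the product can be checked on
  single coordinates.\<close>

definition coords :: "'a::euclidean_space lset \<Rightarrow> coord \<Rightarrow> real" where
  "coords A = case_sum (\<lambda>(r, k, xs). l1_dist (cball 0 (real r)) A (abs_lset (ring_set k xs)))
     (\<lambda>ps. \<integral>x. hats ps x \<partial>perimeter_measure A)"

lemma open_coord: "open {v :: coord \<Rightarrow> real. v i \<in> V}" if "open V"
proof -
  have "continuous_on UNIV (\<lambda>v :: coord \<Rightarrow> real. v i)"
    by (rule continuous_on_product_coordinates)
  from open_vimage[OF that this] show ?thesis by (simp add: vimage_def)
qed

text \<open>Approximating g uniformly by hats controls the integrals only up to the mass near the
  support. A further coordinate, a hat dominating the indicator of a ball containing the support,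
  bounds that mass for all A near \<open>A0\<close>.\<close>

lemma integral_perimeter_coords:
  fixes g :: "'a::euclidean_space \<Rightarrow> real"
  assumes g: "continuous_on UNIV g" "\<And>x. g x \<ge> 0" "bounded {x. g x \<noteq> 0}" and A0: "A0 \<in> FPloc" and e:
      "e > 0"
  shows "\<exists>O'. open O' \<and> coords A0 \<in> O' \<and>
    (\<forall>A\<in>FPloc. coords A \<in> O' \<longrightarrow> \<bar>(\<integral>x. g x \<partial>perimeter_measure A) - (\<integral>x. g x \<partial>perimeter_measure A0)\<bar> < e)"
proof -
  obtain r where r: "\<And>x. g x \<noteq> 0 \<Longrightarrow> norm x \<le> r"
    using g(3) unfolding bounded_iff by blast
  define K where "K = cball (0::'a) r"
  have K: "compact K" "\<And>x. x \<notin> K \<Longrightarrow> g x = 0" using r by (auto simp: K_def)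
  have bK: "bounded_borel (indicat_real K)"
    unfolding K_def by (intro bounded_borel_indicator) auto
  obtain j where j: "dense_seq j \<in> ball (0::'a) 1"
    by (rule dense_seq[of "ball (0::'a) 1"]) auto
  \<comment> \<open>The hat has slope 1 and a centre within 1 of the origin, so a height above |r| +
    2 keeps it at least 1 on the ball of radius r.\<close>
  obtain c :: rat where c: "\<bar>r\<bar> + 2 < of_rat c"
    using of_rat_dense[of "\<bar>r\<bar> + 2" "\<bar>r\<bar> + 3"] by auto
  let ?\<theta> = "[(c, 0, j)]"
  have \<theta>: "indicator K x \<le> hats ?\<theta> x" for x :: 'a
  proof (cases "x \<in> K")
    case True
    then have "dist x (dense_seq j) \<le> r + 1"
      using j dist_triangle[of x "dense_seq j" 0] by (simp add: K_def)
    then show ?thesis using c True by simp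
  qed (simp add: hats_nonneg del: hats.simps)
  define I where "I f A = (\<integral>x. f x \<partial>perimeter_measure A)" for f :: "'a \<Rightarrow> real" and A
  \<comment> \<open>Near \<open>A0\<close> the integral of the dominating hat stays below
    \<open>I (hats ?\<theta>) A0 + 1\<close>, so the approximation errors at A and at
    \<open>A0\<close> are at most e/3 each.\<close>
  define d where "d = e / (3 * (I (hats ?\<theta>) A0 + 1))"
  have \<theta>0: "I (hats ?\<theta>) A0 \<ge> 0"
    unfolding I_def by (intro Bochner_Integration.integral_nonneg hats_nonneg)
  have d: "d > 0" using e \<theta>0 by (simp add: d_def add_nonneg_pos)
  obtain ps where ps: "\<And>x. \<bar>g x - hats ps x\<bar> \<le> d * indicator K x"
    using hats_approx[OF g(1,2) K d] by blast
  have le: "\<bar>I g A - I (hats ps) A\<bar> \<le> d * I (hats ?\<theta>) A" if "A \<in> FPloc" for A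
  proof -
    note V = radon_perimeter_measure[OF that]
    note int = bounded_borel_integrable[OF V]
    have ig: "integrable (perimeter_measure A) g" by (intro int bounded_borel_continuous g)
    have ih: "integrable (perimeter_measure A) (hats qs)" for qs by (intro int bounded_borel_hats)
    have "\<bar>I g A - I (hats ps) A\<bar> = \<bar>\<integral>x. g x - hats ps x \<partial>perimeter_measure A\<bar>"
      unfolding I_def by (simp add: Bochner_Integration.integral_diff[OF ig ih])
    also have "\<dots> \<le> (\<integral>x. \<bar>g x - hats ps x\<bar> \<partial>perimeter_measure A)" by (rule integral_abs_bound)
    also have "\<dots> \<le> (\<integral>x. d * hats ?\<theta> x \<partial>perimeter_measure A)"
    proof (rule integral_mono)
      show "integrable (perimeter_measure A) (\<lambda>x. \<bar>g x - hats ps x\<bar>)"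
        by (intro integrable_abs Bochner_Integration.integrable_diff ig ih)
      show "integrable (perimeter_measure A) (\<lambda>x. d * hats ?\<theta> x)"
        by (intro integrable_mult_right ih)
      show "\<bar>g x - hats ps x\<bar> \<le> d * hats ?\<theta> x" for x
        using ps[of x] mult_left_mono[OF \<theta>[of x], of d] d by linarith
    qed
    also have "\<dots> = d * I (hats ?\<theta>) A" unfolding I_def by (rule integral_mult_right_zero)
    finally show ?thesis .
  qed
  define O' where "O' = {v :: coord \<Rightarrow> real. v (Inr ?\<theta>) \<in> {..<I (hats ?\<theta>) A0 + 1}} \<inter> {v. v (Inr ps) \<in>
      ball (I (hats ps) A0) (e / 3)}"
  have "open O'" unfolding O'_def by (intro open_Int open_coord open_lessThan open_ball)
  moreover have co: "coords A (Inr qs) = I (hats qs) A" for A :: "'a lset" and qs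
    by (simp add: coords_def I_def)
  have "coords A0 \<in> O'" using e by (simp add: O'_def co del: hats.simps)
  moreover have "\<bar>I g A - I g A0\<bar> < e" if A: "A \<in> FPloc" "coords A \<in> O'" for A
  proof -
    have 1: "I (hats ?\<theta>) A < I (hats ?\<theta>) A0 + 1" "\<bar>I (hats ps) A0 - I (hats ps) A\<bar> < e / 3"
      using A(2) by (simp_all add: O'_def co dist_real_def del: hats.simps)
    have "d * I (hats ?\<theta>) A \<le> d * (I (hats ?\<theta>) A0 + 1)" "d * I (hats ?\<theta>) A0 \<le> d * (I (hats ?\<theta>) A0 + 1)"
      using 1 d by (auto intro!: mult_left_mono)
    moreover have "d * (I (hats ?\<theta>) A0 + 1) = e / 3"
    proof -
      have "e / (3 * y) * y = e / 3" if "y > 0" for y :: real using that by simp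
      from this[of "I (hats ?\<theta>) A0 + 1"] \<theta>0 show ?thesis by (simp only: d_def add_nonneg_pos
          zero_less_one)
    qed
    ultimately have "\<bar>I g A - I (hats ps) A\<bar> \<le> e / 3" "\<bar>I g A0 - I (hats ps) A0\<bar> \<le> e / 3"
      using le[OF A(1)] le[OF A0] by linarith+
    with 1(2) show ?thesis by linarith
  qed
  ultimately show ?thesis unfolding I_def by blast
qed

text \<open>It is enough to fit a coordinate neighbourhood around each point of the set, because
  arbitrary unions of such neighbourhoods have the same form. This is how an uncountable subbasis is
  reduced to countably many coordinates.\<close>

lemma loc_strict_open_coords:
  fixes W :: "'a::euclidean_space lset set"
  assumes "openin loc_strict_topology W"
  shows "\<exists>O'. open O' \<and> W = {A \<in> FPloc. coords A \<in> O'}"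
proof -
  have local: "\<exists>O'. open O' \<and> W = {A \<in> FPloc. coords A \<in> O'}"
    if W: "W \<subseteq> FPloc" and *: "\<And>A0. A0 \<in> W \<Longrightarrow> \<exists>O'. open O' \<and> coords A0 \<in> O' \<and> (\<forall>A\<in>FPloc. coords A \<in> O'
        \<longrightarrow> A \<in> W)" for W :: "'a lset set"
  proof -
    obtain Q where Q: "\<And>A0. A0 \<in> W \<Longrightarrow> open (Q A0)" "\<And>A0. A0 \<in> W \<Longrightarrow> coords A0 \<in> Q A0"
      "\<And>A0 A. A0 \<in> W \<Longrightarrow> A \<in> FPloc \<Longrightarrow> coords A \<in> Q A0 \<Longrightarrow> A \<in> W"
      using * by metis
    have "W = {A \<in> FPloc. coords A \<in> (\<Union>A0\<in>W. Q A0)}"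
    proof (intro equalityI subsetI)
      fix A :: "'a lset" assume "A \<in> W"
      then show "A \<in> {A \<in> FPloc. coords A \<in> (\<Union>A0\<in>W. Q A0)}" using W Q(2) by auto
    next
      fix A :: "'a lset" assume "A \<in> {A \<in> FPloc. coords A \<in> (\<Union>A0\<in>W. Q A0)}"
      then show "A \<in> W" using Q(3) by auto
    qed
    then show ?thesis using Q(1) by (intro exI[of _ "\<Union>A0\<in>W. Q A0"]) (auto intro: open_UN)
  qed
  show ?thesis
    using assms unfolding loc_strict_topology_def openin_topology_generated_by_iff
  proof induction
    case Empty
    then show ?case by (intro exI[of _ "{}"]) simp
  next
    case (Int a b)
    then obtain P Q where "open P" "a = {A \<in> FPloc. coords A \<in> P}" "open Q" "b = {A \<in> FPloc. coords
        A \<in> Q}"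
      by blast
    then show ?case by (intro exI[of _ "P \<inter> Q"]) auto
  next
    case (UN X)
    then have "\<forall>W\<in>X. \<exists>O'. open O' \<and> W = {A \<in> FPloc. coords A \<in> O'}" by blast
    from bchoice[OF this] obtain Q where
      Q': "\<forall>W\<in>X. open (Q W) \<and> W = {A \<in> FPloc. coords A \<in> Q W}" ..
    then have Q: "\<And>W. W \<in> X \<Longrightarrow> open (Q W)" "\<And>W. W \<in> X \<Longrightarrow> W = {A \<in> FPloc. coords A \<in> Q W}"
      by blast+
    show ?case
    proof (rule local)
      show "\<Union>X \<subseteq> FPloc" using Q(2) by blast
      fix A0 assume "A0 \<in> \<Union>X"
      then obtain W where W: "W \<in> X" "A0 \<in> W" by blast
      have "\<forall>A\<in>FPloc. coords A \<in> Q W \<longrightarrow> A \<in> \<Union>X" using Q(2)[OF W(1)] W(1) by blast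
      moreover have "coords A0 \<in> Q W" using Q(2)[OF W(1)] W(2) by blast
      ultimately show "\<exists>O'. open O' \<and> coords A0 \<in> O' \<and> (\<forall>A\<in>FPloc. coords A \<in> O' \<longrightarrow> A \<in> \<Union>X)"
        using Q(1)[OF W(1)] by blast
    qed
  next
    case (Basis s)
    then show ?case
    proof
      assume "s \<in> {{A \<in> FPloc. l1_dist K A B < \<epsilon>} | K B \<epsilon>. compact K \<and> B \<in> FPloc \<and> \<epsilon> > 0}"
      then obtain K B \<epsilon> where s: "s = {A \<in> FPloc. l1_dist K A B < \<epsilon>}" and K: "compact K"
        by blast
      obtain r where r: "K \<subseteq> ball 0 r" using bounded_subset_ballD[OF compact_imp_bounded[OF K], of
          0] by auto
      obtain k where "r \<le> real k" using real_arch_simple by blast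
      then have Kk: "K \<subseteq> cball 0 (real k)" using r by auto
      show ?case
      proof (rule local)
        show "s \<subseteq> FPloc" using s by blast
        fix A0 assume "A0 \<in> s"
        \<comment> \<open>Half of the slack, because the distance to the ring set enters the
          triangle inequality twice, from A and from \<open>A0\<close>.\<close>
        then have pos: "(\<epsilon> - l1_dist K A0 B) / 2 > 0" by (simp add: s)
        obtain m xs where R: "l1_dist (cball 0 (real k)) A0 (abs_lset (ring_set m xs)) < (\<epsilon> -
            l1_dist K A0 B) / 2"
          using l1_dist_dense[OF pos] by blast
        let ?R = "abs_lset (ring_set m xs) :: 'a lset"
        define O' where "O' = {v :: coord \<Rightarrow> real. v (Inl (k, m, xs)) \<in> {..<(\<epsilon> - l1_dist K A0 B) / 2}}"
        have "open O'" unfolding O'_def by (intro open_coord) auto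
        moreover have "coords A0 \<in> O'" using R by (simp add: O'_def coords_def)
        moreover have "A \<in> s" if A: "A \<in> FPloc" "coords A \<in> O'" for A
        proof -
          have *: "l1_dist (cball 0 (real k)) A ?R < (\<epsilon> - l1_dist K A0 B) / 2"
            using A(2) by (simp add: O'_def coords_def)
          have "l1_dist K A B \<le> l1_dist K A ?R + (l1_dist K ?R A0 + l1_dist K A0 B)"
            using l1_dist_triangle_compact[OF K, of A B ?R] l1_dist_triangle_compact[OF K, of ?R B
                A0] by linarith
          moreover have "l1_dist K A ?R \<le> l1_dist (cball 0 (real k)) A ?R"
            "l1_dist K ?R A0 \<le> l1_dist (cball 0 (real k)) A0 ?R"
            using l1_dist_mono[OF Kk K compact_cball] by (simp_all add: l1_dist_commute[of K ?R])
          ultimately show ?thesis using * R A(1) by (simp add: s)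
        qed
        ultimately show "\<exists>O'. open O' \<and> coords A0 \<in> O' \<and> (\<forall>A\<in>FPloc. coords A \<in> O' \<longrightarrow> A \<in> s)" by blast
      qed
    next
      assume "s \<in> {{A \<in> FPloc. (LINT x|perimeter_measure A. g x) \<in> V} | g V.
         continuous_on UNIV g \<and> compact_support g \<and> open V}"
      then obtain g V where s: "s = {A \<in> FPloc. (LINT x|perimeter_measure A. g x) \<in> V}"
        and g': "continuous_on UNIV g" "compact_support g" and V: "open V"
        by blast
      note g = g'[unfolded compact_support_iff]
      show ?case
      proof (rule local)
        show "s \<subseteq> FPloc" using s by blast
        fix A0 assume "A0 \<in> s"
        then have A0: "A0 \<in> FPloc" "(\<integral>x. g x \<partial>perimeter_measure A0) \<in> V" by (simp_all add: s)
        then obtain e where e: "e > 0" "\<And>y. \<bar>y - (\<integral>x. g x \<partial>perimeter_measure A0)\<bar> < e \<Longrightarrow> y \<in> V"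
          using V unfolding open_dist dist_real_def by blast
        \<comment> \<open>Finite maxima of hats are nonnegative, so the positive and negative parts
          are approximated separately.\<close>
        define p where "p x = max 0 (g x)" for x
        define n where "n x = max 0 (- g x)" for x
        have pc: "continuous_on UNIV p" "continuous_on UNIV n"
          unfolding p_def n_def using g(1) by (auto intro!: continuous_intros)
        have pb: "bounded {x. p x \<noteq> 0}" "bounded {x. n x \<noteq> 0}"
          by (rule bounded_subset[OF g(2)]; auto simp: p_def n_def)+
        have pn: "p x \<ge> 0" "n x \<ge> 0" for x by (auto simp: p_def n_def)
        have e2: "e / 2 > 0" using e(1) by simp
        have dec: "(\<integral>x. g x \<partial>perimeter_measure A) = (\<integral>x. p x \<partial>perimeter_measure A) - (\<integral>x. n x
            \<partial>perimeter_measure A)" if "A \<in> FPloc" for A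
          unfolding p_def n_def by (rule integral_max_decompose(1)[OF radon_perimeter_measure[OF
              that] bounded_borel_continuous[OF g]])
        obtain P where P: "open P" "coords A0 \<in> P" "\<And>A. A \<in> FPloc \<Longrightarrow> coords A \<in> P \<Longrightarrow> \<bar>(\<integral>x. p x
            \<partial>perimeter_measure A) - (\<integral>x. p x \<partial>perimeter_measure A0)\<bar> < e / 2"
          using integral_perimeter_coords[OF pc(1) pn(1) pb(1) A0(1) e2] by blast
        obtain Q where Q: "open Q" "coords A0 \<in> Q" "\<And>A. A \<in> FPloc \<Longrightarrow> coords A \<in> Q \<Longrightarrow> \<bar>(\<integral>x. n x
            \<partial>perimeter_measure A) - (\<integral>x. n x \<partial>perimeter_measure A0)\<bar> < e / 2"
          using integral_perimeter_coords[OF pc(2) pn(2) pb(2) A0(1) e2] by blast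
        have "A \<in> s" if A: "A \<in> FPloc" "coords A \<in> P \<inter> Q" for A
        proof -
          have "\<bar>(a - b) - (a0 - b0)\<bar> < e" if "\<bar>a - a0\<bar> < e / 2" "\<bar>b - b0\<bar> < e / 2" for a b a0 b0 ::
              real
            using that by linarith
          from this[OF P(3) Q(3)] have "\<bar>(\<integral>x. g x \<partial>perimeter_measure A) - (\<integral>x. g x
              \<partial>perimeter_measure A0)\<bar> < e"
            unfolding dec[OF A(1)] dec[OF A0(1)] using A by blast
          from e(2)[OF this] show ?thesis using A(1) by (simp add: s)
        qed
        then show "\<exists>O'. open O' \<and> coords A0 \<in> O' \<and> (\<forall>A\<in>FPloc. coords A \<in> O' \<longrightarrow> A \<in> s)"
          using P(1,2) Q(1,2) by (intro exI[of _ "P \<inter> Q"]) (auto intro: open_Int)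
      qed
    qed
  qed
qed

lemma space_FPloc_borel: "space FPloc_borel = FPloc"
  unfolding FPloc_borel_def by (rule space_measure_of) (use openin_subset topspace_loc_strict in blast)

text \<open>Preimages of open sets are preimages under \<open>coords\<close>. The L1 coordinates are
  affine in a volume integral, and the others are integrals against a measurably varying perimeter
  measure.\<close>

lemma set_measurable_imp_measurable:
  assumes U: "set_measurable N U"
  shows "U \<in> measurable N FPloc_borel"
  unfolding FPloc_borel_def
proof (rule measurable_measure_of)
  show "{U. openin loc_strict_topology U} \<subseteq> Pow FPloc"
    using openin_subset topspace_loc_strict by blast
  show "U \<in> space N \<rightarrow> FPloc"
    using U by (auto simp: set_measurable_def)
  fix W assume "W \<in> {U. openin loc_strict_topology (U :: 'b lset set)}"
  then obtain O' where O': "open O'" "W = {A \<in> FPloc. coords A \<in> O'}"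
    using loc_strict_open_coords by blast
  have "(\<lambda>\<omega>. coords (U \<omega>)) \<in> borel_measurable N"
  proof (rule measurable_coordinatewise_then_product)
    fix i :: coord
    show "(\<lambda>\<omega>. coords (U \<omega>) i) \<in> borel_measurable N"
    proof (cases i)
      case (Inl t)
      obtain r k xs where t: "t = (r, k, xs)" by (cases t)
      let ?K = "cball (0::'b) (real r)" and ?R = "ring_set k xs :: 'b set"
      have eq: "coords (U \<omega>) i = lset_integral (U \<omega>) (\<lambda>x. indicator ?K x - 2 * indicator (?K \<inter> ?R)
          x) + measure lborel (?K \<inter> ?R)" for \<omega>
        unfolding coords_def Inl t using l1_dist_eq[of ?K ?R "U \<omega>"] ring_set(1)[of k xs] by simp
      have "bounded_borel (\<lambda>x. indicator ?K x - 2 * indicat_real (?K \<inter> ?R) x)"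
        using ring_set(1)[of k xs] by (intro bounded_borel_diff bounded_borel_cmult
            bounded_borel_indicator) (auto simp: bounded_Int)
      then show ?thesis
        unfolding eq using U by (intro borel_measurable_add borel_measurable_const) (auto simp:
            set_measurable_def)
    next
      case (Inr ps)
      show ?thesis
        unfolding coords_def Inr
        using measurable_integral_perimeter_measure[OF U bounded_borel_hats hats_nonneg, of ps] by simp
    qed
  qed
  then have "(\<lambda>\<omega>. coords (U \<omega>)) -` O' \<inter> space N \<in> sets N"
    using O'(1) by (intro measurable_sets) auto
  moreover have "U -` W \<inter> space N = (\<lambda>\<omega>. coords (U \<omega>)) -` O' \<inter> space N"
    using U O'(2) by (auto simp: set_measurable_def)
  ultimately show "U -` W \<inter> space N \<in> sets N" by simp
qed

section \<open>Borel sets of finite perimeter sets\<close>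

lemma FP_FPloc: "A \<in> FP \<Longrightarrow> A \<in> FPloc" and FP_finite_volume: "A \<in> FP \<Longrightarrow> finite_volume A"
  by (simp_all add: FP_def)

lemma openin_strict_topology:
  "openin strict_topology U \<longleftrightarrow> U \<subseteq> FP \<and> (\<forall>A\<in>U. \<exists>r>0. \<forall>B\<in>FP. strict_dist A B < r \<longrightarrow> B \<in> U)"
proof -
  have eq: "(\<exists>r>0. {B. A \<in> FP \<and> B \<in> FP \<and> strict_dist A B < r} \<subseteq> U) \<longleftrightarrow> (\<exists>r>0. \<forall>B\<in>FP. strict_dist A B <
      r \<longrightarrow> B \<in> U)"
    if "A \<in> FP" for A
    using that by (simp add: subset_iff Ball_def imp_conjL)
  show ?thesis
    unfolding strict_topology_def Metric_space.openin_mtopology[OF Metric_space_FP]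
      Metric_space.mball_def[OF Metric_space_FP] Ball_def[of U]
    by (intro conj_cong refl all_cong1 imp_cong eq) blast
qed

lemma space_FP_borel: "space FP_borel = FP"
  unfolding FP_borel_def by (rule space_measure_of) (auto simp: openin_strict_topology)

lemma open_in_FP_borel: "openin strict_topology U \<Longrightarrow> U \<in> sets FP_borel"
  unfolding FP_borel_def by (rule in_measure_of) (auto simp: openin_strict_topology)

lemma integrable_borel_rep: "finite_volume A \<Longrightarrow> integrable lborel (indicat_real (borel_rep A))"
  using finite_volume.abs_eq[of "borel_rep A"] borel_rep[of A]
  by (simp add: abs_borel_rep null_eq_def integrable_completion)

lemma finite_volume_abs:
  assumes "B \<in> sets borel" "integrable lborel (indicat_real B)"
  shows "finite_volume (abs_lset B)"
  using finite_volume.abs_eq[of B] assms by (simp add: null_eq_def integrable_completion)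

lemma l1_dist_UNIV_abs:
  assumes "B \<in> sets borel" "C \<in> sets borel"
  shows "l1_dist UNIV (abs_lset B) (abs_lset C) = (\<integral>x. \<bar>indicat_real B x - indicat_real C x\<bar> \<partial>lborel)"
  using assms by (simp add: l1_dist_abs set_lebesgue_integral_def integral_completion)

lemma l1_dist_UNIV_borel_rep:
  "l1_dist UNIV A B = (\<integral>x. \<bar>indicat_real (borel_rep A) x - indicat_real (borel_rep B) x\<bar> \<partial>lborel)"
  using l1_dist_UNIV_abs[OF borel_rep borel_rep, of A B] by (simp only: abs_borel_rep)

lemma lset_integral_l1_le:
  assumes f: "bounded_borel f" "\<And>x. \<bar>f x\<bar> \<le> C" and B: "B \<in> sets borel" "integrable lborel
      (indicat_real B)"
    and D: "D \<in> sets borel" "integrable lborel (indicat_real D)"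
  shows "\<bar>(\<integral>x. indicator B x * f x \<partial>lborel) - (\<integral>x. indicator D x * f x \<partial>lborel)\<bar> \<le>
    C * (\<integral>x. \<bar>indicat_real B x - indicat_real D x\<bar> \<partial>lborel)"
proof -
  have i: "integrable lborel (\<lambda>x. indicator B x * f x)" "integrable lborel (\<lambda>x. indicator D x * f x)"
    by (intro bounded_borel_integrable radon_lborel bounded_borel_indicator_mult f B D)+
  have "\<bar>(\<integral>x. indicator B x * f x \<partial>lborel) - (\<integral>x. indicator D x * f x \<partial>lborel)\<bar> =
      \<bar>\<integral>x. indicator B x * f x - indicator D x * f x \<partial>lborel\<bar>"
    by (simp add: Bochner_Integration.integral_diff[OF i])
  also have "\<dots> \<le> (\<integral>x. \<bar>indicator B x * f x - indicator D x * f x\<bar> \<partial>lborel)"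
    by (rule integral_abs_bound)
  also have "\<dots> \<le> (\<integral>x. C * \<bar>indicat_real B x - indicat_real D x\<bar> \<partial>lborel)"
  proof (rule integral_mono)
    show "integrable lborel (\<lambda>x. \<bar>indicator B x * f x - indicator D x * f x\<bar>)"
      by (intro integrable_abs Bochner_Integration.integrable_diff i)
    show "integrable lborel (\<lambda>x. C * \<bar>indicat_real B x - indicat_real D x\<bar>)"
      by (intro integrable_mult_right integrable_abs Bochner_Integration.integrable_diff B D)
    show "\<bar>indicator B x * f x - indicator D x * f x\<bar> \<le> C * \<bar>indicat_real B x - indicat_real D x\<bar>" for x
      using f(2)[of x] by (auto simp: indicator_def)
  qed
  also have "\<dots> = C * (\<integral>x. \<bar>indicat_real B x - indicat_real D x\<bar> \<partial>lborel)" by simp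
  finally show ?thesis .
qed

text \<open>Volume integrals are Lipschitz in the L1 distance, hence continuous for the strict
  metric. Borel measurability of the perimeter measure on \<open>FP\<close> follows.\<close>

lemma set_measurable_FP: "set_measurable (FP_borel :: 'a::euclidean_space lset measure) (\<lambda>A. A)"
  unfolding set_measurable_def space_FP_borel
proof (intro conjI ballI allI impI)
  fix f :: "'a \<Rightarrow> real" assume f: "bounded_borel f"
  obtain C where C: "C > 0" "\<And>x. \<bar>f x\<bar> \<le> C" using bounded_borel_bound[OF f] by blast
  show "(\<lambda>A. lset_integral A f) \<in> borel_measurable FP_borel"
  proof (rule borel_measurableI)
    fix V :: "real set" assume V: "open V"
    have "openin strict_topology ((\<lambda>A. lset_integral A f) -` V \<inter> FP)"
      unfolding openin_strict_topology
    proof (intro conjI ballI)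
      fix A assume A: "A \<in> (\<lambda>A. lset_integral A f) -` V \<inter> FP"
      then obtain e where e: "e > 0" "\<And>y. \<bar>y - lset_integral A f\<bar> < e \<Longrightarrow> y \<in> V"
        using V unfolding open_dist dist_real_def by auto
      show "\<exists>r>0. \<forall>B\<in>FP. strict_dist A B < r \<longrightarrow> B \<in> (\<lambda>A. lset_integral A f) -` V \<inter> FP"
      proof (intro exI[of _ "e / C"] conjI ballI impI)
        show "e / C > 0" using e C by simp
        fix B assume B: "B \<in> FP" "strict_dist A B < e / C"
        have "\<bar>lset_integral B f - lset_integral A f\<bar> \<le> C * l1_dist UNIV B A"
          unfolding l1_dist_UNIV_borel_rep lset_integral_eq[OF bounded_borelD(1)[OF f]]
          using A B(1) by (intro lset_integral_l1_le f C(2) borel_rep integrable_borel_rep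
              FP_finite_volume) auto
        also have "l1_dist UNIV B A < e / C"
          using B(2) by (simp add: strict_dist_def l1_dist_commute[of UNIV B A])
        then have "C * l1_dist UNIV B A < e" using C(1) by (simp add: field_simps)
        finally show "B \<in> (\<lambda>A. lset_integral A f) -` V \<inter> FP" using e(2) B(1) by simp
      qed
    qed simp
    then show "(\<lambda>A. lset_integral A f) -` V \<inter> space FP_borel \<in> sets FP_borel"
      unfolding space_FP_borel by (rule open_in_FP_borel)
  qed
qed (rule FP_FPloc)

text \<open>An increasing sequence inside \<open>B0\<close> that exhausts \<open>FP\<close> up to
  the class of the empty set.\<close>

definition charging :: "nat \<Rightarrow> 'a::euclidean_space lset set" where
  "charging n = {A \<in> FP. emeasure (perimeter_measure A) (cball 0 (real n)) > 0}"

lemma measurable_perimeter_FP: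
  "E \<in> sets borel \<Longrightarrow> (\<lambda>A. emeasure (perimeter_measure A) E) \<in> borel_measurable FP_borel"
  by (rule measurable_perimeter_measure[OF set_measurable_FP])

lemma charging_B0: "charging n \<in> B0"
proof -
  have "{A \<in> space FP_borel. 0 < emeasure (perimeter_measure A) (cball 0 (real n))} \<in> sets FP_borel"
    using measurable_perimeter_FP[of "cball 0 (real n)"] by measurable
  then have "charging n \<in> sets FP_borel" by (simp add: charging_def space_FP_borel)
  then show ?thesis unfolding B0_def by (auto simp: charging_def intro!: exI[of _ "cball 0 (real n)"])
qed

lemma B0_subset: "U \<in> B0 \<Longrightarrow> W \<in> sets FP_borel \<Longrightarrow> W \<subseteq> U \<Longrightarrow> W \<in> B0"
  unfolding B0_def by blast

lemma B0_sets: "U \<in> B0 \<Longrightarrow> U \<in> sets FP_borel"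
  unfolding B0_def by blast

lemma not_charging_imp_empty:
  assumes "A \<in> FP" "\<And>n. A \<notin> charging n"
  shows "A = abs_lset {}"
  using assms by (intro perimeter_measure_zero_imp_empty FP_FPloc FP_finite_volume) (auto simp:
      charging_def)

section \<open>Partitioning the finite perimeter sets into small pieces\<close>

definition net_set :: "nat \<Rightarrow> 'a::euclidean_space set" where
  "net_set j = (case from_nat j of (k, xs) \<Rightarrow> ring_set k xs)"

lemma net_set: "(net_set j :: 'a set) \<in> sets borel" "bounded (net_set j :: 'a::euclidean_space set)"
    "integrable lborel (indicat_real (net_set j :: 'a set))"
proof -
  show 1: "net_set j \<in> sets (borel :: 'a measure)" and 2: "bounded (net_set j :: 'a set)"
    unfolding net_set_def using ring_set by (auto split: prod.split)
  show "integrable lborel (indicat_real (net_set j :: 'a set))"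
    by (intro bounded_borel_integrable radon_lborel bounded_borel_indicator 1 2)
qed

definition net_dist :: "'a::euclidean_space lset \<Rightarrow> nat \<Rightarrow> real" where
  "net_dist A j = (\<integral>x. \<bar>indicat_real (borel_rep A) x - indicat_real (net_set j) x\<bar> \<partial>lborel)"

lemma net_dist_eq: "net_dist A j = l1_dist UNIV A (abs_lset (net_set j))"
  using l1_dist_UNIV_abs[OF borel_rep net_set(1), of A j] by (simp add: net_dist_def abs_borel_rep)

lemma net_dist_small:
  assumes "A \<in> FP" "e > 0"
  obtains j where "net_dist A j < e"
proof -
  have "borel_rep A \<in> lmeasurable"
    using integrable_borel_rep[OF FP_finite_volume[OF assms(1)]] by (simp add:
        lmeasurable_iff_integrable integrable_completion)
  then obtain k xs where "(\<integral>x. \<bar>indicat_real (borel_rep A) x - indicat_real (ring_set k xs) x\<bar>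
      \<partial>lebesgue) < e"
    using ring_set_dense[OF _ assms(2)] by blast
  moreover have "(\<integral>x. \<bar>indicat_real (borel_rep A) x - indicat_real (ring_set k xs) x\<bar> \<partial>lebesgue) =
      (\<integral>x. \<bar>indicat_real (borel_rep A) x - indicat_real (ring_set k xs) x\<bar> \<partial>lborel)"
    using ring_set(1)[of k xs, where 'a='a] by (intro integral_completion) simp
  ultimately have "net_dist A (to_nat (k, xs)) < e"
    by (simp add: net_dist_def net_set_def)
  then show ?thesis by (rule that)
qed

lemma net_dist_triangle: "A \<in> FP \<Longrightarrow> B \<in> FP \<Longrightarrow> net_dist B j \<le> l1_dist UNIV B A + net_dist A j"
  unfolding net_dist_eq
  by (intro l1_dist_triangle_UNIV FP_finite_volume finite_volume_abs net_set)

lemma l1_dist_le_net: "A \<in> FP \<Longrightarrow> B \<in> FP \<Longrightarrow> l1_dist UNIV A B \<le> net_dist A j + net_dist B j"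
  unfolding net_dist_eq l1_dist_commute[of UNIV B]
  by (intro l1_dist_triangle_UNIV FP_finite_volume finite_volume_abs net_set)

text \<open>Small in the L1 distance, which separates points and controls unions. L1 balls are open
  for the strict metric, so the pieces are Borel sets of \<open>FP\<close>.\<close>

definition piece :: "nat \<Rightarrow> nat \<Rightarrow> 'a::euclidean_space lset set" where
  "piece k = disjointed (\<lambda>j. {A \<in> FP. net_dist A j < 1 / real (Suc k)})"

lemma piece:
  shows sets_piece: "(piece k j :: 'a::euclidean_space lset set) \<in> sets FP_borel"
    and UN_piece: "(\<Union>j. piece k j) = (FP :: 'a lset set)"
    and piece_disjoint: "disjoint_family (piece k :: nat \<Rightarrow> 'a lset set)"
proof -
  have "{A \<in> FP. net_dist A j < 1 / real (Suc k)} \<in> sets (FP_borel :: 'a lset measure)" for j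
  proof (rule open_in_FP_borel, unfold openin_strict_topology, intro conjI ballI)
    fix A :: "'a lset" assume A: "A \<in> {A \<in> FP. net_dist A j < 1 / real (Suc k)}"
    show "\<exists>r>0. \<forall>B\<in>FP. strict_dist A B < r \<longrightarrow> B \<in> {A \<in> FP. net_dist A j < 1 / real (Suc k)}"
    proof (intro exI[of _ "1 / real (Suc k) - net_dist A j"] conjI ballI impI)
      show "1 / real (Suc k) - net_dist A j > 0" using A by simp
      fix B :: "'a lset" assume B: "B \<in> FP" "strict_dist A B < 1 / real (Suc k) - net_dist A j"
      have "l1_dist UNIV B A \<le> strict_dist A B"
        by (simp add: strict_dist_def l1_dist_commute[of UNIV B A])
      then have "net_dist B j < 1 / real (Suc k)"
        using net_dist_triangle[of A B j] A B by (simp del: of_nat_Suc)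
      then show "B \<in> {A \<in> FP. net_dist A j < 1 / real (Suc k)}" using B(1) by blast
    qed
  qed blast
  then have "range (piece k :: nat \<Rightarrow> 'a lset set) \<subseteq> sets FP_borel"
    unfolding piece_def by (intro sets.range_disjointed_sets) blast
  then show "(piece k j :: 'a lset set) \<in> sets FP_borel" by blast
  show "disjoint_family (piece k :: nat \<Rightarrow> 'a lset set)"
    unfolding piece_def by (rule disjoint_family_disjointed)
  have "(\<Union>j. {A \<in> FP. net_dist A j < 1 / real (Suc k)}) = (FP :: 'a lset set)"
  proof (intro equalityI subsetI)
    fix A :: "'a lset" assume A: "A \<in> FP"
    have "1 / real (Suc k) > 0" by simp
    from net_dist_small[OF A this] obtain j where "net_dist A j < 1 / real (Suc k)" .
    with A show "A \<in> (\<Union>j. {A \<in> FP. net_dist A j < 1 / real (Suc k)})" by blast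
  qed blast
  then show "(\<Union>j. piece k j) = (FP :: 'a lset set)"
    unfolding piece_def UN_disjointed_eq .
qed

lemma net_dist_piece:
  assumes "A \<in> piece k j"
  shows "A \<in> FP" "net_dist A j < 1 / real (Suc k)"
  using subsetD[OF disjointed_subset assms[unfolded piece_def]] by auto

section \<open>Atoms of point processes\<close>

lemma NsharpD:
  assumes "\<nu> \<in> Nsharp"
  shows "sets \<nu> = sets FP_borel" "U \<in> sets FP_borel \<Longrightarrow> emeasure \<nu> U > 0 \<Longrightarrow> emeasure \<nu> U \<ge> 1"
    "U \<in> B0 \<Longrightarrow> emeasure \<nu> U < \<infinity>"
proof -
  show "sets \<nu> = sets FP_borel" "U \<in> B0 \<Longrightarrow> emeasure \<nu> U < \<infinity>"
    using assms by (simp_all add: Nsharp_def)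
  show "emeasure \<nu> U \<ge> 1" if "U \<in> sets FP_borel" "emeasure \<nu> U > 0"
  proof -
    have "emeasure \<nu> U = \<infinity> \<or> (\<exists>n::nat. emeasure \<nu> U = of_nat n)"
      using assms that(1) by (simp add: Nsharp_def)
    then show ?thesis
    proof
      assume "\<exists>n::nat. emeasure \<nu> U = of_nat n"
      then obtain n :: nat where n: "emeasure \<nu> U = of_nat n" by blast
      then have "n \<noteq> 0" using that(2) by (intro notI) simp
      then have "of_nat 1 \<le> (of_nat n :: ennreal)" by (subst of_nat_le_iff) simp
      then show ?thesis using n by simp
    qed simp
  qed
qed

text \<open>Refining along ever finer partitions, some nested pieces keep positive and hence, by
  integrality, at least unit measure; their intersection is a single point.\<close>

lemma exists_atom:
  fixes \<nu> :: "'a::euclidean_space lset measure"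
  assumes \<nu>: "\<nu> \<in> Nsharp" and V: "V \<in> B0" "emeasure \<nu> V > 0"
  shows "\<exists>A\<in>V. A \<in> process_atoms \<nu>"
proof -
  note s = NsharpD(1)[OF \<nu>]
  have VF: "V \<subseteq> FP" using sets.sets_into_space[OF B0_sets[OF V(1)]] by (simp add: space_FP_borel)
  \<comment> \<open>At each stage \<open>SOME\<close> picks a piece that keeps positive measure; its
    existence is established in the induction for \<open>W\<close> below.\<close>
  define W where "W = rec_nat V (\<lambda>k W. W \<inter> piece k (SOME j. emeasure \<nu> (W \<inter> piece k j) > 0))"
  have W0: "W 0 = V" and WS: "W (Suc k) = W k \<inter> piece k (SOME j. emeasure \<nu> (W k \<inter> piece k j) > 0)"
      for k
    by (simp_all add: W_def)
  have W: "W k \<in> sets FP_borel \<and> W k \<subseteq> V \<and> emeasure \<nu> (W k) > 0" for k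
  proof (induction k)
    case 0
    then show ?case using V B0_sets by (simp add: W0)
  next
    case (Suc k)
    have "\<exists>j. emeasure \<nu> (W k \<inter> piece k j) > 0"
    proof (rule ccontr)
      assume "\<not> (\<exists>j. emeasure \<nu> (W k \<inter> piece k j) > 0)"
      then have z: "emeasure \<nu> (W k \<inter> piece k j) = 0" for j by simp
      have "W k = (\<Union>j. W k \<inter> piece k j)" using UN_piece[of k] Suc VF by blast
      moreover have "emeasure \<nu> (\<Union>j. W k \<inter> piece k j) = 0"
        using z Suc sets_piece s by (intro emeasure_UN_eq_0) auto
      ultimately show False using Suc by simp
    qed
    from someI_ex[OF this] show ?case
      using Suc sets_piece unfolding WS by blast
  qed
  have dec: "decseq W" by (rule decseq_SucI) (simp add: WS)
  \<comment> \<open>Continuity from above is justified because every \<open>W k\<close> lies in V, a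
    set from \<open>B0\<close> and hence of finite measure.\<close>
  have "(\<lambda>k. emeasure \<nu> (W k)) \<longlonglongrightarrow> emeasure \<nu> (\<Inter>k. W k)"
  proof (rule Lim_emeasure_decseq[OF _ dec])
    show "range W \<subseteq> sets \<nu>" using W s by blast
    show "emeasure \<nu> (W k) \<noteq> \<infinity>" for k
      using NsharpD(3)[OF \<nu> B0_subset[OF V(1)], of "W k"] W[of k] by auto
  qed
  moreover have "1 \<le> emeasure \<nu> (W k)" for k using NsharpD(2)[OF \<nu>] W[of k] by blast
  ultimately have ge: "1 \<le> emeasure \<nu> (\<Inter>k. W k)" by (intro LIMSEQ_le_const) auto
  then have "(\<Inter>k. W k) \<noteq> {}" by auto
  then obtain A where A: "\<And>k. A \<in> W k" by blast
  have "B = A" if B: "\<And>k. B \<in> W k" for B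
  proof (rule l1_dist_UNIV_eq_0)
    have AB: "A \<in> FP" "B \<in> FP" using A[of 0] B[of 0] VF by (auto simp: W0)
    then show "finite_volume A" "finite_volume B" by (auto intro: FP_finite_volume)
    have "l1_dist UNIV B A \<le> 2 / real (Suc k)" for k
    proof -
      obtain j where "A \<in> piece k j" "B \<in> piece k j"
        using A[of "Suc k"] B[of "Suc k"] unfolding WS by blast
      then have "net_dist A j < 1 / real (Suc k)" "net_dist B j < 1 / real (Suc k)"
        by (simp_all only: net_dist_piece(2))
      then have "l1_dist UNIV B A < 1 / real (Suc k) + 1 / real (Suc k)"
        using l1_dist_le_net[OF AB(2,1), of j] by linarith
      then show ?thesis by simp
    qed
    then have "l1_dist UNIV B A \<le> 0"
      by (intro LIMSEQ_le_const[OF mesh_tendsto_0]) auto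
    then show "l1_dist UNIV B A = 0" using l1_dist_nonneg[of UNIV B A] by linarith
  qed
  then have "(\<Inter>k. W k) = {A}" using A by blast
  then have "emeasure \<nu> {A} > 0" using ge by (metis less_le_trans zero_less_one)
  then show ?thesis using A[of 0] VF by (auto simp: W0 process_atoms_def)
qed

text \<open>A set outside the sigma-algebra has \<open>emeasure\<close> 0 by convention, so
  positivity already makes the singleton measurable; integrality then raises its mass to at least
  1.\<close>

lemma atom_sets:
  assumes "\<nu> \<in> Nsharp" "A \<in> process_atoms \<nu>"
  shows "A \<in> FP" "{A} \<in> sets FP_borel" "emeasure \<nu> {A} \<ge> 1"
proof -
  show "A \<in> FP" using assms(2) by (simp add: process_atoms_def)
  show s: "{A} \<in> sets FP_borel"
  proof (rule ccontr)
    assume "{A} \<notin> sets FP_borel"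
    then have "emeasure \<nu> {A} = 0" by (intro emeasure_notin_sets) (simp add: NsharpD(1)[OF assms(1)])
    then show False using assms(2) by (simp add: process_atoms_def)
  qed
  show "emeasure \<nu> {A} \<ge> 1"
    using NsharpD(2)[OF assms(1) s] assms(2) by (simp add: process_atoms_def)
qed

text \<open>Each atom has mass at least 1 and \<open>charging n\<close> has finite mass, so the
  cardinality of finite sets of such atoms is bounded.\<close>

lemma finite_atoms:
  assumes \<nu>: "\<nu> \<in> Nsharp"
  shows "finite (process_atoms \<nu> \<inter> charging n)"
proof -
  note s = NsharpD(1)[OF \<nu>]
  have fin: "emeasure \<nu> (charging n) < \<infinity>" by (rule NsharpD(3)[OF \<nu> charging_B0])
  obtain c :: nat where c: "emeasure \<nu> (charging n) \<le> of_nat c"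
    using ennreal_Ex_less_of_nat[of "emeasure \<nu> (charging n)"] fin by (auto intro: less_imp_le)
  have "finite (process_atoms \<nu> \<inter> charging n) \<and> card (process_atoms \<nu> \<inter> charging n) \<le> c"
  proof (rule finite_if_finite_subsets_card_bdd)
    fix G assume G: "G \<subseteq> process_atoms \<nu> \<inter> charging n" "finite G"
    have "of_nat (card G) = (\<Sum>A\<in>G. 1 :: ennreal)" by simp
    also have "\<dots> \<le> (\<Sum>A\<in>G. emeasure \<nu> {A})" using G atom_sets(3)[OF \<nu>] by (intro sum_mono) blast
    also have "\<dots> = emeasure \<nu> G"
    proof (rule emeasure_eq_sum_singleton[symmetric])
      show "{x} \<in> sets \<nu>" if "x \<in> G" for x using G atom_sets(2)[OF \<nu>] that s by blast
    qed (rule G)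
    also have "\<dots> \<le> emeasure \<nu> (charging n)"
      using G(1) B0_sets[OF charging_B0] s by (intro emeasure_mono) auto
    also have "\<dots> \<le> of_nat c" by (rule c)
    finally show "card G \<le> c" by simp
  qed
  then show ?thesis ..
qed

lemma atoms_cases:
  assumes "\<nu> \<in> Nsharp" "A \<in> process_atoms \<nu>" "A \<noteq> abs_lset {}"
  obtains n where "A \<in> process_atoms \<nu> \<inter> charging n"
  using not_charging_imp_empty[OF atom_sets(1)[OF assms(1,2)]] assms by blast

text \<open>The class of the empty set is adjoined by hand, being the only atom that may escape
  every \<open>charging n\<close>.\<close>

lemma countable_atoms:
  assumes \<nu>: "\<nu> \<in> Nsharp"
  shows "countable (process_atoms \<nu>)"
proof (rule countable_subset)
  show "process_atoms \<nu> \<subseteq> insert (abs_lset {}) (\<Union>n. process_atoms \<nu> \<inter> charging n)"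
    using atoms_cases[OF \<nu>] by blast
  show "countable (insert (abs_lset {}) (\<Union>n. process_atoms \<nu> \<inter> charging n))"
    by (intro countable_insert countable_UN[OF countableI_type] countable_finite finite_atoms \<nu>)
qed

lemma atoms_subset_FPloc: "process_atoms \<nu> \<subseteq> FPloc"
  using FP_FPloc by (auto simp: process_atoms_def)

lemma radon_atoms:
  fixes \<nu> :: "'a::euclidean_space lset measure"
  assumes \<nu>: "\<nu> \<in> Nsharp"
  shows "radon_measure (sum_measure (process_atoms \<nu>) perimeter_measure)"
proof -
  let ?m = "sum_measure (process_atoms \<nu>) perimeter_measure"
  have s: "sets (perimeter_measure A) = sets borel" if "A \<in> process_atoms \<nu>" for A
    using radon_perimeter_measure[OF subsetD[OF atoms_subset_FPloc that]] by (rule radon_measureD)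
  have ball: "emeasure ?m (cball 0 (real n)) < \<infinity>" for n
  proof -
    let ?f = "\<lambda>A. emeasure (perimeter_measure A) (cball (0::'a) (real n))"
    have eq: "{A \<in> process_atoms \<nu>. 0 < ?f A} = process_atoms \<nu> \<inter> charging n"
      by (auto simp: charging_def process_atoms_def)
    have "emeasure ?m (cball 0 (real n)) = (\<integral>\<^sup>+A. ?f A \<partial>count_space (process_atoms \<nu>))"
      using s by (intro emeasure_sum_measure) auto
    also have "\<dots> = (\<Sum>A\<in>process_atoms \<nu> \<inter> charging n. ?f A)"
      using finite_atoms[OF \<nu>, of n] eq nn_integral_count_space[of "process_atoms \<nu>" ?f] by simp
    also have "\<dots> < \<infinity>"
    proof -
      have "?f A < \<infinity>" if "A \<in> process_atoms \<nu> \<inter> charging n" for A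
        using that atoms_subset_FPloc by (intro radon_emeasure_bounded radon_perimeter_measure) auto
      then show ?thesis using finite_atoms[OF \<nu>, of n] by simp
    qed
    finally show ?thesis .
  qed
  show ?thesis
    unfolding radon_measure_def sets_sum_measure
  proof (intro conjI refl allI impI)
    fix K :: "'a set" assume "compact K"
    then obtain r where r: "K \<subseteq> ball 0 r" using bounded_subset_ballD[OF compact_imp_bounded, of K 0]
        by auto
    obtain n where "r \<le> real n" using real_arch_simple by blast
    then have "K \<subseteq> cball 0 (real n)" using r by auto
    then have "emeasure ?m K \<le> emeasure ?m (cball 0 (real n))"
      by (intro emeasure_mono) (auto simp: sets_sum_measure)
    with ball[of n] show "emeasure ?m K < \<infinity>" by (rule le_less_trans[rotated])
  qed
qed

lemma union_in_FPloc: "\<nu> \<in> Nsharp \<Longrightarrow> countable_union (process_atoms \<nu>) \<in> FPloc"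
  by (rule countable_union_in_FPloc[OF countable_atoms atoms_subset_FPloc refl radon_atoms])

section \<open>Measurability of the union\<close>

lemma space_Nsharp_algebra: "space Nsharp_algebra = Nsharp"
  unfolding Nsharp_algebra_def by (rule space_measure_of) blast

lemma measurable_emeasure_Nsharp:
  assumes "U \<in> B0"
  shows "(\<lambda>\<nu>. emeasure \<nu> U) \<in> borel_measurable Nsharp_algebra"
proof (rule measurableI)
  fix V :: "ennreal set" assume "V \<in> sets borel"
  then have "{\<nu> \<in> Nsharp. emeasure \<nu> U \<in> V} \<in> sets Nsharp_algebra"
    unfolding Nsharp_algebra_def using assms by (intro in_measure_of) blast+
  moreover have "(\<lambda>\<nu>. emeasure \<nu> U) -` V \<inter> space Nsharp_algebra = {\<nu> \<in> Nsharp. emeasure \<nu> U \<in> V}"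
    by (auto simp: space_Nsharp_algebra)
  ultimately show "(\<lambda>\<nu>. emeasure \<nu> U) -` V \<inter> space Nsharp_algebra \<in> sets Nsharp_algebra" by simp
qed simp

text \<open>Encoded by masses of sets from \<open>B0\<close>, which depend measurably on \<nu>;
  \<open>hit_indices_iff\<close> translates it into a statement about atoms.\<close>

definition hit_indices :: "nat \<Rightarrow> nat \<Rightarrow> 'a::euclidean_space lset measure \<Rightarrow> nat set" where
  "hit_indices n k \<nu> = {j. emeasure \<nu> (charging n \<inter> piece k j) > 0}"

lemma hit_B0: "charging n \<inter> piece k j \<in> B0"
  using charging_B0 B0_sets[OF charging_B0] sets_piece by (intro B0_subset[OF charging_B0] sets.Int)
      auto

text \<open>A set from \<open>B0\<close> of positive mass contains an atom by
  \<open>exists_atom\<close>; conversely, an atom passes its mass on to every Borel set containing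
  it.\<close>

lemma hit_indices_iff:
  assumes \<nu>: "\<nu> \<in> Nsharp"
  shows "j \<in> hit_indices n k \<nu> \<longleftrightarrow> (\<exists>A\<in>process_atoms \<nu> \<inter> charging n. A \<in> piece k j)"
proof
  assume "j \<in> hit_indices n k \<nu>"
  then have "0 < emeasure \<nu> (charging n \<inter> piece k j)" by (simp add: hit_indices_def)
  from exists_atom[OF \<nu> hit_B0 this] show "\<exists>A\<in>process_atoms \<nu> \<inter> charging n. A \<in> piece k j" by blast
next
  assume "\<exists>A\<in>process_atoms \<nu> \<inter> charging n. A \<in> piece k j"
  then obtain A where A: "A \<in> process_atoms \<nu>" "A \<in> charging n \<inter> piece k j" by blast
  have "emeasure \<nu> {A} \<le> emeasure \<nu> (charging n \<inter> piece k j)"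
    using A B0_sets[OF hit_B0] NsharpD(1)[OF \<nu>] by (intro emeasure_mono) auto
  then show "j \<in> hit_indices n k \<nu>"
    using A(1) by (auto simp: hit_indices_def process_atoms_def)
qed

lemma finite_hit_indices:
  assumes \<nu>: "\<nu> \<in> Nsharp"
  shows "finite (hit_indices n k \<nu>)"
proof -
  have "hit_indices n k \<nu> \<subseteq> (\<Union>A\<in>process_atoms \<nu> \<inter> charging n. {j. A \<in> piece k j})"
    unfolding subset_iff hit_indices_iff[OF \<nu>] by blast
  moreover have "finite {j. A \<in> piece k j}" for A :: "'a lset"
  proof (cases "\<exists>j. A \<in> piece k j")
    case True
    then obtain j where j: "A \<in> piece k j" by blast
    have "i = j" if "A \<in> piece k i" for i
      using piece_disjoint[of k] j that unfolding disjoint_family_on_def by blast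
    then have "{j. A \<in> piece k j} \<subseteq> {j}" by blast
    then show ?thesis by (rule finite_subset) simp
  qed simp
  ultimately show ?thesis
    using finite_atoms[OF \<nu>, of n] by (meson finite_UN finite_subset)
qed

text \<open>The empty set gets the empty representative, so that only atoms charging some ball matter.\<close>

definition proper_rep :: "'a::euclidean_space lset \<Rightarrow> 'a set" where
  "proper_rep A = (if A = abs_lset {} then {} else borel_rep A)"

lemma proper_rep: "proper_rep A \<in> sets borel" "abs_lset (proper_rep A) = A"
  by (simp_all add: proper_rep_def abs_borel_rep)

lemma net_dist_proper_rep: "net_dist A j = (\<integral>x. \<bar>indicat_real (proper_rep A) x - indicat_real
    (net_set j) x\<bar> \<partial>lborel)"
  using l1_dist_UNIV_abs[OF proper_rep(1) net_set(1), of A j] by (simp add: net_dist_eq proper_rep(2))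

lemma integrable_proper_rep: "A \<in> FP \<Longrightarrow> integrable lborel (indicat_real (proper_rep A))"
  using integrable_borel_rep[OF FP_finite_volume] by (auto simp: proper_rep_def)

lemma integrable_indicator_UN:
  assumes "finite F" "\<And>i. i \<in> F \<Longrightarrow> B i \<in> sets borel" "\<And>i. i \<in> F \<Longrightarrow> integrable lborel (indicat_real (B i))"
  shows "integrable lborel (indicat_real (\<Union>i\<in>F. B i :: 'a::euclidean_space set))"
proof (rule Bochner_Integration.integrable_bound)
  show "integrable lborel (\<lambda>x. \<Sum>i\<in>F. indicat_real (B i) x)"
    by (intro Bochner_Integration.integrable_sum assms(3))
  show "indicat_real (\<Union>i\<in>F. B i) \<in> borel_measurable lborel"
    using assms(1,2) by (intro borel_measurable_indicator) auto
  show "AE x in lborel. norm (indicat_real (\<Union>i\<in>F. B i) x) \<le> norm (\<Sum>i\<in>F. indicat_real (B i) x)"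
  proof (rule AE_I2)
    fix x
    show "norm (indicat_real (\<Union>i\<in>F. B i) x) \<le> norm (\<Sum>i\<in>F. indicat_real (B i) x)"
    proof (cases "\<exists>i\<in>F. x \<in> B i")
      case True
      then obtain i where i: "i \<in> F" "x \<in> B i" by blast
      have "indicat_real (B i) x \<le> (\<Sum>i\<in>F. indicat_real (B i) x)"
        by (rule member_le_sum[OF i(1) _ assms(1)]) simp
      then show ?thesis using i by (simp add: indicator_def)
    qed simp
  qed
qed

section \<open>Approximating the union by the net sets of hit pieces\<close>

context
  fixes f :: "'a::euclidean_space \<Rightarrow> real" and C :: real
  assumes f: "bounded_borel f" "\<And>x. \<bar>f x\<bar> \<le> C"
begin

definition union_integral :: "'i set \<Rightarrow> ('i \<Rightarrow> 'a set) \<Rightarrow> real" where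
  "union_integral I B = (\<integral>x. indicator (\<Union>i\<in>I. B i) x * f x \<partial>lborel)"

text \<open>Each atom in \<open>charging n\<close> is exchanged for the net set of its piece, at an
  L1 cost below 1/(k+1). Atoms in the same piece share a net set, which a union does not
  notice.\<close>

lemma net_union_close:
  fixes \<nu> :: "'a lset measure"
  assumes \<nu>: "\<nu> \<in> Nsharp"
  shows "\<bar>union_integral (process_atoms \<nu> \<inter> charging n) proper_rep - union_integral (hit_indices n k
      \<nu>) net_set\<bar>
    \<le> C * (real (card (process_atoms \<nu> \<inter> charging n)) / real (Suc k))"
proof -
  let ?F = "process_atoms \<nu> \<inter> charging n" and ?J = "hit_indices n k \<nu>"
  let ?X = "\<Union>A\<in>?F. proper_rep A" and ?Y = "\<Union>j\<in>?J. net_set j :: 'a set"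
  note fF = finite_atoms[OF \<nu>, of n] and fJ = finite_hit_indices[OF \<nu>, of n k]
  have FP: "A \<in> FP" if "A \<in> ?F" for A using that by (simp add: process_atoms_def)
  have "\<exists>j. A \<in> piece k j" if "A \<in> FP" for A :: "'a lset" using UN_piece[of k] that by blast
  then obtain h where h: "\<And>A :: 'a lset. A \<in> FP \<Longrightarrow> A \<in> piece k (h A)" by metis
  have X: "?X \<in> sets borel" "integrable lborel (indicat_real ?X)"
    using fF FP proper_rep(1) by (auto intro!: integrable_indicator_UN integrable_proper_rep)
  have Y: "?Y \<in> sets borel" "integrable lborel (indicat_real ?Y)"
    using fJ net_set by (auto intro!: integrable_indicator_UN)
  have C0: "C \<ge> 0" using f(2)[of 0] by linarith
  have i1: "integrable lborel (\<lambda>x. \<bar>indicat_real (proper_rep A) x - indicat_real (net_set (h A))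
      x\<bar>)" if "A \<in> ?F" for A
    by (intro integrable_abs Bochner_Integration.integrable_diff integrable_proper_rep FP[OF that]
        net_set)
  have "(\<integral>x. \<bar>indicat_real ?X x - indicat_real ?Y x\<bar> \<partial>lborel) \<le>
      (\<integral>x. (\<Sum>A\<in>?F. \<bar>indicat_real (proper_rep A) x - indicat_real (net_set (h A)) x\<bar>) \<partial>lborel)"
  proof (rule integral_mono)
    show "integrable lborel (\<lambda>x. \<bar>indicat_real ?X x - indicat_real ?Y x\<bar>)"
      by (intro integrable_abs Bochner_Integration.integrable_diff X Y)
    show "integrable lborel (\<lambda>x. \<Sum>A\<in>?F. \<bar>indicat_real (proper_rep A) x - indicat_real (net_set (h
        A)) x\<bar>)"
      by (intro Bochner_Integration.integrable_sum i1)
    fix x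
    show "\<bar>indicat_real ?X x - indicat_real ?Y x\<bar> \<le> (\<Sum>A\<in>?F. \<bar>indicat_real (proper_rep A) x -
        indicat_real (net_set (h A)) x\<bar>)"
    \<comment> \<open>If at x some atom differs from its net set, one summand equals 1. Otherwise x
      belongs to both unions or to neither.\<close>
    proof (cases "\<exists>A\<in>?F. (x \<in> proper_rep A) \<noteq> (x \<in> net_set (h A))")
      case True
      then obtain A where A: "A \<in> ?F" "(x \<in> proper_rep A) \<noteq> (x \<in> net_set (h A))" by blast
      have "\<bar>indicat_real ?X x - indicat_real ?Y x\<bar> \<le> 1" by (simp add: indicator_def)
      also have "1 = \<bar>indicat_real (proper_rep A) x - indicat_real (net_set (h A)) x\<bar>"
        using A(2) by (cases "x \<in> proper_rep A") auto
      also have "\<dots> \<le> (\<Sum>A\<in>?F. \<bar>indicat_real (proper_rep A) x - indicat_real (net_set (h A)) x\<bar>)"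
        by (rule member_le_sum[OF A(1) _ fF]) simp
      finally show ?thesis .
    next
      case False
      have "x \<in> ?X \<longleftrightarrow> x \<in> ?Y"
      proof
        assume "x \<in> ?X"
        then obtain A where A: "A \<in> ?F" "x \<in> proper_rep A" by blast
        have "h A \<in> ?J" using A(1) h[OF FP[OF A(1)]] hit_indices_iff[OF \<nu>] by blast
        then show "x \<in> ?Y" using False A by blast
      next
        assume "x \<in> ?Y"
        then obtain j where j: "j \<in> ?J" "x \<in> net_set j" by blast
        then obtain A where A: "A \<in> ?F" "A \<in> piece k j" using hit_indices_iff[OF \<nu>] by blast
        have "h A = j"
          using h[OF FP[OF A(1)]] A(2) piece_disjoint[of k] unfolding disjoint_family_on_def by blast
        then show "x \<in> ?X" using False A j by blast
      qed
      then have "indicat_real ?X x = indicat_real ?Y x" by (simp only: indicator_def)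
      then show ?thesis by (simp add: sum_nonneg)
    qed
  qed
  also have "\<dots> = (\<Sum>A\<in>?F. net_dist A (h A))"
    unfolding net_dist_proper_rep by (rule Bochner_Integration.integral_sum) (rule i1)
  also have "\<dots> \<le> (\<Sum>A\<in>?F. 1 / real (Suc k))"
    using net_dist_piece(2)[OF h[OF FP]] by (intro sum_mono less_imp_le) blast
  also have "\<dots> = real (card ?F) / real (Suc k)" by simp
  finally have "(\<integral>x. \<bar>indicat_real ?X x - indicat_real ?Y x\<bar> \<partial>lborel) \<le> real (card ?F) / real (Suc k)" .
  then have "C * (\<integral>x. \<bar>indicat_real ?X x - indicat_real ?Y x\<bar> \<partial>lborel) \<le> C * (real (card ?F) / real
      (Suc k))"
    by (rule mult_left_mono[OF _ C0])
  then show ?thesis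
    using lset_integral_l1_le[OF f X Y] unfolding union_integral_def by linarith
qed

text \<open>Truncated below N, the set of hit indices takes finitely many values, each on a
  measurable event. As the full set is finite, the truncation is eventually exact.\<close>

lemma net_union_measurable:
  "(\<lambda>\<nu>. union_integral (hit_indices n k \<nu>) (net_set :: nat \<Rightarrow> 'a set)) \<in> borel_measurable Nsharp_algebra"
proof (rule borel_measurable_LIMSEQ_real)
  let ?J = "\<lambda>\<nu>. hit_indices n k \<nu>"
  let ?u = "\<lambda>I. union_integral I (net_set :: nat \<Rightarrow> 'a set)"
  show "(\<lambda>N. ?u (?J \<nu> \<inter> {..<N})) \<longlonglongrightarrow> ?u (?J \<nu>)" if "\<nu> \<in> space Nsharp_algebra" for \<nu>
  proof (rule tendsto_eventually)
    have "finite (?J \<nu>)" using that finite_hit_indices by (simp add: space_Nsharp_algebra)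
    then obtain m where m: "?J \<nu> \<subseteq> {..<m}" using finite_nat_iff_bounded by blast
    show "\<forall>\<^sub>F N in sequentially. ?u (?J \<nu> \<inter> {..<N}) = ?u (?J \<nu>)"
      using eventually_ge_at_top[of m]
    proof eventually_elim
      case (elim N)
      then have "?J \<nu> \<inter> {..<N} = ?J \<nu>" using m by fastforce
      then show ?case by simp
    qed
  qed
  fix N
  have pos: "{\<nu> \<in> space Nsharp_algebra. j \<in> ?J \<nu>} \<in> sets Nsharp_algebra" for j
    using measurable_emeasure_Nsharp[OF hit_B0[of n k j]] unfolding hit_indices_def mem_Collect_eq
        by measurable
  have "?J \<nu> \<inter> {..<N} = I \<longleftrightarrow> (\<forall>j\<in>{..<N}. j \<in> ?J \<nu> \<longleftrightarrow> j \<in> I)" if "I \<in> Pow {..<N}" for I \<nu>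
    using that by blast
  then have ev: "{\<nu> \<in> space Nsharp_algebra. ?J \<nu> \<inter> {..<N} = I} \<in> sets Nsharp_algebra" if "I \<in> Pow
      {..<N}" for I
  proof -
    have "{\<nu> \<in> space Nsharp_algebra. \<forall>j\<in>{..<N}. j \<in> ?J \<nu> \<longleftrightarrow> j \<in> I} \<in> sets Nsharp_algebra"
    proof (rule sets.sets_Collect_finite_All)
      fix j
      show "{\<nu> \<in> space Nsharp_algebra. j \<in> ?J \<nu> \<longleftrightarrow> j \<in> I} \<in> sets Nsharp_algebra"
        using pos[of j] sets.sets_Collect_neg[OF pos[of j]] by (cases "j \<in> I") auto
    qed simp
    then show ?thesis using that by (simp only: \<open>\<And>I \<nu>. I \<in> Pow {..<N} \<Longrightarrow> (?J \<nu> \<inter> {..<N} = I) =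
        (\<forall>j\<in>{..<N}. (j \<in> ?J \<nu>) = (j \<in> I))\<close>)
  qed
  have "(\<lambda>\<nu>. \<Sum>I\<in>Pow {..<N}. indicator {\<nu> \<in> space Nsharp_algebra. ?J \<nu> \<inter> {..<N} = I} \<nu> * ?u I) \<in>
      borel_measurable Nsharp_algebra"
    using ev by (intro borel_measurable_sum borel_measurable_times borel_measurable_indicator
        borel_measurable_const)
  moreover have "?u (?J \<nu> \<inter> {..<N}) = (\<Sum>I\<in>Pow {..<N}. indicator {\<nu> \<in> space Nsharp_algebra. ?J \<nu> \<inter>
      {..<N} = I} \<nu> * ?u I)"
    if "\<nu> \<in> space Nsharp_algebra" for \<nu>
  proof -
    have "(\<Sum>I\<in>Pow {..<N}. indicator {\<nu> \<in> space Nsharp_algebra. ?J \<nu> \<inter> {..<N} = I} \<nu> * ?u I) =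
        (\<Sum>I\<in>Pow {..<N}. if I = ?J \<nu> \<inter> {..<N} then ?u (?J \<nu> \<inter> {..<N}) else 0)"
      using that by (intro sum.cong refl) (auto simp: indicator_def)
    also have "\<dots> = ?u (?J \<nu> \<inter> {..<N})" by (simp add: sum.delta)
    finally show ?thesis by simp
  qed
  ultimately show "(\<lambda>\<nu>. ?u (?J \<nu> \<inter> {..<N})) \<in> borel_measurable Nsharp_algebra"
    by (rule measurable_cong[THEN iffD2, rotated])
qed

text \<open>The nets are refined with the ball fixed; the error is C/(k+1) times the finite number
  of atoms in \<open>charging n\<close>.\<close>

lemma charging_union_measurable:
  "(\<lambda>\<nu>. union_integral (process_atoms \<nu> \<inter> charging n) (proper_rep :: 'a lset \<Rightarrow> 'a set)) \<in>
      borel_measurable Nsharp_algebra"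
proof (rule borel_measurable_LIMSEQ_real[OF _ net_union_measurable])
  fix \<nu> :: "'a lset measure" assume "\<nu> \<in> space Nsharp_algebra"
  then have \<nu>: "\<nu> \<in> Nsharp" by (simp add: space_Nsharp_algebra)
  let ?c = "real (card (process_atoms \<nu> \<inter> charging n))"
  have "(\<lambda>k. C * (?c / real (Suc k))) \<longlonglongrightarrow> C * 0"
    by (intro tendsto_mult tendsto_const LIMSEQ_Suc[OF lim_const_over_n])
  then have "(\<lambda>k. C * (?c / real (Suc k))) \<longlonglongrightarrow> 0" by simp
  then have "(\<lambda>k. union_integral (hit_indices n k \<nu>) net_set - union_integral (process_atoms \<nu> \<inter>
      charging n) proper_rep) \<longlonglongrightarrow> 0"
    by (rule Lim_null_comparison[rotated])
      (use net_union_close[OF \<nu>, of n] in \<open>simp add: abs_minus_commute del: of_nat_Suc\<close>)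
  then show "(\<lambda>k. union_integral (hit_indices n k \<nu>) net_set) \<longlonglongrightarrow> union_integral (process_atoms \<nu> \<inter>
      charging n) proper_rep"
    by (rule LIM_zero_cancel)
qed

text \<open>Now the ball grows. The partial unions increase to the union over all atoms, because
  \<open>proper_rep\<close> gives no points to the class of the empty set and every other atom lies
  in some \<open>charging n\<close>.\<close>

lemma union_integral_measurable:
  "(\<lambda>\<nu>. lset_integral (countable_union (process_atoms \<nu>)) f) \<in> borel_measurable Nsharp_algebra"
proof (rule borel_measurable_LIMSEQ_real[OF _ charging_union_measurable])
  fix \<nu> :: "'a lset measure" assume "\<nu> \<in> space Nsharp_algebra"
  then have \<nu>: "\<nu> \<in> Nsharp" by (simp add: space_Nsharp_algebra)
  let ?P = "process_atoms \<nu>"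
  define X where "X n = (\<Union>A\<in>?P \<inter> charging n. proper_rep A)" for n
  have Xb: "X n \<in> sets borel" for n
    unfolding X_def using finite_atoms[OF \<nu>, of n] proper_rep(1) by (intro sets.finite_UN) auto
  have "charging n \<subseteq> (charging m :: 'a lset set)" if "n \<le> m" for n m
  proof
    fix A :: "'a lset" assume A: "A \<in> charging n"
    have "emeasure (perimeter_measure A) (cball 0 (real n)) \<le> emeasure (perimeter_measure A) (cball
        0 (real m))"
      using A that radon_measureD(1)[OF radon_perimeter_measure[OF FP_FPloc, of A]]
      by (intro emeasure_mono) (auto simp: charging_def)
    then show "A \<in> charging m" using A by (auto simp: charging_def)
  qed
  then have inc: "incseq X"
    unfolding X_def incseq_def by (intro allI impI UN_mono Int_mono) auto
  have un: "(\<Union>n. X n) = (\<Union>A\<in>?P. proper_rep A)"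
  proof (intro equalityI subsetI)
    fix x assume "x \<in> (\<Union>A\<in>?P. proper_rep A)"
    then obtain A where A: "A \<in> ?P" "x \<in> proper_rep A" by blast
    then have "A \<noteq> abs_lset {}" by (auto simp: proper_rep_def)
    then obtain n where "A \<in> ?P \<inter> charging n" using atoms_cases[OF \<nu> A(1)] by blast
    then show "x \<in> (\<Union>n. X n)" using A(2) unfolding X_def by blast
  qed (auto simp: X_def)
  have ub: "(\<Union>A\<in>?P. proper_rep A) \<in> sets borel"
    unfolding un[symmetric] using Xb by auto
  have cu: "countable_union ?P = abs_lset (\<Union>A\<in>?P. proper_rep A)"
  proof (rule countable_union_eq[OF countable_atoms[OF \<nu>] _ proper_rep(2)])
    show "proper_rep A \<in> sets lebesgue" for A :: "'a lset"
      using proper_rep(1)[of A] by simp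
  qed
  have fm: "f \<in> borel_measurable borel" by (rule bounded_borelD[OF f(1)])
  have "(\<lambda>n. \<integral>x. indicator (X n) x * f x \<partial>lborel) \<longlonglongrightarrow> (\<integral>x. indicator (\<Union>A\<in>?P. proper_rep A) x * f x
      \<partial>lborel)"
  proof (rule integral_dominated_convergence)
    show "integrable lborel (\<lambda>x. \<bar>f x\<bar>)"
      by (intro bounded_borel_integrable radon_lborel bounded_borel_abs f)
    show "(\<lambda>x. indicator (\<Union>A\<in>?P. proper_rep A) x * f x) \<in> borel_measurable lborel"
      using ub fm by simp
    show "(\<lambda>x. indicator (X n) x * f x) \<in> borel_measurable lborel" for n using Xb fm by simp
    show "AE x in lborel. (\<lambda>n. indicator (X n) x * f x) \<longlonglongrightarrow> indicator (\<Union>A\<in>?P. proper_rep A) x * f x"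
      unfolding un[symmetric] by (intro AE_I2 tendsto_mult tendsto_const LIMSEQ_indicator_incseq inc)
    show "AE x in lborel. norm (indicator (X n) x * f x) \<le> \<bar>f x\<bar>" for n
      by (intro AE_I2) (simp add: indicator_def)
  qed
  then show "(\<lambda>n. union_integral (?P \<inter> charging n) proper_rep) \<longlonglongrightarrow> lset_integral (countable_union ?P) f"
    unfolding cu lset_integral_abs[OF ub fm] union_integral_def X_def .
qed

end

lemma measurable_union:
  "(\<lambda>\<nu>. countable_union (process_atoms \<nu>)) \<in> measurable Nsharp_algebra (FPloc_borel ::
      'a::euclidean_space lset measure)"
proof (rule set_measurable_imp_measurable)
  show "set_measurable Nsharp_algebra (\<lambda>\<nu>. countable_union (process_atoms \<nu>) :: 'a lset)"
    unfolding set_measurable_def space_Nsharp_algebra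
  proof (intro conjI ballI allI impI union_in_FPloc)
    fix f :: "'a \<Rightarrow> real" assume f: "bounded_borel f"
    obtain C where "\<And>x. \<bar>f x\<bar> \<le> C" using bounded_borel_bound[OF f] by blast
    from union_integral_measurable[OF f this]
    show "(\<lambda>\<nu>. lset_integral (countable_union (process_atoms \<nu>)) f) \<in> borel_measurable Nsharp_algebra" .
  qed
qed

section \<open>Translations\<close>

lemma image_translate_eq: "(\<lambda>x. x + z) ` B = {y. y - z \<in> B}" for z :: "'a::euclidean_space"
  by (auto simp: image_iff algebra_simps) (metis diff_add_cancel add.commute)

lemma borel_image_translate:
  fixes z :: "'a::euclidean_space"
  assumes "B \<in> sets borel"
  shows "(\<lambda>x. x + z) ` B \<in> sets borel"
proof -
  have "(\<lambda>y. y - z) -` B \<inter> space borel \<in> sets borel"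
    by (rule measurable_sets[OF _ assms]) simp
  moreover have "(\<lambda>y. y - z) -` B \<inter> space borel = (\<lambda>x. x + z) ` B"
    unfolding image_translate_eq by auto
  ultimately show ?thesis by simp
qed

lemma bounded_image_translate: "bounded B \<Longrightarrow> bounded ((\<lambda>x. x + z) ` B)" for z :: "'a::euclidean_space"
  using bounded_translation[of B z] by (simp add: add.commute)

lemma translate_abs: "B \<in> sets borel \<Longrightarrow> translate z (abs_lset B) = abs_lset ((\<lambda>x. x + z) ` B)"
  using translate.abs_eq[of B z] by (simp add: null_eq_def)

lemma translate_eq: "translate z A = abs_lset ((\<lambda>x. x + z) ` borel_rep A)"
  using translate_abs[OF borel_rep, of z A] by (simp add: abs_borel_rep)

lemma translate_translate: "translate z (translate w A) = translate (w + z) A"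
proof -
  have "(\<lambda>x. x + z) ` (\<lambda>x. x + w) ` borel_rep A = (\<lambda>x. x + (w + z)) ` borel_rep A"
    by (simp add: image_image add.assoc)
  then show ?thesis
    by (simp add: translate_eq[of w A] translate_abs[OF borel_image_translate[OF borel_rep]]
        translate_eq[of "w + z"])
qed

lemma translate_0: "translate 0 A = A"
  by (simp add: translate_eq abs_borel_rep)

lemma translate_inverse: "translate z (translate (- z) A) = A" "translate (- z) (translate z A) = A"
  by (simp_all add: translate_translate translate_0)

lemma indicator_image_translate:
  "indicat_real ((\<lambda>x. x + z) ` B) y = indicat_real B (y - z)" for z :: "'a::euclidean_space"
  unfolding image_translate_eq by (simp add: indicator_def)

lemma measurable_shift_fun:
  "f \<in> borel_measurable borel \<Longrightarrow> (\<lambda>x. f (x + z)) \<in> borel_measurable borel" for z :: "'a::euclidean_space"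
  by (rule measurable_compose[of "\<lambda>x. x + z" borel borel]) auto

lemma lset_integral_translate:
  fixes f :: "'a::euclidean_space \<Rightarrow> real"
  assumes f: "f \<in> borel_measurable borel"
  shows "lset_integral (translate z A) f = lset_integral A (\<lambda>x. f (x + z))"
proof -
  let ?B = "borel_rep A"
  have m: "(\<lambda>x. indicat_real ((\<lambda>x. x + z) ` ?B) x * f x) \<in> borel_measurable borel"
    using f borel_image_translate[OF borel_rep, of z A] by (intro borel_measurable_times
        borel_measurable_indicator)
  have "lset_integral (translate z A) f = (\<integral>x. indicator ((\<lambda>x. x + z) ` ?B) x * f x \<partial>lborel)"
    unfolding translate_eq by (rule lset_integral_abs[OF borel_image_translate[OF borel_rep] f])
  also have "\<dots> = (\<integral>x. indicator ((\<lambda>x. x + z) ` ?B) (x + z) * f (x + z) \<partial>lborel)"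
    by (rule lborel_integral_translate[OF m, symmetric])
  also have "\<dots> = lset_integral A (\<lambda>x. f (x + z))"
    unfolding lset_integral_eq[OF measurable_shift_fun[OF f]] by (simp add: indicator_image_translate)
  finally show ?thesis .
qed

text \<open>The image of a set function under the translation by z, written as evaluation on the set
  moved back so that it also covers vector measures.\<close>

definition translated :: "'a::euclidean_space \<Rightarrow> ('a set \<Rightarrow> 'b) \<Rightarrow> 'a set \<Rightarrow> 'b" where
  "translated z \<mu> E = \<mu> ((\<lambda>x. x + (- z)) ` E)"

lemma radon_distr_translate:
  fixes P :: "'a::euclidean_space measure"
  assumes P: "radon_measure P"
  shows "radon_measure (distr P borel (\<lambda>x. x + z))"
    and "E \<in> sets borel \<Longrightarrow> measure (distr P borel (\<lambda>x. x + z)) E = translated z (measure P) E"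
proof -
  have m: "(\<lambda>x. x + z) \<in> measurable P borel"
    using radon_measureD[OF P] by (simp cong: measurable_cong_sets)
  have vim: "(\<lambda>x. x + z) -` E \<inter> space P = (\<lambda>x. x + (- z)) ` E" for E
    unfolding image_translate_eq using radon_measureD(2)[OF P] by auto
  have em: "emeasure (distr P borel (\<lambda>x. x + z)) E = emeasure P ((\<lambda>x. x + (- z)) ` E)" if "E \<in> sets
      borel" for E
    using emeasure_distr[OF m that] unfolding vim .
  show "radon_measure (distr P borel (\<lambda>x. x + z))"
    unfolding radon_measure_def
  proof (intro conjI allI impI)
    fix K :: "'a set" assume "compact K"
    then show "emeasure (distr P borel (\<lambda>x. x + z)) K < \<infinity>"
      unfolding em[OF borel_compact[OF \<open>compact K\<close>]]
      by (intro radon_emeasure_bounded[OF P] bounded_image_translate compact_imp_bounded)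
  qed simp
  show "measure (distr P borel (\<lambda>x. x + z)) E = translated z (measure P) E" if "E \<in> sets borel"
    using em[OF that] by (simp add: measure_def translated_def)
qed

text \<open>The splitting that belongs to the test function x \<mapsto> \<phi> (x + z), pushed
  forward by the translation, splits the translated measure.\<close>

lemma is_derivative_translate:
  fixes A :: "'a::euclidean_space lset"
  assumes \<mu>: "is_derivative A \<mu>"
  shows "is_derivative (translate z A) (translated z \<mu>)"
  unfolding is_derivative_iff
proof (intro conjI ballI allI impI)
  have v: "vector_radon_measure \<mu>" using \<mu> by (simp add: is_derivative_iff)
  show "vector_radon_measure (translated z \<mu>)"
    unfolding vector_radon_measure_def
  proof (intro allI impI)
    fix E :: "nat \<Rightarrow> 'a set" assume E: "range E \<subseteq> sets borel" "disjoint_family E" "bounded (\<Union>n. E n)"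
    let ?E = "\<lambda>n. (\<lambda>x. x + (- z)) ` E n"
    have un: "(\<Union>n. ?E n) = (\<lambda>x. x + (- z)) ` (\<Union>n. E n)" by (rule image_UN[symmetric])
    have "(\<lambda>n. \<mu> (?E n)) sums \<mu> (\<Union>n. ?E n)"
    proof (rule vector_radon_sums[OF v])
      show "?E n \<in> sets borel" for n using E(1) by (intro borel_image_translate) auto
      show "disjoint_family ?E" using E(2) unfolding disjoint_family_on_def image_translate_eq by blast
      show "bounded (\<Union>n. ?E n)" unfolding un by (rule bounded_image_translate[OF E(3)])
    qed
    then show "(\<lambda>n. translated z \<mu> (E n)) sums translated z \<mu> (\<Union>n. E n)"
      unfolding translated_def un .
  qed
  fix b :: 'a and \<phi> :: "'a \<Rightarrow> real" assume b: "b \<in> Basis" and \<phi>: "test_function \<phi>"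
  let ?\<phi> = "\<lambda>x. \<phi> (x + z)"
  have \<phi>': "test_function ?\<phi>" using test_function_translate[OF \<phi>, of "- z"] by simp
  have fd: "frechet_derivative ?\<phi> (at x) b = frechet_derivative \<phi> (at (x + z)) b" for x
    using frechet_derivative_test_function_translate[OF \<phi>, of "- z" x] by simp
  have "has_signed_integral (\<lambda>E. \<mu> E \<bullet> b) ?\<phi> (- lset_integral A (\<lambda>x. frechet_derivative ?\<phi> (at x) b))"
    using \<mu> b \<phi>' by (simp add: is_derivative_iff)
  then obtain P N where PN: "radon_measure P" "radon_measure N"
    "\<forall>E\<in>sets borel. bounded E \<longrightarrow> \<mu> E \<bullet> b = measure P E - measure N E"
    "- lset_integral A (\<lambda>x. frechet_derivative ?\<phi> (at x) b) = (\<integral>x. \<phi> (x + z) \<partial>P) - (\<integral>x. \<phi> (x + z) \<partial>N)"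
    unfolding has_signed_integral_def by blast
  show "has_signed_integral (\<lambda>E. translated z \<mu> E \<bullet> b) \<phi> (- lset_integral (translate z A) (\<lambda>x.
      frechet_derivative \<phi> (at x) b))"
    unfolding has_signed_integral_def
  proof (intro exI conjI ballI impI)
    show "radon_measure (distr P borel (\<lambda>x. x + z))" "radon_measure (distr N borel (\<lambda>x. x + z))"
      by (rule radon_distr_translate PN)+
    fix E :: "'a set" assume E: "E \<in> sets borel" "bounded E"
    have "\<mu> ((\<lambda>x. x + (- z)) ` E) \<bullet> b = measure P ((\<lambda>x. x + (- z)) ` E) - measure N ((\<lambda>x. x + (- z))
        ` E)"
      using PN(3) borel_image_translate[OF E(1)] bounded_image_translate[OF E(2)] by blast
    then show "translated z \<mu> E \<bullet> b = measure (distr P borel (\<lambda>x. x + z)) E - measure (distr N borel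
        (\<lambda>x. x + z)) E"
      unfolding radon_distr_translate(2)[OF PN(1) E(1)] radon_distr_translate(2)[OF PN(2) E(1)]
          translated_def .
  next
    have "(\<integral>x. \<phi> x \<partial>distr Q borel (\<lambda>x. x + z)) = (\<integral>x. \<phi> (x + z) \<partial>Q)" if "radon_measure Q" for Q
      using radon_measureD[OF that] bounded_borelD(1)[OF bounded_borel_test[OF \<phi>]]
      by (intro integral_distr) (simp_all cong: measurable_cong_sets)
    then show "- lset_integral (translate z A) (\<lambda>x. frechet_derivative \<phi> (at x) b) =
        (\<integral>x. \<phi> x \<partial>distr P borel (\<lambda>x. x + z)) - (\<integral>x. \<phi> x \<partial>distr N borel (\<lambda>x. x + z))"
      using PN(4) lset_integral_translate[OF bounded_borelD(1)[OF bounded_borel_test_derivative[OF \<phi>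
          b]], of z A]
      by (simp add: PN(1,2) fd)
  qed
qed

lemma translate_FPloc: "A \<in> FPloc \<Longrightarrow> translate z A \<in> FPloc"
  using is_derivative_translate unfolding FPloc_def by blast

text \<open>Partitions move along with the set. The reverse inequality is this one with -z in place
  of z.\<close>

lemma variation_translated_le:
  fixes \<mu> :: "'a::euclidean_space set \<Rightarrow> 'a"
  shows "variation (translated z \<mu>) E \<le> variation \<mu> ((\<lambda>x. x + (- z)) ` E)"
  unfolding variation_eq[of "translated z \<mu>"]
proof (rule SUP_least)
  fix F assume F: "F \<in> bounded_partitions E"
  note FD = bounded_partitionsD[OF F]
  let ?F = "\<lambda>h. (\<lambda>x. x + (- z)) ` F h"
  have "?F \<in> bounded_partitions ((\<lambda>x. x + (- z)) ` E)"
    unfolding bounded_partitions_def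
  proof (intro CollectI conjI allI)
    show "range ?F \<subseteq> sets borel" using borel_image_translate[OF FD(1)] by blast
    show "bounded (?F h)" for h by (rule bounded_image_translate[OF FD(2)])
    show "disjoint_family ?F" using FD(3) unfolding disjoint_family_on_def image_translate_eq by blast
    show "(\<Union>h. ?F h) = (\<lambda>x. x + (- z)) ` E" unfolding FD(4)[symmetric] by (rule image_UN[symmetric])
  qed
  then show "(\<Sum>h. ennreal (norm (translated z \<mu> (F h)))) \<le> variation \<mu> ((\<lambda>x. x + (- z)) ` E)"
    unfolding variation_eq translated_def by (rule SUP_upper)
qed

lemma translated_inverse: "translated (- z) (translated z \<mu>) = \<mu>"
  by (simp add: translated_def fun_eq_iff image_image)

lemma variation_translated:
  fixes \<mu> :: "'a::euclidean_space set \<Rightarrow> 'a"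
  shows "variation (translated z \<mu>) E = variation \<mu> ((\<lambda>x. x + (- z)) ` E)"
proof (rule antisym[OF variation_translated_le])
  show "variation \<mu> ((\<lambda>x. x + (- z)) ` E) \<le> variation (translated z \<mu>) E"
    using variation_translated_le[of "- z" "translated z \<mu>" "(\<lambda>x. x + (- z)) ` E"]
    unfolding translated_inverse by (simp add: image_image)
qed

text \<open>The pieces of the partitions are bounded Borel sets, so the variation sees no other
  values.\<close>

lemma variation_cong:
  assumes "\<And>E. E \<in> sets borel \<Longrightarrow> bounded E \<Longrightarrow> \<mu> E = \<nu> E"
  shows "variation \<mu> E = variation \<nu> E"
  unfolding variation_eq
proof (rule SUP_cong[OF refl])
  fix F assume "F \<in> bounded_partitions E"
  then have "\<mu> (F h) = \<nu> (F h)" for h by (intro assms bounded_partitionsD)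
  then show "(\<Sum>h. ennreal (norm (\<mu> (F h)))) = (\<Sum>h. ennreal (norm (\<nu> (F h))))" by (simp only:)
qed

text \<open>The derivatives of A and of its translate are chosen independently. By
  \<open>is_derivative_unique\<close> the latter agrees with the translate of the former on bounded
  Borel sets, which determine the variation.\<close>

lemma perimeter_measure_translate:
  assumes A: "A \<in> FPloc" and E: "E \<in> sets borel"
  shows "emeasure (perimeter_measure (translate z A)) E = emeasure (perimeter_measure A) ((\<lambda>x. x +
      (- z)) ` E)"
proof -
  note d = is_derivative_derivative_measure[OF A]
  note dz = is_derivative_derivative_measure[OF translate_FPloc[OF A, of z]]
  have v: "vector_radon_measure (derivative_measure A)" "vector_radon_measure (derivative_measure
      (translate z A))"
    using d dz by (simp_all add: is_derivative_iff)
  have "emeasure (perimeter_measure (translate z A)) E = variation (derivative_measure (translate z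
      A)) E"
    unfolding perimeter_measure_eq by (rule emeasure_variation_measure[OF v(2) E])
  also have "\<dots> = variation (translated z (derivative_measure A)) E"
    by (rule variation_cong) (rule is_derivative_unique[OF dz is_derivative_translate[OF d]])
  also have "\<dots> = variation (derivative_measure A) ((\<lambda>x. x + (- z)) ` E)"
    by (rule variation_translated)
  also have "\<dots> = emeasure (perimeter_measure A) ((\<lambda>x. x + (- z)) ` E)"
    unfolding perimeter_measure_eq by (rule emeasure_variation_measure[OF v(1)
        borel_image_translate[OF E], symmetric])
  finally show ?thesis .
qed

lemma perimeter_measure_translate_UNIV:
  assumes "A \<in> FPloc"
  shows "emeasure (perimeter_measure (translate z A)) UNIV = emeasure (perimeter_measure A) UNIV"
proof -
  have "(\<lambda>x. x + (- z)) ` UNIV = UNIV" unfolding image_translate_eq by simp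
  then show ?thesis using perimeter_measure_translate[OF assms, of UNIV z] by simp
qed

lemma translate_FP:
  assumes A: "A \<in> FP"
  shows "translate z A \<in> FP"
proof -
  have "integrable lborel (indicat_real ((\<lambda>x. x + z) ` borel_rep A))"
  proof -
    have "integrable (distr lborel borel ((+) z)) (indicat_real ((\<lambda>x. x + z) ` borel_rep A)) \<longleftrightarrow>
        integrable lborel (\<lambda>x. indicat_real ((\<lambda>x. x + z) ` borel_rep A) (z + x))"
      by (rule integrable_distr_eq) (auto intro!: borel_measurable_indicator borel_image_translate)
    then show ?thesis
      using integrable_borel_rep[OF FP_finite_volume[OF A]] by (simp add: lborel_distr_plus
          indicator_image_translate)
  qed
  then have "finite_volume (translate z A)"
    unfolding translate_eq by (intro finite_volume_abs borel_image_translate borel_rep)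
  then show ?thesis
    using A translate_FPloc[OF FP_FPloc[OF A], of z] perimeter_measure_translate_UNIV[of A z] by
        (simp add: FP_def)
qed

lemma l1_dist_UNIV_translate: "l1_dist UNIV (translate z A) (translate z B) = l1_dist UNIV A B"
proof -
  have m: "(\<lambda>x. \<bar>indicat_real ((\<lambda>x. x + z) ` borel_rep A) x - indicat_real ((\<lambda>x. x + z) ` borel_rep
      B) x\<bar>) \<in> borel_measurable borel"
    by (intro borel_measurable_abs borel_measurable_diff borel_measurable_indicator
        borel_image_translate borel_rep)
  have "l1_dist UNIV (translate z A) (translate z B) =
      (\<integral>x. \<bar>indicat_real ((\<lambda>x. x + z) ` borel_rep A) x - indicat_real ((\<lambda>x. x + z) ` borel_rep B) x\<bar>
          \<partial>lborel)"
    unfolding translate_eq by (rule l1_dist_UNIV_abs[OF borel_image_translate[OF borel_rep]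
        borel_image_translate[OF borel_rep]])
  also have "\<dots> = l1_dist UNIV A B"
    unfolding l1_dist_UNIV_borel_rep
    by (subst lborel_integral_translate[OF m, of z, symmetric]) (simp add: indicator_image_translate)
  finally show ?thesis .
qed

lemma strict_dist_translate:
  assumes "A \<in> FP" "B \<in> FP"
  shows "strict_dist (translate z A) (translate z B) = strict_dist A B"
  using perimeter_measure_translate_UNIV[OF FP_FPloc[OF assms(1)], of z]
      perimeter_measure_translate_UNIV[OF FP_FPloc[OF assms(2)], of z]
  by (simp add: strict_dist_def perimeter_def measure_def l1_dist_UNIV_translate)

text \<open>A translation is an isometry for the strict metric, so preimages of open sets are
  open.\<close>

lemma measurable_translate_FP: "translate z \<in> measurable FP_borel (FP_borel :: 'a::euclidean_space
    lset measure)"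
proof (subst (2) FP_borel_def, rule measurable_measure_of)
  show "{U :: 'a lset set. openin strict_topology U} \<subseteq> Pow FP"
    unfolding openin_strict_topology by blast
  show "translate z \<in> space FP_borel \<rightarrow> (FP :: 'a lset set)"
    using translate_FP by (auto simp: space_FP_borel)
  fix U :: "'a lset set" assume "U \<in> {U. openin strict_topology U}"
  then have U: "U \<subseteq> FP" "\<And>A. A \<in> U \<Longrightarrow> \<exists>r>0. \<forall>B\<in>FP. strict_dist A B < r \<longrightarrow> B \<in> U"
    by (simp_all add: openin_strict_topology)
  have "openin strict_topology (translate z -` U \<inter> FP)"
    unfolding openin_strict_topology
  proof (intro conjI ballI)
    fix A assume A: "A \<in> translate z -` U \<inter> FP"
    then obtain r where r: "r > 0" "\<And>B. B \<in> FP \<Longrightarrow> strict_dist (translate z A) B < r \<Longrightarrow> B \<in> U"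
      using U(2)[of "translate z A"] by blast
    have "B \<in> translate z -` U \<inter> FP" if B: "B \<in> FP" "strict_dist A B < r" for B
      using r(2)[OF translate_FP[OF B(1)]] strict_dist_translate[of A B z] A B by simp
    with r(1) show "\<exists>r>0. \<forall>B\<in>FP. strict_dist A B < r \<longrightarrow> B \<in> translate z -` U \<inter> FP" by blast
  qed simp
  then show "translate z -` U \<inter> space FP_borel \<in> sets FP_borel"
    unfolding space_FP_borel by (rule open_in_FP_borel)
qed

section \<open>Measurability of translations for the locally strict topology\<close>

lemma lset_integral_loc_l1_le:
  fixes f :: "'a::euclidean_space \<Rightarrow> real"
  assumes f: "bounded_borel f" "\<And>x. \<bar>f x\<bar> \<le> C" and K: "compact K" "\<And>x. f x \<noteq> 0 \<Longrightarrow> x \<in> K"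
  shows "\<bar>lset_integral A f - lset_integral B f\<bar> \<le> C * l1_dist K A B"
proof -
  have Kb: "K \<in> sets borel" using K(1) by (rule borel_compact)
  have bK: "bounded_borel (indicat_real K)"
    by (rule bounded_borel_indicator[OF Kb compact_imp_bounded[OF K(1)]])
  have l1: "l1_dist K A B = (\<integral>x. indicator K x * \<bar>indicat_real (borel_rep A) x - indicat_real
      (borel_rep B) x\<bar> \<partial>lborel)"
    using l1_dist_abs[OF borel_rep borel_rep, of K A B] Kb
    by (simp add: abs_borel_rep set_lebesgue_integral_def integral_completion)
  have i: "integrable lborel (\<lambda>x. indicator K x * \<bar>indicat_real (borel_rep A) x - indicat_real
      (borel_rep B) x\<bar>)"
    by (intro bounded_borel_integrable[OF radon_lborel] bounded_borel_mult[OF bK, of _ 1]) (auto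
        simp: indicator_def)
  have "\<bar>lset_integral A f - lset_integral B f\<bar> = \<bar>\<integral>x. indicator (borel_rep A) x * f x - indicator
      (borel_rep B) x * f x \<partial>lborel\<bar>"
    unfolding lset_integral_eq[OF bounded_borelD(1)[OF f(1)]]
    by (subst Bochner_Integration.integral_diff[OF integrable_lset[OF f(1)] integrable_lset[OF
        f(1)]]) simp
  also have "\<dots> \<le> (\<integral>x. \<bar>indicator (borel_rep A) x * f x - indicator (borel_rep B) x * f x\<bar> \<partial>lborel)"
    by (rule integral_abs_bound)
  also have "\<dots> \<le> (\<integral>x. C * (indicator K x * \<bar>indicat_real (borel_rep A) x - indicat_real (borel_rep
      B) x\<bar>) \<partial>lborel)"
  proof (rule integral_mono)
    show "integrable lborel (\<lambda>x. \<bar>indicator (borel_rep A) x * f x - indicator (borel_rep B) x * f x\<bar>)"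
      by (intro integrable_abs Bochner_Integration.integrable_diff integrable_lset f)
    show "integrable lborel (\<lambda>x. C * (indicator K x * \<bar>indicat_real (borel_rep A) x - indicat_real
        (borel_rep B) x\<bar>))"
      by (intro integrable_mult_right i)
    show "\<bar>indicator (borel_rep A) x * f x - indicator (borel_rep B) x * f x\<bar> \<le>
        C * (indicator K x * \<bar>indicat_real (borel_rep A) x - indicat_real (borel_rep B) x\<bar>)" for x
      using f(2)[of x] K(2)[of x] by (cases "f x = 0") (auto simp: indicator_def)
  qed
  also have "\<dots> = C * l1_dist K A B" unfolding l1 by simp
  finally show ?thesis .
qed

text \<open>Volume integrals are continuous for the local L1 distances. Together with
  \<open>set_measurable_imp_measurable\<close>, this reduces the measurability of a map between sets
  to that of volume integrals.\<close>

lemma set_measurable_FPloc: "set_measurable (FPloc_borel :: 'a::euclidean_space lset measure) (\<lambda>A. A)"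
  unfolding set_measurable_def space_FPloc_borel
proof (intro conjI ballI allI impI)
  fix f :: "'a \<Rightarrow> real" assume f: "bounded_borel f"
  obtain C where C: "C > 0" "\<And>x. \<bar>f x\<bar> \<le> C" using bounded_borel_bound[OF f] by blast
  define K where "K = closure {x. f x \<noteq> 0}"
  have K: "compact K" "\<And>x. f x \<noteq> 0 \<Longrightarrow> x \<in> K"
    using bounded_borelD(2)[OF f] closure_subset[of "{x. f x \<noteq> 0}"] by (auto simp: K_def)
  show "(\<lambda>A. lset_integral A f) \<in> borel_measurable FPloc_borel"
  proof (rule borel_measurableI)
    fix V :: "real set" assume V: "open V"
    have "openin loc_strict_topology ((\<lambda>A. lset_integral A f) -` V \<inter> FPloc)"
    proof (subst openin_subopen, intro ballI)
      fix A assume A: "A \<in> (\<lambda>A. lset_integral A f) -` V \<inter> FPloc"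
      then obtain e where e: "e > 0" "\<And>y. \<bar>y - lset_integral A f\<bar> < e \<Longrightarrow> y \<in> V"
        using V unfolding open_dist dist_real_def by auto
      have e': "e / C > 0" using e C by simp
      let ?T = "{B \<in> FPloc. l1_dist K B A < e / C}"
      have "openin loc_strict_topology ?T"
        using A e' by (intro openin_loc_strict_l1 K) auto
      moreover have "A \<in> ?T" using A e' by (simp add: l1_dist_self)
      moreover have "?T \<subseteq> (\<lambda>A. lset_integral A f) -` V \<inter> FPloc"
      proof
        fix B assume B: "B \<in> ?T"
        have "\<bar>lset_integral B f - lset_integral A f\<bar> \<le> C * l1_dist K B A"
          by (rule lset_integral_loc_l1_le[OF f C(2) K])
        also have "\<dots> < e" using B C(1) by (simp add: field_simps)
        finally show "B \<in> (\<lambda>A. lset_integral A f) -` V \<inter> FPloc" using e(2) B by simp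
      qed
      ultimately show "\<exists>T. openin loc_strict_topology T \<and> A \<in> T \<and> T \<subseteq> (\<lambda>A. lset_integral A f) -` V \<inter>
          FPloc"
        by blast
    qed
    then show "(\<lambda>A. lset_integral A f) -` V \<inter> space FPloc_borel \<in> sets FPloc_borel"
      unfolding space_FPloc_borel unfolding FPloc_borel_def
      using openin_subset topspace_loc_strict by (intro in_measure_of) blast+
  qed
qed simp

lemma bounded_borel_translate:
  fixes f :: "'a::euclidean_space \<Rightarrow> real"
  assumes f: "bounded_borel f"
  shows "bounded_borel (\<lambda>x. f (x + z))"
proof -
  obtain C where C: "\<And>x. \<bar>f x\<bar> \<le> C" using bounded_borel_bound[OF f] by blast
  have "{x. f (x + z) \<noteq> 0} = (\<lambda>x. x + (- z)) ` {x. f x \<noteq> 0}"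
    unfolding image_translate_eq by simp
  then have "bounded {x. f (x + z) \<noteq> 0}"
    by (simp only: bounded_image_translate[OF bounded_borelD(2)[OF f]])
  with C show ?thesis
    by (intro bounded_borelI[of _ C] measurable_shift_fun bounded_borelD(1)[OF f])
qed

text \<open>An integral over a translate is the integral of a shifted function over the original
  set, so the criterion by volume integrals applies.\<close>

lemma measurable_translate_FPloc: "translate z \<in> measurable FPloc_borel (FPloc_borel ::
    'a::euclidean_space lset measure)"
proof (rule set_measurable_imp_measurable)
  show "set_measurable FPloc_borel (translate z :: 'a lset \<Rightarrow> 'a lset)"
    unfolding set_measurable_def space_FPloc_borel
  proof (intro conjI ballI allI impI translate_FPloc)
    fix f :: "'a \<Rightarrow> real" assume f: "bounded_borel f"
    show "(\<lambda>A. lset_integral (translate z A) f) \<in> borel_measurable FPloc_borel"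
      unfolding lset_integral_translate[OF bounded_borelD(1)[OF f]]
      by (rule set_measurable_integralD[OF set_measurable_FPloc bounded_borel_translate[OF f]])
  qed
qed

text \<open>Shifted representatives of the members serve as representatives of the translates, which
  \<open>countable_union_eq\<close> permits for a countable family.\<close>

lemma countable_union_translate:
  assumes S: "countable S"
  shows "countable_union (translate z ` S) = translate z (countable_union S)"
proof -
  let ?r = "\<lambda>A. (\<lambda>x. x + z) ` borel_rep (translate (- z) A)"
  have "countable_union (translate z ` S) = abs_lset (\<Union>A\<in>translate z ` S. ?r A)"
  proof (rule countable_union_eq)
    show "countable (translate z ` S)" using S by simp
    show "?r A \<in> sets lebesgue" for A using borel_image_translate[OF borel_rep, of z "translate (-
        z) A"] by simp
    show "abs_lset (?r A) = A" for A
      unfolding translate_eq[symmetric] by (rule translate_inverse)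
  qed
  also have "(\<Union>A\<in>translate z ` S. ?r A) = (\<lambda>x. x + z) ` (\<Union>A\<in>S. borel_rep A)"
    by (simp add: translate_inverse image_UN)
  also have "abs_lset \<dots> = translate z (countable_union S)"
    unfolding countable_union_borel_rep[OF S] using S by (intro translate_abs[symmetric]
        sets.countable_UN') auto
  finally show ?thesis .
qed

section \<open>Shifts of point processes\<close>

lemma sets_translate_vimage: "U \<in> sets FP_borel \<Longrightarrow> translate z -` U \<inter> FP \<in> sets FP_borel"
  using measurable_sets[OF measurable_translate_FP] by (simp add: space_FP_borel)

lemma emeasure_shift:
  assumes "\<nu> \<in> Nsharp" "U \<in> sets FP_borel"
  shows "emeasure (shift z \<nu>) U = emeasure \<nu> (translate z -` U \<inter> FP)"
proof -
  note s = NsharpD(1)[OF assms(1)]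
  have "translate z \<in> measurable \<nu> FP_borel"
    using measurable_translate_FP[of z] by (simp add: measurable_cong_sets[OF s refl])
  moreover have "space \<nu> = FP"
    using sets_eq_imp_space_eq[OF s] by (simp add: space_FP_borel)
  ultimately show ?thesis
    unfolding shift_def using assms(2) by (simp add: emeasure_distr)
qed

text \<open>The compact set charged by the members of U moves along: K becomes K - z.\<close>

lemma translate_vimage_B0:
  fixes U :: "'a::euclidean_space lset set"
  assumes U: "U \<in> B0"
  shows "translate z -` U \<inter> FP \<in> B0"
proof -
  obtain K where K: "compact K" "\<And>A. A \<in> U \<Longrightarrow> emeasure (perimeter_measure A) K > 0"
    using U unfolding B0_def by blast
  have Kz: "compact ((\<lambda>x. x + (- z)) ` K)"
    using compact_translation[OF K(1), of "- z"] by (simp add: add.commute)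
  have "emeasure (perimeter_measure A) ((\<lambda>x. x + (- z)) ` K) > 0" if "A \<in> translate z -` U \<inter> FP" for A
    using K(2)[of "translate z A"] that perimeter_measure_translate[OF FP_FPloc borel_compact[OF
        K(1)], of A z] by simp
  with Kz sets_translate_vimage[OF B0_sets[OF U], of z] show ?thesis
    unfolding B0_def by blast
qed

lemma shift_Nsharp:
  assumes \<nu>: "\<nu> \<in> Nsharp"
  shows "shift z \<nu> \<in> Nsharp"
  unfolding Nsharp_def
proof (intro CollectI conjI ballI)
  show "sets (shift z \<nu>) = sets FP_borel" by (simp add: shift_def)
  show "emeasure (shift z \<nu>) U = \<infinity> \<or> (\<exists>n::nat. emeasure (shift z \<nu>) U = of_nat n)" if "U \<in> sets
      FP_borel" for U
    using \<nu> sets_translate_vimage[OF that, of z] unfolding emeasure_shift[OF \<nu> that] Nsharp_def by blast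
  show "emeasure (shift z \<nu>) U < \<infinity>" if "U \<in> B0" for U
    unfolding emeasure_shift[OF \<nu> B0_sets[OF that]] by (rule NsharpD(3)[OF \<nu> translate_vimage_B0[OF
        that]])
qed

lemma measurable_shift: "shift z \<in> measurable Nsharp_algebra (Nsharp_algebra :: 'a::euclidean_space
    lset measure measure)"
proof (subst (2) Nsharp_algebra_def, rule measurable_measure_of)
  show "{{\<nu> \<in> Nsharp. emeasure \<nu> U \<in> V} | U V. U \<in> B0 \<and> V \<in> sets borel} \<subseteq> Pow (Nsharp :: 'a lset
      measure set)"
    by blast
  show "shift z \<in> space Nsharp_algebra \<rightarrow> (Nsharp :: 'a lset measure set)"
    using shift_Nsharp by (auto simp: space_Nsharp_algebra)
  fix W :: "'a lset measure set" assume "W \<in> {{\<nu> \<in> Nsharp. emeasure \<nu> U \<in> V} | U V. U \<in> B0 \<and> V \<in>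
      sets borel}"
  then obtain U V where W: "W = {\<nu> \<in> Nsharp. emeasure \<nu> U \<in> V}" and U: "U \<in> B0" and V: "V \<in> sets borel"
    by blast
  have "shift z -` W \<inter> space Nsharp_algebra = (\<lambda>\<nu>. emeasure \<nu> (translate z -` U \<inter> FP)) -` V \<inter> space
      Nsharp_algebra"
    unfolding W space_Nsharp_algebra using emeasure_shift[OF _ B0_sets[OF U]] shift_Nsharp by auto
  also have "\<dots> \<in> sets Nsharp_algebra"
    by (rule measurable_sets[OF measurable_emeasure_Nsharp[OF translate_vimage_B0[OF U]] V])
  finally show "shift z -` W \<inter> space Nsharp_algebra \<in> sets Nsharp_algebra" .
qed

lemma translate_vimage_singleton: "A \<in> FP \<Longrightarrow> translate z -` {A} \<inter> FP = {translate (- z) A}"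
  using translate_inverse[of z] translate_FP[of A "- z"] by auto

lemma process_atoms_shift:
  assumes \<nu>: "\<nu> \<in> Nsharp"
  shows "process_atoms (shift z \<nu>) = translate z ` process_atoms \<nu>"
proof (intro equalityI subsetI)
  fix A assume A: "A \<in> process_atoms (shift z \<nu>)"
  note s = atom_sets(1,2)[OF shift_Nsharp[OF \<nu>] A]
  have "emeasure \<nu> {translate (- z) A} = emeasure (shift z \<nu>) {A}"
    unfolding emeasure_shift[OF \<nu> s(2)] translate_vimage_singleton[OF s(1)] ..
  then have "translate (- z) A \<in> process_atoms \<nu>"
    using A translate_FP[OF s(1)] by (simp add: process_atoms_def)
  then show "A \<in> translate z ` process_atoms \<nu>"
    using translate_inverse(1)[of z A] by (metis imageI)
next
  fix B assume "B \<in> translate z ` process_atoms \<nu>"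
  then obtain A where A: "A \<in> process_atoms \<nu>" "B = translate z A" by blast
  note s = atom_sets(1,2)[OF \<nu> A(1)]
  \<comment> \<open>Presented as a preimage under a translation, the singleton is seen to be a Borel
    set, as \<open>emeasure_shift\<close> requires.\<close>
  have "{B} = translate (- z) -` {A} \<inter> FP"
    using translate_vimage_singleton[OF s(1), of "- z"] A(2) by simp
  then have B: "{B} \<in> sets FP_borel" using sets_translate_vimage[OF s(2), of "- z"] by simp
  have "emeasure (shift z \<nu>) {B} = emeasure \<nu> {A}"
    unfolding emeasure_shift[OF \<nu> B] using translate_vimage_singleton[of B z] translate_FP[OF s(1)] A(2)
    by (simp add: translate_inverse)
  then show "B \<in> process_atoms (shift z \<nu>)"
    using A translate_FP[OF s(1)] by (simp add: process_atoms_def)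
qed

lemma union_shift:
  assumes "\<nu> \<in> Nsharp"
  shows "countable_union (process_atoms (shift z \<nu>)) = translate z (countable_union (process_atoms \<nu>))"
  unfolding process_atoms_shift[OF assms] by (rule countable_union_translate[OF countable_atoms[OF
      assms]])

theorem theorem6p2:
  fixes M :: "'w measure" and \<Phi> :: "'w \<Rightarrow> 'a::euclidean_space lset measure"
  assumes "random_FP_process M \<Phi>"
  shows "random_FPloc_set M (\<lambda>\<omega>. countable_union (process_atoms (\<Phi> \<omega>))) \<and>
    (stationary_process M \<Phi> \<longrightarrow>
      stationary_set M (\<lambda>\<omega>. countable_union (process_atoms (\<Phi> \<omega>))))"
proof (intro conjI impI)
  let ?U = "\<lambda>\<nu> :: 'a lset measure. countable_union (process_atoms \<nu>)"
  have M: "standard_prob_space M" and \<Phi>: "\<Phi> \<in> measurable M Nsharp_algebra"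
    using assms by (simp_all add: random_FP_process_def)
  have X: "(\<lambda>\<omega>. ?U (\<Phi> \<omega>)) \<in> measurable M FPloc_borel"
    by (rule measurable_compose[OF \<Phi> measurable_union])
  with M show "random_FPloc_set M (\<lambda>\<omega>. ?U (\<Phi> \<omega>))"
    by (simp add: random_FPloc_set_def)
  assume stat: "stationary_process M \<Phi>"
  let ?D = "distr M Nsharp_algebra \<Phi>"
  \<comment> \<open>The law of the union is the image of the law of \<Phi>, so stationarity becomes
    a statement about \<open>?D\<close> and the deterministic map \<open>?U\<close>.\<close>
  have distr_X: "distr M FPloc_borel (\<lambda>\<omega>. ?U (\<Phi> \<omega>)) = distr ?D FPloc_borel ?U"
    using distr_distr[OF measurable_union \<Phi>] by (simp add: o_def)
  have U: "?U \<in> measurable ?D FPloc_borel"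
    using measurable_union by (simp add: measurable_cong_sets[OF sets_distr refl])
  have shift: "shift z \<in> measurable ?D Nsharp_algebra" for z :: 'a
    using measurable_shift[of z] by (simp add: measurable_cong_sets[OF sets_distr refl])
  show "stationary_set M (\<lambda>\<omega>. ?U (\<Phi> \<omega>))"
    unfolding stationary_set_def distr_X
  proof
    fix z :: 'a
    have "distr (distr ?D FPloc_borel ?U) FPloc_borel (translate z) = distr ?D FPloc_borel
        (translate z \<circ> ?U)"
      by (rule distr_distr[OF measurable_translate_FPloc U])
    \<comment> \<open>The equivariance \<open>union_shift\<close> holds at every point of
      \<open>Nsharp\<close>, which is the whole space of \<open>?D\<close>.\<close>
    also have "\<dots> = distr ?D FPloc_borel (?U \<circ> shift z)"
      by (rule distr_cong) (simp_all add: space_Nsharp_algebra union_shift)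
    also have "\<dots> = distr (distr ?D Nsharp_algebra (shift z)) FPloc_borel ?U"
      by (rule distr_distr[OF measurable_union shift, symmetric])
    also have "\<dots> = distr ?D FPloc_borel ?U"
      using stat by (simp add: stationary_process_def)
    finally show "distr (distr ?D FPloc_borel ?U) FPloc_borel (translate z) = distr ?D FPloc_borel ?U" .
  qed
qed

end
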